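(* Let $N\geq 2$, $\alpha\in\mathbb{R}$, and let $m>m^*(N)$. Then the quadratic form $\mathcal{F}_\alpha$ on $L^2_{\mathrm f}(\mathbb{R}^{3N})$ is closed and bounded from below. In particular, $\mathcal{F}_\alpha$ is positive for $\alpha\geq 0$, and for $\alpha<0$ $$\mathcal{F}_\alpha[\psi]\;\geq\;-\frac{\alpha^2}{4\pi^4\big(1-\Lambda(m,N)\big)}\,\|\psi\|^2_{L^2}\qquad\text{for all }\psi\in\mathcal{D}(\mathcal{F}_\alpha).$$
   Context: Setting: $N\geq 2$ identical fermions of unit mass interacting with a different particle of mass $m>0$ via a zero-range interaction, in relative coordinates $\mathbf y_1,\dots,\mathbf y_N\in\mathbb R^3$. $L^2_{\mathrm f}(\mathbb R^{3N})$, $H^1_{\mathrm f}(\mathbb R^{3N})$, $H^{1/2}_{\mathrm f}(\mathbb R^{3N-3})$ denote the subspaces of $L^2$, $H^1$, $H^{1/2}$ consisting of functions totally antisymmetric under exchange of the $\mathbb R^3$-variables. Fourier transform: $\hat f(\mathbf k)=(2\pi)^{-d/2}\int e^{-i\mathbf k\cdot\mathbf x}f(\mathbf x)\,d\mathbf x$. For $\lambda>0$ define $G_\lambda(\mathbf k_1,\dots,\mathbf k_N)=\big[\sum_{i=1}^N k_i^2+\tfrac{2}{m+1}\sum_{i<j}\mathbf k_i\cdot\mathbf k_j+\lambda\big]^{-1}$, $L_\lambda(\mathbf k_1,\dots,\mathbf k_{N-1})=2\pi^2\big(\tfrac{m(m+2)}{(m+1)^2}\sum_{i=1}^{N-1}k_i^2+\tfrac{2m}{(m+1)^2}\sum_{i<j}\mathbf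 k_i\cdot\mathbf k_j+\lambda\big)^{1/2}$. For $\xi\in H^{1/2}_{\mathrm f}(\mathbb R^{3N-3})$ define $\mathcal G^\lambda\xi$ by $\widehat{\mathcal G^\lambda\xi}(\mathbf k_1,\dots,\mathbf k_N)=\sum_{i=1}^N(-1)^{i+1}G_\lambda(\mathbf k_1,\dots,\mathbf k_N)\hat\xi(\breve{\mathbf k}_i)$, where $\breve{\mathbf k}_i=(\mathbf k_1,\dots,\mathbf k_{i-1},\mathbf k_{i+1},\dots,\mathbf k_N)$. Define on $\mathcal D(\Phi^\lambda_\alpha)=H^{1/2}_{\mathrm f}(\mathbb R^{3N-3})$ the form $\Phi^\lambda_\alpha[\xi]=\Phi^\lambda_{\mathrm{diag}}[\xi]+\Phi^\lambda_{\mathrm{off}}[\xi]$ with $\Phi^\lambda_{\mathrm{diag}}[\xi]=\int_{\mathbb R^{3N-3}}|\hat\xi(\mathbf k_1,\dots,\mathbf k_{N-1})|^2[\alpha+L_\lambda(\mathbf k_1,\dots,\mathbf k_{N-1})]\,d\mathbf k_1\cdots d\mathbf k_{N-1}$, $\Phi^\lambda_{\mathrm{off}}[\xi]=(N-1)\int_{\mathbb R^{3N}}\hat\xi^*(\mathbf s,\mathbf k_2,\dots,\mathbf k_{N-1})\hat\xi(\mathbf t,\mathbf k_2,\dots,\mathbf k_{N-1})G_\lambda(\mathbf s,\mathbf t,\mathbf k_2,\dots,\mathbf k_{N-1})\,d\mathbf s\,d\mathbf t\,d\mathbf k_2\cdots d\mathbf k_{N-1}$. Let $\mathcal F_0[\phi]=\int(\sum_i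 k_i^2+\tfrac{2}{m+1}\sum_{i<j}\mathbf k_i\cdot\mathbf k_j)|\hat\phi|^2$ (the form of $H_0=-\sum_i\Delta_{\mathbf y_i}-\tfrac{2}{m+1}\sum_{i<j}\nabla_{\mathbf y_i}\cdot\nabla_{\mathbf y_j}$). Fix $\lambda>0$. The form $\mathcal F_\alpha$ is defined by $\mathcal D(\mathcal F_\alpha)=\{\psi\in L^2_{\mathrm f}(\mathbb R^{3N}):\exists\,\xi\in H^{1/2}_{\mathrm f}(\mathbb R^{3N-3})\text{ with }\phi^\lambda:=\psi-\mathcal G^\lambda\xi\in H^1_{\mathrm f}(\mathbb R^{3N})\}$ and $\mathcal F_\alpha[\psi]=\mathcal F_0[\phi^\lambda]+\lambda\|\phi^\lambda\|^2_{L^2}-\lambda\|\psi\|^2_{L^2}+N\Phi^\lambda_\alpha[\xi]$. Define $\Lambda(m,N)=2\pi^{-1}(N-1)(m+1)^2\big[\tfrac{1}{\sqrt{m(m+2)}}-\arcsin\tfrac{1}{m+1}\big]$; for fixed $N$ it is strictly decreasing in $m\in(0,\infty)$ from $+\infty$ to $0$, and $m^*(N)$ denotes the unique solution of $\Lambda(m,N)=1$ (so $m>m^*(N)$ iff $\Lambda(m,N)<1$). *)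

theory Defs
  imports "HOL-Analysis.Analysis"
begin

text \<open>Configurations of n particles in R^3: functions on the index set {..<n}
  (zero-based indices; extensional, as in the product measure).\<close>
type_synonym cfg = "nat \<Rightarrow> real^3"

definition Mc :: "nat \<Rightarrow> cfg measure" where
  "Mc n = PiM {..<n} (\<lambda>_. lborel)"

definition dotc :: "nat \<Rightarrow> cfg \<Rightarrow> cfg \<Rightarrow> real" where
  "dotc n k x = (\<Sum>j<n. k j \<bullet> x j)"

definition sqc :: "nat \<Rightarrow> cfg \<Rightarrow> real" where
  "sqc n k = (\<Sum>j<n. (norm (k j))^2)"

definition crossc :: "nat \<Rightarrow> cfg \<Rightarrow> real" where
  "crossc n k = (\<Sum>i<n. \<Sum>j\<in>{i<..<n}. k i \<bullet> k j)"

definition L2 :: "nat \<Rightarrow> (cfg \<Rightarrow> complex) \<Rightarrow> bool" where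
  "L2 n f \<longleftrightarrow> f \<in> borel_measurable (Mc n) \<and> integrable (Mc n) (\<lambda>x. (cmod (f x))^2)"

definition norm2 :: "nat \<Rightarrow> (cfg \<Rightarrow> complex) \<Rightarrow> real" where
  "norm2 n f = (\<integral>x. (cmod (f x))^2 \<partial>Mc n)"

definition antisym_f :: "nat \<Rightarrow> (cfg \<Rightarrow> complex) \<Rightarrow> bool" where
  "antisym_f n f \<longleftrightarrow> (\<forall>i<n. \<forall>j<n. i \<noteq> j \<longrightarrow>
     (AE x in Mc n. f (\<lambda>l. if l = i then x j else if l = j then x i else x l) = - f x))"

definition L2f :: "nat \<Rightarrow> (cfg \<Rightarrow> complex) \<Rightarrow> bool" where
  "L2f n f \<longleftrightarrow> L2 n f \<and> antisym_f n f"

definition invF_int :: "nat \<Rightarrow> (cfg \<Rightarrow> complex) \<Rightarrow> cfg \<Rightarrow> complex" where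
  "invF_int n \<phi> x = complex_of_real ((2 * pi) powr (- real (3 * n) / 2)) *
      (\<integral>k. exp (\<i> * complex_of_real (dotc n k x)) * \<phi> k \<partial>Mc n)"

definition is_FT :: "nat \<Rightarrow> (cfg \<Rightarrow> complex) \<Rightarrow> (cfg \<Rightarrow> complex) \<Rightarrow> bool" where
  "is_FT n f g \<longleftrightarrow> L2 n g \<and>
     (\<forall>\<phi>. integrable (Mc n) \<phi> \<and> L2 n \<phi> \<longrightarrow>
        (\<integral>k. g k * cnj (\<phi> k) \<partial>Mc n) = (\<integral>x. f x * cnj (invF_int n \<phi> x) \<partial>Mc n))"

definition FT :: "nat \<Rightarrow> (cfg \<Rightarrow> complex) \<Rightarrow> cfg \<Rightarrow> complex" where
  "FT n f = (SOME g. is_FT n f g)"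

definition iFT :: "nat \<Rightarrow> (cfg \<Rightarrow> complex) \<Rightarrow> cfg \<Rightarrow> complex" where
  "iFT n g = (SOME f. L2 n f \<and> is_FT n f g)"

definition H1f :: "nat \<Rightarrow> (cfg \<Rightarrow> complex) \<Rightarrow> bool" where
  "H1f n f \<longleftrightarrow> L2f n f \<and>
     (\<integral>\<^sup>+k. ennreal ((1 + sqc n k) * (cmod (FT n f k))^2) \<partial>Mc n) < \<infinity>"

definition Hhalf_f :: "nat \<Rightarrow> (cfg \<Rightarrow> complex) \<Rightarrow> bool" where
  "Hhalf_f n f \<longleftrightarrow> L2f n f \<and>
     (\<integral>\<^sup>+k. ennreal (sqrt (1 + sqc n k) * (cmod (FT n f k))^2) \<partial>Mc n) < \<infinity>"

definition G_lam :: "real \<Rightarrow> nat \<Rightarrow> real \<Rightarrow> cfg \<Rightarrow> real" where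
  "G_lam m N lam k = 1 / (sqc N k + 2 / (m + 1) * crossc N k + lam)"

definition L_lam :: "real \<Rightarrow> nat \<Rightarrow> real \<Rightarrow> cfg \<Rightarrow> real" where
  "L_lam m N lam k = 2 * pi^2 * sqrt (m * (m + 2) / (m + 1)^2 * sqc (N - 1) k
        + 2 * m / (m + 1)^2 * crossc (N - 1) k + lam)"

definition drop_idx :: "nat \<Rightarrow> nat \<Rightarrow> cfg \<Rightarrow> cfg" where
  "drop_idx N i k = restrict (\<lambda>j. if j < i then k j else k (Suc j)) {..<N - 1}"

definition Ghat :: "real \<Rightarrow> nat \<Rightarrow> real \<Rightarrow> (cfg \<Rightarrow> complex) \<Rightarrow> cfg \<Rightarrow> complex" where
  "Ghat m N lam \<xi> k = (\<Sum>i<N. (-1)^i * complex_of_real (G_lam m N lam k) * FT (N - 1) \<xi> (drop_idx N i k))"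

definition Gpot :: "real \<Rightarrow> nat \<Rightarrow> real \<Rightarrow> (cfg \<Rightarrow> complex) \<Rightarrow> cfg \<Rightarrow> complex" where
  "Gpot m N lam \<xi> = iFT N (Ghat m N lam \<xi>)"

definition Phi_diag :: "real \<Rightarrow> nat \<Rightarrow> real \<Rightarrow> real \<Rightarrow> (cfg \<Rightarrow> complex) \<Rightarrow> real" where
  "Phi_diag m N lam \<alpha> \<xi> = (\<integral>k. (cmod (FT (N - 1) \<xi> k))^2 * (\<alpha> + L_lam m N lam k) \<partial>Mc (N - 1))"

text \<open>arguments (s,k_2,...,k_{N-1}) and (t,k_2,...,k_{N-1}) with s = k 0, t = k 1\<close>
definition s_arg :: "nat \<Rightarrow> cfg \<Rightarrow> cfg" where
  "s_arg N k = restrict (\<lambda>j. if j = 0 then k 0 else k (Suc j)) {..<N - 1}"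

definition t_arg :: "nat \<Rightarrow> cfg \<Rightarrow> cfg" where
  "t_arg N k = restrict (\<lambda>j. if j = 0 then k 1 else k (Suc j)) {..<N - 1}"

definition Phi_off :: "real \<Rightarrow> nat \<Rightarrow> real \<Rightarrow> (cfg \<Rightarrow> complex) \<Rightarrow> real" where
  "Phi_off m N lam \<xi> = real (N - 1) * Re (\<integral>k. cnj (FT (N - 1) \<xi> (s_arg N k)) * FT (N - 1) \<xi> (t_arg N k)
        * complex_of_real (G_lam m N lam k) \<partial>Mc N)"

definition Phi :: "real \<Rightarrow> nat \<Rightarrow> real \<Rightarrow> real \<Rightarrow> (cfg \<Rightarrow> complex) \<Rightarrow> real" where
  "Phi m N lam \<alpha> \<xi> = Phi_diag m N lam \<alpha> \<xi> + Phi_off m N lam \<xi>"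

definition F0 :: "real \<Rightarrow> nat \<Rightarrow> (cfg \<Rightarrow> complex) \<Rightarrow> real" where
  "F0 m N \<phi> = (\<integral>k. (sqc N k + 2 / (m + 1) * crossc N k) * (cmod (FT N \<phi> k))^2 \<partial>Mc N)"

definition FormDom :: "real \<Rightarrow> nat \<Rightarrow> real \<Rightarrow> (cfg \<Rightarrow> complex) set" where
  "FormDom m N lam = {\<psi>. L2f N \<psi> \<and>
      (\<exists>\<xi>. Hhalf_f (N - 1) \<xi> \<and> H1f N (\<lambda>y. \<psi> y - Gpot m N lam \<xi> y))}"

definition Form :: "real \<Rightarrow> nat \<Rightarrow> real \<Rightarrow> real \<Rightarrow> (cfg \<Rightarrow> complex) \<Rightarrow> real" where
  "Form m N lam \<alpha> \<psi> =
     (let \<xi> = (SOME \<xi>. Hhalf_f (N - 1) \<xi> \<and> H1f N (\<lambda>y. \<psi> y - Gpot m N lam \<xi> y));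
          \<phi> = (\<lambda>y. \<psi> y - Gpot m N lam \<xi> y)
      in F0 m N \<phi> + lam * norm2 N \<phi> - lam * norm2 N \<psi> + real N * Phi m N lam \<alpha> \<xi>)"

definition LambdaMN :: "real \<Rightarrow> nat \<Rightarrow> real" where
  "LambdaMN m N = 2 / pi * real (N - 1) * (m + 1)^2 *
      (1 / sqrt (m * (m + 2)) - arcsin (1 / (m + 1)))"

definition mstar :: "nat \<Rightarrow> real" where
  "mstar N = (THE m. m > 0 \<and> LambdaMN m N = 1)"

definition closed_form :: "nat \<Rightarrow> (cfg \<Rightarrow> complex) set \<Rightarrow> ((cfg \<Rightarrow> complex) \<Rightarrow> real) \<Rightarrow> bool" where
  "closed_form n D F \<longleftrightarrow> D \<subseteq> {f. L2f n f} \<and>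
     (\<forall>\<psi>s \<psi>. (\<forall>j. \<psi>s j \<in> D) \<and> L2f n \<psi> \<and>
        (\<lambda>j. norm2 n (\<lambda>x. \<psi>s j x - \<psi> x)) \<longlonglongrightarrow> 0 \<and>
        (\<forall>\<epsilon>>0. \<exists>K. \<forall>j\<ge>K. \<forall>l\<ge>K. \<bar>F (\<lambda>x. \<psi>s j x - \<psi>s l x)\<bar> < \<epsilon>)
      \<longrightarrow> \<psi> \<in> D \<and> (\<lambda>j. F (\<lambda>x. \<psi>s j x - \<psi> x)) \<longlonglongrightarrow> 0)"

end

theory Submission
  imports Defs "HOL-Probability.Probability" "HOL-Real_Asymp.Real_Asymp"
begin

text \<open>
  In Fourier space let \<open>h\<close> be the symbol of \<open>H\<^sub>0\<close>, \<open>P\<close> the transform of \<open>\<psi>\<close>, \<open>\<eta>\<close> that of \<open>\<xi>\<close> and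
  \<open>B\<close> the antisymmetrised charge (the sum of \<open>(-1)\<^sup>i \<eta>\<close> with the i-th momentum deleted). Completing the
  square in \<open>(h + \<lambda>) |P - B/(h + \<lambda>)|\<^sup>2\<close> and using
  \<open>\<integral> |B|\<^sup>2 (1/(h + \<lambda>) - 1/(h + \<lambda>')) = N (\<Phi>[\<lambda>'] - \<Phi>[\<lambda>])\<close> shows that the value of the form does not
  depend on \<open>\<lambda>\<close>. Hence \<open>F + \<lambda>' \<parallel>\<psi>\<parallel>\<^sup>2 \<ge> N \<Phi>[\<lambda>']\<close> for every \<open>\<lambda>' > 0\<close>, and all claims follow from
  lower bounds on \<open>\<Phi>\<close>: positivity for a suitable \<open>\<lambda>'\<close> gives the stated bounds, growth as
  \<open>\<lambda>' \<rightarrow> \<infinity>\<close> shows that \<open>\<psi>\<close> determines \<open>\<xi>\<close>, and coercivity for large \<open>\<lambda>'\<close> reduces closedness to the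
  completeness of weighted \<open>L\<^sup>2\<close> spaces.

  The off-diagonal part is bounded below, for fixed spectator momenta, by the sharp constant \<open>\<tau>\<close> of the
  kernel \<open>1/(p\<^sup>2 + q\<^sup>2 + 2 a p\<cdot>q + \<mu>)\<close> with \<open>a = 1/(m + 1)\<close>. On functions of even total parity this form is
  nonnegative, since the sign of \<open>a\<close> may be reversed and the kernel is then a mixture of Gaussians.
  On odd functions it is controlled by a Schur test whose weights are the \<open>l = 1\<close> functions
  \<open>q\<^sub>i/|q|\<^sup>3\<close>, which are exact eigenfunctions at \<open>\<mu> = 0\<close>.
\<close>

section \<open>Square integrable functions\<close>

text \<open>Two choice operators shape the proof. \<open>FT\<close> picks some function obeying a
  duality with the inverse transform on integrable L2 test functions, so Plancherel must first
  supply existence, isometry and almost everywhere uniqueness. \<open>Form\<close> picks some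
  charge, so its value has a meaning only once charges are known to be unique up to null sets.
  Everything is therefore moved to momentum space, modulo null sets.

  The threshold comes from the diagonal weight. With the spectators eliminated, \<open>Xq\<close>
  becomes (1 - a^2) |p|^2 plus a nonnegative constant, so the off-diagonal part is at least
  -\<Lambda> 2 pi^2 times the integral of |\<eta>|^2 sqrt X, where \<Lambda> = (N - 1) tau(a) / (2
  pi^2 sqrt (1 - a^2)). The diagonal weight is \<alpha> + 2 pi^2 sqrt (X + l), and the minimum of
  sqrt (X + l) - \<Lambda> sqrt X over X \<ge> 0 is sqrt (l (1 - \<Lambda>^2)). This would even
  allow l = \<alpha>^2 / (4 pi^4 (1 - \<Lambda>^2)); the stated constant has the smaller number 1 -
  \<Lambda> in place of 1 - \<Lambda>^2.\<close>

definition sqi :: "'a measure \<Rightarrow> ('a \<Rightarrow> complex) \<Rightarrow> bool" where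
  "sqi M f \<longleftrightarrow> f \<in> borel_measurable M \<and> integrable M (\<lambda>x. (cmod (f x))^2)"

text \<open>\<open>norm2\<close> is its square; Cauchy sequences and triangle inequalities want the
  root. Without \<open>sqi\<close> the Bochner integral may be the default 0, so the value is
  informative only together with \<open>sqi\<close>.\<close>

definition nrm :: "'a measure \<Rightarrow> ('a \<Rightarrow> complex) \<Rightarrow> real" where
  "nrm M f = sqrt (\<integral>x. (cmod (f x))^2 \<partial>M)"

definition ip :: "'a measure \<Rightarrow> ('a \<Rightarrow> complex) \<Rightarrow> ('a \<Rightarrow> complex) \<Rightarrow> complex" where
  "ip M f g = (\<integral>x. f x * cnj (g x) \<partial>M)"

lemma sqiD[dest]: "sqi M f \<Longrightarrow> f \<in> borel_measurable M" "sqi M f \<Longrightarrow> integrable M (\<lambda>x. (cmod (f x))^2)"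
  by (auto simp: sqi_def)

lemma sqi_iff_nn:
  "sqi M f \<longleftrightarrow> f \<in> borel_measurable M \<and> (\<integral>\<^sup>+x. ennreal ((cmod (f x))^2) \<partial>M) < \<infinity>"
  by (auto simp: sqi_def integrable_iff_bounded)

lemma nrm_nonneg[simp]: "0 \<le> nrm M f"
  by (simp add: nrm_def)

lemma nrm_sq: "(nrm M f)^2 = (\<integral>x. (cmod (f x))^2 \<partial>M)"
  by (simp add: nrm_def)

lemma nn_nrm: "sqi M f \<Longrightarrow> (\<integral>\<^sup>+x. ennreal ((cmod (f x))^2) \<partial>M) = ennreal ((nrm M f)^2)"
  unfolding nrm_sq by (rule nn_integral_eq_integral) auto

lemma borel_measurable_cnj[measurable (raw)]:
  "f \<in> borel_measurable M \<Longrightarrow> (\<lambda>x. cnj (f x)) \<in> borel_measurable M"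
  by (rule measurable_compose[of f M borel cnj])
     (auto intro!: borel_measurable_continuous_onI continuous_intros)

lemma sqi_zero[simp]: "sqi M (\<lambda>_. 0)"
  by (simp add: sqi_def)

lemma sqi_cnj: "sqi M f \<Longrightarrow> sqi M (\<lambda>x. cnj (f x))"
  by (auto simp: sqi_def)

lemma nrm_cnj[simp]: "nrm M (\<lambda>x. cnj (f x)) = nrm M f"
  by (simp add: nrm_def)

lemma sqi_mult: "sqi M f \<Longrightarrow> sqi M (\<lambda>x. c * f x)"
  by (auto simp: sqi_def norm_mult power_mult_distrib)

lemma nrm_mult: "nrm M (\<lambda>x. c * f x) = cmod c * nrm M f"
  by (simp add: nrm_def norm_mult power_mult_distrib real_sqrt_mult)

lemma cmod_add_sq: "(cmod (a + b))^2 \<le> 2 * (cmod a)^2 + 2 * (cmod b)^2"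
proof -
  have "(cmod (a + b))^2 \<le> (cmod a + cmod b)^2"
    by (intro power_mono norm_triangle_ineq) auto
  also have "\<dots> \<le> 2 * (cmod a)^2 + 2 * (cmod b)^2"
    using sum_squares_bound[of "cmod a" "cmod b"] by (simp add: power2_sum)
  finally show ?thesis .
qed

lemma sqi_bound:
  assumes "f \<in> borel_measurable M" "integrable M g" "AE x in M. (cmod (f x))^2 \<le> g x"
  shows "sqi M f"
  unfolding sqi_def using assms
  by (auto intro!: Bochner_Integration.integrable_bound[of M g "\<lambda>x. (cmod (f x))^2"])

lemma sqi_add: 
  assumes "sqi M f" "sqi M g" shows "sqi M (\<lambda>x. f x + g x)"
  using assms by (intro sqi_bound[where g="\<lambda>x. 2 * (cmod (f x))^2 + 2 * (cmod (g x))^2"])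
     (auto simp: sqi_def cmod_add_sq)

lemma sqi_diff: 
  assumes "sqi M f" "sqi M g" shows "sqi M (\<lambda>x. f x - g x)"
  using sqi_add[OF assms(1) sqi_mult[OF assms(2), of "-1"]] by simp

lemma nrm_cong_AE:
  assumes "f \<in> borel_measurable M" "g \<in> borel_measurable M" "AE x in M. f x = g x"
  shows "nrm M f = nrm M g"
  unfolding nrm_def using assms by (intro arg_cong[where f=sqrt] integral_cong_AE) auto

lemma ip_cong_AE:
  assumes "f \<in> borel_measurable M" "g \<in> borel_measurable M" "h \<in> borel_measurable M"
    "AE x in M. f x = g x"
  shows "ip M f h = ip M g h"
  unfolding ip_def using assms by (intro integral_cong_AE) auto

lemma sqi_integrable_abs_prod:
  assumes "sqi M f" "sqi M g" shows "integrable M (\<lambda>x. cmod (f x) * cmod (g x))"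
proof (rule Bochner_Integration.integrable_bound[of M "\<lambda>x. (cmod (f x))^2 + (cmod (g x))^2"])
  show "AE x in M. norm (cmod (f x) * cmod (g x)) \<le> norm ((cmod (f x))\<^sup>2 + (cmod (g x))\<^sup>2)"
  proof (rule AE_I2)
    fix x
    have "0 \<le> cmod (f x) * cmod (g x)" by simp
    moreover have "2 * cmod (f x) * cmod (g x) \<le> (cmod (f x))\<^sup>2 + (cmod (g x))\<^sup>2"
      by (rule sum_squares_bound)
    ultimately have "cmod (f x) * cmod (g x) \<le> (cmod (f x))\<^sup>2 + (cmod (g x))\<^sup>2" by linarith
    then show "norm (cmod (f x) * cmod (g x)) \<le> norm ((cmod (f x))\<^sup>2 + (cmod (g x))\<^sup>2)"
      by simp
  qed
qed (use assms in \<open>auto simp: sqi_def\<close>)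

lemma sqi_integrable_prod:
  assumes "sqi M f" "sqi M g" shows "integrable M (\<lambda>x. f x * cnj (g x))"
  using assms by (intro Bochner_Integration.integrable_bound[OF sqi_integrable_abs_prod[OF assms]])
    (auto simp: norm_mult intro!: borel_measurable_times borel_measurable_cnj)

lemma abs_prod_le:
  assumes f: "sqi M f" and g: "sqi M g"
  shows "(\<integral>x. cmod (f x) * cmod (g x) \<partial>M) \<le> nrm M f * nrm M g"
proof -
  let ?I = "\<integral>x. cmod (f x) * cmod (g x) \<partial>M"
  have I: "ennreal ?I = (\<integral>\<^sup>+x. ennreal (cmod (f x)) * ennreal (cmod (g x)) \<partial>M)"
    by (subst nn_integral_eq_integral[symmetric])
       (use sqi_integrable_abs_prod[OF f g] in \<open>auto simp: ennreal_mult\<close>)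
  have "ennreal (?I^2) = (ennreal ?I)^2" by (simp add: ennreal_power)
  also have "\<dots> \<le> (\<integral>\<^sup>+x. (ennreal (cmod (f x)))^2 \<partial>M) * (\<integral>\<^sup>+x. (ennreal (cmod (g x)))^2 \<partial>M)"
    unfolding I using f g by (intro Cauchy_Schwarz_nn_integral) auto
  also have "\<dots> = ennreal ((nrm M f)^2) * ennreal ((nrm M g)^2)"
    by (simp add: ennreal_power nn_nrm[OF f] nn_nrm[OF g])
  also have "\<dots> = ennreal ((nrm M f * nrm M g)^2)"
    by (simp add: ennreal_mult power_mult_distrib)
  finally have "?I^2 \<le> (nrm M f * nrm M g)^2"
    by (simp add: ennreal_le_iff)
  then show ?thesis by (rule power2_le_imp_le) auto
qed

lemma ip_le:
  assumes f: "sqi M f" and g: "sqi M g"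
  shows "cmod (ip M f g) \<le> nrm M f * nrm M g"
proof -
  have "cmod (ip M f g) \<le> (\<integral>x. cmod (f x * cnj (g x)) \<partial>M)"
    unfolding ip_def by (rule integral_norm_bound)
  also have "\<dots> = (\<integral>x. cmod (f x) * cmod (g x) \<partial>M)" by (simp add: norm_mult)
  also have "\<dots> \<le> nrm M f * nrm M g" by (rule abs_prod_le[OF assms])
  finally show ?thesis .
qed

lemma nrm_triangle:
  assumes f: "sqi M f" and g: "sqi M g"
  shows "nrm M (\<lambda>x. f x + g x) \<le> nrm M f + nrm M g"
proof (rule power2_le_imp_le)
  have "(nrm M (\<lambda>x. f x + g x))^2 \<le> (\<integral>x. (cmod (f x))^2 + 2 * (cmod (f x) * cmod (g x)) + (cmod (g x))^2 \<partial>M)"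
    unfolding nrm_sq
  proof (rule integral_mono)
    show "integrable M (\<lambda>x. (cmod (f x + g x))\<^sup>2)" using sqi_add[OF f g] by auto
    show "integrable M (\<lambda>x. (cmod (f x))\<^sup>2 + 2 * (cmod (f x) * cmod (g x)) + (cmod (g x))\<^sup>2)"
      using sqi_integrable_abs_prod[OF f g] f g
      by (intro Bochner_Integration.integrable_add) auto
    fix x
    have "(cmod (f x + g x))^2 \<le> (cmod (f x) + cmod (g x))^2"
      by (intro power_mono norm_triangle_ineq) auto
    then show "(cmod (f x + g x))\<^sup>2 \<le> (cmod (f x))\<^sup>2 + 2 * (cmod (f x) * cmod (g x)) + (cmod (g x))\<^sup>2"
      by (simp add: power2_sum algebra_simps)
  qed
  also have "\<dots> = (nrm M f)^2 + 2 * (\<integral>x. cmod (f x) * cmod (g x) \<partial>M) + (nrm M g)^2"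
    unfolding nrm_sq using sqi_integrable_abs_prod[OF f g] f g by (simp add: sqiD(2))
  also have "\<dots> \<le> (nrm M f + nrm M g)^2"
    using abs_prod_le[OF f g] by (simp add: power2_sum algebra_simps)
  finally show "(nrm M (\<lambda>x. f x + g x))\<^sup>2 \<le> (nrm M f + nrm M g)\<^sup>2" .
qed simp

lemma nrm_minus_commute: "nrm M (\<lambda>x. f x - g x) = nrm M (\<lambda>x. g x - f x)"
  by (simp add: nrm_def norm_minus_commute)

lemma nrm_triangle3:
  assumes f: "sqi M f" and g: "sqi M g" and h: "sqi M h"
  shows "nrm M (\<lambda>x. f x - h x) \<le> nrm M (\<lambda>x. f x - g x) + nrm M (\<lambda>x. g x - h x)"
  using nrm_triangle[OF sqi_diff[OF f g] sqi_diff[OF g h]] by simp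

lemma nrm_diff_abs:
  assumes f: "sqi M f" and g: "sqi M g"
  shows "\<bar>nrm M f - nrm M g\<bar> \<le> nrm M (\<lambda>x. f x - g x)"
  using nrm_triangle3[OF f g sqi_zero] nrm_triangle3[OF g f sqi_zero] nrm_minus_commute[of M f g]
  by simp

lemma nrm_tendsto:
  assumes "\<And>j. sqi M (u j)" "sqi M f" "(\<lambda>j. nrm M (\<lambda>x. u j x - f x)) \<longlonglongrightarrow> 0"
  shows "(\<lambda>j. nrm M (u j)) \<longlonglongrightarrow> nrm M f"
proof -
  have "(\<lambda>j. nrm M (u j) - nrm M f) \<longlonglongrightarrow> 0"
    by (rule tendsto_rabs_zero_cancel, rule tendsto_sandwich[OF _ _ tendsto_const assms(3)])
       (use nrm_diff_abs[OF assms(1) assms(2)] in auto)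
  then show ?thesis by (simp add: LIM_zero_iff)
qed

lemma ip_diff_left:
  assumes "sqi M f" "sqi M g" "sqi M h"
  shows "ip M (\<lambda>x. f x - g x) h = ip M f h - ip M g h"
  unfolding ip_def using assms by (simp add: left_diff_distrib sqi_integrable_prod)

lemma ip_diff_right:
  assumes "sqi M f" "sqi M g" "sqi M h"
  shows "ip M h (\<lambda>x. f x - g x) = ip M h f - ip M h g"
  unfolding ip_def using assms by (simp add: right_diff_distrib sqi_integrable_prod)

lemma ip_add_right:
  assumes "sqi M f" "sqi M g" "sqi M h"
  shows "ip M h (\<lambda>x. f x + g x) = ip M h f + ip M h g"
  unfolding ip_def using assms by (simp add: distrib_left sqi_integrable_prod)

lemma ip_mult_left: "ip M (\<lambda>x. c * f x) h = c * ip M f h"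
  unfolding ip_def by (simp add: mult.assoc)

lemma ip_mult_right: "ip M h (\<lambda>x. c * f x) = cnj c * ip M h f"
  unfolding ip_def by (simp add: mult.left_commute)

lemma ip_cnj: "ip M g f = cnj (ip M f g)"
proof -
  have "ip M g f = (\<integral>x. cnj (f x * cnj (g x)) \<partial>M)" by (simp add: ip_def mult.commute)
  also have "\<dots> = cnj (ip M f g)" unfolding ip_def by (rule Bochner_Integration.integral_cnj)
  finally show ?thesis .
qed

lemma ip_self: "ip M f f = complex_of_real ((nrm M f)^2)"
  unfolding ip_def nrm_sq by (simp add: complex_norm_square[symmetric] integral_complex_of_real[symmetric])

lemma ip_tendsto_left:
  assumes "\<And>j. sqi M (u j)" "sqi M f" "(\<lambda>j. nrm M (\<lambda>x. u j x - f x)) \<longlonglongrightarrow> 0" "sqi M h"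
  shows "(\<lambda>j. ip M (u j) h) \<longlonglongrightarrow> ip M f h"
proof -
  have "(\<lambda>j. ip M (u j) h - ip M f h) \<longlonglongrightarrow> 0"
  proof (rule Lim_null_comparison)
    show "\<forall>\<^sub>F j in sequentially. norm (ip M (u j) h - ip M f h) \<le> nrm M (\<lambda>x. u j x - f x) * nrm M h"
      using ip_le[OF sqi_diff[OF assms(1,2)] assms(4)] assms by (simp add: ip_diff_left)
    show "(\<lambda>j. nrm M (\<lambda>x. u j x - f x) * nrm M h) \<longlonglongrightarrow> 0"
      using tendsto_mult_right[OF assms(3), of "nrm M h"] by simp
  qed
  then show ?thesis by (simp add: LIM_zero_iff)
qed

lemma nrm_eq_0_AE:
  assumes "sqi M f" "nrm M f = 0" shows "AE x in M. f x = 0"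
proof -
  have "(\<integral>x. (cmod (f x))^2 \<partial>M) = 0" using assms(2) nrm_sq[of M f] by simp
  then have "AE x in M. (cmod (f x))^2 = 0"
    using assms(1) by (subst (asm) integral_nonneg_eq_0_iff_AE) auto
  then show ?thesis by simp
qed

section \<open>Completeness and density in L2\<close>

lemma ennreal_suminf_bounded_terms:
  fixes a :: "nat \<Rightarrow> real"
  assumes "\<And>k. 0 \<le> a k" "(\<Sum>k. ennreal (a k)) < \<infinity>"
  shows "summable a"
  using assms summable_suminf_not_top[of a] by (auto simp: less_top)

text \<open>Riesz-Fischer for functions rather than classes: a fast subsequence converges almost
  everywhere, and Fatou's lemma turns this into norm convergence of the whole sequence.\<close>

lemma sqi_complete:
  fixes u :: "nat \<Rightarrow> 'a \<Rightarrow> complex"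
  assumes u: "\<And>j. sqi M (u j)"
    and cau: "\<And>e. e > 0 \<Longrightarrow> \<exists>K. \<forall>j\<ge>K. \<forall>l\<ge>K. nrm M (\<lambda>x. u j x - u l x) < e"
  obtains f where "sqi M f" "(\<lambda>j. nrm M (\<lambda>x. u j x - f x)) \<longlonglongrightarrow> 0"
proof -
  note [measurable] = sqiD(1)[OF u]
  have "\<exists>K. \<forall>j\<ge>K. \<forall>l\<ge>K. nrm M (\<lambda>x. u j x - u l x) < (1/4)^k" for k :: nat
    by (rule cau) simp
  then obtain K where K: "\<And>k j l. j \<ge> K k \<Longrightarrow> l \<ge> K k \<Longrightarrow> nrm M (\<lambda>x. u j x - u l x) < (1/4)^k"
    by metis
  \<comment> \<open>Partial sums of the thresholds give an index sequence that is monotone and still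
    dominates each \<open>K k\<close>.\<close>
  define r where "r k = (\<Sum>i\<le>k. K i)" for k
  have rK: "r k \<ge> K k" for k unfolding r_def by (rule member_le_sum) auto
  have rS: "r (Suc k) \<ge> r k" for k unfolding r_def by simp
  define v where "v k = u (r k)" for k
  have v[measurable]: "v k \<in> borel_measurable M" for k unfolding v_def by measurable
  have sv: "sqi M (v k)" for k unfolding v_def by (rule u)
  have vd: "nrm M (\<lambda>x. v (Suc k) x - v k x) < (1/4)^k" for k
    unfolding v_def using K rK rS order_trans by blast
  \<comment> \<open>The increments have squared norm below 16^-k, so the weight 4^k keeps the sum of
    the integrals finite. Almost everywhere the weighted terms then tend to 0, and the increments
    are eventually at most 2^-k.\<close>
  have "(\<integral>\<^sup>+x. (\<Sum>k. ennreal (4^k * (cmod (v (Suc k) x - v k x))^2)) \<partial>M) =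
      (\<Sum>k. \<integral>\<^sup>+x. ennreal (4^k * (cmod (v (Suc k) x - v k x))^2) \<partial>M)"
    by (rule nn_integral_suminf) auto
  also have "\<dots> \<le> (\<Sum>k. ennreal ((1/4)^k))"
  proof (intro suminf_le)
    fix k
    have "(\<integral>\<^sup>+x. ennreal (4^k * (cmod (v (Suc k) x - v k x))^2) \<partial>M) =
       ennreal (4^k) * (\<integral>\<^sup>+x. ennreal ((cmod (v (Suc k) x - v k x))^2) \<partial>M)"
      by (subst nn_integral_cmult[symmetric]) (auto simp: ennreal_mult)
    also have "\<dots> = ennreal (4^k * (nrm M (\<lambda>x. v (Suc k) x - v k x))^2)"
      by (subst nn_nrm[OF sqi_diff[OF sv sv]]) (simp add: ennreal_mult)
    also have "\<dots> \<le> ennreal (4^k * ((1/4)^k)^2)"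
      using vd[of k] by (intro ennreal_leI mult_left_mono power_mono) auto
    also have "4^k * ((1/4)^k)^2 = (1/4::real)^k"
      by (simp add: power2_eq_square power_mult_distrib[symmetric] flip: mult.assoc)
    finally show "(\<integral>\<^sup>+x. ennreal (4^k * (cmod (v (Suc k) x - v k x))^2) \<partial>M) \<le> ennreal ((1/4)^k)" .
  qed auto
  also have "\<dots> < \<infinity>"
    by (simp add: suminf_ennreal2 summable_geometric)
  finally have "AE x in M. (\<Sum>k. ennreal (4^k * (cmod (v (Suc k) x - v k x))^2)) \<noteq> \<infinity>"
    by (intro nn_integral_PInf_AE) auto
  then have conv: "AE x in M. convergent (\<lambda>k. v k x)"
  proof eventually_elim
    case (elim x)
    have "summable (\<lambda>k. 4^k * (cmod (v (Suc k) x - v k x))^2)"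
      by (rule ennreal_suminf_bounded_terms) (use elim in \<open>auto simp: less_top\<close>)
    then have "(\<lambda>k. 4^k * (cmod (v (Suc k) x - v k x))^2) \<longlonglongrightarrow> 0" by (rule summable_LIMSEQ_zero)
    then have "\<forall>\<^sub>F k in sequentially. 4^k * (cmod (v (Suc k) x - v k x))^2 < 1"
      by (rule order_tendstoD) simp
    then have "\<forall>\<^sub>F k in sequentially. norm (v (Suc k) x - v k x) \<le> (1/2)^k"
    proof eventually_elim
      case (elim k)
      have "(2^k * cmod (v (Suc k) x - v k x))^2 \<le> 1^2"
        using elim by (simp add: power_mult_distrib power_mult[symmetric] mult.commute[of k]) (simp add: power_mult)
      then have "2^k * cmod (v (Suc k) x - v k x) \<le> 1" by (rule power2_le_imp_le) simp
      then show ?case by (simp add: power_one_over field_simps)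
    qed
    then have "summable (\<lambda>k. v (Suc k) x - v k x)"
      by (rule summable_comparison_test_ev) (simp add: summable_geometric)
    then have "(\<lambda>n. v 0 x + (\<Sum>k<n. v (Suc k) x - v k x)) \<longlonglongrightarrow> v 0 x + (\<Sum>k. v (Suc k) x - v k x)"
      by (intro tendsto_intros summable_LIMSEQ)
    moreover have "v 0 x + (\<Sum>k<n. v (Suc k) x - v k x) = v n x" for n
      using sum_lessThan_telescope[of "\<lambda>k. v k x" n] by simp
    ultimately show ?case by (auto simp: convergent_def)
  qed
  define f where "f x = lim (\<lambda>k. v k x)" for x
  have f[measurable]: "f \<in> borel_measurable M" unfolding f_def by measurable
  have lim: "AE x in M. (\<lambda>k. v k x) \<longlonglongrightarrow> f x"
    using conv by eventually_elim (simp add: f_def convergent_LIMSEQ_iff)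
  \<comment> \<open>Only the subsequence converges pointwise; Fatou in its index, with j fixed,
    transfers the Cauchy bound to the distance between any late \<open>u j\<close> and the
    limit.\<close>
  have fatou: "(\<integral>\<^sup>+x. ennreal ((cmod (u j x - f x))^2) \<partial>M) \<le> ennreal (((1/4)^i)^2)" if "j \<ge> K i" for i j
  proof -
    have "(\<integral>\<^sup>+x. ennreal ((cmod (u j x - f x))^2) \<partial>M) =
       (\<integral>\<^sup>+x. liminf (\<lambda>k. ennreal ((cmod (u j x - v k x))^2)) \<partial>M)"
    proof (rule nn_integral_cong_AE)
      show "AE x in M. ennreal ((cmod (u j x - f x))\<^sup>2) = liminf (\<lambda>k. ennreal ((cmod (u j x - v k x))^2))"
        using lim
      proof eventually_elim
        case (elim x)
        have "(\<lambda>k. ennreal ((cmod (u j x - v k x))^2)) \<longlonglongrightarrow> ennreal ((cmod (u j x - f x))\<^sup>2)"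
          using elim by (intro tendsto_intros)
        then show ?case using lim_imp_Liminf trivial_limit_sequentially by metis
      qed
    qed
    also have "\<dots> \<le> liminf (\<lambda>k. \<integral>\<^sup>+x. ennreal ((cmod (u j x - v k x))^2) \<partial>M)"
      by (rule nn_integral_liminf) auto
    also have "\<dots> \<le> ennreal (((1/4)^i)^2)"
    proof (rule Liminf_le)
      show "\<forall>\<^sub>F k in sequentially. (\<integral>\<^sup>+x. ennreal ((cmod (u j x - v k x))^2) \<partial>M) \<le> ennreal (((1/4)^i)^2)"
        unfolding eventually_sequentially
      proof (intro exI allI impI)
        fix k assume "k \<ge> i"
        then have "r k \<ge> r i" by (rule lift_Suc_mono_le[of r, OF rS])
        then have "nrm M (\<lambda>x. u j x - v k x) < (1/4)^i"
          unfolding v_def using K[OF that] rK[of i] by auto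
        then show "(\<integral>\<^sup>+x. ennreal ((cmod (u j x - v k x))^2) \<partial>M) \<le> ennreal (((1/4)^i)^2)"
          unfolding nn_nrm[OF sqi_diff[OF u sv]] by (intro ennreal_leI power_mono) auto
      qed
    qed auto
    finally show ?thesis .
  qed
  have s1: "sqi M (\<lambda>x. u j x - f x)" if "j \<ge> K i" for i j
    unfolding sqi_iff_nn using fatou[OF that] by (auto intro: le_less_trans)
  have sf: "sqi M f"
    using sqi_diff[OF u[of "K 0"] s1[of 0 "K 0"]] by simp
  have "(\<lambda>j. nrm M (\<lambda>x. u j x - f x)) \<longlonglongrightarrow> 0"
  proof (rule LIMSEQ_I)
    fix e :: real assume "e > 0"
    then obtain i where i: "(1/4)^i < e" using real_arch_pow_inv[of e "1/4"] by auto
    show "\<exists>no. \<forall>n\<ge>no. norm (nrm M (\<lambda>x. u n x - f x) - 0) < e"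
    proof (intro exI allI impI)
      fix n assume n: "n \<ge> K i"
      have "ennreal ((nrm M (\<lambda>x. u n x - f x))^2) \<le> ennreal (((1/4)^i)^2)"
        using fatou[OF n] nn_nrm[OF s1[OF n]] by simp
      then have "(nrm M (\<lambda>x. u n x - f x))^2 \<le> ((1/4)^i)^2" by (simp add: ennreal_le_iff)
      then have "nrm M (\<lambda>x. u n x - f x) \<le> (1/4)^i" by (rule power2_le_imp_le) simp
      then show "norm (nrm M (\<lambda>x. u n x - f x) - 0) < e" using i by simp
    qed
  qed
  with sf show ?thesis by (rule that)
qed

lemma nrm_limit_Cauchy:
  assumes u: "\<And>j. sqi M (u j)" and f: "sqi M f" and l: "(\<lambda>j. nrm M (\<lambda>x. u j x - f x)) \<longlonglongrightarrow> 0"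
    and e: "e > 0"
  shows "\<exists>K. \<forall>j\<ge>K. \<forall>l\<ge>K. nrm M (\<lambda>x. u j x - u l x) < e"
proof -
  from LIMSEQ_D[OF l, of "e/2"] e obtain K where K: "\<And>j. j \<ge> K \<Longrightarrow> nrm M (\<lambda>x. u j x - f x) < e/2"
    by auto
  show ?thesis
  proof (intro exI allI impI)
    fix j l assume "K \<le> j" "K \<le> l"
    then show "nrm M (\<lambda>x. u j x - u l x) < e"
      using nrm_triangle3[OF u f u, of j l] K[of j] K[of l] nrm_minus_commute[of M "u l" f] by simp
  qed
qed

text \<open>Truncation to an exhaustion by sets of finite measure, where |f| \<le> 1 + |f|^2 makes a
  square integrable f integrable. This is the density of the test functions on which
  \<open>is_FT\<close> is formulated.\<close>

lemma (in sigma_finite_measure) sqi_approx: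
  assumes f: "sqi M f"
  obtains u where "\<And>j. sqi M (u j)" "\<And>j. integrable M (u j)" "(\<lambda>j. nrm M (\<lambda>x. u j x - f x)) \<longlonglongrightarrow> 0"
proof -
  note [measurable] = sqiD(1)[OF f]
  obtain A :: "nat \<Rightarrow> 'a set" where A: "range A \<subseteq> sets M" "(\<Union>i. A i) = space M"
      "\<And>i. emeasure M (A i) \<noteq> \<infinity>" "incseq A"
    using sigma_finite_incseq by blast
  have [measurable]: "A i \<in> sets M" for i using A by auto
  define u where "u j x = indicator (A j) x * f x" for j x
  have [measurable]: "u j \<in> borel_measurable M" for j unfolding u_def by measurable
  have su: "sqi M (u j)" for j
    by (rule sqi_bound[OF _ sqiD(2)[OF f]]) (auto simp: u_def indicator_def)
  have ui: "integrable M (u j)" for j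
  proof (rule Bochner_Integration.integrable_bound[of M "\<lambda>x. indicator (A j) x + (cmod (f x))^2"])
    show "integrable M (\<lambda>x. indicator (A j) x + (cmod (f x))^2)"
      using f A(3)[of j] by (auto simp: less_top)
    show "AE x in M. norm (u j x) \<le> norm (indicator (A j) x + (cmod (f x))^2)"
    proof (rule AE_I2)
      fix x
      have "cmod (f x) \<le> 1 + (cmod (f x))^2"
      proof -
        have "2 * cmod (f x) \<le> 1 + (cmod (f x))^2" using sum_squares_bound[of "cmod (f x)" 1] by simp
        moreover have "0 \<le> cmod (f x)" by simp
        ultimately show ?thesis by linarith
      qed
      then show "norm (u j x) \<le> norm (indicator (A j) x + (cmod (f x))^2)"
        by (auto simp: u_def indicator_def)
    qed
  qed auto
  have "(\<lambda>j. \<integral>x. (cmod (u j x - f x))^2 \<partial>M) \<longlonglongrightarrow> (\<integral>x. 0 \<partial>M)"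
  proof (rule integral_dominated_convergence[of _ _ _ "\<lambda>x. (cmod (f x))^2"])
    show "AE x in M. (\<lambda>j. (cmod (u j x - f x))^2) \<longlonglongrightarrow> 0"
    proof (rule AE_I2)
      fix x assume "x \<in> space M"
      then obtain i where "x \<in> A i" using A(2) by auto
      then have "x \<in> A j" if "j \<ge> i" for j using incseqD[OF A(4) that] by auto
      then have "\<forall>\<^sub>F j in sequentially. (cmod (u j x - f x))^2 = 0"
        unfolding eventually_sequentially by (auto simp: u_def intro!: exI[of _ i])
      then show "(\<lambda>j. (cmod (u j x - f x))^2) \<longlonglongrightarrow> 0" by (rule tendsto_eventually)
    qed
    show "\<And>j. AE x in M. norm ((cmod (u j x - f x))\<^sup>2) \<le> (cmod (f x))\<^sup>2"
      by (auto simp: u_def indicator_def)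
  qed (use f in auto)
  then have "(\<lambda>j. sqrt (\<integral>x. (cmod (u j x - f x))^2 \<partial>M)) \<longlonglongrightarrow> sqrt 0"
    by (intro tendsto_real_sqrt) simp
  then have "(\<lambda>j. nrm M (\<lambda>x. u j x - f x)) \<longlonglongrightarrow> 0" by (simp add: nrm_def)
  with su ui show ?thesis by (rule that)
qed

section \<open>The Plancherel theorem on configuration space\<close>

interpretation lbps: product_sigma_finite "\<lambda>_::nat. lborel :: (real^3) measure" ..

lemma sigma_finite_Mc: "sigma_finite_measure (Mc n)"
  unfolding Mc_def by (rule lbps.sigma_finite) simp

interpretation Mc: sigma_finite_measure "Mc n" for n
  by (rule sigma_finite_Mc)

interpretation McMc: pair_sigma_finite "Mc n" "Mc n'" for n n'
  by (simp add: pair_sigma_finite_def sigma_finite_Mc)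

lemma space_Mc: "space (Mc n) = PiE {..<n} (\<lambda>_. UNIV)"
  by (simp add: Mc_def space_PiM)

lemma measurable_Mc_component:
  assumes "j < n" shows "(\<lambda>k. k j) \<in> borel_measurable (Mc n)"
proof -
  have "(\<lambda>k. k j) \<in> measurable (Mc n) lborel"
    unfolding Mc_def using assms by (intro measurable_component_singleton) simp
  then show ?thesis by simp
qed

lemma measurable_Mc_component':
  assumes "f \<in> measurable M (Mc n)" "j < n" shows "(\<lambda>x. f x j) \<in> borel_measurable M"
  by (rule measurable_compose[OF assms(1) measurable_Mc_component[OF assms(2)]])

lemma dotc_measurable[measurable (raw)]:
  assumes "f \<in> measurable M (Mc n)" "g \<in> measurable M (Mc n)"
  shows "(\<lambda>x. dotc n (f x) (g x)) \<in> borel_measurable M"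
  unfolding dotc_def
  by (intro borel_measurable_sum borel_measurable_inner measurable_Mc_component'[OF assms(1)]
      measurable_Mc_component'[OF assms(2)]) auto

lemma sqc_measurable[measurable (raw)]:
  assumes "f \<in> measurable M (Mc n)"
  shows "(\<lambda>x. sqc n (f x)) \<in> borel_measurable M"
  unfolding sqc_def
  by (intro borel_measurable_sum borel_measurable_power measurable_compose[OF measurable_Mc_component'[OF assms(1)] borel_measurable_norm]) auto

lemma crossc_measurable[measurable (raw)]:
  assumes "f \<in> measurable M (Mc n)"
  shows "(\<lambda>x. crossc n (f x)) \<in> borel_measurable M"
  unfolding crossc_def
  by (intro borel_measurable_sum borel_measurable_inner measurable_Mc_component'[OF assms(1)]) auto

section \<open>Gaussian integrals and their Fourier transforms\<close>

lemma has_bochner_gauss_real: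
  assumes "s > 0"
  shows "has_bochner_integral lborel (\<lambda>x::real. complex_of_real (exp (- s * x^2)) * exp (\<i> * complex_of_real (u * x)))
    (complex_of_real (sqrt (pi / s) * exp (- (u^2) / (4 * s))))"
proof -
  \<comment> \<open>Rescaling by sqrt (2 s) turns the Gaussian into the standard normal density,
    whose characteristic function supplies the value.\<close>
  define c where "c = sqrt (2 * s)"
  have c: "c > 0" "c^2 = 2 * s" using assms by (auto simp: c_def)
  define t where "t = u / c"
  let ?f = "\<lambda>y. std_normal_density y *\<^sub>R iexp (t * y)"
  have pi: "prob_space std_normal_distribution" by (rule prob_space_normal_density) simp
  have i: "integrable std_normal_distribution (\<lambda>x. iexp (t * x))"
    using prob_space.integrable_iexp[OF pi, of "\<lambda>x. t * x"] by simp
  have 1: "integrable lborel ?f"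
    using i by (subst (asm) integrable_density) (auto simp: normal_density_nonneg)
  have "(\<integral>y. ?f y \<partial>lborel) = char std_normal_distribution t"
    unfolding char_def by (subst integral_density) (auto simp: normal_density_nonneg)
  also have "\<dots> = complex_of_real (exp (- (t^2) / 2))"
    by (simp add: char_std_normal_distribution)
  finally have "has_bochner_integral lborel ?f (complex_of_real (exp (- (t^2) / 2)))"
    using 1 by (metis has_bochner_integral_iff)
  then have "has_bochner_integral lborel (\<lambda>x. ?f (0 + c * x)) (complex_of_real (exp (- (t^2) / 2)) /\<^sub>R \<bar>c\<bar>)"
    using c by (subst lborel_has_bochner_integral_real_affine_iff[symmetric]) (auto simp: field_simps)
  then have "has_bochner_integral lborel (\<lambda>x. complex_of_real (sqrt (2*pi)) * ?f (c * x))
     (complex_of_real (sqrt (2*pi)) * (complex_of_real (exp (- (t^2) / 2)) /\<^sub>R \<bar>c\<bar>))"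
    by (intro has_bochner_integral_mult_right) simp
  moreover have "complex_of_real (sqrt (2*pi)) * ?f (c * x) = complex_of_real (exp (- s * x^2)) * exp (\<i> * complex_of_real (u * x))" for x
    using c by (simp add: std_normal_density_def t_def scaleR_conv_of_real power_mult_distrib field_simps)
  moreover have "complex_of_real (sqrt (2*pi)) * (complex_of_real (exp (- (t^2) / 2)) /\<^sub>R \<bar>c\<bar>) =
     complex_of_real (sqrt (pi / s) * exp (- (u^2) / (4 * s)))"
  proof -
    have "sqrt (2 * pi) / c = sqrt (pi / s)" unfolding c_def by (simp add: real_sqrt_divide real_sqrt_mult)
    moreover have "t^2/2 = u^2/(4 * s)" using c by (simp add: t_def power_divide)
    ultimately show ?thesis using c by (simp add: scaleR_conv_of_real field_simps)
  qed
  ultimately show ?thesis by simp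
qed

lemma has_bochner_lborel_prod:
  fixes f :: "'a::euclidean_space \<Rightarrow> real \<Rightarrow> complex"
  assumes "\<And>b. b \<in> Basis \<Longrightarrow> has_bochner_integral lborel (f b) (I b)"
  shows "has_bochner_integral lborel (\<lambda>x::'a. \<Prod>b\<in>Basis. f b (x \<bullet> b)) (\<Prod>b\<in>Basis. I b)"
proof -
  interpret product_sigma_finite "\<lambda>_::'a. lborel :: real measure" ..
  have i: "integrable lborel (f b)" "integral\<^sup>L lborel (f b) = I b" if "b \<in> Basis" for b
    using assms[OF that] by (auto simp: has_bochner_integral_iff)
  have [measurable]: "f b \<in> borel_measurable borel" if "b \<in> Basis" for b
    using i(1)[OF that] by auto
  have m: "(\<lambda>f. \<Sum>b\<in>Basis. f b *\<^sub>R b) \<in> measurable (PiM Basis (\<lambda>_. lborel)) (borel :: 'a measure)"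
    by (intro borel_measurable_sum borel_measurable_scaleR borel_measurable_const
       measurable_component_singleton[of _ Basis "\<lambda>_. lborel", simplified]) 
  have eq: "(\<Prod>b\<in>Basis. f b ((\<Sum>c\<in>Basis. g c *\<^sub>R c) \<bullet> b)) = (\<Prod>b\<in>Basis. f b (g b))" for g
    by (intro prod.cong) (auto simp: inner_sum_left_Basis)
  have "has_bochner_integral (PiM Basis (\<lambda>_. lborel)) (\<lambda>g. \<Prod>b\<in>Basis. f b (g b)) (\<Prod>b\<in>Basis. I b)"
    unfolding has_bochner_integral_iff using i
    by (auto intro!: product_integrable_prod simp: product_integral_prod)
  then show ?thesis
    using m eq by (subst lborel_eq, subst has_bochner_integral_distr) auto
qed

lemma Basis3_card: "card (Basis :: (real^3) set) = 3"
  by simp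

lemma has_bochner_gauss_vec:
  fixes u :: "real^3"
  assumes "s > 0"
  shows "has_bochner_integral lborel (\<lambda>x. complex_of_real (exp (- s * (norm x)^2)) * exp (\<i> * complex_of_real (u \<bullet> x)))
    (complex_of_real (sqrt (pi / s)^3 * exp (- ((norm u)^2) / (4 * s))))"
proof -
  have "has_bochner_integral lborel (\<lambda>x::real^3. \<Prod>b\<in>Basis. complex_of_real (exp (- s * (x \<bullet> b)^2)) * exp (\<i> * complex_of_real ((u \<bullet> b) * (x \<bullet> b))))
     (\<Prod>b\<in>(Basis::(real^3) set). complex_of_real (sqrt (pi / s) * exp (- ((u \<bullet> b)^2) / (4 * s))))"
    by (rule has_bochner_lborel_prod, rule has_bochner_gauss_real, rule assms)
  moreover have "(\<Prod>b\<in>Basis. complex_of_real (exp (- s * (x \<bullet> b)^2)) * exp (\<i> * complex_of_real ((u \<bullet> b) * (x \<bullet> b))))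
    = complex_of_real (exp (- s * (norm x)^2)) * exp (\<i> * complex_of_real (u \<bullet> x))" for x :: "real^3"
  proof -
    have "(norm x)^2 = (\<Sum>b\<in>Basis. (x \<bullet> b)^2)"
      unfolding power2_norm_eq_inner by (subst euclidean_inner) (simp add: power2_eq_square)
    moreover have "u \<bullet> x = (\<Sum>b\<in>Basis. (u \<bullet> b) * (x \<bullet> b))" by (rule euclidean_inner)
    ultimately show ?thesis
      by (simp only: prod.distrib of_real_prod[symmetric] exp_sum[symmetric] finite_Basis sum_distrib_left of_real_sum)
  qed
  moreover have "(\<Prod>b\<in>(Basis::(real^3) set). complex_of_real (sqrt (pi / s) * exp (- ((u \<bullet> b)^2) / (4 * s))))
     = complex_of_real (sqrt (pi / s)^3 * exp (- ((norm u)^2) / (4 * s)))"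
  proof -
    have "- ((norm u)^2) / (4 * s) = (\<Sum>b\<in>Basis. - ((u \<bullet> b)^2) / (4 * s))"
      unfolding power2_norm_eq_inner by (subst euclidean_inner) (simp add: power2_eq_square sum_negf sum_divide_distrib)
    then show ?thesis
      by (simp only: of_real_prod[symmetric] prod.distrib exp_sum[symmetric] finite_Basis prod_constant Basis3_card)
  qed
  ultimately show ?thesis by simp
qed

lemma nn_gauss_vec:
  fixes c :: "real^3"
  assumes "s > 0"
  shows "(\<integral>\<^sup>+x. ennreal (exp (- s * (norm (x - c))^2)) \<partial>lborel) = ennreal (sqrt (pi / s)^3)"
proof -
  have h: "has_bochner_integral lborel (\<lambda>x::real^3. complex_of_real (exp (- s * (norm x)^2))) (complex_of_real (sqrt (pi / s)^3))"
    using has_bochner_gauss_vec[OF assms, of 0] by simp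
  then have r: "has_bochner_integral lborel (\<lambda>x::real^3. exp (- s * (norm x)^2)) (sqrt (pi / s)^3)"
    using has_bochner_integral_Re[OF h] by simp
  have "(\<integral>\<^sup>+x. ennreal (exp (- s * (norm x)^2)) \<partial>(lborel :: (real^3) measure)) = ennreal (sqrt (pi / s)^3)"
    using r nn_integral_eq_integral[of lborel "\<lambda>x::real^3. exp (- s * (norm x)^2)"] by (auto simp: has_bochner_integral_iff)
  moreover have "(\<integral>\<^sup>+x. ennreal (exp (- s * (norm (x - c))^2)) \<partial>lborel) = (\<integral>\<^sup>+x. ennreal (exp (- s * (norm x)^2)) \<partial>(lborel :: (real^3) measure))"
    by (subst lborel_distr_plus[of c, symmetric], subst nn_integral_distr) auto
  ultimately show ?thesis by simp
qed

text \<open>The Fourier integral of exp (-s |x|^2) at k - k'. As a kernel it has total mass (2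
  pi)^(3n) for every s and concentrates on the diagonal as s tends to 0.\<close>

definition Gam :: "nat \<Rightarrow> real \<Rightarrow> cfg \<Rightarrow> cfg \<Rightarrow> real" where
  "Gam n s k k' = (\<Prod>j<n. sqrt (pi / s)^3 * exp (- ((norm (k j - k' j))^2) / (4 * s)))"

lemma Gam_pos: "s > 0 \<Longrightarrow> 0 < Gam n s k k'"
  unfolding Gam_def by (intro prod_pos) auto

lemma Gam_commute: "Gam n s k k' = Gam n s k' k"
  unfolding Gam_def by (simp add: norm_minus_commute)

lemma Gam_measurable[measurable (raw)]:
  assumes "f \<in> measurable M (Mc n)" "g \<in> measurable M (Mc n)"
  shows "(\<lambda>x. Gam n s (f x) (g x)) \<in> borel_measurable M"
  unfolding Gam_def
proof (rule borel_measurable_prod)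
  fix j assume j: "j \<in> {..<n}"
  have [measurable]: "(\<lambda>x. f x j) \<in> borel_measurable M" "(\<lambda>x. g x j) \<in> borel_measurable M"
    using measurable_Mc_component'[OF assms(1), of j] measurable_Mc_component'[OF assms(2), of j] j by auto
  show "(\<lambda>x. sqrt (pi / s) ^ 3 * exp (- ((norm (f x j - g x j))\<^sup>2) / (4 * s))) \<in> borel_measurable M"
    by measurable
qed

lemma prod_ennreal': "finite A \<Longrightarrow> (\<And>i. i \<in> A \<Longrightarrow> 0 \<le> f i) \<Longrightarrow> ennreal (\<Prod>i\<in>A. f i) = (\<Prod>i\<in>A. ennreal (f i))"
  by (simp add: prod_ennreal)

lemma nn_Gam:
  assumes s: "s > 0"
  shows "(\<integral>\<^sup>+k'. ennreal (Gam n s k k') \<partial>Mc n) = ennreal ((2 * pi)^(3 * n))"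
proof -
  have 1: "(\<integral>\<^sup>+y. ennreal (sqrt (pi / s)^3 * exp (- ((norm (k j - y))^2) / (4 * s))) \<partial>lborel) = ennreal ((2*pi)^3)" for j
  proof -
    have "(\<integral>\<^sup>+y. ennreal (sqrt (pi / s)^3 * exp (- ((norm (k j - y))^2) / (4 * s))) \<partial>lborel) =
       (\<integral>\<^sup>+y. ennreal (sqrt (pi / s)^3) * ennreal (exp (- (1/(4 * s)) * (norm (y - k j))^2)) \<partial>lborel)"
    proof (rule nn_integral_cong)
      fix y
      have "- ((norm (k j - y))^2) / (4 * s) = - (1/(4 * s)) * (norm (y - k j))^2"
        by (subst norm_minus_commute) simp
      then show "ennreal (sqrt (pi / s)^3 * exp (- ((norm (k j - y))^2) / (4 * s))) =
         ennreal (sqrt (pi / s)^3) * ennreal (exp (- (1/(4 * s)) * (norm (y - k j))^2))"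
        using s by (simp only: ennreal_mult) (simp add: ennreal_mult')
    qed
    also have "\<dots> = ennreal (sqrt (pi / s)^3) * ennreal (sqrt (pi / (1/(4 * s)))^3)"
      using s by (subst nn_integral_cmult, simp, subst nn_gauss_vec) auto
    also have "\<dots> = ennreal ((sqrt (pi / s) * sqrt (pi / (1/(4 * s))))^3)"
      using s by (simp add: ennreal_mult[symmetric] power_mult_distrib)
    also have "sqrt (pi / s) * sqrt (pi / (1/(4 * s))) = sqrt ((2 * pi)^2)"
      unfolding real_sqrt_mult[symmetric] using s by (simp add: power2_eq_square)
    also have "\<dots> = 2 * pi" by (subst real_sqrt_abs) simp
    finally show ?thesis .
  qed
  have "(\<integral>\<^sup>+k'. ennreal (Gam n s k k') \<partial>Mc n) =
     (\<integral>\<^sup>+k'. (\<Prod>j\<in>{..<n}. ennreal (sqrt (pi / s)^3 * exp (- ((norm (k j - k' j))^2) / (4 * s)))) \<partial>PiM {..<n} (\<lambda>_. lborel))"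
    unfolding Gam_def Mc_def using s by (intro nn_integral_cong prod_ennreal') auto
  also have "\<dots> = (\<Prod>j\<in>{..<n}. \<integral>\<^sup>+y. ennreal (sqrt (pi / s)^3 * exp (- ((norm (k j - y))^2) / (4 * s))) \<partial>lborel)"
    by (rule lbps.product_nn_integral_prod) auto
  also have "\<dots> = ennreal ((2 * pi)^(3 * n))"
    unfolding 1 by (simp add: ennreal_power power_mult)
  finally show ?thesis .
qed

section \<open>Gaussian regularisation of the inverse transform\<close>

definition eik :: "nat \<Rightarrow> cfg \<Rightarrow> cfg \<Rightarrow> complex" where
  "eik n k x = exp (\<i> * complex_of_real (dotc n k x))"

lemma cmod_eik[simp]: "cmod (eik n k x) = 1"
  by (simp add: eik_def)

lemma eik_measurable[measurable (raw)]:
  assumes "f \<in> measurable M (Mc n)" "g \<in> measurable M (Mc n)"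
  shows "(\<lambda>x. eik n (f x) (g x)) \<in> borel_measurable M"
  unfolding eik_def using dotc_measurable[OF assms] by measurable

lemma eik_commute: "eik n k x = eik n x k"
  by (simp add: eik_def dotc_def inner_commute)

lemma gauss_FT_n:
  assumes s: "s > 0"
  shows "has_bochner_integral (Mc n) (\<lambda>x. complex_of_real (exp (- s * sqc n x)) * (eik n k x * cnj (eik n k' x)))
     (complex_of_real (Gam n s k k'))"
proof -
  let ?f = "\<lambda>j x. complex_of_real (exp (- s * (norm x)^2)) * exp (\<i> * complex_of_real ((k j - k' j) \<bullet> x))"
  have eq: "complex_of_real (exp (- s * sqc n x)) * (eik n k x * cnj (eik n k' x)) = (\<Prod>j\<in>{..<n}. ?f j (x j))" for x
  proof -
    have "eik n k x * cnj (eik n k' x) = exp (\<Sum>j<n. \<i> * complex_of_real ((k j - k' j) \<bullet> x j))"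
      by (simp add: eik_def dotc_def exp_cnj exp_add[symmetric] inner_diff_left right_diff_distrib sum_distrib_left sum_subtractf sum_negf)
    moreover have "complex_of_real (exp (- s * sqc n x)) = (\<Prod>j<n. complex_of_real (exp (- s * (norm (x j))^2)))"
      by (simp add: sqc_def sum_distrib_left exp_sum sum_negf[symmetric] of_real_prod)
    ultimately show ?thesis by (simp add: prod.distrib exp_sum)
  qed
  have i: "integrable lborel (?f j)" "integral\<^sup>L lborel (?f j) = complex_of_real (sqrt (pi / s)^3 * exp (- ((norm (k j - k' j))^2) / (4 * s)))" for j
    using has_bochner_gauss_vec[OF s, of "k j - k' j"] by (simp_all add: has_bochner_integral_iff)
  show ?thesis
    unfolding eq Mc_def has_bochner_integral_iff
    using lbps.product_integrable_prod[of "{..<n}" ?f] lbps.product_integral_prod[of "{..<n}" ?f] i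
    by (simp add: Gam_def of_real_prod)
qed

text \<open>The inverse Fourier integral stripped of its prefactor (2 pi)^(-3n/2), which is
  \<open>fc\<close> below.\<close>

definition Wt :: "nat \<Rightarrow> (cfg \<Rightarrow> complex) \<Rightarrow> cfg \<Rightarrow> complex" where
  "Wt n \<phi> x = (\<integral>k. eik n k x * \<phi> k \<partial>Mc n)"

lemma Wt_measurable[measurable]:
  assumes [measurable]: "\<phi> \<in> borel_measurable (Mc n)"
  shows "Wt n \<phi> \<in> borel_measurable (Mc n)"
  unfolding Wt_def by measurable

lemma integrable_eik_mult:
  assumes "integrable (Mc n) \<phi>" "x \<in> space (Mc n)"
  shows "integrable (Mc n) (\<lambda>k. eik n k x * \<phi> k)"
proof -
  have [measurable]: "\<phi> \<in> borel_measurable (Mc n)" using assms by auto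
  have [measurable]: "(\<lambda>k. x) \<in> measurable (Mc n) (Mc n)" using assms by simp
  show ?thesis
    by (rule Bochner_Integration.integrable_bound[OF assms(1)]) (auto simp: norm_mult)
qed

lemma has_bochner_pair_prod:
  fixes f g :: "_ \<Rightarrow> complex"
  assumes "sigma_finite_measure M1" "sigma_finite_measure M2"
  assumes f: "integrable M1 f" and g: "integrable M2 g"
  shows "has_bochner_integral (M1 \<Otimes>\<^sub>M M2) (\<lambda>(x, y). f x * g y) ((\<integral>x. f x \<partial>M1) * (\<integral>y. g y \<partial>M2))"
proof -
  interpret M1: sigma_finite_measure M1 by fact
  interpret M2: sigma_finite_measure M2 by fact
  interpret pair_sigma_finite M1 M2 ..
  have [measurable]: "f \<in> borel_measurable M1" "g \<in> borel_measurable M2" using f g by auto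
  have i: "integrable (M1 \<Otimes>\<^sub>M M2) (\<lambda>(x, y). f x * g y)"
  proof (rule Fubini_integrable)
    show "integrable M1 (\<lambda>x. \<integral>y. norm (case (x, y) of (x, y) \<Rightarrow> f x * g y) \<partial>M2)"
      using f by (simp add: norm_mult)
    show "AE x in M1. integrable M2 (\<lambda>y. case (x, y) of (x, y) \<Rightarrow> f x * g y)"
      using g by simp
  qed measurable
  have "(\<integral>z. (case z of (x, y) \<Rightarrow> f x * g y) \<partial>(M1 \<Otimes>\<^sub>M M2)) = (\<integral>x. f x \<partial>M1) * (\<integral>y. g y \<partial>M2)"
    using integral_fst'[OF i] by simp
  with i show ?thesis by (simp add: has_bochner_integral_iff)
qed

text \<open>Schur test with constant weights: x y \<le> (x^2 + y^2) / 2, and the symmetric kernel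
  has the same mass in either variable.\<close>

lemma Gam_bound_nn:
  assumes s: "s > 0" and [measurable]: "\<phi> \<in> borel_measurable (Mc n)"
  shows "(\<integral>\<^sup>+k. \<integral>\<^sup>+k'. ennreal (cmod (\<phi> k) * cmod (\<phi> k') * Gam n s k k') \<partial>Mc n \<partial>Mc n)
     \<le> ennreal ((2 * pi)^(3 * n)) * (\<integral>\<^sup>+k. ennreal ((cmod (\<phi> k))^2) \<partial>Mc n)"
proof -
  let ?C = "ennreal ((2 * pi)^(3 * n))"
  have "(\<integral>\<^sup>+k. \<integral>\<^sup>+k'. ennreal (cmod (\<phi> k) * cmod (\<phi> k') * Gam n s k k') \<partial>Mc n \<partial>Mc n)
    \<le> (\<integral>\<^sup>+k. \<integral>\<^sup>+k'. (ennreal ((cmod (\<phi> k))^2/2) * ennreal (Gam n s k k')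
         + ennreal ((cmod (\<phi> k'))^2/2) * ennreal (Gam n s k k')) \<partial>Mc n \<partial>Mc n)"
  proof (intro nn_integral_mono)
    fix k k'
    have "cmod (\<phi> k) * cmod (\<phi> k') \<le> (cmod (\<phi> k))^2/2 + (cmod (\<phi> k'))^2/2"
      using sum_squares_bound[of "cmod (\<phi> k)" "cmod (\<phi> k')"] by simp
    then have "cmod (\<phi> k) * cmod (\<phi> k') * Gam n s k k' \<le> (cmod (\<phi> k))^2/2 * Gam n s k k' + (cmod (\<phi> k'))^2/2 * Gam n s k k'"
      using mult_right_mono[OF _ less_imp_le[OF Gam_pos[OF s, of n k k']]] by (simp only: distrib_right[symmetric])
    then show "ennreal (cmod (\<phi> k) * cmod (\<phi> k') * Gam n s k k') \<le>
       ennreal ((cmod (\<phi> k))^2/2) * ennreal (Gam n s k k') + ennreal ((cmod (\<phi> k'))^2/2) * ennreal (Gam n s k k')"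
      using Gam_pos[OF s, of n k k'] by (simp add: ennreal_mult[symmetric] ennreal_plus[symmetric] ennreal_leI less_imp_le del: ennreal_plus)
  qed
  also have "\<dots> = (\<integral>\<^sup>+k. \<integral>\<^sup>+k'. ennreal ((cmod (\<phi> k))^2/2) * ennreal (Gam n s k k') \<partial>Mc n \<partial>Mc n)
     + (\<integral>\<^sup>+k. \<integral>\<^sup>+k'. ennreal ((cmod (\<phi> k'))^2/2) * ennreal (Gam n s k k') \<partial>Mc n \<partial>Mc n)"
    by (subst nn_integral_add[symmetric]) (auto intro!: nn_integral_cong nn_integral_add)
  also have "(\<integral>\<^sup>+k. \<integral>\<^sup>+k'. ennreal ((cmod (\<phi> k'))^2/2) * ennreal (Gam n s k k') \<partial>Mc n \<partial>Mc n) =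
    (\<integral>\<^sup>+k'. \<integral>\<^sup>+k. ennreal ((cmod (\<phi> k'))^2/2) * ennreal (Gam n s k k') \<partial>Mc n \<partial>Mc n)"
    by (rule McMc.Fubini') measurable
  also have "(\<integral>\<^sup>+k'. \<integral>\<^sup>+k. ennreal ((cmod (\<phi> k'))^2/2) * ennreal (Gam n s k k') \<partial>Mc n \<partial>Mc n) =
    (\<integral>\<^sup>+k. \<integral>\<^sup>+k'. ennreal ((cmod (\<phi> k))^2/2) * ennreal (Gam n s k k') \<partial>Mc n \<partial>Mc n)"
    by (simp add: Gam_commute)
  also have "(\<integral>\<^sup>+k. \<integral>\<^sup>+k'. ennreal ((cmod (\<phi> k))^2/2) * ennreal (Gam n s k k') \<partial>Mc n \<partial>Mc n) =
     (\<integral>\<^sup>+k. ?C * ennreal ((cmod (\<phi> k))^2/2) \<partial>Mc n)"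
    by (intro nn_integral_cong, subst nn_integral_cmult) (auto simp: nn_Gam[OF s] mult.commute)
  also have "\<dots> = ?C * (\<integral>\<^sup>+k. ennreal ((cmod (\<phi> k))^2/2) \<partial>Mc n)"
    by (rule nn_integral_cmult) measurable
  also have "?C * (\<integral>\<^sup>+k. ennreal ((cmod (\<phi> k))^2/2) \<partial>Mc n) + ?C * (\<integral>\<^sup>+k. ennreal ((cmod (\<phi> k))^2/2) \<partial>Mc n) =
     ?C * (\<integral>\<^sup>+k. ennreal ((cmod (\<phi> k))^2/2) + ennreal ((cmod (\<phi> k))^2/2) \<partial>Mc n)"
    by (simp add: nn_integral_add distrib_left)
  also have "(\<lambda>k. ennreal ((cmod (\<phi> k))^2/2) + ennreal ((cmod (\<phi> k))^2/2)) = (\<lambda>k. ennreal ((cmod (\<phi> k))^2))"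
    by (intro ext, subst ennreal_plus[symmetric]) auto
  finally show ?thesis .
qed

text \<open>The Gaussian factor makes the triple integral over x, k, k' absolutely convergent, so
  Fubini allows the x-integral to be done first, which produces the kernel
  \<open>Gam\<close>.\<close>

lemma Wt_reg:
  assumes s: "s > 0" and \<phi>: "integrable (Mc n) \<phi>"
  shows "integrable (Mc n) (\<lambda>x. exp (- s * sqc n x) * (cmod (Wt n \<phi> x))^2)" (is ?A)
    "complex_of_real (\<integral>x. exp (- s * sqc n x) * (cmod (Wt n \<phi> x))^2 \<partial>Mc n) =
     (\<integral>(k, k'). \<phi> k * cnj (\<phi> k') * complex_of_real (Gam n s k k') \<partial>(Mc n \<Otimes>\<^sub>M Mc n))" (is ?B)
proof -
  let ?P = "Mc n \<Otimes>\<^sub>M Mc n"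
  interpret P: sigma_finite_measure ?P by (rule McMc.sigma_finite_measure_axioms)
  interpret MP: pair_sigma_finite "Mc n" ?P ..
  have [measurable]: "\<phi> \<in> borel_measurable (Mc n)" using \<phi> by auto
  let ?g = "\<lambda>x. complex_of_real (exp (- s * sqc n x))"
  let ?h = "\<lambda>x (k, k'). ?g x * ((eik n k x * \<phi> k) * cnj (eik n k' x * \<phi> k'))"
  have gi: "integrable (Mc n) (\<lambda>x. exp (- s * sqc n x))"
    using has_bochner_integral_Re[OF gauss_FT_n[OF s, of n "\<lambda>_. 0" "\<lambda>_. 0"]]
    by (simp add: has_bochner_integral_iff eik_def dotc_def)
  have hb: "has_bochner_integral ?P (\<lambda>(k, k'). (eik n k x * \<phi> k) * cnj (eik n k' x * \<phi> k')) (Wt n \<phi> x * cnj (Wt n \<phi> x))"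
    if x: "x \<in> space (Mc n)" for x
  proof -
    have i: "integrable (Mc n) (\<lambda>k. eik n k x * \<phi> k)" by (rule integrable_eik_mult[OF \<phi> x])
    have "has_bochner_integral ?P (\<lambda>(k, k'). (eik n k x * \<phi> k) * cnj (eik n k' x * \<phi> k'))
       ((\<integral>k. eik n k x * \<phi> k \<partial>Mc n) * (\<integral>k. cnj (eik n k x * \<phi> k) \<partial>Mc n))"
      by (rule has_bochner_pair_prod[OF sigma_finite_Mc sigma_finite_Mc i]) (rule integrable_bounded_linear[OF bounded_linear_cnj i])
    also have "(\<integral>k. cnj (eik n k x * \<phi> k) \<partial>Mc n) = cnj (Wt n \<phi> x)"
      unfolding Wt_def by (rule Bochner_Integration.integral_cnj)
    finally show ?thesis unfolding Wt_def[of n \<phi> x, symmetric] .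
  qed
  have nP: "has_bochner_integral ?P (\<lambda>(k, k'). complex_of_real (cmod (\<phi> k)) * complex_of_real (cmod (\<phi> k')))
       ((\<integral>k. complex_of_real (cmod (\<phi> k)) \<partial>Mc n) * (\<integral>k. complex_of_real (cmod (\<phi> k)) \<partial>Mc n))"
    by (rule has_bochner_pair_prod[OF sigma_finite_Mc sigma_finite_Mc]) (use \<phi> in auto)
  have nP': "integrable ?P (\<lambda>(k, k'). cmod (\<phi> k) * cmod (\<phi> k'))"
    using has_bochner_integral_Re[OF nP] by (simp add: has_bochner_integral_iff case_prod_beta')
  have I: "integrable (Mc n \<Otimes>\<^sub>M ?P) (\<lambda>(x, z). ?h x z)"
  proof (rule MP.Fubini_integrable)
    show "integrable (Mc n) (\<lambda>x. \<integral>z. norm (case (x, z) of (x, z) \<Rightarrow> ?h x z) \<partial>?P)"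
    proof -
      have eq: "(\<integral>z. norm (case (x, z) of (x, z) \<Rightarrow> ?h x z) \<partial>?P) = exp (- s * sqc n x) * (\<integral>(k, k'). cmod (\<phi> k) * cmod (\<phi> k') \<partial>?P)" for x
      proof -
        have "norm (case (x, z) of (x, z) \<Rightarrow> ?h x z) = exp (- s * sqc n x) * (case z of (k, k') \<Rightarrow> cmod (\<phi> k) * cmod (\<phi> k'))" for z
          by (simp add: norm_mult case_prod_beta)
        then show ?thesis by simp
      qed
      show ?thesis unfolding eq using gi by simp
    qed
    show "AE x in Mc n. integrable ?P (\<lambda>z. case (x, z) of (x, z) \<Rightarrow> ?h x z)"
    proof (rule AE_I2)
      fix x assume "x \<in> space (Mc n)"
      from hb[OF this] have "integrable ?P (\<lambda>(k, k'). (eik n k x * \<phi> k) * cnj (eik n k' x * \<phi> k'))"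
        by (simp add: has_bochner_integral_iff)
      then have "integrable ?P (\<lambda>z. ?g x * (case z of (k, k') \<Rightarrow> (eik n k x * \<phi> k) * cnj (eik n k' x * \<phi> k')))"
        by (intro integrable_mult_right) auto
      then show "integrable ?P (\<lambda>z. case (x, z) of (x, z) \<Rightarrow> ?h x z)" by (simp add: case_prod_beta)
    qed
  qed measurable
  have inner: "(\<integral>z. ?h x z \<partial>?P) = complex_of_real (exp (- s * sqc n x) * (cmod (Wt n \<phi> x))^2)" if x: "x \<in> space (Mc n)" for x
  proof -
    have "(\<integral>z. ?h x z \<partial>?P) = (\<integral>z. ?g x * (case z of (k, k') \<Rightarrow> (eik n k x * \<phi> k) * cnj (eik n k' x * \<phi> k')) \<partial>?P)"
      by (simp add: case_prod_beta)
    also have "\<dots> = ?g x * (\<integral>z. (case z of (k, k') \<Rightarrow> (eik n k x * \<phi> k) * cnj (eik n k' x * \<phi> k')) \<partial>?P)"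
      by (rule integral_mult_right_zero)
    also have "\<dots> = ?g x * (Wt n \<phi> x * cnj (Wt n \<phi> x))"
      using hb[OF x] by (simp add: has_bochner_integral_iff)
    finally show ?thesis by (simp add: complex_norm_square[symmetric])
  qed
  have "integrable (Mc n) (\<lambda>x. \<integral>z. ?h x z \<partial>?P)"
    using MP.integrable_fst'[OF I] by simp
  then have i2: "integrable (Mc n) (\<lambda>x. complex_of_real (exp (- s * sqc n x) * (cmod (Wt n \<phi> x))^2))"
    by (subst (asm) Bochner_Integration.integrable_cong[OF refl inner]) auto
  then show ?A using integrable_Re by fastforce
  have "complex_of_real (\<integral>x. exp (- s * sqc n x) * (cmod (Wt n \<phi> x))^2 \<partial>Mc n) =
     (\<integral>x. complex_of_real (exp (- s * sqc n x) * (cmod (Wt n \<phi> x))^2) \<partial>Mc n)"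
    by (rule integral_complex_of_real[symmetric])
  also have "\<dots> = (\<integral>x. (\<integral>z. ?h x z \<partial>?P) \<partial>Mc n)"
    by (rule Bochner_Integration.integral_cong[OF refl inner[symmetric]])
  also have "\<dots> = (\<integral>z. (\<integral>x. ?h x z \<partial>Mc n) \<partial>?P)"
    using MP.Fubini_integral[of ?h] I by simp
  also have "\<dots> = (\<integral>(k, k'). \<phi> k * cnj (\<phi> k') * complex_of_real (Gam n s k k') \<partial>?P)"
  proof (rule Bochner_Integration.integral_cong[OF refl])
    fix z :: "cfg \<times> cfg"
    obtain k k' where z: "z = (k, k')" by force
    have "(\<integral>x. ?h x z \<partial>Mc n) = (\<integral>x. (\<phi> k * cnj (\<phi> k')) * (?g x * (eik n k x * cnj (eik n k' x))) \<partial>Mc n)"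
      unfolding z by (intro Bochner_Integration.integral_cong refl) (simp add: algebra_simps)
    also have "\<dots> = (\<phi> k * cnj (\<phi> k')) * (\<integral>x. ?g x * (eik n k x * cnj (eik n k' x)) \<partial>Mc n)"
      by (rule integral_mult_right_zero)
    also have "(\<integral>x. ?g x * (eik n k x * cnj (eik n k' x)) \<partial>Mc n) = complex_of_real (Gam n s k k')"
      using gauss_FT_n[OF s, of n k k'] by (simp add: has_bochner_integral_iff)
    finally show "(\<integral>x. ?h x z \<partial>Mc n) = (case z of (k, k') \<Rightarrow> \<phi> k * cnj (\<phi> k') * complex_of_real (Gam n s k k'))"
      unfolding z by simp
  qed
  finally show ?B .
qed

lemma Wt_pair_integrable:
  assumes s: "s > 0" and \<phi>: "sqi (Mc n) \<phi>"
  shows "integrable (Mc n \<Otimes>\<^sub>M Mc n) (\<lambda>(k, k'). \<phi> k * cnj (\<phi> k') * complex_of_real (Gam n s k k'))" (is ?A)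
    "(\<integral>\<^sup>+z. ennreal (norm (case z of (k, k') \<Rightarrow> \<phi> k * cnj (\<phi> k') * complex_of_real (Gam n s k k'))) \<partial>(Mc n \<Otimes>\<^sub>M Mc n))
      \<le> ennreal ((2 * pi)^(3 * n) * (nrm (Mc n) \<phi>)^2)" (is ?B)
proof -
  have [measurable]: "\<phi> \<in> borel_measurable (Mc n)" using \<phi> by auto
  let ?f = "\<lambda>(k, k'). \<phi> k * cnj (\<phi> k') * complex_of_real (Gam n s k k')"
  have "(\<integral>\<^sup>+z. ennreal (norm (?f z)) \<partial>(Mc n \<Otimes>\<^sub>M Mc n)) =
     (\<integral>\<^sup>+k. \<integral>\<^sup>+k'. ennreal (norm (?f (k, k'))) \<partial>Mc n \<partial>Mc n)"
    by (rule Mc.nn_integral_fst[symmetric]) measurable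
  also have "\<dots> = (\<integral>\<^sup>+k. \<integral>\<^sup>+k'. ennreal (cmod (\<phi> k) * cmod (\<phi> k') * Gam n s k k') \<partial>Mc n \<partial>Mc n)"
    using Gam_pos[OF s] by (intro nn_integral_cong) (simp add: norm_mult abs_of_pos)
  also have "\<dots> \<le> ennreal ((2 * pi)^(3 * n)) * (\<integral>\<^sup>+k. ennreal ((cmod (\<phi> k))^2) \<partial>Mc n)"
    by (rule Gam_bound_nn[OF s]) measurable
  also have "\<dots> = ennreal ((2 * pi)^(3 * n) * (nrm (Mc n) \<phi>)^2)"
    by (simp add: nn_nrm[OF \<phi>] ennreal_mult)
  finally show ?B .
  then show ?A by (intro integrableI_bounded) (auto intro: le_less_trans)
qed

text \<open>One half of Plancherel. The regularised integrals are bounded uniformly in s by the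
  Schur test, and Fatou's lemma removes the Gaussian along s = 1 / (j + 1).\<close>

lemma Wt_contraction:
  assumes \<phi>: "integrable (Mc n) \<phi>" "sqi (Mc n) \<phi>"
  shows "sqi (Mc n) (Wt n \<phi>)" "(nrm (Mc n) (Wt n \<phi>))^2 \<le> (2 * pi)^(3 * n) * (nrm (Mc n) \<phi>)^2"
proof -
  have [measurable]: "\<phi> \<in> borel_measurable (Mc n)" using \<phi> by auto
  let ?R = "(2 * pi)^(3 * n) * (nrm (Mc n) \<phi>)^2"
  let ?f = "\<lambda>j x. exp (- (1 / real (Suc j)) * sqc n x) * (cmod (Wt n \<phi> x))^2"
  have bd: "(\<integral>\<^sup>+x. ennreal (?f j x) \<partial>Mc n) \<le> ennreal ?R" for j
  proof -
    have s: "1 / real (Suc j) > 0" by simp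
    have "(\<integral>\<^sup>+x. ennreal (?f j x) \<partial>Mc n) = ennreal (\<integral>x. ?f j x \<partial>Mc n)"
      by (rule nn_integral_eq_integral[OF Wt_reg(1)[OF s \<phi>(1)]]) simp
    also have "(\<integral>x. ?f j x \<partial>Mc n) \<le> ?R"
    proof -
      have "ennreal (cmod (complex_of_real (\<integral>x. ?f j x \<partial>Mc n))) \<le> ennreal ?R"
        unfolding Wt_reg(2)[OF s \<phi>(1)]
        by (rule order_trans[OF integral_norm_bound_ennreal[OF Wt_pair_integrable(1)[OF s \<phi>(2)]] Wt_pair_integrable(2)[OF s \<phi>(2)]])
      then have "cmod (complex_of_real (\<integral>x. ?f j x \<partial>Mc n)) \<le> ?R" by (subst (asm) ennreal_le_iff) auto
      then show ?thesis unfolding norm_of_real by linarith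
    qed
    finally show ?thesis by (simp add: ennreal_leI)
  qed
  have "(\<integral>\<^sup>+x. ennreal ((cmod (Wt n \<phi> x))^2) \<partial>Mc n) = (\<integral>\<^sup>+x. liminf (\<lambda>j. ennreal (?f j x)) \<partial>Mc n)"
  proof (rule nn_integral_cong)
    fix x
    have "(\<lambda>j. 1 / real (Suc j)) \<longlonglongrightarrow> 0"
      using LIMSEQ_inverse_real_of_nat by (simp add: inverse_eq_divide)
    from tendsto_mult_right[OF tendsto_minus[OF this], of "sqc n x"]
    have "(\<lambda>j. 1 / real (Suc j)) \<longlonglongrightarrow> 0"
      using LIMSEQ_inverse_real_of_nat by (simp add: inverse_eq_divide)
    from tendsto_mult_right[OF tendsto_minus[OF this], of "sqc n x"]
    have "(\<lambda>j. - (1 / real (Suc j)) * sqc n x) \<longlonglongrightarrow> - 0 * sqc n x" .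
    from tendsto_mult[OF tendsto_exp[OF this] tendsto_const]
    have "(\<lambda>j. ?f j x) \<longlonglongrightarrow> exp (- 0 * sqc n x) * (cmod (Wt n \<phi> x))^2" .
    then have "(\<lambda>j. ennreal (?f j x)) \<longlonglongrightarrow> ennreal ((cmod (Wt n \<phi> x))^2)"
      by (intro tendsto_ennrealI) simp
    then show "ennreal ((cmod (Wt n \<phi> x))^2) = liminf (\<lambda>j. ennreal (?f j x))"
      using lim_imp_Liminf trivial_limit_sequentially by metis
  qed
  also have "\<dots> \<le> liminf (\<lambda>j. \<integral>\<^sup>+x. ennreal (?f j x) \<partial>Mc n)"
    by (rule nn_integral_liminf) measurable
  also have "\<dots> \<le> ennreal ?R"
    by (rule Liminf_le) (use bd in auto)
  finally have le: "(\<integral>\<^sup>+x. ennreal ((cmod (Wt n \<phi> x))^2) \<partial>Mc n) \<le> ennreal ?R" .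
  then show "sqi (Mc n) (Wt n \<phi>)"
    unfolding sqi_iff_nn by (auto intro: le_less_trans)
  from nn_nrm[OF this] le show "(nrm (Mc n) (Wt n \<phi>))^2 \<le> ?R"
    by (simp add: ennreal_le_iff)
qed

section \<open>The reverse inequality on open rectangles\<close>

definition dsq :: "nat \<Rightarrow> cfg \<Rightarrow> cfg \<Rightarrow> real" where
  "dsq n k k' = (\<Sum>j<n. (norm (k j - k' j))^2)"

lemma Gam_exp: "Gam n s k k' = (sqrt (pi / s)^3)^n * exp (- dsq n k k' / (4 * s))"
  unfolding Gam_def dsq_def prod.distrib
  by (simp add: exp_sum[symmetric] sum_negf[symmetric] sum_divide_distrib)

text \<open>Half of the exponent is spent on the distance d; the other half is a Gaussian of doubled
  parameter, whose mass is again (2 pi)^(3n). The power of sqrt 2 is the ratio of the two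
  prefactors.\<close>

lemma Gam_tail:
  assumes s: "s > 0" and d: "d > 0" and i: "i < n" "d \<le> norm (k i - k' i)"
  shows "Gam n s k k' \<le> exp (- (d^2) / (8 * s)) * ((sqrt 2)^3)^n * Gam n (2 * s) k k'"
proof -
  have "d^2 \<le> (norm (k i - k' i))^2" using d i by (intro power_mono) auto
  also have "\<dots> \<le> dsq n k k'" unfolding dsq_def by (rule member_le_sum) (use i in auto)
  finally have "d^2 \<le> dsq n k k'" .
  then have "- dsq n k k' / (4 * s) \<le> - (d^2) / (8 * s) + - dsq n k k' / (4 * (2 * s))"
    using s by (simp add: field_simps)
  then have "exp (- dsq n k k' / (4 * s)) \<le> exp (- (d^2) / (8 * s)) * exp (- dsq n k k' / (4 * (2 * s)))"
    by (simp add: exp_add[symmetric])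
  moreover have "(sqrt (pi / s)^3)^n = ((sqrt 2)^3)^n * (sqrt (pi / (2 * s))^3)^n"
    unfolding power_mult_distrib[symmetric] real_sqrt_mult[symmetric] using s by simp
  ultimately show ?thesis unfolding Gam_exp
    using s by (simp add: mult.assoc mult.left_commute[of "exp (- (d^2) / (8 * s))"] mult_left_mono)
qed

text \<open>Open sides give every point of the box a positive distance to the complement, finite
  side measures make the indicator a test function, and the family is an intersection-stable
  generator of the product sigma-algebra.\<close>

definition orect :: "nat \<Rightarrow> cfg set set" where
  "orect n = {PiE {..<n} S |S. \<forall>j<n. open (S j) \<and> emeasure lborel (S j) < \<infinity>}"

lemma orect_sets: "B \<in> orect n \<Longrightarrow> B \<in> sets (Mc n)"
  unfolding orect_def Mc_def by (auto intro!: sets_PiM_I_finite)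

lemma orect_finite: "B \<in> orect n \<Longrightarrow> emeasure (Mc n) B < \<infinity>"
proof -
  assume "B \<in> orect n"
  then obtain S where S: "B = PiE {..<n} S" "\<And>j. j < n \<Longrightarrow> open (S j)" "\<And>j. j < n \<Longrightarrow> emeasure lborel (S j) < \<infinity>"
    by (auto simp: orect_def)
  have "emeasure (Mc n) B = (\<Prod>j<n. emeasure lborel (S j))"
    unfolding S(1) Mc_def by (rule lbps.emeasure_PiM) (use S(2) in auto)
  then show ?thesis using S(3) by (simp add: less_top[symmetric] ennreal_prod_eq_top)
qed

lemma orect_nbhd:
  assumes "B \<in> orect n" "k \<in> B"
  obtains d where "d > 0" "\<And>k'. k' \<in> space (Mc n) \<Longrightarrow> k' \<notin> B \<Longrightarrow> \<exists>i<n. d \<le> norm (k i - k' i)"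
proof -
  obtain S where S: "B = PiE {..<n} S" "\<And>j. j < n \<Longrightarrow> open (S j)" using assms by (auto simp: orect_def)
  have "\<exists>d>0. \<forall>y. dist y (k j) < d \<longrightarrow> y \<in> S j" if "j < n" for j
    using S(2)[OF that] assms(2) that unfolding S(1) open_dist by (auto simp: PiE_def Pi_def)
  then obtain d where d: "\<And>j. j < n \<Longrightarrow> d j > 0" "\<And>j y. j < n \<Longrightarrow> dist y (k j) < d j \<Longrightarrow> y \<in> S j"
    by metis
  define e where "e = Min (insert 1 (d ` {..<n}))"
  have e: "e > 0" "\<And>j. j < n \<Longrightarrow> e \<le> d j" unfolding e_def using d(1) by auto
  show ?thesis
  proof (rule that[OF e(1)])
    fix k' assume k': "k' \<in> space (Mc n)" "k' \<notin> B"
    then obtain i where i: "i < n" "k' i \<notin> S i" unfolding S(1) space_Mc by (auto simp: PiE_def Pi_def)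
    then have "\<not> dist (k' i) (k i) < e" using d(2)[of i "k' i"] e(2)[of i] by auto
    then show "\<exists>i<n. e \<le> norm (k i - k' i)" using i by (auto simp: dist_norm norm_minus_commute not_less)
  qed
qed

text \<open>At a point of B the kernel eventually puts its full mass inside B, because B is open.
  The regularised pairings over B x B therefore recover (2 pi)^(3n) times the measure of B in the
  limit.\<close>

lemma Wt_orect:
  assumes B: "B \<in> orect n"
  shows "(2 * pi)^(3 * n) * (nrm (Mc n) (indicator B))^2 \<le> (nrm (Mc n) (Wt n (indicator B)))^2"
proof -
  let ?C = "(2 * pi)^(3 * n)"
  have [measurable]: "B \<in> sets (Mc n)" by (rule orect_sets[OF B])
  have int: "integrable (Mc n) (indicator B :: cfg \<Rightarrow> complex)"
    using orect_finite[OF B] by (intro integrable_real_indicator[THEN integrable_of_real, of B, where 'a=complex, unfolded of_real_indicator]) auto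
  have sq: "sqi (Mc n) (indicator B)"
  proof -
    have "(\<lambda>x. (cmod (indicator B x))^2) = indicator B" by (auto simp: indicator_def)
    then show ?thesis unfolding sqi_def using orect_finite[OF B] by (auto intro!: integrable_real_indicator)
  qed
  define r where "r j = 1 / real (Suc j)" for j
  have r: "r j > 0" for j by (simp add: r_def)
  define I where "I j k = (\<integral>\<^sup>+k'. indicator B k' * ennreal (Gam n (r j) k k') \<partial>Mc n)" for j k
  \<comment> \<open>The regularised norm equals the kernel integral over B x B, and dropping the
    factor exp (-s |x|^2) can only enlarge it.\<close>
  have low: "(\<integral>\<^sup>+k. indicator B k * I j k \<partial>Mc n) \<le> ennreal ((nrm (Mc n) (Wt n (indicator B)))^2)" for j
  proof -
    have "complex_of_real (\<integral>x. exp (- r j * sqc n x) * (cmod (Wt n (indicator B) x))^2 \<partial>Mc n) =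
       (\<integral>(k, k'). indicator B k * cnj (indicator B k') * complex_of_real (Gam n (r j) k k') \<partial>(Mc n \<Otimes>\<^sub>M Mc n))"
      by (rule Wt_reg(2)[OF r int])
    also have "\<dots> = (\<integral>z. complex_of_real (case z of (k, k') \<Rightarrow> indicator B k * indicator B k' * Gam n (r j) k k') \<partial>(Mc n \<Otimes>\<^sub>M Mc n))"
      by (intro Bochner_Integration.integral_cong refl) (auto simp: indicator_def)
    also have "\<dots> = complex_of_real (\<integral>(k, k'). indicator B k * indicator B k' * Gam n (r j) k k' \<partial>(Mc n \<Otimes>\<^sub>M Mc n))"
      by (rule integral_complex_of_real)
    finally have eq: "(\<integral>x. exp (- r j * sqc n x) * (cmod (Wt n (indicator B) x))^2 \<partial>Mc n) =
      (\<integral>(k, k'). indicator B k * indicator B k' * Gam n (r j) k k' \<partial>(Mc n \<Otimes>\<^sub>M Mc n))"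
      by (simp only: of_real_eq_iff)
    have ii: "integrable (Mc n \<Otimes>\<^sub>M Mc n) (\<lambda>(k, k'). indicator B k * indicator B k' * Gam n (r j) k k')"
      by (rule Bochner_Integration.integrable_bound[OF Wt_pair_integrable(1)[OF r sq, of j]])
         (auto simp: indicator_def)
    have "(\<integral>\<^sup>+k. indicator B k * I j k \<partial>Mc n) = (\<integral>\<^sup>+k. \<integral>\<^sup>+k'. ennreal (indicator B k * indicator B k' * Gam n (r j) k k') \<partial>Mc n \<partial>Mc n)"
      unfolding I_def by (intro nn_integral_cong, subst nn_integral_cmult[symmetric])
        (auto intro!: nn_integral_cong simp: indicator_def)
    also have "\<dots> = (\<integral>\<^sup>+z. ennreal (case z of (k, k') \<Rightarrow> indicator B k * indicator B k' * Gam n (r j) k k') \<partial>(Mc n \<Otimes>\<^sub>M Mc n))"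
      by (subst Mc.nn_integral_fst[symmetric]) auto
    also have "\<dots> = ennreal (\<integral>(k, k'). indicator B k * indicator B k' * Gam n (r j) k k' \<partial>(Mc n \<Otimes>\<^sub>M Mc n))"
      using Gam_pos[OF r] by (intro nn_integral_eq_integral ii) (auto simp: less_imp_le)
    also have "\<dots> = (\<integral>\<^sup>+x. ennreal (exp (- r j * sqc n x) * (cmod (Wt n (indicator B) x))^2) \<partial>Mc n)"
      unfolding eq[symmetric] by (rule nn_integral_eq_integral[symmetric, OF Wt_reg(1)[OF r int]]) simp
    also have "\<dots> \<le> (\<integral>\<^sup>+x. ennreal ((cmod (Wt n (indicator B) x))^2) \<partial>Mc n)"
    proof (intro nn_integral_mono ennreal_leI)
      fix x
      have "0 \<le> sqc n x" unfolding sqc_def by (intro sum_nonneg) auto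
      then have "exp (- r j * sqc n x) \<le> 1" using r[of j] by (simp add: mult_nonneg_nonneg less_imp_le)
      then show "exp (- r j * sqc n x) * (cmod (Wt n (indicator B) x))\<^sup>2 \<le> (cmod (Wt n (indicator B) x))\<^sup>2"
        by (intro mult_left_le_one_le) auto
    qed
    also have "\<dots> = ennreal ((nrm (Mc n) (Wt n (indicator B)))^2)"
      by (rule nn_nrm[OF Wt_contraction(1)[OF int sq]])
    finally show ?thesis .
  qed
  \<comment> \<open>Mass lost outside B is at most \<open>t j\<close>, which decays like exp (-d^2 /
    (8 s)) with d the distance supplied by \<open>orect_nbhd\<close>.\<close>
  have lim: "ennreal ?C \<le> liminf (\<lambda>j. I j k)" if k: "k \<in> B" for k
  proof -
    obtain d where d: "d > 0" "\<And>k'. k' \<in> space (Mc n) \<Longrightarrow> k' \<notin> B \<Longrightarrow> \<exists>i<n. d \<le> norm (k i - k' i)"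
      using orect_nbhd[OF B k] by blast
    have ks[simp]: "k \<in> space (Mc n)" using k sets.sets_into_space[OF orect_sets[OF B]] by auto
    have [measurable]: "(\<lambda>x. k) \<in> measurable (Mc n) (Mc n)" by simp
    define t where "t j = exp (- (d^2) / (8 * r j)) * ((sqrt 2)^3)^n * ?C" for j
    have t0: "t j \<ge> 0" for j by (simp add: t_def)
    have le: "ennreal ?C \<le> I j k + ennreal (t j)" for j
    proof -
      have "ennreal ?C = (\<integral>\<^sup>+k'. ennreal (Gam n (r j) k k') \<partial>Mc n)" by (rule nn_Gam[OF r, symmetric])
      also have "\<dots> \<le> (\<integral>\<^sup>+k'. indicator B k' * ennreal (Gam n (r j) k k') +
          ennreal (exp (- (d^2) / (8 * r j)) * ((sqrt 2)^3)^n) * ennreal (Gam n (2 * r j) k k') \<partial>Mc n)"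
      proof (rule nn_integral_mono)
        fix k' assume k': "k' \<in> space (Mc n)"
        show "ennreal (Gam n (r j) k k') \<le> indicator B k' * ennreal (Gam n (r j) k k') +
          ennreal (exp (- (d^2) / (8 * r j)) * ((sqrt 2)^3)^n) * ennreal (Gam n (2 * r j) k k')"
        proof (cases "k' \<in> B")
          case False
          then obtain i where i: "i < n" "d \<le> norm (k i - k' i)" using d(2)[OF k'] by auto
          from Gam_tail[where i=i and n=n and k=k and k'=k' and s="r j" and d=d, OF r d(1) i] show ?thesis using False r[of j] Gam_pos[of "2 * r j" n k k']
            by (simp add: ennreal_mult'[symmetric] ennreal_leI)
        qed simp
      qed
      also have "\<dots> = I j k + ennreal (exp (- (d^2) / (8 * r j)) * ((sqrt 2)^3)^n) * ennreal ?C"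
        unfolding I_def using nn_Gam[of "2 * r j" n k] r[of j]
        by (subst nn_integral_add) (auto simp: nn_integral_cmult)
      also have "\<dots> = I j k + ennreal (t j)" unfolding t_def by (subst ennreal_mult''[symmetric]) auto
      finally show ?thesis .
    qed
    have tl: "t \<longlonglongrightarrow> 0"
    proof -
      have "(\<lambda>j. exp (- (d^2) / (8 * r j))) \<longlonglongrightarrow> 0"
      proof (rule filterlim_compose[OF exp_at_bot])
        have "filterlim (\<lambda>j. (d^2/8) * real (Suc j)) at_top sequentially"
          using d(1) by (intro filterlim_tendsto_pos_mult_at_top[OF tendsto_const _ filterlim_compose[OF filterlim_real_sequentially filterlim_Suc]]) auto
        then have "filterlim (\<lambda>j. - ((d^2/8) * real (Suc j))) at_bot sequentially"
          by (rule filterlim_compose[OF filterlim_uminus_at_bot_at_top])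
        moreover have "- ((d^2/8) * real (Suc j)) = - (d^2) / (8 * r j)" for j by (simp add: r_def)
        ultimately show "filterlim (\<lambda>j. - (d^2) / (8 * r j)) at_bot sequentially" by (simp add: mult.commute)
      qed
      then have "(\<lambda>j. exp (- (d^2) / (8 * r j)) * ((sqrt 2)^3)^n * ?C) \<longlonglongrightarrow> 0 * ((sqrt 2)^3)^n * ?C"
        by (intro tendsto_intros)
      moreover have "t = (\<lambda>j. exp (- (d^2) / (8 * r j)) * ((sqrt 2)^3)^n * ?C)" by (auto simp: t_def)
      ultimately show ?thesis by (simp only: mult_zero_left)
    qed
    have "(\<lambda>j. ennreal (?C - t j)) \<longlonglongrightarrow> ennreal (?C - 0)"
      by (intro tendsto_ennrealI tendsto_intros tl)
    then have "ennreal ?C = liminf (\<lambda>j. ennreal (?C - t j))"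
      using lim_imp_Liminf[OF trivial_limit_sequentially] by fastforce
    also have "\<dots> \<le> liminf (\<lambda>j. I j k)"
    proof (rule Liminf_mono, rule always_eventually, rule allI)
      fix j
      show "ennreal (?C - t j) \<le> I j k"
        using le[of j] unfolding ennreal_minus[OF t0[of j], symmetric] by (simp add: ennreal_minus_le_iff add.commute)
    qed
    finally show ?thesis .
  qed
  have "ennreal (?C * (nrm (Mc n) (indicator B))^2) = (\<integral>\<^sup>+k. ennreal ?C * indicator B k \<partial>Mc n)"
  proof -
    have "ennreal ((nrm (Mc n) (indicator B))^2) = (\<integral>\<^sup>+k. indicator B k \<partial>Mc n)"
      unfolding nn_nrm[OF sq, symmetric] by (intro nn_integral_cong) (auto simp: indicator_def)
    then show ?thesis by (subst nn_integral_cmult) (auto simp: ennreal_mult)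
  qed
  also have "\<dots> \<le> (\<integral>\<^sup>+k. liminf (\<lambda>j. indicator B k * I j k) \<partial>Mc n)"
    using lim by (intro nn_integral_mono) (auto simp: indicator_def)
  also have "\<dots> \<le> liminf (\<lambda>j. \<integral>\<^sup>+k. indicator B k * I j k \<partial>Mc n)"
    unfolding I_def by (rule nn_integral_liminf) measurable
  also have "\<dots> \<le> ennreal ((nrm (Mc n) (Wt n (indicator B)))^2)"
    by (rule Liminf_le) (use low in auto)
  finally show ?thesis by (subst (asm) ennreal_le_iff) auto
qed

section \<open>The normalised inverse transform on test functions\<close>

lemma L2_sqi: "L2 n f \<longleftrightarrow> sqi (Mc n) f"
  by (simp add: L2_def sqi_def)

lemma norm2_nrm: "norm2 n f = (nrm (Mc n) f)^2"
  by (simp add: norm2_def nrm_sq)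

definition fc :: "nat \<Rightarrow> real" where "fc n = (2 * pi) powr (- real (3 * n) / 2)"

lemma fc_sq: "(fc n)^2 * (2 * pi)^(3 * n) = 1"
proof -
  have "(fc n)^2 = (2 * pi) powr (- real (3 * n))"
    unfolding fc_def power2_eq_square powr_add[symmetric] by simp
  moreover have "(2 * pi)^(3 * n) = (2 * pi) powr (real (3 * n))" by (subst powr_realpow) auto
  ultimately show ?thesis by (simp add: powr_add[symmetric])
qed

lemma invF_int_eq: "invF_int n \<phi> = (\<lambda>x. complex_of_real (fc n) * Wt n \<phi> x)"
  by (auto simp: invF_int_def fc_def Wt_def eik_def)

definition testf :: "nat \<Rightarrow> (cfg \<Rightarrow> complex) \<Rightarrow> bool" where
  "testf n \<phi> \<longleftrightarrow> integrable (Mc n) \<phi> \<and> sqi (Mc n) \<phi>"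

lemma is_FT_iff: "is_FT n f g \<longleftrightarrow> sqi (Mc n) g \<and> (\<forall>\<phi>. testf n \<phi> \<longrightarrow> ip (Mc n) g \<phi> = ip (Mc n) f (invF_int n \<phi>))"
  by (simp add: is_FT_def testf_def L2_sqi ip_def)

lemma invF_sqi: "testf n \<phi> \<Longrightarrow> sqi (Mc n) (invF_int n \<phi>)"
  unfolding invF_int_eq testf_def by (intro sqi_mult Wt_contraction) auto

lemma invF_nrm_le: assumes "testf n \<phi>" shows "nrm (Mc n) (invF_int n \<phi>) \<le> nrm (Mc n) \<phi>"
proof (rule power2_le_imp_le)
  have "(nrm (Mc n) (invF_int n \<phi>))^2 = (fc n)^2 * (nrm (Mc n) (Wt n \<phi>))^2"
    unfolding invF_int_eq nrm_mult by (simp add: power_mult_distrib)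
  also have "\<dots> \<le> (fc n)^2 * ((2 * pi)^(3 * n) * (nrm (Mc n) \<phi>)^2)"
    using assms by (intro mult_left_mono Wt_contraction) (auto simp: testf_def)
  also have "\<dots> = (nrm (Mc n) \<phi>)^2" using fc_sq[of n] by (simp add: mult.assoc[symmetric])
  finally show "(nrm (Mc n) (invF_int n \<phi>))\<^sup>2 \<le> (nrm (Mc n) \<phi>)^2" .
qed simp

lemma testf_orect: assumes "B \<in> orect n" shows "testf n (indicator B)"
proof -
  have [measurable]: "B \<in> sets (Mc n)" by (rule orect_sets[OF assms])
  have "(\<lambda>x. (cmod (indicator B x))^2) = indicator B" by (auto simp: indicator_def)
  then have "sqi (Mc n) (indicator B)" unfolding sqi_def using orect_finite[OF assms] by (auto intro!: integrable_real_indicator)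
  moreover have "integrable (Mc n) (indicator B :: cfg \<Rightarrow> complex)"
    using orect_finite[OF assms] by (intro integrable_real_indicator[THEN integrable_of_real, of B, where 'a=complex, unfolded of_real_indicator]) auto
  ultimately show ?thesis by (simp add: testf_def)
qed

lemma invF_nrm_orect: assumes "B \<in> orect n" shows "nrm (Mc n) (indicator B) \<le> nrm (Mc n) (invF_int n (indicator B))"
proof (rule power2_le_imp_le)
  have "(nrm (Mc n) (indicator B))^2 = (fc n)^2 * ((2 * pi)^(3 * n) * (nrm (Mc n) (indicator B))^2)"
    using fc_sq[of n] by (simp add: mult.assoc[symmetric])
  also have "\<dots> \<le> (fc n)^2 * (nrm (Mc n) (Wt n (indicator B)))^2"
    by (intro mult_left_mono Wt_orect assms) auto
  also have "\<dots> = (nrm (Mc n) (invF_int n (indicator B)))^2"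
    unfolding invF_int_eq nrm_mult by (simp add: power_mult_distrib)
  finally show "(nrm (Mc n) (indicator B))^2 \<le> (nrm (Mc n) (invF_int n (indicator B)))\<^sup>2" .
qed simp

lemma nrm_diff_sq:
  assumes f: "sqi M f" and g: "sqi M g"
  shows "(nrm M (\<lambda>x. f x - w * g x))^2 = (nrm M f)^2 - 2 * Re (cnj w * ip M f g) + (cmod w)^2 * (nrm M g)^2"
proof -
  have wg: "sqi M (\<lambda>x. w * g x)" by (rule sqi_mult[OF g])
  have "complex_of_real ((nrm M (\<lambda>x. f x - w * g x))^2) = ip M (\<lambda>x. f x - w * g x) (\<lambda>x. f x - w * g x)"
    by (rule ip_self[symmetric])
  also have "\<dots> = ip M f f - cnj w * ip M f g - (w * ip M g f - w * (cnj w * ip M g g))"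
    by (simp add: ip_diff_left[OF f wg sqi_diff[OF f wg]] ip_diff_right[OF f wg f] ip_diff_right[OF f wg g] ip_mult_left right_diff_distrib ip_mult_right)
  also have "w * ip M g f = cnj (cnj w * ip M f g)" by (simp add: ip_cnj[of M g f])
  finally have "(nrm M (\<lambda>x. f x - w * g x))^2 = Re (ip M f f - cnj w * ip M f g - (cnj (cnj w * ip M f g) - w * (cnj w * ip M g g)))"
    by (metis Re_complex_of_real)
  also have "\<dots> = (nrm M f)^2 - 2 * Re (cnj w * ip M f g) + (cmod w)^2 * (nrm M g)^2"
    unfolding ip_self by (simp add: mult.assoc[symmetric] complex_norm_square[symmetric] del: of_real_power)
  finally show ?thesis .
qed

lemma invF_lin:
  assumes "testf n f" "testf n g" "x \<in> space (Mc n)"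
  shows "invF_int n (\<lambda>k. f k - w * g k) x = invF_int n f x - w * invF_int n g x"
proof -
  have "Wt n (\<lambda>k. f k - w * g k) x = (\<integral>k. eik n k x * f k - w * (eik n k x * g k) \<partial>Mc n)"
    unfolding Wt_def by (intro Bochner_Integration.integral_cong refl) (simp add: algebra_simps)
  also have "\<dots> = Wt n f x - w * Wt n g x"
    unfolding Wt_def using integrable_eik_mult[of n f x] integrable_eik_mult[of n g x] assms
    by (subst Bochner_Integration.integral_diff) (auto simp: testf_def)
  finally show ?thesis by (simp only: invF_int_eq right_diff_distrib mult.left_commute)
qed

lemma testf_diff: "testf n f \<Longrightarrow> testf n g \<Longrightarrow> testf n (\<lambda>k. f k - w * g k)"
  unfolding testf_def by (auto intro: sqi_diff sqi_mult)

lemma nrm_cong: "(\<And>x. x \<in> space M \<Longrightarrow> f x = g x) \<Longrightarrow> nrm M f = nrm M g"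
  unfolding nrm_def by (intro arg_cong[where f=sqrt] Bochner_Integration.integral_cong) auto

text \<open>The defect form <f, g> - <Uf, Ug> is positive semidefinite and vanishes on the diagonal at an
  indicator of an open rectangle, hence (Cauchy--Schwarz) it vanishes against such an indicator.\<close>
lemma invF_ip_orect:
  assumes \<phi>: "testf n \<phi>" and B: "B \<in> orect n"
  shows "ip (Mc n) \<phi> (indicator B) = ip (Mc n) (invF_int n \<phi>) (invF_int n (indicator B))"
proof (rule ccontr)
  let ?M = "Mc n" let ?U = "invF_int n" let ?\<chi> = "indicator B :: cfg \<Rightarrow> complex"
  assume ne: "ip ?M \<phi> ?\<chi> \<noteq> ip ?M (?U \<phi>) (?U ?\<chi>)"
  define D where "D = ip ?M \<phi> ?\<chi> - ip ?M (?U \<phi>) (?U ?\<chi>)"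
  define E where "E = (nrm ?M \<phi>)^2 - (nrm ?M (?U \<phi>))^2"
  have D0: "cmod D > 0" using ne by (simp add: D_def)
  note \<chi> = testf_orect[OF B]
  have s: "sqi ?M \<phi>" "sqi ?M ?\<chi>" using \<phi> \<chi> by (auto simp: testf_def)
  have arith: "a - 2 * b + c \<le> d - 2 * e + f \<Longrightarrow> f \<le> c \<Longrightarrow> 2 * (e - b) \<le> d - a" for a b c d e f :: real
    by (simp add: algebra_simps)
  \<comment> \<open>The contraction is applied to \<phi> - w \<chi> with w = t D. The terms
    quadratic in w may be dropped, since the transform does not shrink \<chi>; what remains is
    linear in t and bounded by the fixed number E.\<close>
  have key: "2 * t * (cmod D)^2 \<le> E" if t: "t \<ge> 0" for t
  proof -
    define w where "w = complex_of_real t * D"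
    have "nrm ?M (?U (\<lambda>k. \<phi> k - w * ?\<chi> k)) \<le> nrm ?M (\<lambda>k. \<phi> k - w * ?\<chi> k)"
      by (rule invF_nrm_le[OF testf_diff[OF \<phi> \<chi>]])
    moreover have "nrm ?M (?U (\<lambda>k. \<phi> k - w * ?\<chi> k)) = nrm ?M (\<lambda>x. ?U \<phi> x - w * ?U ?\<chi> x)"
      by (rule nrm_cong) (rule invF_lin[OF \<phi> \<chi>])
    ultimately have "(nrm ?M (\<lambda>x. ?U \<phi> x - w * ?U ?\<chi> x))^2 \<le> (nrm ?M (\<lambda>k. \<phi> k - w * ?\<chi> k))^2"
      by (simp add: power_mono)
    then have "(nrm ?M (?U \<phi>))^2 - 2 * Re (cnj w * ip ?M (?U \<phi>) (?U ?\<chi>)) + (cmod w)^2 * (nrm ?M (?U ?\<chi>))^2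
       \<le> (nrm ?M \<phi>)^2 - 2 * Re (cnj w * ip ?M \<phi> ?\<chi>) + (cmod w)^2 * (nrm ?M ?\<chi>)^2"
      unfolding nrm_diff_sq[OF invF_sqi[OF \<phi>] invF_sqi[OF \<chi>]] nrm_diff_sq[OF s] .
    moreover have "(cmod w)^2 * (nrm ?M ?\<chi>)^2 \<le> (cmod w)^2 * (nrm ?M (?U ?\<chi>))^2"
      by (intro mult_left_mono power_mono invF_nrm_orect B) auto
    ultimately have "2 * (Re (cnj w * ip ?M \<phi> ?\<chi>) - Re (cnj w * ip ?M (?U \<phi>) (?U ?\<chi>))) \<le> E"
      unfolding E_def by (rule arith)
    moreover have "Re (cnj w * ip ?M \<phi> ?\<chi>) - Re (cnj w * ip ?M (?U \<phi>) (?U ?\<chi>)) = Re (cnj w * D)"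
      by (simp add: D_def right_diff_distrib)
    moreover have "Re (cnj w * D) = t * (cmod D)^2"
    proof -
      have "cnj w * D = complex_of_real t * (D * cnj D)" by (simp add: w_def)
      also have "\<dots> = complex_of_real (t * (cmod D)^2)" by (simp add: complex_norm_square[symmetric])
      finally show ?thesis by (metis Re_complex_of_real)
    qed
    ultimately show ?thesis by simp
  qed
  have E0: "E \<ge> 0" using key[of 0] by simp
  \<comment> \<open>With t = (E + 1) / |D|^2 the linear bound would read 2 (E + 1) \<le> E.\<close>
  have "2 * ((E + 1) / (cmod D)^2) * (cmod D)^2 \<le> E" by (rule key) (use E0 in auto)
  then show False using D0 E0 by simp
qed

text \<open>A cylinder over an open set usually has sides of infinite measure, so it is exhausted by
  its intersections with bounded boxes. This makes every coordinate measurable for the generated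
  sigma-algebra.\<close>

lemma sets_Mc_orect: "sets (Mc n) = sigma_sets (space (Mc n)) (orect n)"
proof
  let ?O = "space (Mc n)"
  have sub: "orect n \<subseteq> Pow ?O" using orect_sets sets.sets_into_space by blast
  define N where "N = sigma ?O (orect n)"
  have sN: "space N = ?O" "sets N = sigma_sets ?O (orect n)" using sub by (auto simp: N_def)
  have bN: "orect n \<subseteq> sets N" unfolding sN by auto
  have "(\<lambda>f. f) \<in> measurable N (PiM {..<n} (\<lambda>_. lborel :: (real^3) measure))"
  proof (rule measurable_PiM_single')
    fix i assume i: "i \<in> {..<n}"
    have "(\<lambda>f. f i) \<in> borel_measurable N"
    proof (rule borel_measurableI)
      fix S :: "(real^3) set" assume S: "open S"
      define T where "T k j = (if j = i then S \<inter> ball 0 (real k) else ball 0 (real k))" for k :: nat and j :: nat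
      have "open (T k j) \<and> emeasure lborel (T k j) < \<infinity>" for k j
      proof
        show "open (T k j)" unfolding T_def using S by (simp add: open_Int)
        have "T k j \<subseteq> ball 0 (real k)" by (auto simp: T_def)
        then show "emeasure lborel (T k j) < \<infinity>"
          by (intro emeasure_bounded_finite bounded_subset[OF bounded_ball])
      qed
      then have "PiE {..<n} (T k) \<in> orect n" for k
        unfolding orect_def by blast
      then have "(\<Union>k. PiE {..<n} (T k)) \<in> sets N" using bN by auto
      moreover have "(\<Union>k. PiE {..<n} (T k)) = (\<lambda>f. f i) -` S \<inter> space N"
      proof (intro set_eqI iffI)
        fix f assume "f \<in> (\<Union>k. PiE {..<n} (T k))"
        then show "f \<in> (\<lambda>f. f i) -` S \<inter> space N"
          using i unfolding sN space_Mc by (auto simp: PiE_def Pi_def T_def split: if_splits)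
      next
        fix f assume f: "f \<in> (\<lambda>f. f i) -` S \<inter> space N"
        obtain k :: nat where k: "real k > (\<Sum>j<n. norm (f j))" using reals_Archimedean2 by blast
        have "norm (f j) < real k" if "j < n" for j
        proof -
          have "norm (f j) \<le> (\<Sum>j<n. norm (f j))" by (rule member_le_sum) (use that in auto)
          then show ?thesis using k by simp
        qed
        then have "f \<in> PiE {..<n} (T k)" using f unfolding sN space_Mc by (auto simp: PiE_def Pi_def T_def)
        then show "f \<in> (\<Union>k. PiE {..<n} (T k))" by auto
      qed
      ultimately show "(\<lambda>f. f i) -` S \<inter> space N \<in> sets N" by simp
    qed
    then show "(\<lambda>f. f i) \<in> measurable N lborel" by simp
  qed (auto simp: sN space_Mc)
  then have m: "(\<lambda>f. f) \<in> measurable N (Mc n)" by (simp add: Mc_def)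
  show "sets (Mc n) \<subseteq> sigma_sets ?O (orect n)"
  proof
    fix A assume A: "A \<in> sets (Mc n)"
    have "(\<lambda>f. f) -` A \<inter> space N \<in> sets N" by (rule measurable_sets[OF m A])
    moreover have "(\<lambda>f. f) -` A \<inter> space N = A" using sets.sets_into_space[OF A] sN by auto
    ultimately show "A \<in> sigma_sets ?O (orect n)" using sN by simp
  qed
  show "sigma_sets ?O (orect n) \<subseteq> sets (Mc n)"
    by (rule sets.sigma_sets_subset) (use orect_sets in auto)
qed

lemma Int_stable_orect: "Int_stable (orect n)"
proof (rule Int_stableI)
  fix A B assume "A \<in> orect n" "B \<in> orect n"
  then obtain S T where S: "A = PiE {..<n} S" "\<forall>j<n. open (S j) \<and> emeasure lborel (S j) < \<infinity>"
    and T: "B = PiE {..<n} T" "\<forall>j<n. open (T j) \<and> emeasure lborel (T j) < \<infinity>" unfolding orect_def by blast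
  have "emeasure lborel (S j \<inter> T j) < \<infinity>" if "j < n" for j
    using S(2) T(2) that by (intro le_less_trans[OF emeasure_mono[of "S j \<inter> T j" "S j"]]) auto
  then show "A \<inter> B \<in> orect n"
    unfolding orect_def S(1) T(1) PiE_Int using S(2) T(2) by (auto intro!: exI[of _ "\<lambda>j. S j \<inter> T j"])
qed

text \<open>Inside a bounded box d is integrable, and the sets over which its integral vanishes form
  a Dynkin system containing the open rectangles; hence d vanishes there. Countably many boxes
  exhaust the space.\<close>

lemma sqi_eq_0_if_orect:
  assumes d: "sqi (Mc n) d" and z: "\<And>B. B \<in> orect n \<Longrightarrow> ip (Mc n) d (indicator B) = 0"
  shows "AE x in Mc n. d x = 0"
proof -
  let ?M = "Mc n"
  have [measurable]: "d \<in> borel_measurable ?M" using d by auto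
  define R where "R k = PiE {..<n} (\<lambda>_. ball (0::real^3) (real k))" for k :: nat
  have R: "R k \<in> orect n" for k
    unfolding orect_def R_def using emeasure_bounded_finite[OF bounded_ball[of "0::real^3" "real k"]]
    by (intro CollectI exI[of _ "\<lambda>_. ball 0 (real k)"]) simp
  have Rm[measurable]: "R k \<in> sets ?M" for k by (rule orect_sets[OF R])
  have li: "(LINT x:B|?M. d x) = ip ?M d (indicator B)" for B
    unfolding ip_def set_lebesgue_integral_def by (intro Bochner_Integration.integral_cong refl) (auto simp: indicator_def)
  have "AE x in ?M. x \<in> R k \<longrightarrow> d x = 0" for k
  proof -
    let ?d = "\<lambda>x. indicator (R k) x *\<^sub>R d x"
    have di: "integrable ?M ?d"
    proof -
      have "integrable ?M (\<lambda>x. d x * cnj (indicator (R k) x))"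
        using sqi_integrable_prod[OF d] testf_orect[OF R] by (auto simp: testf_def)
      then show ?thesis by (rule Bochner_Integration.integrable_cong[THEN iffD1, OF refl, rotated]) (auto simp: indicator_def)
    qed
    have sdi: "set_integrable ?M A ?d" if "A \<in> sets ?M" for A
      unfolding set_integrable_def using di that by (rule integrable_mult_indicator[rotated])
    have "AE x in ?M. ?d x = 0"
    proof (rule Mc.density_zero[OF di])
      fix A assume "A \<in> sets ?M"
      then have A: "A \<in> sigma_sets (space ?M) (orect n)" unfolding sets_Mc_orect .
      have sub: "orect n \<subseteq> Pow (space ?M)" using orect_sets sets.sets_into_space by blast
      show "(LINT x:A|?M. ?d x) = 0"
        using Int_stable_orect sub A
      proof (induction rule: sigma_sets_induct_disjoint)
        case (basic A)
        have "(LINT x:A|?M. ?d x) = (LINT x:A \<inter> R k|?M. d x)"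
          unfolding set_lebesgue_integral_def by (intro Bochner_Integration.integral_cong refl) (auto simp: indicator_def)
        also have "\<dots> = 0" unfolding li using Int_stableD[OF Int_stable_orect basic R] by (rule z)
        finally show ?case .
      next
        case empty show ?case by (simp add: set_lebesgue_integral_def)
      next
        \<comment> \<open>The box \<open>R k\<close> is itself an open rectangle, so the integral
          over the whole space of the cut-off function is 0 and complements inherit the
          property.\<close>
        case (compl A)
        have Am: "A \<in> sets ?M" using compl(1) unfolding sets_Mc_orect .
        have "(LINT x:space ?M|?M. ?d x) = (LINT x:R k|?M. d x)"
          unfolding set_lebesgue_integral_def by (intro Bochner_Integration.integral_cong refl) (auto simp: indicator_def)
        also have "\<dots> = 0" unfolding li by (rule z[OF R])
        finally have 1: "(LINT x:space ?M|?M. ?d x) = 0" .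
        have "(LINT x:(space ?M - A) \<union> A|?M. ?d x) = (LINT x:space ?M - A|?M. ?d x) + (LINT x:A|?M. ?d x)"
          by (rule set_integral_Un) (auto intro!: sdi Am)
        moreover have "(space ?M - A) \<union> A = space ?M" using sets.sets_into_space[OF Am] by auto
        ultimately show ?case using 1 compl(2) by simp
      next
        case (union A)
        have Am: "A i \<in> sets ?M" for i using union(2) unfolding sets_Mc_orect by auto
        have "(LINT x:(\<Union>i. A i)|?M. ?d x) = (\<Sum>i. LINT x:A i|?M. ?d x)"
          using union(1) Am by (intro lebesgue_integral_countable_add sdi) (auto simp: disjoint_family_on_def)
        then show ?case using union(3) by simp
      qed
    qed
    then show ?thesis by eventually_elim (auto simp: indicator_def)
  qed
  then have "AE x in ?M. \<forall>k. x \<in> R k \<longrightarrow> d x = 0" unfolding AE_all_countable by blast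
  then show ?thesis
  proof (rule AE_mp, intro AE_I2 impI)
    fix x assume x: "x \<in> space ?M" and *: "\<forall>k. x \<in> R k \<longrightarrow> d x = 0"
    obtain k :: nat where k: "real k > (\<Sum>j<n. norm (x j))" using reals_Archimedean2 by blast
    have "norm (x j) < real k" if "j < n" for j
    proof -
      have "norm (x j) \<le> (\<Sum>j<n. norm (x j))" by (rule member_le_sum) (use that in auto)
      then show ?thesis using k by simp
    qed
    then have "x \<in> R k" using x unfolding R_def space_Mc by (auto simp: PiE_def Pi_def)
    then show "d x = 0" using * by blast
  qed
qed

text \<open>The forward transform on test functions, written as two conjugations around the inverse
  one so that all its bounds are inherited.\<close>

definition fF :: "nat \<Rightarrow> (cfg \<Rightarrow> complex) \<Rightarrow> cfg \<Rightarrow> complex" where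
  "fF n f = (\<lambda>x. cnj (invF_int n (\<lambda>k. cnj (f k)) x))"

lemma testf_cnj: "testf n f \<Longrightarrow> testf n (\<lambda>k. cnj (f k))"
  unfolding testf_def by (auto intro: sqi_cnj integrable_bounded_linear[OF bounded_linear_cnj])

lemma fF_sqi: "testf n f \<Longrightarrow> sqi (Mc n) (fF n f)"
  unfolding fF_def by (intro sqi_cnj invF_sqi testf_cnj)

lemma fF_nrm_le: "testf n f \<Longrightarrow> nrm (Mc n) (fF n f) \<le> nrm (Mc n) f"
  unfolding fF_def using invF_nrm_le[OF testf_cnj] by simp

lemma fF_diff:
  assumes "testf n f" "testf n g" "x \<in> space (Mc n)"
  shows "fF n (\<lambda>k. f k - g k) x = fF n f x - fF n g x"
  using invF_lin[OF testf_cnj testf_cnj, of n f g x 1] assms unfolding fF_def by simp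

text \<open>Fubini for two integrable functions against a kernel of modulus 1. This is the duality
  required by \<open>is_FT\<close>, so \<open>fF\<close> really produces transforms.\<close>

lemma fF_adjoint:
  assumes f: "testf n f" and \<phi>: "testf n \<phi>"
  shows "ip (Mc n) (fF n f) \<phi> = ip (Mc n) f (invF_int n \<phi>)"
proof -
  have fi: "integrable (Mc n) f" "integrable (Mc n) (\<lambda>k. cnj (\<phi> k))"
    using f testf_cnj[OF \<phi>] by (auto simp: testf_def)
  have [measurable]: "f \<in> borel_measurable (Mc n)" "\<phi> \<in> borel_measurable (Mc n)"
    using f \<phi> by (auto simp: testf_def)
  let ?h = "\<lambda>x k. f x * cnj (\<phi> k) * cnj (eik n k x)"
  have i: "integrable (Mc n \<Otimes>\<^sub>M Mc n) (case_prod ?h)"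
  proof (rule Bochner_Integration.integrable_bound)
    show "integrable (Mc n \<Otimes>\<^sub>M Mc n) (\<lambda>(x, k). f x * cnj (\<phi> k))"
      using has_bochner_pair_prod[OF sigma_finite_Mc sigma_finite_Mc fi] by (simp add: has_bochner_integral_iff)
  qed (auto simp: norm_mult)
  have F: "(\<integral>k. (\<integral>x. ?h x k \<partial>Mc n) \<partial>Mc n) = (\<integral>x. (\<integral>k. ?h x k \<partial>Mc n) \<partial>Mc n)"
    by (rule McMc.Fubini_integral[OF i])
  have "ip (Mc n) (fF n f) \<phi> = (\<integral>k. complex_of_real (fc n) * (\<integral>x. ?h x k \<partial>Mc n) \<partial>Mc n)"
    unfolding ip_def
  proof (intro Bochner_Integration.integral_cong refl)
    fix k
    have "fF n f k = complex_of_real (fc n) * cnj (\<integral>x. eik n x k * cnj (f x) \<partial>Mc n)"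
      unfolding fF_def invF_int_eq Wt_def by simp
    also have "cnj (\<integral>x. eik n x k * cnj (f x) \<partial>Mc n) = (\<integral>x. cnj (eik n x k * cnj (f x)) \<partial>Mc n)"
      by (rule Bochner_Integration.integral_cnj[symmetric])
    also have "\<dots> = (\<integral>x. f x * cnj (eik n k x) \<partial>Mc n)"
      by (intro Bochner_Integration.integral_cong refl) (subst eik_commute, simp)
    finally have 1: "fF n f k = complex_of_real (fc n) * (\<integral>x. f x * cnj (eik n k x) \<partial>Mc n)" .
    have "(\<integral>x. ?h x k \<partial>Mc n) = (\<integral>x. cnj (\<phi> k) * (f x * cnj (eik n k x)) \<partial>Mc n)"
      by (intro Bochner_Integration.integral_cong refl) (simp add: ac_simps)
    also have "\<dots> = cnj (\<phi> k) * (\<integral>x. f x * cnj (eik n k x) \<partial>Mc n)"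
      by (rule integral_mult_right_zero)
    finally show "fF n f k * cnj (\<phi> k) = complex_of_real (fc n) * (\<integral>x. ?h x k \<partial>Mc n)"
      unfolding 1 by (simp add: ac_simps)
  qed
  also have "\<dots> = complex_of_real (fc n) * (\<integral>x. (\<integral>k. ?h x k \<partial>Mc n) \<partial>Mc n)"
    by (simp add: F)
  also have "\<dots> = (\<integral>x. complex_of_real (fc n) * (\<integral>k. ?h x k \<partial>Mc n) \<partial>Mc n)" by simp
  also have "\<dots> = ip (Mc n) f (invF_int n \<phi>)"
    unfolding ip_def
  proof (intro Bochner_Integration.integral_cong refl)
    fix x
    have "cnj (invF_int n \<phi> x) = complex_of_real (fc n) * cnj (\<integral>k. eik n k x * \<phi> k \<partial>Mc n)"
      unfolding invF_int_eq Wt_def by simp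
    also have "cnj (\<integral>k. eik n k x * \<phi> k \<partial>Mc n) = (\<integral>k. cnj (eik n k x * \<phi> k) \<partial>Mc n)"
      by (rule Bochner_Integration.integral_cnj[symmetric])
    finally have 1: "cnj (invF_int n \<phi> x) = complex_of_real (fc n) * (\<integral>k. cnj (eik n k x * \<phi> k) \<partial>Mc n)" .
    have "(\<integral>k. ?h x k \<partial>Mc n) = (\<integral>k. f x * cnj (eik n k x * \<phi> k) \<partial>Mc n)"
      by (intro Bochner_Integration.integral_cong refl) (simp add: ac_simps)
    also have "\<dots> = f x * (\<integral>k. cnj (eik n k x * \<phi> k) \<partial>Mc n)"
      by (rule integral_mult_right_zero)
    finally show "complex_of_real (fc n) * (\<integral>k. ?h x k \<partial>Mc n) = f x * cnj (invF_int n \<phi> x)"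
      unfolding 1 by (simp only: ac_simps)
  qed
  finally show ?thesis .
qed

section \<open>Extension to L2, inversion and uniqueness\<close>

lemma test_approx:
  assumes "sqi (Mc n) f"
  obtains u where "\<And>j. testf n (u j)" "(\<lambda>j. nrm (Mc n) (\<lambda>x. u j x - f x)) \<longlonglongrightarrow> 0"
  by (rule Mc.sqi_approx[OF assms]) (auto simp: testf_def)

lemma is_FT_limit:
  assumes f: "\<And>j. sqi (Mc n) (f j)" "sqi (Mc n) f0" "(\<lambda>j. nrm (Mc n) (\<lambda>x. f j x - f0 x)) \<longlonglongrightarrow> 0"
    and g: "\<And>j. is_FT n (f j) (g j)" "sqi (Mc n) g0" "(\<lambda>j. nrm (Mc n) (\<lambda>x. g j x - g0 x)) \<longlonglongrightarrow> 0"
  shows "is_FT n f0 g0"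
  unfolding is_FT_iff
proof (intro conjI allI impI g(2))
  fix \<phi> assume \<phi>: "testf n \<phi>"
  have "(\<lambda>j. ip (Mc n) (g j) \<phi>) \<longlonglongrightarrow> ip (Mc n) g0 \<phi>"
    using g \<phi> by (intro ip_tendsto_left) (auto simp: is_FT_iff testf_def)
  moreover have "(\<lambda>j. ip (Mc n) (f j) (invF_int n \<phi>)) \<longlonglongrightarrow> ip (Mc n) f0 (invF_int n \<phi>)"
    using f invF_sqi[OF \<phi>] by (intro ip_tendsto_left) auto
  moreover have "ip (Mc n) (g j) \<phi> = ip (Mc n) (f j) (invF_int n \<phi>)" for j
    using g(1)[of j] \<phi> by (simp add: is_FT_iff)
  ultimately show "ip (Mc n) g0 \<phi> = ip (Mc n) f0 (invF_int n \<phi>)"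
    using LIMSEQ_unique by auto
qed

lemma is_FT_fF: "testf n f \<Longrightarrow> is_FT n f (fF n f)"
  unfolding is_FT_iff using fF_sqi fF_adjoint by auto

text \<open>Extension by continuity: the contraction \<open>fF\<close> sends an approximating
  sequence to a Cauchy sequence. The sequence is returned as well, because norms are later compared
  along it.\<close>

lemma FT_ext:
  assumes f: "sqi (Mc n) f"
  obtains u g where "\<And>j. testf n (u j)" "(\<lambda>j. nrm (Mc n) (\<lambda>x. u j x - f x)) \<longlonglongrightarrow> 0" "sqi (Mc n) g"
    "(\<lambda>j. nrm (Mc n) (\<lambda>x. fF n (u j) x - g x)) \<longlonglongrightarrow> 0" "is_FT n f g"
proof -
  obtain u where u: "\<And>j. testf n (u j)" "(\<lambda>j. nrm (Mc n) (\<lambda>x. u j x - f x)) \<longlonglongrightarrow> 0"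
    by (rule test_approx[OF f]) blast
  have us: "sqi (Mc n) (u j)" for j using u(1) by (auto simp: testf_def)
  obtain g where g: "sqi (Mc n) g" "(\<lambda>j. nrm (Mc n) (\<lambda>x. fF n (u j) x - g x)) \<longlonglongrightarrow> 0"
  proof (rule sqi_complete[of "Mc n" "\<lambda>j. fF n (u j)"])
    show "\<And>j. sqi (Mc n) (fF n (u j))" by (rule fF_sqi[OF u(1)])
    fix e :: real assume "e > 0"
    from nrm_limit_Cauchy[OF us f u(2) this] obtain K where K: "\<forall>j\<ge>K. \<forall>l\<ge>K. nrm (Mc n) (\<lambda>x. u j x - u l x) < e" ..
    have "nrm (Mc n) (\<lambda>x. fF n (u j) x - fF n (u l) x) \<le> nrm (Mc n) (\<lambda>x. u j x - u l x)" for j l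
    proof -
      have "nrm (Mc n) (\<lambda>x. fF n (u j) x - fF n (u l) x) = nrm (Mc n) (fF n (\<lambda>k. u j k - u l k))"
        by (rule nrm_cong) (simp add: fF_diff[OF u(1) u(1)])
      also have "\<dots> \<le> nrm (Mc n) (\<lambda>k. u j k - u l k)"
        using testf_diff[OF u(1) u(1), of j 1 l] by (intro fF_nrm_le) simp
      finally show ?thesis .
    qed
    then show "\<exists>K. \<forall>j\<ge>K. \<forall>l\<ge>K. nrm (Mc n) (\<lambda>x. fF n (u j) x - fF n (u l) x) < e"
      using K le_less_trans by blast
  qed blast
  show ?thesis
    by (rule that[OF u g is_FT_limit[OF us f u(2) is_FT_fF[OF u(1)] g]])
qed

text \<open>Fourier inversion. The transform g of \<open>invF_int n \<phi>\<close> and \<phi> itself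
  have equal pairings with rectangle indicators by \<open>invF_ip_orect\<close>, so they agree
  almost everywhere. Since g is also a limit of contracted functions, the inequality opposite to
  \<open>invF_nrm_le\<close> follows.\<close>

lemma is_FT_invF: assumes \<phi>: "testf n \<phi>" shows "is_FT n (invF_int n \<phi>) \<phi>" and "nrm (Mc n) \<phi> = nrm (Mc n) (invF_int n \<phi>)"
proof -
  have us: "sqi (Mc n) (invF_int n \<phi>)" by (rule invF_sqi[OF \<phi>])
  have s\<phi>: "sqi (Mc n) \<phi>" using \<phi> by (simp add: testf_def)
  obtain u g where u: "\<And>j. testf n (u j)" "(\<lambda>j. nrm (Mc n) (\<lambda>x. u j x - invF_int n \<phi> x)) \<longlonglongrightarrow> 0"
    and g: "sqi (Mc n) g" "(\<lambda>j. nrm (Mc n) (\<lambda>x. fF n (u j) x - g x)) \<longlonglongrightarrow> 0" "is_FT n (invF_int n \<phi>) g"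
    by (rule FT_ext[OF us]) blast
  have "AE x in Mc n. \<phi> x - g x = 0"
  proof (rule sqi_eq_0_if_orect[OF sqi_diff[OF s\<phi> g(1)]])
    fix B assume B: "B \<in> orect n"
    have "ip (Mc n) g (indicator B) = ip (Mc n) (invF_int n \<phi>) (invF_int n (indicator B))"
      using g(3) testf_orect[OF B] by (simp add: is_FT_iff)
    also have "\<dots> = ip (Mc n) \<phi> (indicator B)" by (rule invF_ip_orect[OF \<phi> B, symmetric])
    finally show "ip (Mc n) (\<lambda>x. \<phi> x - g x) (indicator B) = 0"
      using testf_orect[OF B] by (subst ip_diff_left[OF s\<phi> g(1)]) (auto simp: testf_def)
  qed
  then have ae: "AE x in Mc n. g x = \<phi> x" by auto
  have m: "g \<in> borel_measurable (Mc n)" "\<phi> \<in> borel_measurable (Mc n)" using g(1) s\<phi> by auto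
  have "ip (Mc n) \<phi> \<zeta> = ip (Mc n) g \<zeta>" if "testf n \<zeta>" for \<zeta>
    by (rule ip_cong_AE) (use that m ae in \<open>auto simp: testf_def\<close>)
  then show "is_FT n (invF_int n \<phi>) \<phi>" using g(3) s\<phi> by (simp add: is_FT_iff)
  have "nrm (Mc n) \<phi> = nrm (Mc n) g" by (rule nrm_cong_AE) (use m ae in auto)
  also have "\<dots> \<le> nrm (Mc n) (invF_int n \<phi>)"
  proof (rule LIMSEQ_le)
    show "(\<lambda>j. nrm (Mc n) (fF n (u j))) \<longlonglongrightarrow> nrm (Mc n) g"
      by (rule nrm_tendsto[OF fF_sqi[OF u(1)] g(1,2)])
    show "(\<lambda>j. nrm (Mc n) (u j)) \<longlonglongrightarrow> nrm (Mc n) (invF_int n \<phi>)"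
      by (rule nrm_tendsto[OF _ us u(2)]) (use u(1) in \<open>auto simp: testf_def\<close>)
    show "\<exists>N. \<forall>j\<ge>N. nrm (Mc n) (fF n (u j)) \<le> nrm (Mc n) (u j)"
      using fF_nrm_le[OF u(1)] by auto
  qed
  finally show "nrm (Mc n) \<phi> = nrm (Mc n) (invF_int n \<phi>)"
    using invF_nrm_le[OF \<phi>] by simp
qed

lemma fF_nrm: "testf n f \<Longrightarrow> nrm (Mc n) (fF n f) = nrm (Mc n) f"
  unfolding fF_def using is_FT_invF(2)[OF testf_cnj] by simp

text \<open>The dual side of \<open>is_FT\<close> sees f only up to null sets, and rectangle
  indicators are test functions that separate L2. This makes the choice inside \<open>FT\<close>
  harmless.\<close>

lemma is_FT_unique:
  assumes f: "AE x in Mc n. f x = f' x" "f \<in> borel_measurable (Mc n)" "f' \<in> borel_measurable (Mc n)"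
    and g: "is_FT n f g" "is_FT n f' g'"
  shows "AE x in Mc n. g x = g' x"
proof -
  have s: "sqi (Mc n) g" "sqi (Mc n) g'" using g by (auto simp: is_FT_iff)
  have "AE x in Mc n. g x - g' x = 0"
  proof (rule sqi_eq_0_if_orect[OF sqi_diff[OF s]])
    fix B assume B: "B \<in> orect n"
    have "ip (Mc n) g (indicator B) = ip (Mc n) f (invF_int n (indicator B))"
      using g(1) testf_orect[OF B] by (simp add: is_FT_iff)
    also have "\<dots> = ip (Mc n) f' (invF_int n (indicator B))"
      using f invF_sqi[OF testf_orect[OF B]] by (intro ip_cong_AE) auto
    also have "\<dots> = ip (Mc n) g' (indicator B)" using g(2) testf_orect[OF B] by (simp add: is_FT_iff)
    finally show "ip (Mc n) (\<lambda>x. g x - g' x) (indicator B) = 0"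
      using testf_orect[OF B] by (subst ip_diff_left[OF s]) (auto simp: testf_def)
  qed
  then show ?thesis by auto
qed

lemma is_FT_diff:
  assumes f: "sqi (Mc n) f" "sqi (Mc n) f'" and g: "is_FT n f g" "is_FT n f' g'"
  shows "is_FT n (\<lambda>x. f x - f' x) (\<lambda>x. g x - g' x)"
proof -
  have s: "sqi (Mc n) g" "sqi (Mc n) g'" using g by (auto simp: is_FT_iff)
  show ?thesis unfolding is_FT_iff
  proof (intro conjI allI impI sqi_diff s)
    fix \<phi> assume \<phi>: "testf n \<phi>"
    then have s\<phi>: "sqi (Mc n) \<phi>" by (simp add: testf_def)
    show "ip (Mc n) (\<lambda>x. g x - g' x) \<phi> = ip (Mc n) (\<lambda>x. f x - f' x) (invF_int n \<phi>)"
      using g \<phi> unfolding ip_diff_left[OF s s\<phi>] ip_diff_left[OF f invF_sqi[OF \<phi>]] by (simp add: is_FT_iff)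
  qed
qed

lemma is_FT_nrm:
  assumes f: "sqi (Mc n) f" and g: "is_FT n f g"
  shows "nrm (Mc n) g = nrm (Mc n) f"
proof -
  obtain u h where u: "\<And>j. testf n (u j)" "(\<lambda>j. nrm (Mc n) (\<lambda>x. u j x - f x)) \<longlonglongrightarrow> 0"
    and h: "sqi (Mc n) h" "(\<lambda>j. nrm (Mc n) (\<lambda>x. fF n (u j) x - h x)) \<longlonglongrightarrow> 0" "is_FT n f h"
    by (rule FT_ext[OF f]) blast
  have "(\<lambda>j. nrm (Mc n) (fF n (u j))) \<longlonglongrightarrow> nrm (Mc n) h"
    by (rule nrm_tendsto[OF fF_sqi[OF u(1)] h(1,2)])
  moreover have "(\<lambda>j. nrm (Mc n) (u j)) \<longlonglongrightarrow> nrm (Mc n) f"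
    by (rule nrm_tendsto[OF _ f u(2)]) (use u(1) in \<open>auto simp: testf_def\<close>)
  ultimately have "nrm (Mc n) h = nrm (Mc n) f"
    unfolding fF_nrm[OF u(1)] by (rule LIMSEQ_unique)
  moreover have "nrm (Mc n) g = nrm (Mc n) h"
  proof (rule nrm_cong_AE)
    show "AE x in Mc n. g x = h x"
      by (rule is_FT_unique[where f=f and f'=f]) (use f g h in auto)
  qed (use g h in \<open>auto simp: is_FT_iff\<close>)
  ultimately show ?thesis by simp
qed

lemma is_FT_FT: "sqi (Mc n) f \<Longrightarrow> is_FT n f (FT n f)"
proof -
  assume "sqi (Mc n) f"
  then obtain g where "is_FT n f g" by (rule FT_ext) 
  then show ?thesis unfolding FT_def by (rule someI[of "is_FT n f"])
qed

lemma FT_sqi: "sqi (Mc n) f \<Longrightarrow> sqi (Mc n) (FT n f)"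
  using is_FT_FT by (auto simp: is_FT_iff)

lemma FT_nrm: "sqi (Mc n) f \<Longrightarrow> nrm (Mc n) (FT n f) = nrm (Mc n) f"
  by (rule is_FT_nrm[OF _ is_FT_FT])

lemma FT_diff:
  assumes "sqi (Mc n) f" "sqi (Mc n) g"
  shows "AE k in Mc n. FT n (\<lambda>x. f x - g x) k = FT n f k - FT n g k"
  by (rule is_FT_unique[OF _ _ _ is_FT_FT[OF sqi_diff[OF assms]] is_FT_diff[OF assms is_FT_FT[OF assms(1)] is_FT_FT[OF assms(2)]]])
     (use sqi_diff[OF assms] in auto)

text \<open>Surjectivity: the same extension by continuity, now for \<open>invF_int\<close>, with
  \<open>is_FT_invF\<close> identifying the transform along the sequence.\<close>

lemma iFT_ex:
  assumes g: "sqi (Mc n) g" shows "\<exists>f. sqi (Mc n) f \<and> is_FT n f g"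
proof -
  obtain u where u: "\<And>j. testf n (u j)" "(\<lambda>j. nrm (Mc n) (\<lambda>x. u j x - g x)) \<longlonglongrightarrow> 0"
    by (rule test_approx[OF g]) blast
  have us: "sqi (Mc n) (u j)" for j using u(1) by (auto simp: testf_def)
  obtain f where f: "sqi (Mc n) f" "(\<lambda>j. nrm (Mc n) (\<lambda>x. invF_int n (u j) x - f x)) \<longlonglongrightarrow> 0"
  proof (rule sqi_complete[of "Mc n" "\<lambda>j. invF_int n (u j)"])
    show "\<And>j. sqi (Mc n) (invF_int n (u j))" by (rule invF_sqi[OF u(1)])
    fix e :: real assume "e > 0"
    from nrm_limit_Cauchy[OF us g u(2) this] obtain K where K: "\<forall>j\<ge>K. \<forall>l\<ge>K. nrm (Mc n) (\<lambda>x. u j x - u l x) < e" ..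
    have "nrm (Mc n) (\<lambda>x. invF_int n (u j) x - invF_int n (u l) x) \<le> nrm (Mc n) (\<lambda>x. u j x - u l x)" for j l
    proof -
      have "nrm (Mc n) (\<lambda>x. invF_int n (u j) x - invF_int n (u l) x) = nrm (Mc n) (invF_int n (\<lambda>k. u j k - 1 * u l k))"
        by (rule nrm_cong) (subst invF_lin[OF u(1) u(1)], auto)
      also have "\<dots> \<le> nrm (Mc n) (\<lambda>k. u j k - 1 * u l k)"
        by (rule invF_nrm_le[OF testf_diff[OF u(1) u(1)]])
      finally show ?thesis by simp
    qed
    then show "\<exists>K. \<forall>j\<ge>K. \<forall>l\<ge>K. nrm (Mc n) (\<lambda>x. invF_int n (u j) x - invF_int n (u l) x) < e"
      using K le_less_trans by blast
  qed blast
  have "is_FT n f g"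
    by (rule is_FT_limit[OF invF_sqi[OF u(1)] f is_FT_invF(1)[OF u(1)] g u(2)])
  with f(1) show ?thesis by blast
qed

lemma iFT_FT:
  assumes "sqi (Mc n) g"
  shows "sqi (Mc n) (iFT n g)" "is_FT n (iFT n g) g"
  using someI_ex[OF iFT_ex[OF assms]] unfolding iFT_def L2_sqi by auto

lemma FT_iFT:
  assumes "sqi (Mc n) g"
  shows "AE k in Mc n. FT n (iFT n g) k = g k"
  by (rule is_FT_unique[OF _ _ _ is_FT_FT[OF iFT_FT(1)[OF assms]] iFT_FT(2)[OF assms]])
    (use iFT_FT(1)[OF assms] in auto)

section \<open>The kernel form on one particle\<close>

lemma exp_eq_normal_density:
  assumes "u > 0"
  shows "exp (- u * (x - c)^2) = sqrt (pi / u) * normal_density c (1 / sqrt (2 * u)) x"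
proof -
  have "2 * (1 / sqrt (2 * u))^2 = 1 / u" using assms by (simp add: power_divide)
  then have "2 * pi * (1 / sqrt (2 * u))^2 = pi / u" "(x - c)^2 / (2 * (1 / sqrt (2 * u))^2) = u * (x - c)^2"
    using assms by (simp_all add: field_simps)
  then show ?thesis using assms unfolding normal_density_def by (simp add: real_sqrt_divide)
qed

lemma has_bochner_gauss_moments:
  assumes u: "u > 0"
  shows "has_bochner_integral lborel (\<lambda>x. exp (- u * (x - c)^2)) (sqrt (pi / u))"
    "has_bochner_integral lborel (\<lambda>x. exp (- u * (x - c)^2) * x) (sqrt (pi / u) * c)"
    "has_bochner_integral lborel (\<lambda>x. exp (- u * x^2) * x^2) (sqrt (pi / u) / (2 * u))"
    "has_bochner_integral lborel (\<lambda>x. exp (- u * x^2) * \<bar>x\<bar>) (1 / u)"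
    "has_bochner_integral lborel (\<lambda>x. exp (- u * x^2) * \<bar>x\<bar>^3) (1 / u^2)"
proof -
  define s where "s = 1 / sqrt (2 * u)"
  have s: "s > 0" "s^2 = 1 / (2 * u)" using u by (auto simp: s_def power_divide)
  note e = exp_eq_normal_density[OF u, folded s_def]
  show "has_bochner_integral lborel (\<lambda>x. exp (- u * (x - c)^2)) (sqrt (pi / u))"
    unfolding e using has_bochner_integral_mult_right[OF normal_moment_even[OF s(1), of c 0], of "sqrt (pi / u)"] by simp
  show "has_bochner_integral lborel (\<lambda>x. exp (- u * (x - c)^2) * x) (sqrt (pi / u) * c)"
    unfolding e using has_bochner_integral_mult_right[OF normal_moment_nz_1[OF s(1), of c], of "sqrt (pi / u)"]
    by (simp add: mult.assoc)
  note e0 = e[where c=0, simplified]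
  show "has_bochner_integral lborel (\<lambda>x. exp (- u * x^2) * x^2) (sqrt (pi / u) / (2 * u))"
    using has_bochner_integral_mult_right[OF normal_moment_even[OF s(1), of 0 1], of "sqrt (pi / u)"] s u
    by (simp add: e0 mult.assoc)
  have q: "sqrt (pi / u) * (s * sqrt (2 / pi)) = 1 / u"
  proof -
    have "s = sqrt (1 / (2 * u))" by (simp add: s_def real_sqrt_divide)
    then have "sqrt (pi / u) * (s * sqrt (2 / pi)) = sqrt ((1/u)^2)"
      using u by (simp only: real_sqrt_mult[symmetric]) (simp add: power2_eq_square)
    then show ?thesis using u by (simp only: real_sqrt_abs) simp
  qed
  show "has_bochner_integral lborel (\<lambda>x. exp (- u * x^2) * \<bar>x\<bar>) (1 / u)"
    using has_bochner_integral_mult_right[OF normal_moment_abs_odd[OF s(1), of 0 0], of "sqrt (pi / u)"] q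
    by (simp add: e0 mult.assoc)
  have "sqrt (pi / u) * (2 * s^3 * sqrt (2 / pi)) = 2 * s^2 * (sqrt (pi / u) * (s * sqrt (2 / pi)))"
    by (simp add: power2_eq_square power3_eq_cube)
  also have "\<dots> = 1 / u^2" unfolding q s(2) using u by (simp add: power2_eq_square)
  finally have c: "sqrt (pi / u) * (2 * s^3 * sqrt (2 / pi)) = 1 / u^2" .
  show "has_bochner_integral lborel (\<lambda>x. exp (- u * x^2) * \<bar>x\<bar>^3) (1 / u^2)"
  proof -
    have f: "(\<lambda>x. exp (- u * x^2) * \<bar>x\<bar>^3) = (\<lambda>x. sqrt (pi / u) * (normal_density 0 s x * \<bar>x - 0\<bar>^(2 * 1 + 1)))"
      by (rule ext) (simp add: e0)
    have c': "sqrt (pi / u) * (2^1 * s^(2 * 1 + 1) * fact 1 * sqrt (2 / pi)) = 1 / u^2" using c by simp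
    show ?thesis
      unfolding f c'[symmetric] by (rule has_bochner_integral_mult_right[OF normal_moment_abs_odd[OF s(1), of 0 1]])
  qed
qed

lemma has_bochner_nn:
  assumes "has_bochner_integral M f r" "\<And>x. 0 \<le> f x"
  shows "(\<integral>\<^sup>+x. ennreal (f x) \<partial>M) = ennreal r"
  using assms nn_integral_eq_integral[of M f] by (auto simp: has_bochner_integral_iff)

lemma nn_inv:
  assumes "u > 0"
  shows "(\<integral>\<^sup>+x. ennreal (exp (- u * x^2) * \<bar>x\<bar>) \<partial>lborel) = ennreal (1 / u)"
    "(\<integral>\<^sup>+x. ennreal (exp (- u * x^2) * \<bar>x\<bar>^3) \<partial>lborel) = ennreal (1 / u^2)"
    "(\<integral>\<^sup>+x. ennreal (exp (- u * x^2) * x^2) \<partial>lborel) = ennreal (sqrt pi / (2 * (u * sqrt u)))"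
    "(\<integral>\<^sup>+x. ennreal (exp (- u * x^2)) \<partial>lborel) = ennreal (sqrt (pi / u))"
proof -
  have "sqrt (pi / u) / (2 * u) = sqrt pi / (2 * (u * sqrt u))" by (simp add: real_sqrt_divide)
  then show "(\<integral>\<^sup>+x. ennreal (exp (- u * x^2) * x^2) \<partial>lborel) = ennreal (sqrt pi / (2 * (u * sqrt u)))"
    using has_bochner_nn[OF has_bochner_gauss_moments(3)[OF assms]] by simp
qed (rule has_bochner_nn, use has_bochner_gauss_moments[OF assms] has_bochner_gauss_moments(1)[OF assms, where c=0, simplified] in auto)+

text \<open>The representation of 1/u that turns the kernel \<open>Gk\<close> into a superposition
  of Gaussians, on which coordinates factorise and parities can be taken.\<close>

lemma integral_exp_decay:
  assumes "u > 0"
  shows "(\<integral>\<^sup>+t. ennreal (exp (- t * u)) * indicator {0..} t \<partial>lborel) = ennreal (1 / u)"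
    "has_bochner_integral lborel (\<lambda>t. indicator {0..} t * exp (- t * u)) (1 / u)"
proof -
  have "(\<integral>\<^sup>+t. ennreal (exp (- t * u)) * indicator {0..} t \<partial>lborel) = ennreal (0 - (- exp (- 0 * u) / u))"
  proof (rule nn_integral_FTC_atLeast)
    show "((\<lambda>t. - exp (- t * u) / u) \<longlongrightarrow> 0) at_top" using assms by real_asymp
  qed (use assms in \<open>auto intro!: derivative_eq_intros\<close>)
  then show *: "(\<integral>\<^sup>+t. ennreal (exp (- t * u)) * indicator {0..} t \<partial>lborel) = ennreal (1 / u)" by simp
  show "has_bochner_integral lborel (\<lambda>t. indicator {0..} t * exp (- t * u)) (1 / u)"
  proof (rule has_bochner_integral_nn_integral)
    have "(\<integral>\<^sup>+t. ennreal (indicator {0..} t * exp (- t * u)) \<partial>lborel) = (\<integral>\<^sup>+t. ennreal (exp (- t * u)) * indicator {0..} t \<partial>lborel)"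
      by (intro nn_integral_cong) (auto simp: indicator_def)
    then show "(\<integral>\<^sup>+t. ennreal (indicator {0..} t * exp (- t * u)) \<partial>lborel) = ennreal (1 / u)" using * by simp
  qed (use assms in auto)
qed

text \<open>Completing the square about b/u and -b/u reduces both to moments of shifted Gaussians.
  The product x sinh (2 b x) has the sign of b throughout, so the absolute values cost
  nothing.\<close>

lemma gauss_cosh:
  assumes u: "u > 0"
  shows "(\<integral>\<^sup>+x. ennreal (exp (- u * x^2) * cosh (2 * b * x)) \<partial>lborel) = ennreal (sqrt (pi / u) * exp (b^2 / u))"
    "(\<integral>\<^sup>+x. ennreal (exp (- u * x^2) * (\<bar>x\<bar> * \<bar>sinh (2 * b * x)\<bar>)) \<partial>lborel) = ennreal (sqrt (pi / u) * (\<bar>b\<bar> / u) * exp (b^2 / u))"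
proof -
  define c where "c = b / u"
  have ex: "exp (- u * x^2) * exp (2 * b * x) = exp (b^2 / u) * exp (- u * (x - c)^2)"
    "exp (- u * x^2) * exp (- (2 * b * x)) = exp (b^2 / u) * exp (- u * (x - - c)^2)" for x
    unfolding exp_add[symmetric] c_def using u by (simp_all add: field_simps power2_eq_square)
  note m1 = has_bochner_gauss_moments(1)[OF u, of c] has_bochner_gauss_moments(1)[OF u, of "- c"]
  note m2 = has_bochner_gauss_moments(2)[OF u, of c] has_bochner_gauss_moments(2)[OF u, of "- c"]
  have "has_bochner_integral lborel (\<lambda>x. exp (b^2 / u) / 2 * (exp (- u * (x - c)^2) + exp (- u * (x - - c)^2)))
     (exp (b^2 / u) / 2 * (sqrt (pi / u) + sqrt (pi / u)))"
    by (intro has_bochner_integral_mult_right has_bochner_integral_add m1)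
  moreover have "exp (b^2 / u) / 2 * (exp (- u * (x - c)^2) + exp (- u * (x - - c)^2)) = exp (- u * x^2) * cosh (2 * b * x)" for x
    unfolding cosh_field_def using ex[of x] by (simp add: field_simps)
  ultimately have "has_bochner_integral lborel (\<lambda>x. exp (- u * x^2) * cosh (2 * b * x)) (sqrt (pi / u) * exp (b^2 / u))"
    by (simp add: mult.commute)
  then show "(\<integral>\<^sup>+x. ennreal (exp (- u * x^2) * cosh (2 * b * x)) \<partial>lborel) = ennreal (sqrt (pi / u) * exp (b^2 / u))"
    by (rule has_bochner_nn) simp
  have "has_bochner_integral lborel (\<lambda>x. exp (b^2 / u) / 2 * (exp (- u * (x - c)^2) * x - exp (- u * (x - - c)^2) * x))
     (exp (b^2 / u) / 2 * (sqrt (pi / u) * c - sqrt (pi / u) * (- c)))"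
    by (intro has_bochner_integral_mult_right has_bochner_integral_diff m2)
  moreover have "exp (b^2 / u) / 2 * (exp (- u * (x - c)^2) * x - exp (- u * (x - - c)^2) * x) = exp (- u * x^2) * (x * sinh (2 * b * x))" for x
    unfolding sinh_field_def using ex[of x] by (simp add: field_simps)
  moreover have "exp (b^2 / u) / 2 * (sqrt (pi / u) * c - sqrt (pi / u) * (- c)) = sqrt (pi / u) * c * exp (b^2 / u)"
    by simp
  ultimately have h: "has_bochner_integral lborel (\<lambda>x. exp (- u * x^2) * (x * sinh (2 * b * x))) (sqrt (pi / u) * c * exp (b^2 / u))"
    by (simp only:)
  have sg: "\<bar>x\<bar> * \<bar>sinh (2 * b * x)\<bar> = sgn b * (x * sinh (2 * b * x))" for x
  proof -
    have "b * (x * sinh (2 * b * x)) \<ge> 0"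
    proof -
      have "y * sinh y \<ge> 0" for y :: real by (cases "y \<ge> 0") (auto simp: zero_le_mult_iff)
      from this[of "2 * b * x"] show ?thesis by (simp add: mult.assoc)
    qed
    then show ?thesis
      by (cases "b = 0") (auto simp: abs_mult[symmetric] sgn_if zero_le_mult_iff mult_le_0_iff)
  qed
  have "has_bochner_integral lborel (\<lambda>x. sgn b * (exp (- u * x^2) * (x * sinh (2 * b * x)))) (sgn b * (sqrt (pi / u) * c * exp (b^2 / u)))"
    by (rule has_bochner_integral_mult_right[OF h])
  moreover have "sgn b * (sqrt (pi / u) * c * exp (b^2 / u)) = sqrt (pi / u) * (\<bar>b\<bar> / u) * exp (b^2 / u)"
    by (simp add: c_def abs_sgn mult.commute)
  ultimately have "has_bochner_integral lborel (\<lambda>x. exp (- u * x^2) * (\<bar>x\<bar> * \<bar>sinh (2 * b * x)\<bar>)) (sqrt (pi / u) * (\<bar>b\<bar> / u) * exp (b^2 / u))"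
    unfolding sg by (simp add: mult.left_commute)
  then show "(\<integral>\<^sup>+x. ennreal (exp (- u * x^2) * (\<bar>x\<bar> * \<bar>sinh (2 * b * x)\<bar>)) \<partial>lborel) = ennreal (sqrt (pi / u) * (\<bar>b\<bar> / u) * exp (b^2 / u))"
    by (rule has_bochner_nn) simp
qed

lemma nn_integral_even:
  fixes f :: "real \<Rightarrow> ennreal"
  assumes [measurable]: "f \<in> borel_measurable borel" and e: "\<And>x. f (- x) = f x"
  shows "(\<integral>\<^sup>+x. f x \<partial>lborel) = 2 * (\<integral>\<^sup>+x. f x * indicator {0..} x \<partial>lborel)"
proof -
  have "(\<integral>\<^sup>+x. f x \<partial>lborel) = (\<integral>\<^sup>+x. f x * indicator {0..} x + f x * indicator {..<0} x \<partial>lborel)"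
    by (intro nn_integral_cong) (auto simp: indicator_def)
  also have "\<dots> = (\<integral>\<^sup>+x. f x * indicator {0..} x \<partial>lborel) + (\<integral>\<^sup>+x. f x * indicator {..<0} x \<partial>lborel)"
    by (rule nn_integral_add) auto
  also have "(\<integral>\<^sup>+x. f x * indicator {..<0} x \<partial>lborel) = (\<integral>\<^sup>+x. f x * indicator {0<..} x \<partial>lborel)"
    by (subst nn_integral_real_affine[where t=0 and c="-1"]) (auto simp: e indicator_def intro!: nn_integral_cong)
  also have "\<dots> = (\<integral>\<^sup>+x. f x * indicator {0..} x \<partial>lborel)"
    by (intro nn_integral_cong_AE AE_I[where N="{0}"]) (auto simp: indicator_def split: if_splits)
  finally show ?thesis by (simp add: mult_2)
qed

text \<open>Up to sign, the l = 1 eigenvalue of the kernel 1 / (p^2 + q^2 + 2 a p.q) relative to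
  multiplication by |p|; see \<open>Sk_eigen\<close>. \<open>Lambda_tau\<close> matches it with
  \<Lambda>.\<close>

definition tau :: "real \<Rightarrow> real" where
  "tau a = 4 * pi / a^2 * (a - sqrt (1 - a^2) * arcsin a)"

text \<open>The substitution z = v / sqrt (1 + v^2) turns the integrand into a multiple of z^2 /
  (b^2 + a^2 z^2), with b^2 = 1 - a^2, whose antiderivative is an arctangent. In this form
  positivity and monotonicity in a are visible, unlike in the closed form.\<close>

lemma tau_integral:
  assumes a: "0 < a" "a < 1"
  shows "(\<integral>\<^sup>+v. ennreal (4 * pi * a * (v^2 / (v^2 + (1 - a^2)) / (sqrt (1 + v^2))^3)) * indicator {0..} v \<partial>lborel) = ennreal (tau a)"
    "tau a \<ge> 0"
proof -
  define b where "b = sqrt (1 - a^2)"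
  have a2: "a^2 < 1" using a by (simp add: power_less_one_iff)
  have b: "b > 0" "b^2 = 1 - a^2" using a2 by (auto simp: b_def)
  let ?F = "\<lambda>v. 4 * pi / a * (v / sqrt (1 + v^2) - b / a * arctan (a / b * (v / sqrt (1 + v^2))))"
  let ?T = "4 * pi / a * (1 - b / a * arctan (a / b * 1))"
  have z: "((\<lambda>v. v / sqrt (1 + v^2)) \<longlongrightarrow> 1) (at_top :: real filter)" by real_asymp
  have lim: "(?F \<longlongrightarrow> ?T) at_top" by (intro tendsto_intros z)
  have D: "DERIV ?F v :> 4 * pi * a * (v^2 / (v^2 + (1 - a^2)) / (sqrt (1 + v^2))^3)" for v
  proof -
    let ?w = "sqrt (1 + v^2)"
    have w: "?w > 0" "?w^2 = 1 + v^2" by (auto simp: add_pos_nonneg)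
    have w0: "1 + v^2 > 0" by (simp add: add_pos_nonneg)
    have Dz: "DERIV (\<lambda>v. v / sqrt (1 + v^2)) v :> 1 / ?w^3"
    proof -
      have "DERIV (\<lambda>v. v / sqrt (1 + v^2)) v :> (1 * ?w - v * (inverse ?w / 2 * (2 * v))) / (?w * ?w)"
        using w0 by (auto intro!: derivative_eq_intros)
      moreover have "(1 * ?w - v * (inverse ?w / 2 * (2 * v))) / (?w * ?w) = 1 / ?w^3"
      proof -
        have "?w - v * (inverse ?w / 2 * (2 * v)) = (?w^2 - v^2) / ?w"
          using w(1) by (simp add: field_simps power2_eq_square)
        also have "\<dots> = 1 / ?w" unfolding w(2) by simp
        finally show ?thesis by (simp add: power3_eq_cube)
      qed
      ultimately show ?thesis by simp
    qed
    let ?z = "v / ?w"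
    have "DERIV ?F v :> 4 * pi / a * (1 / ?w^3 - b / a * (inverse (1 + (a / b * ?z)^2) * (a / b * (1 / ?w^3))))"
      by (rule DERIV_cmult[OF DERIV_diff[OF Dz DERIV_cmult[OF DERIV_chain2[OF DERIV_arctan DERIV_cmult[OF Dz]]]]])
    moreover have "4 * pi / a * (1 / ?w^3 - b / a * (inverse (1 + (a / b * ?z)^2) * (a / b * (1 / ?w^3)))) =
        4 * pi / a * (1 - inverse (1 + (a / b * ?z)^2)) / ?w^3"
    proof -
      have gen: "b / a * (I * (a / b * (1 / W))) = I / W" for I W using a b by simp
      show ?thesis unfolding gen by (simp add: diff_divide_distrib right_diff_distrib)
    qed
    moreover have "1 - inverse (1 + (a / b * ?z)^2) = a^2 * (v^2 / (v^2 + (1 - a^2)))"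
    proof -
      have sq: "(a / b * ?z)^2 = a^2 * v^2 / (b^2 * (1 + v^2))"
        unfolding power_mult_distrib power_divide w(2) by simp
      have pos: "b^2 * (1 + v^2) > 0" using b(1) by (simp add: add_pos_nonneg)
      have e2: "b^2 * (1 + v^2) + a^2 * v^2 = v^2 + (1 - a^2)" unfolding b(2) by (simp add: algebra_simps)
      have pos2: "v^2 + (1 - a^2) > 0" using a2 by (simp add: add_nonneg_pos)
      have "1 + (a / b * ?z)^2 = (v^2 + (1 - a^2)) / (b^2 * (1 + v^2))"
      proof -
        have nz: "b^2 * (1 + v^2) \<noteq> 0" using pos by linarith
        show ?thesis unfolding sq e2[symmetric] by (simp only: add_divide_distrib divide_self[OF nz])
      qed
      then have "1 - inverse (1 + (a / b * ?z)^2) = ((v^2 + (1 - a^2)) - b^2 * (1 + v^2)) / (v^2 + (1 - a^2))"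
        using pos2 by (simp add: diff_divide_distrib)
      then show ?thesis unfolding e2[symmetric] by simp
    qed
    ultimately show ?thesis using a by (simp add: power2_eq_square mult.assoc)
  qed
  have nn: "0 \<le> 4 * pi * a * (v^2 / (v^2 + (1 - a^2)) / (sqrt (1 + v^2))^3)" for v
    using a a2 by (intro mult_nonneg_nonneg divide_nonneg_nonneg) auto
  have FT: "(\<integral>\<^sup>+v. ennreal (4 * pi * a * (v^2 / (v^2 + (1 - a^2)) / (sqrt (1 + v^2))^3)) * indicator {0..} v \<partial>lborel) = ennreal (?T - ?F 0)"
    by (rule nn_integral_FTC_atLeast[OF _ D nn lim]) measurable
  \<comment> \<open>Both are the angle of the right triangle with opposite side a, adjacent side b
    and hypotenuse 1.\<close>
  have "arctan (a / b) = arcsin a"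
    using arcsin_arctan[of a] a by (simp add: b_def)
  then have T: "?T - ?F 0 = tau a"
    unfolding tau_def b_def[symmetric] using a by (simp add: field_simps power2_eq_square)
  show "(\<integral>\<^sup>+v. ennreal (4 * pi * a * (v^2 / (v^2 + (1 - a^2)) / (sqrt (1 + v^2))^3)) * indicator {0..} v \<partial>lborel) = ennreal (tau a)"
    using FT T by simp
  have "?F 0 \<le> ?T"
  proof (rule tendsto_lowerbound[OF lim])
    show "\<forall>\<^sub>F x in at_top. ?F 0 \<le> ?F x"
      unfolding eventually_at_top_linorder
    proof (intro exI[of _ 0] allI impI)
      fix x :: real assume "0 \<le> x"
      then show "?F 0 \<le> ?F x"
      proof (rule DERIV_nonneg_imp_nondecreasing)
        fix v
        show "\<exists>y. DERIV ?F v :> y \<and> 0 \<le> y"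
          by (rule exI, rule conjI, rule D, rule nn)
      qed
    qed
  qed simp
  then show "tau a \<ge> 0" using T by linarith
qed

section \<open>The exact eigenfunction of the l = 1 sector\<close>

lemma nn_integral_vec3_prod:
  fixes f :: "3 \<Rightarrow> real \<Rightarrow> real"
  assumes [measurable]: "\<And>i. f i \<in> borel_measurable borel" and nn: "\<And>i x. 0 \<le> f i x"
  shows "(\<integral>\<^sup>+q. ennreal (\<Prod>i\<in>UNIV. f i (q $ i)) \<partial>(lborel :: (real^3) measure)) = (\<Prod>i\<in>UNIV. \<integral>\<^sup>+x. ennreal (f i x) \<partial>lborel)"
proof -
  let ?B = "Basis :: (real^3) set"
  have B: "?B = range (\<lambda>i. axis i 1)" by (auto simp: Basis_vec_def)
  have inj: "inj (\<lambda>i::3. axis i (1::real))" by (auto simp: inj_on_def axis_eq_axis)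
  have r: "(\<Prod>b\<in>?B. g b) = (\<Prod>i\<in>UNIV. g (axis i 1))" for g :: "real^3 \<Rightarrow> ennreal"
    unfolding B prod.reindex[OF inj] by (simp add: comp_def)
  define ix :: "real^3 \<Rightarrow> 3" where "ix b = (THE i. b = axis i 1)" for b
  have ai: "ix (axis i (1::real)) = i" for i
    unfolding ix_def by (rule the_equality) (auto simp: axis_eq_axis)
  have "(\<integral>\<^sup>+q. ennreal (\<Prod>i\<in>UNIV. f i (q $ i)) \<partial>(lborel :: (real^3) measure)) =
     (\<integral>\<^sup>+q. (\<Prod>b\<in>?B. ennreal (f (ix b) (q \<bullet> b))) \<partial>lborel)"
    unfolding r ai by (intro nn_integral_cong) (simp add: prod_ennreal nn inner_axis)
  also have "\<dots> = (\<Prod>b\<in>?B. \<integral>\<^sup>+x. ennreal (f (ix b) x) \<partial>lborel)"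
    by (rule nn_integral_lborel_prod) auto
  also have "\<dots> = (\<Prod>i\<in>UNIV. \<integral>\<^sup>+x. ennreal (f i x) \<partial>lborel)" unfolding r ai ..
  finally show ?thesis .
qed

lemma norm_sq_vec3: "(norm (x :: real^3))^2 = (\<Sum>i\<in>UNIV. (x $ i)^2)"
  unfolding power2_norm_eq_inner inner_vec_def by (simp add: power2_eq_square)

lemma borel_measurable_sinh_cosh[measurable (raw)]:
  fixes f :: "_ \<Rightarrow> real"
  assumes "f \<in> borel_measurable M"
  shows "(\<lambda>x. sinh (f x)) \<in> borel_measurable M" "(\<lambda>x. cosh (f x)) \<in> borel_measurable M"
  by (rule measurable_compose[OF assms], intro borel_measurable_continuous_onI continuous_intros)+

lemma prod_split1: "(\<Prod>j\<in>UNIV. h j) = h i * (\<Prod>j\<in>- {i}. h j)" for i :: "'i::finite"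
  by (subst prod.remove[of UNIV i]) (auto simp: Compl_eq_Diff_UNIV)

lemma gauss_sinh_cosh_vec:
  fixes b :: "real^3" and i :: 3
  assumes s: "s > 0"
  shows "(\<integral>\<^sup>+q. ennreal (exp (- s * (norm q)^2) * (\<bar>q $ i\<bar> * \<bar>sinh (2 * b $ i * q $ i)\<bar>) * (\<Prod>j\<in>- {i}. cosh (2 * b $ j * q $ j))) \<partial>lborel)
    = ennreal (sqrt (pi / s)^3 * (\<bar>b $ i\<bar> / s) * exp ((norm b)^2 / s))"
proof -
  define g where "g j x = (if j = i then exp (- s * x^2) * (\<bar>x\<bar> * \<bar>sinh (2 * b $ i * x)\<bar>) else exp (- s * x^2) * cosh (2 * b $ j * x))" for j :: 3 and x :: real
  have sqrt: "sqrt (pi / s) ^ card (- {i}) = sqrt (pi / s)^2"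
    by (simp add: Compl_eq_Diff_UNIV card_Diff_singleton)
  have "(\<integral>\<^sup>+q. ennreal (exp (- s * (norm q)^2) * (\<bar>q $ i\<bar> * \<bar>sinh (2 * b $ i * q $ i)\<bar>) * (\<Prod>j\<in>- {i}. cosh (2 * b $ j * q $ j))) \<partial>lborel)
    = (\<integral>\<^sup>+q. ennreal (\<Prod>j\<in>UNIV. g j (q $ j)) \<partial>(lborel :: (real^3) measure))"
  proof (intro nn_integral_cong arg_cong[where f=ennreal])
    fix q :: "real^3"
    have "exp (- s * (norm q)^2) = (\<Prod>j\<in>UNIV. exp (- s * (q $ j)^2))"
      by (simp add: norm_sq_vec3 sum_distrib_left exp_sum[symmetric])
    then have "exp (- s * (norm q)^2) = exp (- s * (q $ i)^2) * (\<Prod>j\<in>- {i}. exp (- s * (q $ j)^2))"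
      using prod_split1[where i=i and h="\<lambda>j. exp (- s * (q $ j)^2)"] by simp
    moreover have "(\<Prod>j\<in>- {i}. g j (q $ j)) = (\<Prod>j\<in>- {i}. exp (- s * (q $ j)^2)) * (\<Prod>j\<in>- {i}. cosh (2 * b $ j * q $ j))"
      unfolding prod.distrib[symmetric] by (intro prod.cong) (auto simp: g_def)
    ultimately show "exp (- s * (norm q)^2) * (\<bar>q $ i\<bar> * \<bar>sinh (2 * b $ i * q $ i)\<bar>) * (\<Prod>j\<in>- {i}. cosh (2 * b $ j * q $ j)) = (\<Prod>j\<in>UNIV. g j (q $ j))"
      unfolding prod_split1[where i=i and h="\<lambda>j. g j (q $ j)"] by (simp add: g_def[of i] mult_ac)
  qed
  also have "\<dots> = (\<Prod>j\<in>UNIV. \<integral>\<^sup>+x. ennreal (g j x) \<partial>lborel)"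
  proof (rule nn_integral_vec3_prod)
    fix j
    have "(\<lambda>x. exp (- s * x^2) * (\<bar>x\<bar> * \<bar>sinh (2 * b $ i * x)\<bar>)) \<in> borel_measurable borel"
      "(\<lambda>x. exp (- s * x^2) * cosh (2 * b $ j * x)) \<in> borel_measurable borel" by measurable
    then show "g j \<in> borel_measurable borel" by (cases "j = i") (simp_all add: g_def[abs_def])
  qed (simp add: g_def)
  also have "\<dots> = (\<integral>\<^sup>+x. ennreal (g i x) \<partial>lborel) * (\<Prod>j\<in>- {i}. \<integral>\<^sup>+x. ennreal (g j x) \<partial>lborel)"
    by (rule prod_split1)
  also have "(\<integral>\<^sup>+x. ennreal (g i x) \<partial>lborel) = ennreal (sqrt (pi / s) * (\<bar>b $ i\<bar> / s) * exp ((b $ i)^2 / s))"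
    using gauss_cosh(2)[OF s, of "b $ i"] by (simp add: g_def)
  also have "(\<Prod>j\<in>- {i}. \<integral>\<^sup>+x. ennreal (g j x) \<partial>lborel) = (\<Prod>j\<in>- {i}. ennreal (sqrt (pi / s) * exp ((b $ j)^2 / s)))"
    using gauss_cosh(1)[OF s] by (intro prod.cong) (auto simp: g_def)
  also have "\<dots> = ennreal (\<Prod>j\<in>- {i}. sqrt (pi / s) * exp ((b $ j)^2 / s))"
    using s by (intro prod_ennreal) auto
  also have "(\<Prod>j\<in>- {i}. sqrt (pi / s) * exp ((b $ j)^2 / s)) = sqrt (pi / s)^2 * (\<Prod>j\<in>- {i}. exp ((b $ j)^2 / s))"
    by (simp add: prod.distrib sqrt)
  also have "ennreal (sqrt (pi / s) * (\<bar>b $ i\<bar> / s) * exp ((b $ i)^2 / s)) * ennreal (sqrt (pi / s)^2 * (\<Prod>j\<in>- {i}. exp ((b $ j)^2 / s)))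
     = ennreal (sqrt (pi / s) * (\<bar>b $ i\<bar> / s) * exp ((b $ i)^2 / s) * (sqrt (pi / s)^2 * (\<Prod>j\<in>- {i}. exp ((b $ j)^2 / s))))"
    by (rule ennreal_mult'[symmetric]) (use s in auto)
  also have "sqrt (pi / s) * (\<bar>b $ i\<bar> / s) * exp ((b $ i)^2 / s) * (sqrt (pi / s)^2 * (\<Prod>j\<in>- {i}. exp ((b $ j)^2 / s)))
     = sqrt (pi / s)^3 * (\<bar>b $ i\<bar> / s) * (\<Prod>j\<in>UNIV. exp ((b $ j)^2 / s))"
    unfolding prod_split1[where i=i and h="\<lambda>j. exp ((b $ j)^2 / s)"] by (simp add: power2_eq_square power3_eq_cube mult_ac)
  also have "(\<Prod>j\<in>UNIV. exp ((b $ j)^2 / s)) = exp ((norm b)^2 / s)"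
    by (simp add: norm_sq_vec3 sum_divide_distrib exp_sum[symmetric])
  finally show ?thesis .
qed

text \<open>The Gaussian exp (-t (p^2 + q^2 + 2 a p.q)) made odd in coordinate i and even in the
  others, in absolute value. It dominates the projected Gaussian of every sector that is odd in
  coordinate i.\<close>

definition Sk :: "real \<Rightarrow> 3 \<Rightarrow> real \<Rightarrow> real^3 \<Rightarrow> real^3 \<Rightarrow> real" where
  "Sk a i t p q = exp (- t * (norm p)^2) * exp (- t * (norm q)^2) *
     (\<bar>sinh (2 * (a * t * p $ i) * q $ i)\<bar> * (\<Prod>j\<in>- {i}. cosh (2 * (a * t * p $ j) * q $ j)))"

lemma Sk_nonneg: "0 \<le> Sk a i t p q"
  unfolding Sk_def by (intro mult_nonneg_nonneg prod_nonneg) auto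

lemma Sk_commute: "Sk a i t p q = Sk a i t q p"
  unfolding Sk_def by (simp add: mult.commute mult.left_commute)

lemma vec_nth_measurable[measurable]: "(\<lambda>x :: real^3. x $ i) \<in> borel_measurable borel"
  by (intro borel_measurable_continuous_onI continuous_intros)

lemma Sk_measurable[measurable (raw)]:
  assumes [measurable]: "t \<in> borel_measurable M" "p \<in> borel_measurable M" "q \<in> borel_measurable M"
  shows "(\<lambda>x. Sk a i (t x) (p x) (q x)) \<in> borel_measurable M"
  unfolding Sk_def by measurable

text \<open>The l = 1 function \<open>q\<^sub>i/|q|\<^sup>3\<close> is an exact eigenfunction, which makes the Schur test below sharp.\<close>
lemma Sk_eigen:
  assumes a: "0 < a" "a < 1" and p: "p \<noteq> 0"
  shows "(\<integral>\<^sup>+t. indicator {0..} t * (\<integral>\<^sup>+q. ennreal (Sk a i t p q * (\<bar>q $ i\<bar> / (norm q)^3)) \<partial>lborel) \<partial>lborel)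
    = ennreal (tau a * (\<bar>p $ i\<bar> / (norm p)^2))"
proof -
  have a2: "a^2 < 1" using a by (simp add: power_less_one_iff)
  let ?h = "\<lambda>t q. exp (- t * (norm q)^2) * (\<bar>sinh (2 * (a * t * p $ i) * q $ i)\<bar> * (\<Prod>j\<in>- {i}. cosh (2 * (a * t * p $ j) * q $ j)))"
  let ?E = "\<lambda>t v. 2 * pi * a * \<bar>p $ i\<bar> * (v^2 / (sqrt (1 + v^2))^5) * exp (- t * ((norm p)^2 * ((v^2 + (1 - a^2)) / (1 + v^2))))"
  have h0: "0 \<le> (\<Prod>j\<in>- {i}. cosh (2 * (a * t * p $ j) * q $ j))" for t and q :: "real^3" by (intro prod_nonneg) auto
  have inner: "(\<integral>\<^sup>+q. ennreal (Sk a i t p q * (\<bar>q $ i\<bar> / (norm q)^3)) \<partial>lborel) = (\<integral>\<^sup>+v. ennreal (?E t v) \<partial>lborel)"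
    if t: "t > 0" for t
  proof -
    let ?X = "\<lambda>q::real^3. \<bar>q $ i\<bar> * \<bar>sinh (2 * (a * t * p $ i) * q $ i)\<bar> * (\<Prod>j\<in>- {i}. cosh (2 * (a * t * p $ j) * q $ j))"
    \<comment> \<open>The singular factor is a Gaussian superposition: 1/|q|^3 is 2 / sqrt pi times
      the integral of s^2 exp (-s^2 |q|^2) over s. The q-integral then becomes an explicit Gaussian
      one.\<close>
    have "(\<integral>\<^sup>+q. ennreal (Sk a i t p q * (\<bar>q $ i\<bar> / (norm q)^3)) \<partial>lborel) =
      (\<integral>\<^sup>+q. (\<integral>\<^sup>+s. ennreal (2 / sqrt pi * exp (- t * (norm p)^2) * s^2 * (exp (- (t + s^2) * (norm q)^2) * ?X q)) \<partial>lborel) \<partial>lborel)"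
    proof (rule nn_integral_cong_AE)
      have "AE q in (lborel :: (real^3) measure). q \<noteq> 0" by (rule AE_lborel_singleton)
      then show "AE q in lborel. ennreal (Sk a i t p q * (\<bar>q $ i\<bar> / (norm q)^3)) =
         (\<integral>\<^sup>+s. ennreal (2 / sqrt pi * exp (- t * (norm p)^2) * s^2 * (exp (- (t + s^2) * (norm q)^2) * ?X q)) \<partial>lborel)"
      proof eventually_elim
        case (elim q)
        let ?c = "2 / sqrt pi * exp (- t * (norm p)^2) * exp (- t * (norm q)^2) * ?X q"
        have X0: "0 \<le> ?X q" using h0[of t q] by (intro mult_nonneg_nonneg) auto
        have c0: "0 \<le> ?c" using X0 by simp
        have "(\<integral>\<^sup>+s. ennreal (2 / sqrt pi * exp (- t * (norm p)^2) * s^2 * (exp (- (t + s^2) * (norm q)^2) * ?X q)) \<partial>lborel) =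
          (\<integral>\<^sup>+s. ennreal ?c * ennreal (exp (- ((norm q)^2) * s^2) * s^2) \<partial>lborel)"
        proof (rule nn_integral_cong)
          fix s :: real
          have e: "exp (- (t + s^2) * (norm q)^2) = exp (- t * (norm q)^2) * exp (- ((norm q)^2) * s^2)"
            unfolding exp_add[symmetric] by (simp add: algebra_simps)
          show "ennreal (2 / sqrt pi * exp (- t * (norm p)^2) * s^2 * (exp (- (t + s^2) * (norm q)^2) * ?X q)) =
             ennreal ?c * ennreal (exp (- ((norm q)^2) * s^2) * s^2)"
            unfolding e by (subst ennreal_mult[symmetric]) (use c0 in \<open>auto simp: mult_ac\<close>)
        qed
        also have "\<dots> = ennreal ?c * ennreal (sqrt pi / (2 * ((norm q)^2 * sqrt ((norm q)^2))))"
          using elim by (subst nn_integral_cmult, simp, subst nn_inv(3)) auto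
        also have "\<dots> = ennreal (?c * (sqrt pi / (2 * (norm q)^3)))"
          by (subst ennreal_mult[symmetric]) (use c0 in \<open>auto simp: power3_eq_cube power2_eq_square\<close>)
        also have "?c * (sqrt pi / (2 * (norm q)^3)) = Sk a i t p q * (\<bar>q $ i\<bar> / (norm q)^3)"
        proof -
          have g: "2 / sqrt pi * P * Q * (A * S * C) * (sqrt pi / (2 * W)) = P * Q * (S * C) * (A / W)" for P Q A S C W :: real
            by (simp add: field_simps)
          show ?thesis unfolding Sk_def by (rule g)
        qed
        finally show ?case by simp
      qed
    qed
    also have "\<dots> = (\<integral>\<^sup>+s. (\<integral>\<^sup>+q. ennreal (2 / sqrt pi * exp (- t * (norm p)^2) * s^2 * (exp (- (t + s^2) * (norm q)^2) * ?X q)) \<partial>lborel) \<partial>lborel)"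
      by (rule lborel_pair.Fubini') measurable
    also have "\<dots> = (\<integral>\<^sup>+s. ennreal (2 / sqrt pi * exp (- t * (norm p)^2) * s^2 *
        (sqrt (pi / (t + s^2))^3 * (a * t * \<bar>p $ i\<bar> / (t + s^2)) * exp ((a * t)^2 * (norm p)^2 / (t + s^2)))) \<partial>lborel)"
    proof (rule nn_integral_cong)
      fix s :: real
      have ts: "t + s^2 > 0" using t by (simp add: add_pos_nonneg)
      have "(\<integral>\<^sup>+q. ennreal (2 / sqrt pi * exp (- t * (norm p)^2) * s^2 * (exp (- (t + s^2) * (norm q)^2) * ?X q)) \<partial>lborel) =
         (\<integral>\<^sup>+q. ennreal (2 / sqrt pi * exp (- t * (norm p)^2) * s^2) * ennreal (exp (- (t + s^2) * (norm q)^2) * ?X q) \<partial>lborel)"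
        using h0[of t] by (intro nn_integral_cong, subst ennreal_mult[symmetric]) (auto intro!: mult_nonneg_nonneg)
      also have "\<dots> = ennreal (2 / sqrt pi * exp (- t * (norm p)^2) * s^2) * (\<integral>\<^sup>+q. ennreal (exp (- (t + s^2) * (norm q)^2) * ?X q) \<partial>lborel)"
        by (rule nn_integral_cmult) measurable
      also have "(\<integral>\<^sup>+q. ennreal (exp (- (t + s^2) * (norm q)^2) * ?X q) \<partial>lborel) =
          ennreal (sqrt (pi / (t + s^2))^3 * (\<bar>((a * t) *\<^sub>R p) $ i\<bar> / (t + s^2)) * exp ((norm ((a * t) *\<^sub>R p))^2 / (t + s^2)))"
        using gauss_sinh_cosh_vec[OF ts, of i "(a * t) *\<^sub>R p"] by (simp add: mult.assoc)
      also have "\<dots> = ennreal (sqrt (pi / (t + s^2))^3 * (a * t * \<bar>p $ i\<bar> / (t + s^2)) * exp ((a * t)^2 * (norm p)^2 / (t + s^2)))"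
        using a t by (simp add: abs_mult power_mult_distrib)
      also have "ennreal (2 / sqrt pi * exp (- t * (norm p)^2) * s^2) * \<dots> = ennreal (2 / sqrt pi * exp (- t * (norm p)^2) * s^2 *
        (sqrt (pi / (t + s^2))^3 * (a * t * \<bar>p $ i\<bar> / (t + s^2)) * exp ((a * t)^2 * (norm p)^2 / (t + s^2))))"
        using a t ts by (intro ennreal_mult[symmetric]) (auto intro!: mult_nonneg_nonneg)
      finally show "(\<integral>\<^sup>+q. ennreal (2 / sqrt pi * exp (- t * (norm p)^2) * s^2 * (exp (- (t + s^2) * (norm q)^2) * ?X q)) \<partial>lborel) = \<dots>" .
    qed
    \<comment> \<open>Substituting s = sqrt t v cancels every power of t outside the exponential and
      makes the exponent linear in t.\<close>
    also have "\<dots> = ennreal \<bar>sqrt t\<bar> * (\<integral>\<^sup>+v. ennreal (2 / sqrt pi * exp (- t * (norm p)^2) * (0 + sqrt t * v)^2 *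
        (sqrt (pi / (t + (0 + sqrt t * v)^2))^3 * (a * t * \<bar>p $ i\<bar> / (t + (0 + sqrt t * v)^2)) * exp ((a * t)^2 * (norm p)^2 / (t + (0 + sqrt t * v)^2)))) \<partial>lborel)"
      by (rule nn_integral_real_affine[where t=0 and c="sqrt t"]) (use t in auto)
    also have "\<dots> = (\<integral>\<^sup>+v. ennreal \<bar>sqrt t\<bar> * ennreal (2 / sqrt pi * exp (- t * (norm p)^2) * (0 + sqrt t * v)^2 *
        (sqrt (pi / (t + (0 + sqrt t * v)^2))^3 * (a * t * \<bar>p $ i\<bar> / (t + (0 + sqrt t * v)^2)) * exp ((a * t)^2 * (norm p)^2 / (t + (0 + sqrt t * v)^2)))) \<partial>lborel)"
      by (rule nn_integral_cmult[symmetric]) measurable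
    also have "\<dots> = (\<integral>\<^sup>+v. ennreal (?E t v) \<partial>lborel)"
      proof (rule nn_integral_cong)
        fix v :: real
        define w where "w = sqrt (1 + v^2)"
        have w: "w > 0" "w^2 = 1 + v^2" by (auto simp: w_def add_pos_nonneg)
        define r where "r = sqrt t"
        have r: "r > 0" "t = r^2" using t by (auto simp: r_def)
        have sr: "0 + sqrt t * v = r * v" by (simp add: r_def)
        have ts: "t + (r * v)^2 = t * w^2" using r(2) unfolding w(2) by (simp add: power_mult_distrib algebra_simps)
        have s1: "sqrt (pi / (t * w^2)) = sqrt pi / (r * w)"
          unfolding real_sqrt_divide real_sqrt_mult r_def[symmetric] using w(1) by simp
        have e1: "exp (- t * (norm p)^2) * exp ((a * t)^2 * (norm p)^2 / (t * w^2)) = exp (- t * ((norm p)^2 * ((v^2 + (1 - a^2)) / (1 + v^2))))"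
        proof -
          have "- t * (norm p)^2 + (a * t)^2 * (norm p)^2 / (t * w^2) = - t * ((norm p)^2 * ((w^2 - a^2) / w^2))"
            using t w(1) by (simp add: field_simps power2_eq_square)
          then show ?thesis unfolding exp_add[symmetric] w(2) by (simp add: add.commute add_diff_eq)
        qed
        have p3: "sqrt pi^3 = pi * sqrt pi" by (simp add: power3_eq_cube)
        have gen: "r * (2 / sqrt pi * X * (r * v)^2 * ((sqrt pi / (r * w))^3 * (a * t * \<bar>p $ i\<bar> / (t * w^2)) * Y)) =
           2 * pi * a * \<bar>p $ i\<bar> * (v^2 / w^5) * (X * Y)" for X Y
          using r(1) w(1) unfolding r(2) power_divide p3 power_mult_distrib by (simp add: field_simps eval_nat_numeral)
        have main: "r * (2 / sqrt pi * exp (- t * (norm p)^2) * (r * v)^2 * ((sqrt pi / (r * w))^3 * (a * t * \<bar>p $ i\<bar> / (t * w^2)) * exp ((a * t)^2 * (norm p)^2 / (t * w^2)))) = ?E t v"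
          unfolding e1[symmetric] w_def[symmetric] by (rule gen)
        show "ennreal \<bar>sqrt t\<bar> * ennreal (2 / sqrt pi * exp (- t * (norm p)^2) * (0 + sqrt t * v)^2 *
          (sqrt (pi / (t + (0 + sqrt t * v)^2))^3 * (a * t * \<bar>p $ i\<bar> / (t + (0 + sqrt t * v)^2)) * exp ((a * t)^2 * (norm p)^2 / (t + (0 + sqrt t * v)^2))))
          = ennreal (?E t v)"
          unfolding sr unfolding ts s1 main[symmetric] unfolding r_def[symmetric]
          by (simp only: abs_of_pos[OF r(1)] ennreal_mult'[OF less_imp_le[OF r(1)], symmetric])
      qed
    finally show ?thesis .
  qed
  have "(\<integral>\<^sup>+t. indicator {0..} t * (\<integral>\<^sup>+q. ennreal (Sk a i t p q * (\<bar>q $ i\<bar> / (norm q)^3)) \<partial>lborel) \<partial>lborel)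
     = (\<integral>\<^sup>+t. (\<integral>\<^sup>+v. indicator {0..} t * ennreal (?E t v) \<partial>lborel) \<partial>lborel)"
  proof (rule nn_integral_cong_AE)
    have "AE t in (lborel :: real measure). t \<noteq> 0" by (rule AE_lborel_singleton)
    then show "AE t in lborel. indicator {0..} t * (\<integral>\<^sup>+q. ennreal (Sk a i t p q * (\<bar>q $ i\<bar> / (norm q)^3)) \<partial>lborel) = (\<integral>\<^sup>+v. indicator {0..} t * ennreal (?E t v) \<partial>lborel)"
    proof eventually_elim
      case (elim t)
      show ?case
      proof (cases "t > 0")
        case True
        then have i: "(indicator {0..} t :: ennreal) = 1" by simp
        show ?thesis unfolding i mult_1 by (rule inner[OF True])
      next
        case False
        then have i: "(indicator {0..} t :: ennreal) = 0" using elim by simp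
        show ?thesis unfolding i by simp
      qed
    qed
  qed
  \<comment> \<open>After the exchange the t-integral is a plain exponential one; it yields 1/|p|^2
    and leaves in v, up to a constant, the integrand of \<open>tau_integral\<close>.\<close>
  also have "\<dots> = (\<integral>\<^sup>+v. (\<integral>\<^sup>+t. indicator {0..} t * ennreal (?E t v) \<partial>lborel) \<partial>lborel)"
    by (rule lborel_pair.Fubini') measurable
  also have "\<dots> = (\<integral>\<^sup>+v. ennreal (\<bar>p $ i\<bar> / (norm p)^2 * (2 * pi * a * (v^2 / (v^2 + (1 - a^2)) / (sqrt (1 + v^2))^3))) \<partial>lborel)"
  proof (rule nn_integral_cong)
    fix v :: real
    let ?u = "(norm p)^2 * ((v^2 + (1 - a^2)) / (1 + v^2))"
    have v1: "1 + v^2 > 0" "v^2 + (1 - a^2) > 0" using a2 by (auto simp: add_pos_nonneg add_nonneg_pos)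
    have u: "?u > 0" using p v1 by simp
    let ?c = "2 * pi * a * \<bar>p $ i\<bar> * (v^2 / (sqrt (1 + v^2))^5)"
    have c0: "0 \<le> ?c" using a v1 by (intro mult_nonneg_nonneg divide_nonneg_nonneg) auto
    have "(\<integral>\<^sup>+t. indicator {0..} t * ennreal (?E t v) \<partial>lborel) =
      (\<integral>\<^sup>+t. ennreal ?c * (ennreal (exp (- t * ?u)) * indicator {0..} t) \<partial>lborel)"
      by (intro nn_integral_cong) (simp only: ennreal_mult'[OF c0], simp only: mult_ac)
    also have "\<dots> = ennreal ?c * (\<integral>\<^sup>+t. ennreal (exp (- t * ?u)) * indicator {0..} t \<partial>lborel)"
      by (rule nn_integral_cmult) measurable
    also have "(\<integral>\<^sup>+t. ennreal (exp (- t * ?u)) * indicator {0..} t \<partial>lborel) = ennreal (1 / ?u)"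
      by (rule integral_exp_decay(1)[OF u])
    also have "ennreal ?c * ennreal (1 / ?u) = ennreal (?c * (1 / ?u))"
      by (rule ennreal_mult'[OF c0, symmetric])
    also have "?c * (1 / ?u) = \<bar>p $ i\<bar> / (norm p)^2 * (2 * pi * a * (v^2 / (v^2 + (1 - a^2)) / (sqrt (1 + v^2))^3))"
    proof -
      define w where "w = sqrt (1 + v^2)"
      have w: "w^2 > 0" "1 + v^2 = w^2" using v1 by (auto simp: w_def)
      have w5: "w^5 = w^3 * w^2" by (simp add: power_add[symmetric])
      have g: "c * P * (V / (A * W)) * (1 / (n * (x / W))) = P / n * (c * (V / x / A))" if "W > 0" for c P V A W n x :: real
        using that by (cases "A = 0"; cases "n = 0"; cases "x = 0") (simp_all add: field_simps)
      have sw: "sqrt (w^2) = w" using v1 unfolding w_def by simp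
      show ?thesis unfolding w_def[symmetric] w(2) sw w5 by (rule g[OF w(1)])
    qed
    finally show "(\<integral>\<^sup>+t. indicator {0..} t * ennreal (?E t v) \<partial>lborel) = ennreal (\<bar>p $ i\<bar> / (norm p)^2 * (2 * pi * a * (v^2 / (v^2 + (1 - a^2)) / (sqrt (1 + v^2))^3)))" .
  qed
  \<comment> \<open>The variable v ran over the whole line, while \<open>tau_integral\<close> is
    stated on the half line; evenness supplies the factor 2.\<close>
  also have "\<dots> = 2 * (\<integral>\<^sup>+v. ennreal (\<bar>p $ i\<bar> / (norm p)^2 * (2 * pi * a * (v^2 / (v^2 + (1 - a^2)) / (sqrt (1 + v^2))^3))) * indicator {0..} v \<partial>lborel)"
    by (rule nn_integral_even) auto
  also have "(\<integral>\<^sup>+v. ennreal (\<bar>p $ i\<bar> / (norm p)^2 * (2 * pi * a * (v^2 / (v^2 + (1 - a^2)) / (sqrt (1 + v^2))^3))) * indicator {0..} v \<partial>lborel)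
     = (\<integral>\<^sup>+v. ennreal (\<bar>p $ i\<bar> / (norm p)^2 / 2) * (ennreal (4 * pi * a * (v^2 / (v^2 + (1 - a^2)) / (sqrt (1 + v^2))^3)) * indicator {0..} v) \<partial>lborel)"
  proof (rule nn_integral_cong)
    fix v :: real
    have X0: "0 \<le> \<bar>p $ i\<bar> / (norm p)^2 / 2" by simp
    have g: "X * (2 * pi * a * Y) = X / 2 * (4 * pi * a * Y)" for X Y by simp
    show "ennreal (\<bar>p $ i\<bar> / (norm p)^2 * (2 * pi * a * (v^2 / (v^2 + (1 - a^2)) / (sqrt (1 + v^2))^3))) * indicator {0..} v =
      ennreal (\<bar>p $ i\<bar> / (norm p)^2 / 2) * (ennreal (4 * pi * a * (v^2 / (v^2 + (1 - a^2)) / (sqrt (1 + v^2))^3)) * indicator {0..} v)"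
      unfolding g ennreal_mult'[OF X0] by (rule mult.assoc)
  qed
  also have "\<dots> = ennreal (\<bar>p $ i\<bar> / (norm p)^2 / 2) * (\<integral>\<^sup>+v. ennreal (4 * pi * a * (v^2 / (v^2 + (1 - a^2)) / (sqrt (1 + v^2))^3)) * indicator {0..} v \<partial>lborel)"
    by (rule nn_integral_cmult) measurable
  also have "\<dots> = ennreal (\<bar>p $ i\<bar> / (norm p)^2 / 2) * ennreal (tau a)"
    unfolding tau_integral(1)[OF a] ..
  also have "2 * \<dots> = ennreal 2 * ennreal (\<bar>p $ i\<bar> / (norm p)^2 / 2 * tau a)"
    by (subst ennreal_mult[symmetric]) (use tau_integral(2)[OF a] in auto)
  also have "\<dots> = ennreal (2 * (\<bar>p $ i\<bar> / (norm p)^2 / 2 * tau a))"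
    by (rule ennreal_mult[symmetric]) (use tau_integral(2)[OF a] in auto)
  finally show ?thesis by (simp add: mult.commute)
qed

section \<open>Absolute convergence of the kernel form by a Schur test\<close>

abbreviation lb3 :: "(real^3) measure" where "lb3 \<equiv> lborel"
abbreviation lb33 :: "((real^3) \<times> (real^3)) measure" where "lb33 \<equiv> lborel \<Otimes>\<^sub>M lborel"

text \<open>Two Gaussian parameters linearise the two denominators: |x| exp (-u x^2) integrates to
  1/u with u = |p|^2 + |q|^2, and exp (-s |q|^2) on the half line to 1/|q|^2. The q-integral is then
  Gaussian, and s and x follow in turn.\<close>

lemma inner_schur:
  fixes p :: "real^3"
  assumes p: "p \<noteq> 0"
  shows "(\<integral>\<^sup>+q. ennreal (1 / ((norm q)^2 * ((norm p)^2 + (norm q)^2))) \<partial>lb3) = ennreal (2 * pi^2 / norm p)"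
proof -
  let ?F = "\<lambda>q x s. ennreal (exp (- (x^2) * (norm p)^2) * \<bar>x\<bar>) * (indicator {0..} s * ennreal (exp (- (s + x^2) * (norm q)^2)))"
  have "(\<integral>\<^sup>+q. ennreal (1 / ((norm q)^2 * ((norm p)^2 + (norm q)^2))) \<partial>lb3) = (\<integral>\<^sup>+q. \<integral>\<^sup>+x. \<integral>\<^sup>+s. ?F q x s \<partial>lborel \<partial>lborel \<partial>lb3)"
  proof (rule nn_integral_cong_AE)
    have "AE q in lb3. q \<noteq> 0" by (rule AE_lborel_singleton)
    then show "AE q in lb3. ennreal (1 / ((norm q)^2 * ((norm p)^2 + (norm q)^2))) = (\<integral>\<^sup>+x. \<integral>\<^sup>+s. ?F q x s \<partial>lborel \<partial>lborel)"
    proof eventually_elim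
      case (elim q)
      have q2: "(norm q)^2 > 0" using elim by simp
      have u: "(norm p)^2 + (norm q)^2 > 0" using q2 by (simp add: add_nonneg_pos)
      have "(\<integral>\<^sup>+x. \<integral>\<^sup>+s. ?F q x s \<partial>lborel \<partial>lborel) = (\<integral>\<^sup>+x. ennreal (exp (- ((norm p)^2 + (norm q)^2) * x^2) * \<bar>x\<bar>) * ennreal (1 / (norm q)^2) \<partial>lborel)"
      proof (rule nn_integral_cong)
        fix x :: real
        have "(\<integral>\<^sup>+s. ?F q x s \<partial>lborel) = (\<integral>\<^sup>+s. ennreal (exp (- ((norm p)^2 + (norm q)^2) * x^2) * \<bar>x\<bar>) * (ennreal (exp (- s * (norm q)^2)) * indicator {0..} s) \<partial>lborel)"
        proof (rule nn_integral_cong)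
          fix s :: real
          have "exp (- (x^2) * (norm p)^2) * \<bar>x\<bar> * exp (- (s + x^2) * (norm q)^2) = exp (- ((norm p)^2 + (norm q)^2) * x^2) * \<bar>x\<bar> * exp (- s * (norm q)^2)"
            by (simp add: exp_add[symmetric] algebra_simps)
          then have "ennreal (exp (- (x^2) * (norm p)^2) * \<bar>x\<bar>) * ennreal (exp (- (s + x^2) * (norm q)^2)) =
             ennreal (exp (- ((norm p)^2 + (norm q)^2) * x^2) * \<bar>x\<bar>) * ennreal (exp (- s * (norm q)^2))"
            by (subst (1 2) ennreal_mult[symmetric]) (simp_all only: abs_ge_zero exp_ge_zero mult_nonneg_nonneg)
          then show "?F q x s = ennreal (exp (- ((norm p)^2 + (norm q)^2) * x^2) * \<bar>x\<bar>) * (ennreal (exp (- s * (norm q)^2)) * indicator {0..} s)"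
            by (cases "s \<ge> 0") simp_all
        qed
        also have "\<dots> = ennreal (exp (- ((norm p)^2 + (norm q)^2) * x^2) * \<bar>x\<bar>) * (\<integral>\<^sup>+s. ennreal (exp (- s * (norm q)^2)) * indicator {0..} s \<partial>lborel)"
          by (rule nn_integral_cmult) measurable
        finally show "(\<integral>\<^sup>+s. ?F q x s \<partial>lborel) = ennreal (exp (- ((norm p)^2 + (norm q)^2) * x^2) * \<bar>x\<bar>) * ennreal (1 / (norm q)^2)"
          unfolding integral_exp_decay(1)[OF q2] .
      qed
      also have "\<dots> = (\<integral>\<^sup>+x. ennreal (exp (- ((norm p)^2 + (norm q)^2) * x^2) * \<bar>x\<bar>) \<partial>lborel) * ennreal (1 / (norm q)^2)"
        by (rule nn_integral_multc) measurable
      also have "\<dots> = ennreal (1 / ((norm p)^2 + (norm q)^2)) * ennreal (1 / (norm q)^2)"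
        unfolding nn_inv(1)[OF u] ..
      also have "\<dots> = ennreal (1 / ((norm q)^2 * ((norm p)^2 + (norm q)^2)))"
        using u q2 by (subst ennreal_mult[symmetric]) (auto simp: mult.commute)
      finally show ?case by simp
    qed
  qed
  also have "\<dots> = (\<integral>\<^sup>+x. \<integral>\<^sup>+q. \<integral>\<^sup>+s. ?F q x s \<partial>lborel \<partial>lb3 \<partial>lborel)"
    by (rule lborel_pair.Fubini') measurable
  also have "\<dots> = (\<integral>\<^sup>+x. ennreal (2 * pi * sqrt pi) * ennreal (exp (- ((norm p)^2) * x^2)) \<partial>lborel)"
  proof (rule nn_integral_cong_AE)
    have "AE x in (lborel :: real measure). x \<noteq> 0" by (rule AE_lborel_singleton)
    then show "AE x in lborel. (\<integral>\<^sup>+q. \<integral>\<^sup>+s. ?F q x s \<partial>lborel \<partial>lb3) = ennreal (2 * pi * sqrt pi) * ennreal (exp (- ((norm p)^2) * x^2))"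
    proof eventually_elim
      case (elim x)
      have x2: "x^2 > 0" using elim by simp
      let ?c = "ennreal (exp (- (x^2) * (norm p)^2) * \<bar>x\<bar>)"
      have "(\<integral>\<^sup>+q. \<integral>\<^sup>+s. ?F q x s \<partial>lborel \<partial>lb3) = (\<integral>\<^sup>+s. \<integral>\<^sup>+q. ?F q x s \<partial>lb3 \<partial>lborel)"
        by (rule lborel_pair.Fubini') measurable
      also have "\<dots> = (\<integral>\<^sup>+s. ?c * (ennreal (pi * sqrt pi / ((s + x^2) * sqrt (s + x^2))) * indicator {0..} s) \<partial>lborel)"
      proof (rule nn_integral_cong)
        fix s :: real
        have "(\<integral>\<^sup>+q. ?F q x s \<partial>lb3) = ?c * (\<integral>\<^sup>+q. indicator {0..} s * ennreal (exp (- (s + x^2) * (norm q)^2)) \<partial>lb3)"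
          by (rule nn_integral_cmult) measurable
        also have "(\<integral>\<^sup>+q. indicator {0..} s * ennreal (exp (- (s + x^2) * (norm q)^2)) \<partial>lb3) = indicator {0..} s * (\<integral>\<^sup>+q. ennreal (exp (- (s + x^2) * (norm q)^2)) \<partial>lb3)"
          by (rule nn_integral_cmult) measurable
        also have "\<dots> = ennreal (pi * sqrt pi / ((s + x^2) * sqrt (s + x^2))) * indicator {0..} s"
        proof (cases "s \<ge> 0")
          case True
          then have sx: "s + x^2 > 0" using x2 by (rule add_nonneg_pos)
          have "(\<integral>\<^sup>+q. ennreal (exp (- (s + x^2) * (norm q)^2)) \<partial>lb3) = ennreal (sqrt (pi / (s + x^2))^3)"
            using nn_gauss_vec[OF sx, of 0] by simp
          also have "sqrt (pi / (s + x^2))^3 = pi * sqrt pi / ((s + x^2) * sqrt (s + x^2))"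
            using sx by (simp add: real_sqrt_divide power_divide power3_eq_cube)
          finally show ?thesis using True by simp
        qed simp
        finally show "(\<integral>\<^sup>+q. ?F q x s \<partial>lb3) = ?c * (ennreal (pi * sqrt pi / ((s + x^2) * sqrt (s + x^2))) * indicator {0..} s)" .
      qed
      also have "\<dots> = ?c * (\<integral>\<^sup>+s. ennreal (pi * sqrt pi / ((s + x^2) * sqrt (s + x^2))) * indicator {0..} s \<partial>lborel)"
        by (rule nn_integral_cmult) measurable
      also have "(\<integral>\<^sup>+s. ennreal (pi * sqrt pi / ((s + x^2) * sqrt (s + x^2))) * indicator {0..} s \<partial>lborel) =
          ennreal (0 - (- (2 * pi * sqrt pi) / sqrt (0 + x^2)))"
      proof (rule nn_integral_FTC_atLeast)
        show "((\<lambda>s. - (2 * pi * sqrt pi) / sqrt (s + x^2)) \<longlongrightarrow> 0) at_top" by real_asymp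
        fix s :: real assume "0 \<le> s"
        then have sx: "s + x^2 > 0" using x2 by (rule add_nonneg_pos)
        define w where "w = sqrt (s + x^2)"
        have w: "w > 0" "s + x^2 = w * w" using sx by (auto simp: w_def)
        have "DERIV (\<lambda>s. - (2 * pi * sqrt pi) / sqrt (s + x^2)) s :> (0 * sqrt (s + x^2) - (- (2 * pi * sqrt pi)) * (inverse (sqrt (s + x^2)) / 2)) / (sqrt (s + x^2) * sqrt (s + x^2))"
          using sx by (auto intro!: derivative_eq_intros)
        moreover have "(0 * sqrt (s + x^2) - (- (2 * pi * sqrt pi)) * (inverse (sqrt (s + x^2)) / 2)) / (sqrt (s + x^2) * sqrt (s + x^2)) = pi * sqrt pi / ((s + x^2) * sqrt (s + x^2))"
          unfolding w_def[symmetric] w(2) using w(1) by (simp add: field_simps)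
        ultimately show "DERIV (\<lambda>s. - (2 * pi * sqrt pi) / sqrt (s + x^2)) s :> pi * sqrt pi / ((s + x^2) * sqrt (s + x^2))"
          by simp
        show "0 \<le> pi * sqrt pi / ((s + x^2) * sqrt (s + x^2))" using sx by simp
      qed measurable
      also have "0 - (- (2 * pi * sqrt pi) / sqrt (0 + x^2)) = 2 * pi * sqrt pi / \<bar>x\<bar>" by simp
      also have "?c * ennreal (2 * pi * sqrt pi / \<bar>x\<bar>) = ennreal (exp (- (x^2) * (norm p)^2) * \<bar>x\<bar> * (2 * pi * sqrt pi / \<bar>x\<bar>))"
        by (rule ennreal_mult'[symmetric]) simp
      also have "exp (- (x^2) * (norm p)^2) * \<bar>x\<bar> * (2 * pi * sqrt pi / \<bar>x\<bar>) = (2 * pi * sqrt pi) * exp (- ((norm p)^2) * x^2)"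
        using elim by (simp add: mult.commute)
      also have "ennreal \<dots> = ennreal (2 * pi * sqrt pi) * ennreal (exp (- ((norm p)^2) * x^2))"
        by (rule ennreal_mult') simp
      finally show ?case .
    qed
  qed
  also have "\<dots> = ennreal (2 * pi * sqrt pi) * (\<integral>\<^sup>+x. ennreal (exp (- ((norm p)^2) * x^2)) \<partial>lborel)"
    by (rule nn_integral_cmult) measurable
  also have "\<dots> = ennreal (2 * pi * sqrt pi) * ennreal (sqrt (pi / (norm p)^2))"
    using p by (subst nn_inv(4)) auto
  also have "\<dots> = ennreal (2 * pi * sqrt pi * sqrt (pi / (norm p)^2))"
    by (rule ennreal_mult'[symmetric]) simp
  also have "2 * pi * sqrt pi * sqrt (pi / (norm p)^2) = 2 * pi^2 / norm p"
    by (simp add: real_sqrt_divide power2_eq_square)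
  finally show ?thesis .
qed

definition Gk :: "real \<Rightarrow> real \<Rightarrow> real^3 \<Rightarrow> real^3 \<Rightarrow> real" where
  "Gk a \<mu> p q = 1 / ((norm p)^2 + (norm q)^2 + 2 * a * (p \<bullet> q) + \<mu>)"

lemma Gk_measurable[measurable (raw)]:
  assumes [measurable]: "p \<in> borel_measurable M" "q \<in> borel_measurable M"
  shows "(\<lambda>x. Gk a \<mu> (p x) (q x)) \<in> borel_measurable M"
  unfolding Gk_def by measurable

lemma Gk_den:
  fixes p q :: "real^3"
  assumes a: "0 \<le> a"
  shows "(1 - a) * ((norm p)^2 + (norm q)^2) \<le> (norm p)^2 + (norm q)^2 + 2 * a * (p \<bullet> q)"
proof -
  have "0 \<le> a * (norm (p + q))^2" using a by simp
  also have "(norm (p + q))^2 = (norm p)^2 + (norm q)^2 + 2 * (p \<bullet> q)"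
    by (simp add: power2_norm_eq_inner inner_add inner_commute)
  finally show ?thesis by (simp add: algebra_simps)
qed

lemma Gk_pos:
  fixes p q :: "real^3"
  assumes "0 \<le> a" "a < 1" "\<mu> > 0"
  shows "(norm p)^2 + (norm q)^2 + 2 * a * (p \<bullet> q) + \<mu> > 0" "Gk a \<mu> p q > 0"
proof -
  have "0 \<le> (1 - a) * ((norm p)^2 + (norm q)^2)" using assms by simp
  then show "(norm p)^2 + (norm q)^2 + 2 * a * (p \<bullet> q) + \<mu> > 0" using Gk_den[of a p q] assms by linarith
  then show "Gk a \<mu> p q > 0" by (simp add: Gk_def)
qed

lemma Gk_le:
  fixes p q :: "real^3"
  assumes a: "0 \<le> a" "a < 1" "\<mu> > 0" and ne: "p \<noteq> 0 \<or> q \<noteq> 0"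
  shows "Gk a \<mu> p q \<le> 1 / (1 - a) * (1 / ((norm p)^2 + (norm q)^2))"
proof -
  have "(norm p)^2 + (norm q)^2 > 0" using ne by (auto simp: add_nonneg_pos add_pos_nonneg)
  then have n1: "0 < (1 - a) * ((norm p)^2 + (norm q)^2)" using a by simp
  have n2: "(1 - a) * ((norm p)^2 + (norm q)^2) \<le> (norm p)^2 + (norm q)^2 + 2 * a * (p \<bullet> q) + \<mu>"
    using Gk_den[of a p q] a by linarith
  have "Gk a \<mu> p q \<le> 1 / ((1 - a) * ((norm p)^2 + (norm q)^2))"
    unfolding Gk_def by (rule frac_le[OF _ _ n1 n2]) simp_all
  then show ?thesis by simp
qed

text \<open>The homogeneous Sobolev norm of order 1/2 in momentum space, which is the scale on which
  the kernel form at \<mu> = 0 is invariant.\<close>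

definition adm :: "(real^3 \<Rightarrow> real) \<Rightarrow> bool" where
  "adm f \<longleftrightarrow> f \<in> borel_measurable borel \<and> (\<integral>\<^sup>+p. ennreal (norm p * (f p)^2) \<partial>lb3) < \<infinity>"

text \<open>The product |x y| is split as (|x| |p| / |q|) (|y| |q| / |p|) before the
  arithmetic-geometric inequality; with these weights each half is integrable in the opposite
  variable by \<open>inner_schur\<close>.\<close>

lemma schur_pair:
  fixes x y :: real and p q :: "real^3"
  assumes a: "0 \<le> a" "a < 1" "\<mu> > 0" and that: "p \<noteq> 0" "q \<noteq> 0"
  shows "\<bar>x * y\<bar> * Gk a \<mu> p q \<le> 1 / (1 - a) / 2 * (((norm p)^2 * x^2) * (1 / ((norm q)^2 * ((norm p)^2 + (norm q)^2)))
     + ((norm q)^2 * y^2) * (1 / ((norm p)^2 * ((norm q)^2 + (norm p)^2))))"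
proof -
  define P where "P = norm p" define Q where "Q = norm q"
  have am: "X * Y \<le> (X^2 + Y^2) / 2" for X Y :: real using sum_squares_bound[of X Y] by simp
  have pos: "P > 0" "Q > 0" using that by (auto simp: P_def Q_def)
  have "\<bar>x * y\<bar> * Gk a \<mu> p q \<le> \<bar>x * y\<bar> * (1 / (1 - a) * (1 / ((norm p)^2 + (norm q)^2)))"
    by (intro mult_left_mono Gk_le a) (use that in auto)
  also have "\<dots> = 1 / (1 - a) * ((\<bar>x\<bar> * P / Q) * (\<bar>y\<bar> * Q / P) / (P^2 + Q^2))"
    using pos by (simp add: abs_mult P_def[symmetric] Q_def[symmetric])
  finally have 1: "\<bar>x * y\<bar> * Gk a \<mu> p q \<le> 1 / (1 - a) * ((\<bar>x\<bar> * P / Q) * (\<bar>y\<bar> * Q / P) / (P^2 + Q^2))" .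
  have "(\<bar>x\<bar> * P / Q) * (\<bar>y\<bar> * Q / P) \<le> ((\<bar>x\<bar> * P / Q)^2 + (\<bar>y\<bar> * Q / P)^2) / 2"
    by (rule am)
  then have "1 / (1 - a) * ((\<bar>x\<bar> * P / Q) * (\<bar>y\<bar> * Q / P) / (P^2 + Q^2)) \<le> 1 / (1 - a) * (((\<bar>x\<bar> * P / Q)^2 + (\<bar>y\<bar> * Q / P)^2) / 2 / (P^2 + Q^2))"
    using a by (intro mult_left_mono divide_right_mono) auto
  also have "\<dots> = 1 / (1 - a) / 2 * ((P^2 * x^2) * (1 / (Q^2 * (P^2 + Q^2))) + (Q^2 * y^2) * (1 / (P^2 * (Q^2 + P^2))))"
  proof -
    have g: "k * ((A + B) / 2 / D) = k / 2 * (A * (1 / D) + B * (1 / D))" for k A B D :: real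
      by (simp add: add_divide_distrib distrib_left)
    have A: "(\<bar>x\<bar> * P / Q)^2 * (1 / (P^2 + Q^2)) = (P^2 * x^2) * (1 / (Q^2 * (P^2 + Q^2)))"
      "(\<bar>y\<bar> * Q / P)^2 * (1 / (P^2 + Q^2)) = (Q^2 * y^2) * (1 / (P^2 * (Q^2 + P^2)))"
      by (simp_all add: power_mult_distrib power_divide add.commute mult.commute)
    show ?thesis unfolding g A ..
  qed
  finally show ?thesis using 1 unfolding P_def Q_def by linarith
qed

lemma AE_neq0_pair: "AE z in lb33. fst z \<noteq> 0 \<and> snd z \<noteq> 0"
proof (rule lborel_pair.AE_pair_measure)
  have "{z \<in> space lb33. fst z \<noteq> 0 \<and> snd z \<noteq> 0} = (- {0}) \<times> (- {0})"
    by (auto simp: space_pair_measure)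
  moreover have "(- {0::real^3}) \<times> (- {0::real^3}) \<in> sets lb33"
    by (rule pair_measureI) auto
  ultimately show "{z \<in> space lb33. fst z \<noteq> 0 \<and> snd z \<noteq> 0} \<in> sets lb33" by simp
  have n: "AE p in lb3. p \<noteq> 0" by (rule AE_lborel_singleton)
  show "AE p in lb3. AE q in lb3. fst (p, q) \<noteq> 0 \<and> snd (p, q) \<noteq> 0"
    using n
  proof eventually_elim
    case (elim p)
    show ?case using n by eventually_elim (simp add: elim)
  qed
qed

text \<open>The kernel is an argument because the parity arguments replace it by combinations of its
  reflections while the functions stay fixed.\<close>

definition IH :: "(real^3 \<Rightarrow> real) \<Rightarrow> (real^3 \<Rightarrow> real) \<Rightarrow> (real^3 \<Rightarrow> real^3 \<Rightarrow> real) \<Rightarrow> real" where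
  "IH f g H = (\<integral>z. f (fst z) * g (snd z) * H (fst z) (snd z) \<partial>lb33)"

definition II :: "(real^3 \<Rightarrow> real) \<Rightarrow> (real^3 \<Rightarrow> real) \<Rightarrow> (real^3 \<Rightarrow> real^3 \<Rightarrow> real) \<Rightarrow> bool" where
  "II f g H \<longleftrightarrow> integrable lb33 (\<lambda>z. f (fst z) * g (snd z) * H (fst z) (snd z))"

lemma admD[dest]: "adm f \<Longrightarrow> f \<in> borel_measurable borel"
  by (simp add: adm_def)

lemma adm_integrable: "adm f \<Longrightarrow> integrable lb3 (\<lambda>p. norm p * (f p)^2)"
  unfolding adm_def by (auto intro!: integrableI_bounded)

lemma ennreal_sum_prod:
  "0 \<le> A \<Longrightarrow> 0 \<le> B \<Longrightarrow> 0 \<le> C \<Longrightarrow> 0 \<le> D \<Longrightarrow> ennreal (A * B + C * D) = ennreal A * ennreal B + ennreal C * ennreal D"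
  by (simp add: ennreal_mult')

text \<open>The pointwise estimate \<open>schur_pair\<close> integrated. Its constant is crude: it
  serves absolute convergence and continuity, while the sharp lower bound comes from parity.\<close>

lemma schur_bound:
  assumes a: "0 \<le> a" "a < 1" "\<mu> > 0" and [measurable]: "f \<in> borel_measurable borel" "g \<in> borel_measurable borel"
  shows "(\<integral>\<^sup>+z. ennreal (\<bar>f (fst z) * g (snd z)\<bar> * Gk a \<mu> (fst z) (snd z)) \<partial>lb33)
    \<le> ennreal (pi^2 / (1 - a)) * ((\<integral>\<^sup>+p. ennreal (norm p * (f p)^2) \<partial>lb3) + (\<integral>\<^sup>+p. ennreal (norm p * (g p)^2) \<partial>lb3))"
proof -
  let ?W = "\<lambda>p q :: real^3. 1 / ((norm q)^2 * ((norm p)^2 + (norm q)^2))"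
  let ?c = "1 / (1 - a) / 2"
  have W: "?W p q \<ge> 0" for p q by (intro divide_nonneg_nonneg) auto
  have c: "?c \<ge> 0" using a by simp
  have eq: "(\<integral>\<^sup>+p. \<integral>\<^sup>+q. ennreal ((norm p)^2 * (h p)^2) * ennreal (?W p q) \<partial>lb3 \<partial>lb3) = ennreal (2 * pi^2) * (\<integral>\<^sup>+p. ennreal (norm p * (h p)^2) \<partial>lb3)"
    if [measurable]: "h \<in> borel_measurable borel" for h :: "real^3 \<Rightarrow> real"
  proof -
    have "(\<integral>\<^sup>+p. \<integral>\<^sup>+q. ennreal ((norm p)^2 * (h p)^2) * ennreal (?W p q) \<partial>lb3 \<partial>lb3) = (\<integral>\<^sup>+p. ennreal (2 * pi^2) * ennreal (norm p * (h p)^2) \<partial>lb3)"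
    proof (rule nn_integral_cong_AE)
      have "AE p in lb3. p \<noteq> 0" by (rule AE_lborel_singleton)
      then show "AE p in lb3. (\<integral>\<^sup>+q. ennreal ((norm p)^2 * (h p)^2) * ennreal (?W p q) \<partial>lb3) = ennreal (2 * pi^2) * ennreal (norm p * (h p)^2)"
      proof eventually_elim
        case (elim p)
        have "(\<integral>\<^sup>+q. ennreal ((norm p)^2 * (h p)^2) * ennreal (?W p q) \<partial>lb3) = ennreal ((norm p)^2 * (h p)^2) * (\<integral>\<^sup>+q. ennreal (?W p q) \<partial>lb3)"
          by (rule nn_integral_cmult) measurable
        also have "\<dots> = ennreal ((norm p)^2 * (h p)^2) * ennreal (2 * pi^2 / norm p)"
          unfolding inner_schur[OF elim] ..
        also have "\<dots> = ennreal ((norm p)^2 * (h p)^2 * (2 * pi^2 / norm p))"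
          by (rule ennreal_mult'[symmetric]) simp
        also have "(norm p)^2 * (h p)^2 * (2 * pi^2 / norm p) = (2 * pi^2) * (norm p * (h p)^2)"
          using elim by (simp add: power2_eq_square)
        also have "ennreal \<dots> = ennreal (2 * pi^2) * ennreal (norm p * (h p)^2)"
          by (rule ennreal_mult') simp
        finally show ?case .
      qed
    qed
    also have "\<dots> = ennreal (2 * pi^2) * (\<integral>\<^sup>+p. ennreal (norm p * (h p)^2) \<partial>lb3)"
      by (rule nn_integral_cmult) measurable
    finally show ?thesis .
  qed
  have "(\<integral>\<^sup>+z. ennreal (\<bar>f (fst z) * g (snd z)\<bar> * Gk a \<mu> (fst z) (snd z)) \<partial>lb33) \<le>
    (\<integral>\<^sup>+z. ennreal ?c * (ennreal ((norm (fst z))^2 * (f (fst z))^2) * ennreal (?W (fst z) (snd z)) +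
       ennreal ((norm (snd z))^2 * (g (snd z))^2) * ennreal (?W (snd z) (fst z))) \<partial>lb33)"
  proof (rule nn_integral_mono_AE)
    show "AE z in lb33. ennreal (\<bar>f (fst z) * g (snd z)\<bar> * Gk a \<mu> (fst z) (snd z)) \<le> ennreal ?c * (ennreal ((norm (fst z))^2 * (f (fst z))^2) * ennreal (?W (fst z) (snd z)) +
       ennreal ((norm (snd z))^2 * (g (snd z))^2) * ennreal (?W (snd z) (fst z)))"
      using AE_neq0_pair
    proof eventually_elim
      case (elim z)
      have "\<bar>f (fst z) * g (snd z)\<bar> * Gk a \<mu> (fst z) (snd z) \<le> ?c * (((norm (fst z))^2 * (f (fst z))^2) * ?W (fst z) (snd z) + ((norm (snd z))^2 * (g (snd z))^2) * ?W (snd z) (fst z))"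
        by (rule schur_pair[OF a]) (use elim in auto)
      then have "ennreal (\<bar>f (fst z) * g (snd z)\<bar> * Gk a \<mu> (fst z) (snd z)) \<le> ennreal (?c * (((norm (fst z))^2 * (f (fst z))^2) * ?W (fst z) (snd z) + ((norm (snd z))^2 * (g (snd z))^2) * ?W (snd z) (fst z)))"
        by (rule ennreal_leI)
      also have "\<dots> = ennreal ?c * (ennreal ((norm (fst z))^2 * (f (fst z))^2) * ennreal (?W (fst z) (snd z)) +
       ennreal ((norm (snd z))^2 * (g (snd z))^2) * ennreal (?W (snd z) (fst z)))"
        unfolding ennreal_mult'[OF c] by (rule arg_cong[where f="\<lambda>x. ennreal ?c * x"], rule ennreal_sum_prod, simp, rule W, simp, rule W)
      finally show ?case .
    qed
  qed
  also have "\<dots> = ennreal ?c * (\<integral>\<^sup>+z. ennreal ((norm (fst z))^2 * (f (fst z))^2) * ennreal (?W (fst z) (snd z)) +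
       ennreal ((norm (snd z))^2 * (g (snd z))^2) * ennreal (?W (snd z) (fst z)) \<partial>lb33)"
    by (rule nn_integral_cmult) measurable
  also have "(\<integral>\<^sup>+z. ennreal ((norm (fst z))^2 * (f (fst z))^2) * ennreal (?W (fst z) (snd z)) +
       ennreal ((norm (snd z))^2 * (g (snd z))^2) * ennreal (?W (snd z) (fst z)) \<partial>lb33) =
     (\<integral>\<^sup>+z. ennreal ((norm (fst z))^2 * (f (fst z))^2) * ennreal (?W (fst z) (snd z)) \<partial>lb33) +
     (\<integral>\<^sup>+z. ennreal ((norm (snd z))^2 * (g (snd z))^2) * ennreal (?W (snd z) (fst z)) \<partial>lb33)"
    by (rule nn_integral_add) measurable
  also have "(\<integral>\<^sup>+z. ennreal ((norm (fst z))^2 * (f (fst z))^2) * ennreal (?W (fst z) (snd z)) \<partial>lb33) = (\<integral>\<^sup>+p. \<integral>\<^sup>+q. ennreal ((norm p)^2 * (f p)^2) * ennreal (?W p q) \<partial>lb3 \<partial>lb3)"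
    by (subst lborel.nn_integral_fst[symmetric]) auto
  also have "\<dots> = ennreal (2 * pi^2) * (\<integral>\<^sup>+p. ennreal (norm p * (f p)^2) \<partial>lb3)" by (rule eq) measurable
  also have "(\<integral>\<^sup>+z. ennreal ((norm (snd z))^2 * (g (snd z))^2) * ennreal (?W (snd z) (fst z)) \<partial>lb33) = (\<integral>\<^sup>+p. \<integral>\<^sup>+q. ennreal ((norm p)^2 * (g p)^2) * ennreal (?W p q) \<partial>lb3 \<partial>lb3)"
    by (subst lborel_pair.nn_integral_snd[symmetric]) auto
  also have "\<dots> = ennreal (2 * pi^2) * (\<integral>\<^sup>+p. ennreal (norm p * (g p)^2) \<partial>lb3)" by (rule eq) measurable
  also have "ennreal ?c * (ennreal (2 * pi^2) * (\<integral>\<^sup>+p. ennreal (norm p * (f p)^2) \<partial>lb3) + ennreal (2 * pi^2) * (\<integral>\<^sup>+p. ennreal (norm p * (g p)^2) \<partial>lb3)) =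
     ennreal ?c * ennreal (2 * pi^2) * ((\<integral>\<^sup>+p. ennreal (norm p * (f p)^2) \<partial>lb3) + (\<integral>\<^sup>+p. ennreal (norm p * (g p)^2) \<partial>lb3))"
    by (simp only: distrib_left mult.assoc)
  also have "ennreal ?c * ennreal (2 * pi^2) = ennreal (pi^2 / (1 - a))"
  proof -
    have g: "1 / x / 2 * (2 * y) = y / x" for x y :: real by simp
    show ?thesis unfolding ennreal_mult'[OF c, symmetric] g ..
  qed
  finally show ?thesis .
qed

lemma II_Gk:
  assumes a: "0 \<le> a" "a < 1" "\<mu> > 0" and f: "adm f" and g: "adm g"
  shows "II f g (Gk a \<mu>)"
proof -
  have [measurable]: "f \<in> borel_measurable borel" "g \<in> borel_measurable borel" using f g by auto
  show ?thesis unfolding II_def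
  proof (rule integrableI_bounded)
    have "(\<integral>\<^sup>+z. ennreal (norm (f (fst z) * g (snd z) * Gk a \<mu> (fst z) (snd z))) \<partial>lb33) = (\<integral>\<^sup>+z. ennreal (\<bar>f (fst z) * g (snd z)\<bar> * Gk a \<mu> (fst z) (snd z)) \<partial>lb33)"
      using Gk_pos(2)[OF a] by (intro nn_integral_cong) (simp add: abs_mult less_imp_le)
    also have "\<dots> \<le> ennreal (pi^2 / (1 - a)) * ((\<integral>\<^sup>+p. ennreal (norm p * (f p)^2) \<partial>lb3) + (\<integral>\<^sup>+p. ennreal (norm p * (g p)^2) \<partial>lb3))"
      by (rule schur_bound[OF a]) measurable
    also have "\<dots> < \<infinity>" using f g unfolding adm_def by (simp add: ennreal_mult_less_top)
    finally show "(\<integral>\<^sup>+z. ennreal (norm (f (fst z) * g (snd z) * Gk a \<mu> (fst z) (snd z))) \<partial>lb33) < \<infinity>" .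
  qed measurable
qed

section \<open>Coordinate reflections and projection of the kernel\<close>

definition refl3 :: "3 \<Rightarrow> real^3 \<Rightarrow> real^3" where
  "refl3 j x = (\<chi> i. if i = j then - x $ i else x $ i)"

lemma refl3_nth: "refl3 j x $ i = (if i = j then - x $ i else x $ i)"
  by (simp add: refl3_def)

lemma refl3_refl3[simp]: "refl3 j (refl3 j x) = x"
  by (simp add: vec_eq_iff refl3_nth)

lemma refl3_commute: "refl3 i (refl3 j x) = refl3 j (refl3 i x)"
  by (simp add: vec_eq_iff refl3_nth)

lemma inner3: "x \<bullet> y = (\<Sum>i\<in>UNIV. x $ i * y $ i)" for x y :: "real^3"
  by (simp add: inner_vec_def)

lemma inner_refl3[simp]: "refl3 j x \<bullet> refl3 j y = x \<bullet> y"
  unfolding inner3 by (intro sum.cong) (auto simp: refl3_nth)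

lemma norm_refl3[simp]: "norm (refl3 j x) = norm x"
  by (simp add: norm_eq_sqrt_inner)

lemma distr_refl3: "distr lborel borel (refl3 j) = lb3"
proof -
  define c where "c b = (if b = axis j 1 then - 1 else 1 :: real)" for b :: "real^3"
  have "refl3 j = (\<lambda>x. 0 + (\<Sum>b\<in>Basis. (c b * (x \<bullet> b)) *\<^sub>R b))"
  proof (rule ext, rule vec_eq_iff[THEN iffD2], rule allI)
    fix x :: "real^3" and i
    have "(0 + (\<Sum>b\<in>Basis. (c b * (x \<bullet> b)) *\<^sub>R b)) $ i = (\<Sum>b\<in>Basis. (c b * (x \<bullet> b)) *\<^sub>R b) \<bullet> axis i 1"
      by (simp add: inner_axis)
    also have "\<dots> = c (axis i 1) * (x \<bullet> axis i 1)"
      by (rule inner_sum_left_Basis) simp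
    also have "\<dots> = refl3 j x $ i" by (simp add: c_def refl3_nth inner_axis axis_eq_axis)
    finally show "refl3 j x $ i = (0 + (\<Sum>b\<in>Basis. (c b * (x \<bullet> b)) *\<^sub>R b)) $ i" by simp
  qed
  moreover have "lborel = density (distr lborel borel (\<lambda>x. 0 + (\<Sum>b\<in>Basis. (c b * (x \<bullet> b)) *\<^sub>R b))) (\<lambda>_. (\<Prod>b\<in>Basis. \<bar>c b\<bar>))"
    by (rule lborel_affine_euclidean) (simp add: c_def)
  moreover have "(\<Prod>b\<in>Basis. \<bar>c b\<bar>) = 1" by (intro prod.neutral) (auto simp: c_def)
  ultimately show ?thesis by (simp add: density_1)
qed

lemma distr_refl3': "distr lborel lborel (refl3 j) = lb3"
  by (rule trans[OF distr_cong distr_refl3]) auto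

lemma refl3_measurable[measurable]: "refl3 j \<in> borel_measurable borel"
proof -
  have "refl3 j = (\<lambda>x. x - (2 * x $ j) *\<^sub>R axis j 1)"
    by (auto simp: fun_eq_iff vec_eq_iff refl3_nth axis_def)
  then show ?thesis by simp
qed

lemma distr_pair_snd: "distr lb33 lb33 (\<lambda>z. (fst z, refl3 j (snd z))) = lb33"
proof -
  have "lb33 = distr lb3 lborel (\<lambda>x. x) \<Otimes>\<^sub>M distr lb3 lborel (refl3 j)"
    using distr_refl3'[of j] by (simp add: distr_id2)
  also have "\<dots> = distr lb33 (lb3 \<Otimes>\<^sub>M lb3) (\<lambda>(x, y). (x, refl3 j y))"
  proof (rule pair_measure_distr)
    show "sigma_finite_measure (distr lb3 lborel (refl3 j))" unfolding distr_refl3' by (rule lborel.sigma_finite_measure_axioms)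
  qed measurable
  finally show ?thesis by (simp add: case_prod_beta')
qed

lemma distr_pair_fst: "distr lb33 lb33 (\<lambda>z. (refl3 j (fst z), snd z)) = lb33"
proof -
  have "lb33 = distr lb3 lborel (refl3 j) \<Otimes>\<^sub>M distr lb3 lborel (\<lambda>x. x)"
    using distr_refl3'[of j] by (simp add: distr_id2)
  also have "\<dots> = distr lb33 (lb3 \<Otimes>\<^sub>M lb3) (\<lambda>(x, y). (refl3 j x, y))"
    by (rule pair_measure_distr) (auto simp: distr_id2 lborel.sigma_finite_measure_axioms)
  finally show ?thesis by (simp add: case_prod_beta')
qed

text \<open>A change of variables in the second argument moves the reflection from the function onto
  the kernel, at the price of the parity e.\<close>

lemma IH_snd:
  assumes [measurable]: "f \<in> borel_measurable borel" "g \<in> borel_measurable borel" "(\<lambda>z. H (fst z) (snd z)) \<in> borel_measurable lb33"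
    and g: "\<And>x. g (refl3 j x) = e * g x" and e: "e = 1 \<or> e = - 1"
  shows "IH f g H = e * IH f g (\<lambda>p q. H p (refl3 j q))" "II f g H \<Longrightarrow> II f g (\<lambda>p q. H p (refl3 j q))"
proof -
  let ?F = "\<lambda>z. f (fst z) * g (snd z) * H (fst z) (snd z)"
  let ?T = "\<lambda>z :: (real^3) \<times> (real^3). (fst z, refl3 j (snd z))"
  have F[measurable]: "?F \<in> borel_measurable lb33" by measurable
  have T: "?T \<in> measurable lb33 lb33" by measurable
  have eq: "?F (?T z) = f (fst z) * (e * g (snd z)) * H (fst z) (refl3 j (snd z))" for z by (simp add: g)
  have "IH f g H = integral\<^sup>L (distr lb33 lb33 ?T) ?F" unfolding IH_def distr_pair_snd ..
  also have "\<dots> = (\<integral>z. ?F (?T z) \<partial>lb33)" by (rule integral_distr[OF T F])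
  also have "\<dots> = (\<integral>z. e * (f (fst z) * g (snd z) * H (fst z) (refl3 j (snd z))) \<partial>lb33)"
    unfolding eq by (simp add: mult_ac)
  also have "\<dots> = e * IH f g (\<lambda>p q. H p (refl3 j q))" unfolding IH_def by (rule integral_mult_right_zero)
  finally show "IH f g H = e * IH f g (\<lambda>p q. H p (refl3 j q))" .
  assume "II f g H"
  then have "integrable (distr lb33 lb33 ?T) ?F" unfolding II_def distr_pair_snd .
  then have "integrable lb33 (\<lambda>z. ?F (?T z))" by (subst (asm) integrable_distr_eq[OF T F])
  then show "II f g (\<lambda>p q. H p (refl3 j q))"
    unfolding II_def eq using e by auto
qed

text \<open>Projection of the kernel, in its second variable, onto parity e under reflection j. On
  functions of that parity it leaves the form unchanged (\<open>IH_AA\<close>).\<close>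

definition AA :: "real \<Rightarrow> 3 \<Rightarrow> (real^3 \<Rightarrow> real^3 \<Rightarrow> real) \<Rightarrow> real^3 \<Rightarrow> real^3 \<Rightarrow> real" where
  "AA e j H p q = (H p q + e * H p (refl3 j q)) / 2"

lemma IH_AA:
  assumes f: "f \<in> borel_measurable borel" and m: "(\<lambda>z. H (fst z) (snd z)) \<in> borel_measurable lb33"
    and g: "\<And>x. f (refl3 j x) = e * f x" and e: "e = 1 \<or> e = - 1" and i: "II f f H"
  shows "IH f f (AA e j H) = IH f f H" "II f f (AA e j H)" "(\<lambda>z. AA e j H (fst z) (snd z)) \<in> borel_measurable lb33"
proof -
  note S = IH_snd[OF f f m g e]
  have i2: "integrable lb33 (\<lambda>z. f (fst z) * f (snd z) * H (fst z) (refl3 j (snd z)))" using S(2)[OF i] unfolding II_def .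
  have eq: "f (fst z) * f (snd z) * AA e j H (fst z) (snd z) = (f (fst z) * f (snd z) * H (fst z) (snd z)) / 2 + e / 2 * (f (fst z) * f (snd z) * H (fst z) (refl3 j (snd z)))" for z
    unfolding AA_def by (simp add: field_simps)
  have "IH f f (AA e j H) = IH f f H / 2 + e / 2 * IH f f (\<lambda>p q. H p (refl3 j q))"
    unfolding IH_def eq using i i2 unfolding II_def by (subst Bochner_Integration.integral_add) auto
  also have "\<dots> = IH f f H" using S(1) by simp
  finally show "IH f f (AA e j H) = IH f f H" .
  show "II f f (AA e j H)" unfolding II_def eq using i i2 unfolding II_def by auto
  have T: "(\<lambda>z. (fst z, refl3 j (snd z))) \<in> measurable lb33 lb33" by measurable
  have "(\<lambda>z. H (fst z) (refl3 j (snd z))) \<in> borel_measurable lb33"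
    using measurable_compose[OF T m] by simp
  with m show "(\<lambda>z. AA e j H (fst z) (snd z)) \<in> borel_measurable lb33"
    unfolding AA_def by measurable
qed

lemma AA_has_bochner:
  assumes "\<And>p q. has_bochner_integral M (\<lambda>t. X t p q) (H p q)"
  shows "has_bochner_integral M (\<lambda>t. AA e j (X t) p q) (AA e j H p q)"
  unfolding AA_def by (intro has_bochner_integral_divide_zero has_bochner_integral_add has_bochner_integral_mult_right assms)

text \<open>A kernel that is a product over coordinates stays one: the reflection only flips the
  sign of the j-th argument, so only the j-th factor is replaced by its even or odd part.\<close>

lemma AA_product:
  "AA e j (\<lambda>p q. E * (exp (- t * (norm p)^2) * exp (- t * (norm q)^2)) * (\<Prod>i\<in>UNIV. \<phi> i (c * p $ i * q $ i))) =
    (\<lambda>p q. E * (exp (- t * (norm p)^2) * exp (- t * (norm q)^2)) * (\<Prod>i\<in>UNIV. (\<phi>(j := \<lambda>y. (\<phi> j y + e * \<phi> j (- y)) / 2)) i (c * p $ i * q $ i)))"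
proof (intro ext)
  fix p q :: "real^3"
  let ?R = "\<Prod>i\<in>- {j}. \<phi> i (c * p $ i * q $ i)"
  have 1: "(\<Prod>i\<in>UNIV. \<phi> i (c * p $ i * q $ i)) = \<phi> j (c * p $ j * q $ j) * ?R"
    by (rule prod_split1)
  have 2: "(\<Prod>i\<in>UNIV. \<phi> i (c * p $ i * refl3 j q $ i)) = \<phi> j (- (c * p $ j * q $ j)) * ?R"
  proof -
    have "(\<Prod>i\<in>UNIV. \<phi> i (c * p $ i * refl3 j q $ i)) = \<phi> j (c * p $ j * refl3 j q $ j) * (\<Prod>i\<in>- {j}. \<phi> i (c * p $ i * refl3 j q $ i))"
      by (rule prod_split1)
    also have "(\<Prod>i\<in>- {j}. \<phi> i (c * p $ i * refl3 j q $ i)) = ?R" by (intro prod.cong) (auto simp: refl3_nth)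
    finally show ?thesis by (simp add: refl3_nth)
  qed
  have 3: "(\<Prod>i\<in>UNIV. (\<phi>(j := \<lambda>y. (\<phi> j y + e * \<phi> j (- y)) / 2)) i (c * p $ i * q $ i)) =
     (\<phi> j (c * p $ j * q $ j) + e * \<phi> j (- (c * p $ j * q $ j))) / 2 * ?R"
  proof -
    have "(\<Prod>i\<in>- {j}. (\<phi>(j := \<lambda>y. (\<phi> j y + e * \<phi> j (- y)) / 2)) i (c * p $ i * q $ i)) = ?R"
      by (intro prod.cong) auto
    then show ?thesis by (subst prod_split1[where i=j]) simp
  qed
  show "AA e j (\<lambda>p q. E * (exp (- t * (norm p)^2) * exp (- t * (norm q)^2)) * (\<Prod>i\<in>UNIV. \<phi> i (c * p $ i * q $ i))) p q =
    E * (exp (- t * (norm p)^2) * exp (- t * (norm q)^2)) * (\<Prod>i\<in>UNIV. (\<phi>(j := \<lambda>y. (\<phi> j y + e * \<phi> j (- y)) / 2)) i (c * p $ i * q $ i))"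
    unfolding AA_def 1 2 3 norm_refl3 by (simp add: field_simps)
qed

section \<open>Sectors of definite parity\<close>

definition hh :: "real \<Rightarrow> real \<Rightarrow> real" where "hh e y = (exp (- y) + e * exp y) / 2"

lemma hh_abs: assumes "e = 1 \<or> e = - 1" shows "\<bar>hh e y\<bar> \<le> cosh y"
proof -
  have "exp y > 0" "exp (- y) > 0" by auto
  then show ?thesis using assms unfolding hh_def cosh_field_def by (auto simp: abs_le_iff field_simps)
qed

lemma hh_minus: "\<bar>hh (- 1) y\<bar> = \<bar>sinh y\<bar>"
  unfolding hh_def sinh_field_def by (simp add: abs_minus_commute)

text \<open>Projecting the kernel onto the parities of f does not change the form, but it makes the
  odd coordinate contribute a sinh, whose modulus is bounded through \<open>Sk\<close>. The Schur
  test with weight |q_i| / |q|^3 then loses nothing, this weight being an eigenfunction.\<close>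

lemma odd_sector:
  assumes a: "0 < a" "a < 1" and \<mu>: "\<mu> > 0" and f: "adm f"
    and par: "\<And>j x. f (refl3 j x) = e j * f x" and e: "\<And>j. e j = 1 \<or> e j = - 1" and i: "e i = - 1"
  shows "\<bar>IH f f (Gk a \<mu>)\<bar> \<le> tau a * (\<integral>p. norm p * (f p)^2 \<partial>lb3)"
proof -
  have [measurable]: "f \<in> borel_measurable borel" using f by auto
  have a': "0 \<le> a" using a by simp
  define K where "K = AA (e 1) 1 (AA (e 2) 2 (AA (e 3) 3 (Gk a \<mu>)))"
  have m0: "(\<lambda>z. Gk a \<mu> (fst z) (snd z)) \<in> borel_measurable lb33" by measurable
  note f' = admD[OF f]
  note i0 = II_Gk[OF a' a(2) \<mu> f f]
  note A3 = IH_AA[OF f' m0 par e i0, of 3]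
  note A2 = IH_AA[OF f' A3(3) par e A3(2), of 2]
  note A1 = IH_AA[OF f' A2(3) par e A2(2), of 1, folded K_def]
  have KG: "IH f f (Gk a \<mu>) = IH f f K" using A1(1) A2(1) A3(1) by simp
  have Km[measurable]: "(\<lambda>z. K (fst z) (snd z)) \<in> borel_measurable lb33" by (rule A1(3))
  define X where "X t = (\<lambda>p q :: real^3. (indicator {0..} t * exp (- t * \<mu>)) * (exp (- t * (norm p)^2) * exp (- t * (norm q)^2)) * (\<Prod>i\<in>UNIV. exp (- (2 * a * t * p $ i * q $ i))))" for t :: real
  have XG: "has_bochner_integral lborel (\<lambda>t. X t p q) (Gk a \<mu> p q)" for p q
  proof -
    have "X t p q = indicator {0..} t * exp (- t * ((norm p)^2 + (norm q)^2 + 2 * a * (p \<bullet> q) + \<mu>))" for t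
    proof -
      have "(\<Prod>i\<in>UNIV. exp (- (2 * a * t * p $ i * q $ i))) = exp (- t * (2 * a * (p \<bullet> q)))"
        by (simp add: exp_sum[symmetric] inner3 sum_distrib_left sum_negf mult_ac)
      then show ?thesis unfolding X_def by (simp add: exp_add[symmetric] algebra_simps)
    qed
    then show ?thesis using integral_exp_decay(2)[OF Gk_pos(1)[OF a' a(2) \<mu>], of p q] by (simp add: Gk_def)
  qed
  define Y where "Y t = AA (e 1) 1 (AA (e 2) 2 (AA (e 3) 3 (X t)))" for t
  have YK: "has_bochner_integral lborel (\<lambda>t. Y t p q) (K p q)" for p q
    unfolding Y_def K_def by (intro AA_has_bochner XG)
  have Y: "Y t p q = (indicator {0..} t * exp (- t * \<mu>)) * (exp (- t * (norm p)^2) * exp (- t * (norm q)^2)) * (\<Prod>i\<in>UNIV. hh (e i) (2 * a * t * p $ i * q $ i))" for t p q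
  proof -
    let ?E = "indicator {0..} t * exp (- t * \<mu>)"
    let ?\<phi> = "\<lambda>(i :: 3) y. exp (- y) :: real"
    let ?\<phi>3 = "?\<phi>(3 := \<lambda>y. (?\<phi> 3 y + e 3 * ?\<phi> 3 (- y)) / 2)"
    let ?\<phi>2 = "?\<phi>3(2 := \<lambda>y. (?\<phi>3 2 y + e 2 * ?\<phi>3 2 (- y)) / 2)"
    let ?\<phi>1 = "?\<phi>2(1 := \<lambda>y. (?\<phi>2 1 y + e 1 * ?\<phi>2 1 (- y)) / 2)"
    have X: "X t = (\<lambda>p q. ?E * (exp (- t * (norm p)^2) * exp (- t * (norm q)^2)) * (\<Prod>i\<in>UNIV. ?\<phi> i (2 * a * t * p $ i * q $ i)))"
      unfolding X_def ..
    have 3: "AA (e 3) 3 (X t) = (\<lambda>p q. ?E * (exp (- t * (norm p)^2) * exp (- t * (norm q)^2)) * (\<Prod>i\<in>UNIV. ?\<phi>3 i (2 * a * t * p $ i * q $ i)))"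
      unfolding X by (rule AA_product)
    have 2: "AA (e 2) 2 (AA (e 3) 3 (X t)) = (\<lambda>p q. ?E * (exp (- t * (norm p)^2) * exp (- t * (norm q)^2)) * (\<Prod>i\<in>UNIV. ?\<phi>2 i (2 * a * t * p $ i * q $ i)))"
      unfolding 3 by (rule AA_product)
    have 1: "Y t = (\<lambda>p q. ?E * (exp (- t * (norm p)^2) * exp (- t * (norm q)^2)) * (\<Prod>i\<in>UNIV. ?\<phi>1 i (2 * a * t * p $ i * q $ i)))"
      unfolding Y_def 2 by (rule AA_product)
    have "?\<phi>1 i y = hh (e i) y" for i y
      using exhaust_3[of i] by (auto simp: hh_def)
    then show ?thesis unfolding 1 by simp
  qed
  \<comment> \<open>\<open>hh\<close> is cosh for e = 1 and -sinh for e = -1, and |sinh| \<le> cosh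
    covers the coordinates other than i whatever their parity. The factor exp (-t \<mu>) \<le> 1
    reduces the bound to \<mu> = 0.\<close>
  have Yb: "ennreal \<bar>Y t p q\<bar> \<le> indicator {0..} t * ennreal (Sk a i t p q)" for t p q
  proof (cases "t \<ge> 0")
    case True
    let ?C = "\<Prod>j\<in>- {i}. cosh (2 * (a * t * p $ j) * q $ j)"
    have "\<bar>\<Prod>j\<in>UNIV. hh (e j) (2 * a * t * p $ j * q $ j)\<bar> = \<bar>hh (e i) (2 * a * t * p $ i * q $ i)\<bar> * (\<Prod>j\<in>- {i}. \<bar>hh (e j) (2 * a * t * p $ j * q $ j)\<bar>)"
      unfolding prod_split1[where i=i and h="\<lambda>j. hh (e j) (2 * a * t * p $ j * q $ j)"] by (simp add: abs_mult abs_prod)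
    also have "\<dots> \<le> \<bar>sinh (2 * (a * t * p $ i) * q $ i)\<bar> * ?C"
      unfolding i hh_minus
    proof (intro mult_mono prod_mono conjI)
      show "\<bar>hh (e j) (2 * a * t * p $ j * q $ j)\<bar> \<le> cosh (2 * (a * t * p $ j) * q $ j)" for j
        using hh_abs[OF e[of j], of "2 * a * t * p $ j * q $ j"] by (simp add: mult.assoc)
    qed (auto simp: mult.assoc intro!: prod_nonneg)
    finally have le: "\<bar>\<Prod>j\<in>UNIV. hh (e j) (2 * a * t * p $ j * q $ j)\<bar> \<le> \<bar>sinh (2 * (a * t * p $ i) * q $ i)\<bar> * ?C" .
    have "\<bar>Y t p q\<bar> = exp (- t * \<mu>) * (exp (- t * (norm p)^2) * exp (- t * (norm q)^2) * \<bar>\<Prod>j\<in>UNIV. hh (e j) (2 * a * t * p $ j * q $ j)\<bar>)"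
      unfolding Y using True by (simp add: abs_mult)
    also have "\<dots> \<le> 1 * (exp (- t * (norm p)^2) * exp (- t * (norm q)^2) * (\<bar>sinh (2 * (a * t * p $ i) * q $ i)\<bar> * ?C))"
      using True \<mu> by (intro mult_mono[of "exp (- t * \<mu>)" 1] mult_left_mono le) auto
    finally have "\<bar>Y t p q\<bar> \<le> Sk a i t p q" by (simp add: Sk_def)
    then show ?thesis using True by (simp add: ennreal_leI)
  qed (simp add: Y)
  have Kb: "ennreal \<bar>K p q\<bar> \<le> (\<integral>\<^sup>+t. indicator {0..} t * ennreal (Sk a i t p q) \<partial>lborel)" for p q
  proof -
    have "ennreal (norm (\<integral>t. Y t p q \<partial>lborel)) \<le> (\<integral>\<^sup>+t. ennreal (norm (Y t p q)) \<partial>lborel)"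
      by (rule integral_norm_bound_ennreal) (use YK[of p q] in \<open>simp add: has_bochner_integral_iff\<close>)
    also have "\<dots> \<le> (\<integral>\<^sup>+t. indicator {0..} t * ennreal (Sk a i t p q) \<partial>lborel)"
      using Yb by (intro nn_integral_mono) simp
    finally show ?thesis using YK[of p q] by (simp add: has_bochner_integral_iff)
  qed
  define v where "v p = \<bar>p $ i\<bar> / (norm p)^3" for p :: "real^3"
  have [measurable]: "v \<in> borel_measurable borel" unfolding v_def by measurable
  have v0: "v p \<ge> 0" for p by (simp add: v_def)
  \<comment> \<open>Arithmetic-geometric inequality with ratio v q / v p. Where the weight v
    vanishes, a coordinate i is 0 and the kernel vanishes too, so division by zero does no
    harm.\<close>
  have am: "\<bar>f p * f q\<bar> * Sk a i t p q \<le> (f p)^2 / v p / 2 * (Sk a i t p q * v q) + (f q)^2 / v q / 2 * (Sk a i t q p * v p)" for p q t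
  proof (cases "v p = 0 \<or> v q = 0")
    case True
    then have "p $ i = 0 \<or> q $ i = 0" by (auto simp: v_def)
    then have "Sk a i t p q = 0" "Sk a i t q p = 0" by (auto simp: Sk_def)
    then show ?thesis by simp
  next
    case False
    then have pos: "v p > 0" "v q > 0" using v0[of p] v0[of q] by auto
    have "\<bar>f p * f q\<bar> \<le> (f p)^2 / v p / 2 * v q + (f q)^2 / v q / 2 * v p"
    proof -
      define r where "r = sqrt (v q / v p)"
      have r: "r > 0" "r^2 = v q / v p" using pos by (auto simp: r_def)
      have g: "X * Y \<le> (X^2 + Y^2) / 2" for X Y :: real using sum_squares_bound[of X Y] by simp
      have 1: "\<bar>f p * f q\<bar> = (\<bar>f p\<bar> * r) * (\<bar>f q\<bar> / r)" using r(1) by (simp add: abs_mult)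
      have 2: "(\<bar>f p\<bar> * r)^2 = (f p)^2 / v p * v q" "(\<bar>f q\<bar> / r)^2 = (f q)^2 / v q * v p"
        unfolding power_mult_distrib power_divide r(2) by simp_all
      have "\<bar>f p * f q\<bar> \<le> ((f p)^2 / v p * v q + (f q)^2 / v q * v p) / 2"
        unfolding 1 2[symmetric] by (rule g)
      then show ?thesis by (simp add: add_divide_distrib)
    qed
    from mult_right_mono[OF this Sk_nonneg[of a i t p q]]
    show ?thesis unfolding Sk_commute[of a i t q p] by (simp add: algebra_simps)
  qed
  let ?J = "\<lambda>p. \<integral>\<^sup>+t. indicator {0..} t * (\<integral>\<^sup>+q. ennreal (Sk a i t p q * v q) \<partial>lb3) \<partial>lborel"
  let ?g = "\<lambda>p. (f p)^2 / v p / 2"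
  have g0: "?g p \<ge> 0" for p using v0 by simp
  \<comment> \<open>Each half of the split is integrated over q and t first, which is the eigenvalue
    relation: |f p|^2 / (2 v p) times tau |p| v p.\<close>
  have half: "(\<integral>\<^sup>+p. \<integral>\<^sup>+q. \<integral>\<^sup>+t. indicator {0..} t * ennreal (?g p * (Sk a i t p q * v q)) \<partial>lborel \<partial>lb3 \<partial>lb3) \<le> (\<integral>\<^sup>+p. ennreal (tau a / 2 * (norm p * (f p)^2)) \<partial>lb3)"
  proof (rule nn_integral_mono)
    fix p
    have "(\<integral>\<^sup>+q. \<integral>\<^sup>+t. indicator {0..} t * ennreal (?g p * (Sk a i t p q * v q)) \<partial>lborel \<partial>lb3) = (\<integral>\<^sup>+t. \<integral>\<^sup>+q. indicator {0..} t * ennreal (?g p * (Sk a i t p q * v q)) \<partial>lb3 \<partial>lborel)"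
      by (rule lborel_pair.Fubini') measurable
    also have "\<dots> = (\<integral>\<^sup>+t. ennreal (?g p) * (indicator {0..} t * (\<integral>\<^sup>+q. ennreal (Sk a i t p q * v q) \<partial>lb3)) \<partial>lborel)"
    proof (rule nn_integral_cong)
      fix t :: real
      have "(\<integral>\<^sup>+q. indicator {0..} t * ennreal (?g p * (Sk a i t p q * v q)) \<partial>lb3) = (\<integral>\<^sup>+q. (ennreal (?g p) * indicator {0..} t) * ennreal (Sk a i t p q * v q) \<partial>lb3)"
        unfolding ennreal_mult'[OF g0] by (simp only: mult_ac)
      also have "\<dots> = (ennreal (?g p) * indicator {0..} t) * (\<integral>\<^sup>+q. ennreal (Sk a i t p q * v q) \<partial>lb3)"
        by (rule nn_integral_cmult) measurable
      finally show "(\<integral>\<^sup>+q. indicator {0..} t * ennreal (?g p * (Sk a i t p q * v q)) \<partial>lb3) = ennreal (?g p) * (indicator {0..} t * (\<integral>\<^sup>+q. ennreal (Sk a i t p q * v q) \<partial>lb3))"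
        by (simp only: mult.assoc)
    qed
    also have "\<dots> = ennreal (?g p) * ?J p"
      by (rule nn_integral_cmult) measurable
    also have "\<dots> \<le> ennreal (tau a / 2 * (norm p * (f p)^2))"
    proof (cases "p = 0")
      case True then show ?thesis by (simp add: v_def)
    next
      case False
      have "?J p = ennreal (tau a * (\<bar>p $ i\<bar> / (norm p)^2))"
        unfolding v_def by (rule Sk_eigen[OF a False])
      then have "ennreal (?g p) * ?J p = ennreal (?g p * (tau a * (\<bar>p $ i\<bar> / (norm p)^2)))"
        by (simp only: ennreal_mult'[OF g0])
      also have "?g p * (tau a * (\<bar>p $ i\<bar> / (norm p)^2)) \<le> tau a / 2 * (norm p * (f p)^2)"
        using False tau_integral(2)[OF a] by (cases "p $ i = 0") (simp_all add: v_def power2_eq_square power3_eq_cube)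
      then have "ennreal (?g p * (tau a * (\<bar>p $ i\<bar> / (norm p)^2))) \<le> ennreal (tau a / 2 * (norm p * (f p)^2))" by (rule ennreal_leI)
      finally show ?thesis .
    qed
    finally show "(\<integral>\<^sup>+q. \<integral>\<^sup>+t. indicator {0..} t * ennreal (?g p * (Sk a i t p q * v q)) \<partial>lborel \<partial>lb3) \<le> ennreal (tau a / 2 * (norm p * (f p)^2))" .
  qed
  let ?T = "\<lambda>p q. \<integral>\<^sup>+t. indicator {0..} t * ennreal (?g p * (Sk a i t p q * v q)) \<partial>lborel"
  have "ennreal \<bar>IH f f K\<bar> \<le> (\<integral>\<^sup>+z. ennreal (norm (f (fst z) * f (snd z) * K (fst z) (snd z))) \<partial>lb33)"
    unfolding IH_def real_norm_def[symmetric] by (rule integral_norm_bound_ennreal) (use A1(2) in \<open>simp add: II_def\<close>)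
  also have "\<dots> \<le> (\<integral>\<^sup>+z. ?T (fst z) (snd z) + ?T (snd z) (fst z) \<partial>lb33)"
  proof (rule nn_integral_mono)
    fix z :: "(real^3) \<times> (real^3)"
    obtain p q where z: "z = (p, q)" by force
    have "ennreal (norm (f p * f q * K p q)) = ennreal \<bar>f p * f q\<bar> * ennreal \<bar>K p q\<bar>"
      by (simp add: abs_mult ennreal_mult[symmetric])
    also have "\<dots> \<le> ennreal \<bar>f p * f q\<bar> * (\<integral>\<^sup>+t. indicator {0..} t * ennreal (Sk a i t p q) \<partial>lborel)"
      by (intro mult_left_mono Kb) simp
    also have "\<dots> = (\<integral>\<^sup>+t. ennreal \<bar>f p * f q\<bar> * (indicator {0..} t * ennreal (Sk a i t p q)) \<partial>lborel)"
      by (rule nn_integral_cmult[symmetric]) measurable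
    also have "\<dots> \<le> (\<integral>\<^sup>+t. indicator {0..} t * ennreal (?g p * (Sk a i t p q * v q)) + indicator {0..} t * ennreal (?g q * (Sk a i t q p * v p)) \<partial>lborel)"
    proof (rule nn_integral_mono)
      fix t :: real
      have "ennreal \<bar>f p * f q\<bar> * ennreal (Sk a i t p q) \<le> ennreal (?g p * (Sk a i t p q * v q) + ?g q * (Sk a i t q p * v p))"
        unfolding ennreal_mult'[OF abs_ge_zero, symmetric] by (rule ennreal_leI[OF am])
      also have "\<dots> = ennreal (?g p * (Sk a i t p q * v q)) + ennreal (?g q * (Sk a i t q p * v p))"
        using v0 Sk_nonneg g0 by (intro ennreal_plus mult_nonneg_nonneg) auto
      finally show "ennreal \<bar>f p * f q\<bar> * (indicator {0..} t * ennreal (Sk a i t p q)) \<le> indicator {0..} t * ennreal (?g p * (Sk a i t p q * v q)) + indicator {0..} t * ennreal (?g q * (Sk a i t q p * v p))"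
        by (cases "t \<ge> 0") simp_all
    qed
    also have "\<dots> = ?T p q + ?T q p" by (rule nn_integral_add) measurable
    finally show "ennreal (norm (f (fst z) * f (snd z) * K (fst z) (snd z))) \<le> ?T (fst z) (snd z) + ?T (snd z) (fst z)"
      unfolding z by simp
  qed
  also have "\<dots> = (\<integral>\<^sup>+z. ?T (fst z) (snd z) \<partial>lb33) + (\<integral>\<^sup>+z. ?T (snd z) (fst z) \<partial>lb33)"
    by (rule nn_integral_add) measurable
  also have "(\<integral>\<^sup>+z. ?T (fst z) (snd z) \<partial>lb33) = (\<integral>\<^sup>+p. \<integral>\<^sup>+q. ?T p q \<partial>lb3 \<partial>lb3)"
    by (subst lborel.nn_integral_fst[symmetric]) auto
  also have "(\<integral>\<^sup>+z. ?T (snd z) (fst z) \<partial>lb33) = (\<integral>\<^sup>+p. \<integral>\<^sup>+q. ?T p q \<partial>lb3 \<partial>lb3)"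
    by (subst lborel_pair.nn_integral_snd[symmetric]) auto
  also have "(\<integral>\<^sup>+p. \<integral>\<^sup>+q. ?T p q \<partial>lb3 \<partial>lb3) + (\<integral>\<^sup>+p. \<integral>\<^sup>+q. ?T p q \<partial>lb3 \<partial>lb3) \<le>
     (\<integral>\<^sup>+p. ennreal (tau a / 2 * (norm p * (f p)^2)) \<partial>lb3) + (\<integral>\<^sup>+p. ennreal (tau a / 2 * (norm p * (f p)^2)) \<partial>lb3)"
    by (intro add_mono half)
  also have "(\<integral>\<^sup>+p. ennreal (tau a / 2 * (norm p * (f p)^2)) \<partial>lb3) = ennreal (\<integral>p. tau a / 2 * (norm p * (f p)^2) \<partial>lb3)"
    using adm_integrable[OF f] tau_integral(2)[OF a] by (intro nn_integral_eq_integral) auto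
  also have "(\<integral>p. tau a / 2 * (norm p * (f p)^2) \<partial>lb3) = tau a / 2 * (\<integral>p. norm p * (f p)^2 \<partial>lb3)"
    by (rule integral_mult_right_zero)
  also have "ennreal (tau a / 2 * (\<integral>p. norm p * (f p)^2 \<partial>lb3)) + ennreal (tau a / 2 * (\<integral>p. norm p * (f p)^2 \<partial>lb3)) = ennreal (tau a * (\<integral>p. norm p * (f p)^2 \<partial>lb3))"
    using tau_integral(2)[OF a] by (subst ennreal_plus[symmetric]) (auto intro!: mult_nonneg_nonneg integral_nonneg_AE)
  finally have "ennreal \<bar>IH f f K\<bar> \<le> ennreal (tau a * (\<integral>p. norm p * (f p)^2 \<partial>lb3))" .
  then show ?thesis unfolding KG
    by (subst (asm) ennreal_le_iff) (use tau_integral(2)[OF a] in \<open>auto intro!: mult_nonneg_nonneg integral_nonneg_AE\<close>)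
qed

text \<open>Fubini makes it the square of an integral; in the nonintegrable case the Bochner
  integral is 0.\<close>

lemma integral_sq_nonneg:
  fixes h :: "real^3 \<Rightarrow> real"
  shows "0 \<le> (\<integral>z. h (fst z) * h (snd z) \<partial>lb33)"
proof (cases "integrable lb33 (\<lambda>z. h (fst z) * h (snd z))")
  case True
  then have "(\<integral>z. h (fst z) * h (snd z) \<partial>lb33) = (\<integral>p. \<integral>q. h p * h q \<partial>lb3 \<partial>lb3)"
    using lborel_pair.integral_fst'[of "\<lambda>z. h (fst z) * h (snd z)"] by simp
  also have "\<dots> = (\<integral>p. h p \<partial>lb3) * (\<integral>p. h p \<partial>lb3)"
    by simp
  finally show ?thesis by simp
qed (simp add: not_integrable_integral_eq)

text \<open>With the sign of a reversed, the Gaussian in p and q is, for each t, an integral over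
  centres z of products \<open>gg t z p * gg t z q\<close>. The form is thus a positive
  superposition of squares.\<close>

lemma pos_mixture:
  assumes a: "0 < a" "a < 1" and \<mu>: "\<mu> > 0" and [measurable]: "f \<in> borel_measurable borel" and i: "II f f (Gk (- a) \<mu>)"
  shows "0 \<le> IH f f (Gk (- a) \<mu>)"
proof -
  let ?Y = "lborel \<Otimes>\<^sub>M lborel :: (real \<times> (real^3)) measure"
  interpret Y: sigma_finite_measure ?Y by (rule lborel_pair.sigma_finite_measure_axioms)
  interpret P: sigma_finite_measure lb33 by (rule lborel_pair.sigma_finite_measure_axioms)
  interpret PY: pair_sigma_finite lb33 ?Y ..
  \<comment> \<open>The cube is the inverse of the z-integral of exp (-4 a t |z|^2), so that the
    superposition reproduces the kernel exactly.\<close>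
  define w where "w t = indicator {0..} t * exp (- t * \<mu>) * (sqrt (4 * a * t / pi))^3" for t :: real
  define gg where "gg t z p = exp (- t * (1 - a) * (norm p)^2) * exp (- (2 * a * t) * (norm (p - z))^2)" for t and z p :: "real^3"
  have w0: "w t \<ge> 0" for t unfolding w_def using a by (auto simp: indicator_def)
  have gg0: "gg t z p \<ge> 0" for t z p by (simp add: gg_def)
  have [measurable]: "w \<in> borel_measurable borel" unfolding w_def by measurable
  have [measurable]: "(\<lambda>x. gg (t x) (z x) (p x)) \<in> borel_measurable M"
    if [measurable]: "t \<in> borel_measurable M" "z \<in> borel_measurable M" "p \<in> borel_measurable M" for t z p and M :: "'m measure"
    unfolding gg_def by measurable
  have Gp: "Gk (- a) \<mu> p q > 0" "(norm p)^2 + (norm q)^2 + 2 * (- a) * (p \<bullet> q) + \<mu> > 0" for p q :: "real^3"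
  proof -
    have "(norm p)^2 + (norm (- q))^2 + 2 * a * (p \<bullet> (- q)) + \<mu> > 0" using Gk_pos(1)[of a \<mu> p "- q"] a \<mu> by simp
    then show "(norm p)^2 + (norm q)^2 + 2 * (- a) * (p \<bullet> q) + \<mu> > 0" by simp
    then show "Gk (- a) \<mu> p q > 0" by (simp add: Gk_def)
  qed
  have mix: "(\<integral>\<^sup>+y. ennreal (w (fst y) * (gg (fst y) (snd y) p * gg (fst y) (snd y) q)) \<partial>?Y) = ennreal (Gk (- a) \<mu> p q)" for p q
  proof -
    let ?u = "(norm p)^2 + (norm q)^2 + 2 * (- a) * (p \<bullet> q) + \<mu>"
    have "(\<integral>\<^sup>+y. ennreal (w (fst y) * (gg (fst y) (snd y) p * gg (fst y) (snd y) q)) \<partial>?Y) = (\<integral>\<^sup>+t. \<integral>\<^sup>+z. ennreal (w t * (gg t z p * gg t z q)) \<partial>lb3 \<partial>lborel)"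
      by (subst lborel.nn_integral_fst[symmetric]) auto
    also have "\<dots> = (\<integral>\<^sup>+t. ennreal (exp (- t * ?u)) * indicator {0..} t \<partial>lborel)"
    proof (rule nn_integral_cong_AE)
      have "AE t in (lborel :: real measure). t \<noteq> 0" by (rule AE_lborel_singleton)
      then show "AE t in lborel. (\<integral>\<^sup>+z. ennreal (w t * (gg t z p * gg t z q)) \<partial>lb3) = ennreal (exp (- t * ?u)) * indicator {0..} t"
      proof eventually_elim
        case (elim t)
        show ?case
        proof (cases "t > 0")
          case False
          then show ?thesis using elim by (simp add: w_def)
        next
          case True
          have s: "4 * a * t > 0" using a True by simp
          let ?c = "(1/2) *\<^sub>R (p + q)"
          let ?k = "w t * exp (- t * ((norm p)^2 + (norm q)^2 + 2 * (- a) * (p \<bullet> q)))"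
          have k0: "0 \<le> ?k" using w0 by simp
          have eq: "w t * (gg t z p * gg t z q) = ?k * exp (- (4 * a * t) * (norm (z - ?c))^2)" for z
          proof -
            \<comment> \<open>Parallelogram law about the midpoint of p and q; the part left over in
              p - q is what supplies the cross term 2 a p.q with the desired sign.\<close>
            have "(norm (p - z))^2 + (norm (q - z))^2 = 2 * (norm (z - ?c))^2 + (1/2) * (norm (p - q))^2"
              unfolding power2_norm_eq_inner by (simp add: inner_simps inner_commute field_simps)
            then have "(2 * a * t) * (norm (p - z))^2 + (2 * a * t) * (norm (q - z))^2 = (4 * a * t) * (norm (z - ?c))^2 + a * t * (norm (p - q))^2"
              unfolding distrib_left[symmetric] by (simp add: algebra_simps)
            moreover have "(norm (p - q))^2 = (norm p)^2 + (norm q)^2 - 2 * (p \<bullet> q)"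
              unfolding power2_norm_eq_inner by (simp add: inner_simps inner_commute)
            ultimately have "(2 * a * t) * (norm (p - z))^2 + (2 * a * t) * (norm (q - z))^2 = (4 * a * t) * (norm (z - ?c))^2 + a * t * ((norm p)^2 + (norm q)^2 - 2 * (p \<bullet> q))"
              by simp
            then have "- t * (1 - a) * (norm p)^2 + - (2 * a * t) * (norm (p - z))^2 + (- t * (1 - a) * (norm q)^2 + - (2 * a * t) * (norm (q - z))^2)
              = - t * ((norm p)^2 + (norm q)^2 + 2 * (- a) * (p \<bullet> q)) + - (4 * a * t) * (norm (z - ?c))^2"
              by (simp add: algebra_simps)
            then show ?thesis unfolding gg_def exp_add[symmetric] by (simp only: mult.assoc exp_add[symmetric])
          qed
          have "(\<integral>\<^sup>+z. ennreal (w t * (gg t z p * gg t z q)) \<partial>lb3) = (\<integral>\<^sup>+z. ennreal ?k * ennreal (exp (- (4 * a * t) * (norm (z - ?c))^2)) \<partial>lb3)"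
            unfolding eq ennreal_mult'[OF k0] ..
          also have "\<dots> = ennreal ?k * (\<integral>\<^sup>+z. ennreal (exp (- (4 * a * t) * (norm (z - ?c))^2)) \<partial>lb3)"
            by (rule nn_integral_cmult) measurable
          also have "\<dots> = ennreal (?k * sqrt (pi / (4 * a * t))^3)"
            unfolding nn_gauss_vec[OF s] ennreal_mult'[OF k0] ..
          also have "?k * sqrt (pi / (4 * a * t))^3 = exp (- t * ?u)"
          proof -
            have "sqrt (4 * a * t / pi) * sqrt (pi / (4 * a * t)) = 1"
              unfolding real_sqrt_mult[symmetric] using a True by simp
            then have "(sqrt (4 * a * t / pi))^3 * sqrt (pi / (4 * a * t))^3 = 1"
              unfolding power_mult_distrib[symmetric] by simp
            then have "?k * sqrt (pi / (4 * a * t))^3 = exp (- t * \<mu>) * exp (- t * ((norm p)^2 + (norm q)^2 + 2 * (- a) * (p \<bullet> q)))"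
              unfolding w_def using True by (simp add: mult_ac)
            then show ?thesis unfolding exp_add[symmetric] by (simp add: algebra_simps)
          qed
          finally show ?thesis using True by simp
        qed
      qed
    qed
    also have "\<dots> = ennreal (1 / ?u)" by (rule integral_exp_decay(1)[OF Gp(2)])
    finally show ?thesis by (simp add: Gk_def)
  qed
  let ?F = "\<lambda>x y. f (fst x) * f (snd x) * (w (fst y) * (gg (fst y) (snd y) (fst x) * gg (fst y) (snd y) (snd x)))"
  have wg0: "0 \<le> w (fst y) * (gg (fst y) (snd y) p * gg (fst y) (snd y) q)" for y p q
    using w0 gg0 by simp
  have hb: "has_bochner_integral ?Y (\<lambda>y. w (fst y) * (gg (fst y) (snd y) p * gg (fst y) (snd y) q)) (Gk (- a) \<mu> p q)" for p q
    by (rule has_bochner_integral_nn_integral) (use wg0 mix less_imp_le[OF Gp(1)] in auto)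
  have I: "integrable (lb33 \<Otimes>\<^sub>M ?Y) (case_prod ?F)"
  proof (rule PY.Fubini_integrable)
    show "integrable lb33 (\<lambda>x. \<integral>y. norm (case (x, y) of (x, y) \<Rightarrow> ?F x y) \<partial>?Y)"
    proof -
      have "(\<integral>y. norm (case (x, y) of (x, y) \<Rightarrow> ?F x y) \<partial>?Y) = norm (f (fst x) * f (snd x) * Gk (- a) \<mu> (fst x) (snd x))" for x
      proof -
        have "(\<integral>y. norm (case (x, y) of (x, y) \<Rightarrow> ?F x y) \<partial>?Y) = (\<integral>y. \<bar>f (fst x) * f (snd x)\<bar> * (w (fst y) * (gg (fst y) (snd y) (fst x) * gg (fst y) (snd y) (snd x))) \<partial>?Y)"
          by (intro Bochner_Integration.integral_cong refl) (simp only: prod.case real_norm_def abs_mult[of "f (fst x) * f (snd x)"] abs_of_nonneg[OF wg0])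
        also have "\<dots> = \<bar>f (fst x) * f (snd x)\<bar> * Gk (- a) \<mu> (fst x) (snd x)"
          using hb[of "fst x" "snd x"] by (subst integral_mult_right_zero) (simp add: has_bochner_integral_iff)
        finally show ?thesis using Gp(1)[of "fst x" "snd x"] by (simp add: abs_mult)
      qed
      then show ?thesis using i unfolding II_def by (simp only:) (rule integrable_norm)
    qed
    show "AE x in lb33. integrable ?Y (\<lambda>y. case (x, y) of (x, y) \<Rightarrow> ?F x y)"
      using hb by (intro AE_I2) (auto simp: has_bochner_integral_iff intro!: integrable_mult_right)
  qed measurable
  have "IH f f (Gk (- a) \<mu>) = (\<integral>x. (\<integral>y. ?F x y \<partial>?Y) \<partial>lb33)"
    unfolding IH_def
  proof (intro Bochner_Integration.integral_cong refl)
    fix x :: "(real^3) \<times> (real^3)"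
    show "f (fst x) * f (snd x) * Gk (- a) \<mu> (fst x) (snd x) = (\<integral>y. ?F x y \<partial>?Y)"
      using hb[of "fst x" "snd x"] by (subst integral_mult_right_zero) (simp add: has_bochner_integral_iff)
  qed
  also have "\<dots> = (\<integral>y. (\<integral>x. ?F x y \<partial>lb33) \<partial>?Y)"
    by (rule PY.Fubini_integral[OF I, symmetric])
  also have "\<dots> \<ge> 0"
  proof (rule integral_nonneg_AE, rule AE_I2)
    fix y :: "real \<times> (real^3)"
    have "(\<integral>x. ?F x y \<partial>lb33) = (\<integral>x. w (fst y) * ((\<lambda>p. f p * gg (fst y) (snd y) p) (fst x) * (\<lambda>p. f p * gg (fst y) (snd y) p) (snd x)) \<partial>lb33)"
      by (intro Bochner_Integration.integral_cong refl) (simp add: mult_ac)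
    also have "\<dots> = w (fst y) * (\<integral>x. (\<lambda>p. f p * gg (fst y) (snd y) p) (fst x) * (\<lambda>p. f p * gg (fst y) (snd y) p) (snd x) \<partial>lb33)"
      by (rule integral_mult_right_zero)
    also have "\<dots> \<ge> 0" by (intro mult_nonneg_nonneg w0 integral_sq_nonneg)
    finally show "0 \<le> (\<integral>x. ?F x y \<partial>lb33)" .
  qed
  finally show ?thesis .
qed

text \<open>For total parity \<open>+1\<close> replacing \<open>q\<close> by \<open>-q\<close> turns \<open>a\<close> into \<open>-a\<close>.\<close>
lemma even_sector:
  assumes a: "0 < a" "a < 1" and \<mu>: "\<mu> > 0" and f: "adm f"
    and par: "\<And>j x. f (refl3 j x) = e j * f x" and e: "\<And>j. e j = 1 \<or> e j = - 1" and pr: "e 1 * e 2 * e 3 = 1"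
  shows "0 \<le> IH f f (Gk a \<mu>)"
proof -
  note f' = admD[OF f]
  have a': "0 \<le> a" using a by simp
  have m3: "(\<lambda>z. Gk a \<mu> (fst z) (snd z)) \<in> borel_measurable lb33"
    and m2: "(\<lambda>z. Gk a \<mu> (fst z) (refl3 3 (snd z))) \<in> borel_measurable lb33"
    and m1: "(\<lambda>z. Gk a \<mu> (fst z) (refl3 3 (refl3 2 (snd z)))) \<in> borel_measurable lb33"
    by measurable
  note i0 = II_Gk[OF a' a(2) \<mu> f f]
  note S3 = IH_snd[OF f' f' m3 par e, of 3]
  note S2 = IH_snd[OF f' f' m2 par e, of 2]
  note S1 = IH_snd[OF f' f' m1 par e, of 1]
  have neg: "refl3 3 (refl3 2 (refl3 1 q)) = - q" for q
    by (simp add: vec_eq_iff refl3_nth forall_3)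
  have k: "(\<lambda>p q. Gk a \<mu> p (refl3 3 (refl3 2 (refl3 1 q)))) = Gk (- a) \<mu>"
    unfolding neg Gk_def by (simp add: fun_eq_iff)
  have "IH f f (Gk a \<mu>) = e 3 * (e 2 * (e 1 * IH f f (Gk (- a) \<mu>)))"
    unfolding S3(1) S2(1) S1(1) k ..
  also have "\<dots> = (e 1 * e 2 * e 3) * IH f f (Gk (- a) \<mu>)" by simp
  finally have "IH f f (Gk a \<mu>) = IH f f (Gk (- a) \<mu>)" unfolding pr by simp
  moreover have "II f f (Gk (- a) \<mu>)"
    using S1(2)[OF S2(2)[OF S3(2)[OF i0]]] unfolding k .
  ultimately show ?thesis using pos_mixture[OF a \<mu> f'] by simp
qed

text \<open>The form plus its claimed bound, so that the target is nonnegativity and the splitting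
  into parities is additive.\<close>

definition Qf :: "real \<Rightarrow> real \<Rightarrow> (real^3 \<Rightarrow> real) \<Rightarrow> real" where
  "Qf a \<mu> f = IH f f (Gk a \<mu>) + tau a * (\<integral>p. norm p * (f p)^2 \<partial>lb3)"

text \<open>Three reflections stand in for spherical harmonics: parities with product 1 have even
  total parity, and otherwise at least one of them is -1, so one of the two sector lemmas
  applies.\<close>

lemma Qf_sector:
  assumes a: "0 < a" "a < 1" and \<mu>: "\<mu> > 0" and f: "adm f"
    and par: "\<And>j x. f (refl3 j x) = e j * f x" and e: "\<And>j. e j = 1 \<or> e j = - 1"
  shows "0 \<le> Qf a \<mu> f"
proof -
  have n: "0 \<le> tau a * (\<integral>p. norm p * (f p)^2 \<partial>lb3)"
    using tau_integral(2)[OF a] by (auto intro!: mult_nonneg_nonneg integral_nonneg_AE)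
  show ?thesis
  proof (cases "e 1 * e 2 * e 3 = 1")
    case True
    from even_sector[OF a \<mu> f par e this] n show ?thesis by (simp add: Qf_def)
  next
    case False
    have "e 1 = - 1 \<or> e 2 = - 1 \<or> e 3 = - 1" using False e[of 1] e[of 2] e[of 3] by auto
    then obtain i where "e i = - 1" by blast
    from odd_sector[OF a \<mu> f par e this] show ?thesis unfolding Qf_def by linarith
  qed
qed

section \<open>Decomposition into parities\<close>

lemma refl3_both:
  assumes m: "(\<lambda>z. F (fst z) (snd z)) \<in> borel_measurable lb33"
  shows "(\<integral>z. F (fst z) (snd z) \<partial>lb33) = (\<integral>z. (F (refl3 j (fst z)) (refl3 j (snd z)) :: real) \<partial>lb33)"
proof -
  have T1: "(\<lambda>z. (refl3 j (fst z), snd z)) \<in> measurable lb33 lb33" by measurable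
  have T2: "(\<lambda>z. (fst z, refl3 j (snd z))) \<in> measurable lb33 lb33" by measurable
  have m2: "(\<lambda>z. F (refl3 j (fst z)) (snd z)) \<in> borel_measurable lb33" using measurable_compose[OF T1 m] by simp
  have "(\<integral>z. F (fst z) (snd z) \<partial>lb33) = (\<integral>z. F (fst z) (snd z) \<partial>(distr lb33 lb33 (\<lambda>z. (refl3 j (fst z), snd z))))"
    unfolding distr_pair_fst ..
  also have "\<dots> = (\<integral>z. F (refl3 j (fst z)) (snd z) \<partial>lb33)"
    by (subst integral_distr[OF T1 m]) simp
  also have "\<dots> = (\<integral>z. F (refl3 j (fst z)) (snd z) \<partial>(distr lb33 lb33 (\<lambda>z. (fst z, refl3 j (snd z)))))"
    unfolding distr_pair_snd ..
  also have "\<dots> = (\<integral>z. F (refl3 j (fst z)) (refl3 j (snd z)) \<partial>lb33)"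
    by (subst integral_distr[OF T2 m2]) simp
  finally show ?thesis .
qed

lemma nn_refl3:
  assumes [measurable]: "h \<in> borel_measurable borel"
  shows "(\<integral>\<^sup>+p. h (refl3 j p) \<partial>lb3) = (\<integral>\<^sup>+p. h p \<partial>lb3)"
proof -
  have "(\<integral>\<^sup>+p. h p \<partial>lb3) = (\<integral>\<^sup>+p. h p \<partial>(distr lborel borel (refl3 j)))" unfolding distr_refl3 ..
  also have "\<dots> = (\<integral>\<^sup>+p. h (refl3 j p) \<partial>lb3)" by (rule nn_integral_distr) measurable
  finally show ?thesis ..
qed

lemma adm_refl3: assumes f: "adm f" shows "adm (\<lambda>x. f (refl3 j x))"
proof -
  have [measurable]: "f \<in> borel_measurable borel" using f by auto
  have "(\<integral>\<^sup>+p. ennreal (norm p * (f (refl3 j p))^2) \<partial>lb3) = (\<integral>\<^sup>+p. ennreal (norm (refl3 j p) * (f (refl3 j p))^2) \<partial>lb3)" by simp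
  also have "\<dots> = (\<integral>\<^sup>+p. ennreal (norm p * (f p)^2) \<partial>lb3)"
    by (rule nn_refl3) measurable
  finally show ?thesis using f by (simp add: adm_def)
qed

lemma adm_bound:
  assumes f: "adm f" and g: "adm g" and [measurable]: "h \<in> borel_measurable borel" and le: "\<And>p. (h p)^2 \<le> (f p)^2 + (g p)^2"
  shows "adm h"
proof -
  have [measurable]: "f \<in> borel_measurable borel" "g \<in> borel_measurable borel" using f g by auto
  have "(\<integral>\<^sup>+p. ennreal (norm p * (h p)^2) \<partial>lb3) \<le> (\<integral>\<^sup>+p. ennreal (norm p * (f p)^2) + ennreal (norm p * (g p)^2) \<partial>lb3)"
  proof (rule nn_integral_mono)
    fix p
    have "norm p * (h p)^2 \<le> norm p * (f p)^2 + norm p * (g p)^2"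
      unfolding distrib_left[symmetric] by (intro mult_left_mono le) simp
    then show "ennreal (norm p * (h p)^2) \<le> ennreal (norm p * (f p)^2) + ennreal (norm p * (g p)^2)"
      by (simp add: ennreal_plus[symmetric] ennreal_leI del: ennreal_plus)
  qed
  also have "\<dots> = (\<integral>\<^sup>+p. ennreal (norm p * (f p)^2) \<partial>lb3) + (\<integral>\<^sup>+p. ennreal (norm p * (g p)^2) \<partial>lb3)"
    by (rule nn_integral_add) measurable
  also have "\<dots> < \<infinity>" using f g by (simp add: adm_def)
  finally show ?thesis by (simp add: adm_def)
qed

text \<open>Form and weight are invariant when both arguments are reflected, so the cross terms
  between even and odd part cancel as in the parallelogram identity.\<close>

lemma Qf_split:
  fixes j :: 3
  assumes a: "0 < a" "a < 1" and \<mu>: "\<mu> > 0" and f: "adm f"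
  defines "fp \<equiv> \<lambda>x. (f x + f (refl3 j x)) / 2" and "fm \<equiv> \<lambda>x. (f x - f (refl3 j x)) / 2"
  shows "adm fp" "adm fm" "Qf a \<mu> f = Qf a \<mu> fp + Qf a \<mu> fm"
proof -
  let ?r = "\<lambda>x. f (refl3 j x)"
  have a': "0 \<le> a" using a by simp
  note fr = adm_refl3[OF f, of j]
  have [measurable]: "f \<in> borel_measurable borel" using f by auto
  have sq: "((x + y) / 2)^2 \<le> x^2 + y^2" "((x - y) / 2)^2 \<le> x^2 + y^2" for x y :: real
    using sum_squares_bound[of x y] sum_squares_bound[of x "- y"] zero_le_power2[of x] zero_le_power2[of y]
    by (auto simp: power2_sum power2_diff power_divide)
  show p: "adm fp" unfolding fp_def by (rule adm_bound[OF f fr]) (measurable, rule sq)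
  show m: "adm fm" unfolding fm_def by (rule adm_bound[OF f fr]) (measurable, rule sq)
  let ?F = "\<lambda>f z. f (fst z) * f (snd z) * Gk a \<mu> (fst z) (snd z)"
  note i = II_Gk[OF a' a(2) \<mu>, unfolded II_def]
  have "IH ?r ?r (Gk a \<mu>) = IH f f (Gk a \<mu>)"
  proof -
    have "IH f f (Gk a \<mu>) = (\<integral>z. f (refl3 j (fst z)) * f (refl3 j (snd z)) * Gk a \<mu> (refl3 j (fst z)) (refl3 j (snd z)) \<partial>lb33)"
      unfolding IH_def by (rule refl3_both) measurable
    then show ?thesis unfolding IH_def by (simp add: Gk_def)
  qed
  moreover have "IH fp fp (Gk a \<mu>) + IH fm fm (Gk a \<mu>) = (IH f f (Gk a \<mu>) + IH ?r ?r (Gk a \<mu>)) / 2"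
  proof -
    have "IH fp fp (Gk a \<mu>) + IH fm fm (Gk a \<mu>) = (\<integral>z. ?F fp z + ?F fm z \<partial>lb33)"
      unfolding IH_def by (rule Bochner_Integration.integral_add[symmetric]) (rule i p m)+
    also have "\<dots> = (\<integral>z. (?F f z + ?F ?r z) / 2 \<partial>lb33)"
      by (intro Bochner_Integration.integral_cong refl) (simp add: fp_def fm_def field_simps)
    also have "\<dots> = (\<integral>z. ?F f z + ?F ?r z \<partial>lb33) / 2" by (rule integral_divide_zero)
    also have "(\<integral>z. ?F f z + ?F ?r z \<partial>lb33) = IH f f (Gk a \<mu>) + IH ?r ?r (Gk a \<mu>)"
      unfolding IH_def by (rule Bochner_Integration.integral_add) (rule i f fr)+
    finally show ?thesis .
  qed
  ultimately have 1: "IH f f (Gk a \<mu>) = IH fp fp (Gk a \<mu>) + IH fm fm (Gk a \<mu>)" by simp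
  have "(\<integral>p. norm p * (?r p)^2 \<partial>lb3) = (\<integral>p. norm p * (f p)^2 \<partial>lb3)"
  proof -
    have "(\<integral>p. norm p * (f p)^2 \<partial>lb3) = (\<integral>p. norm p * (f p)^2 \<partial>(distr lborel borel (refl3 j)))" unfolding distr_refl3 ..
    also have "\<dots> = (\<integral>p. norm (refl3 j p) * (f (refl3 j p))^2 \<partial>lb3)" by (rule integral_distr) measurable
    finally show ?thesis by simp
  qed
  moreover have "(\<integral>p. norm p * (fp p)^2 \<partial>lb3) + (\<integral>p. norm p * (fm p)^2 \<partial>lb3) = ((\<integral>p. norm p * (f p)^2 \<partial>lb3) + (\<integral>p. norm p * (?r p)^2 \<partial>lb3)) / 2"
  proof -
    note ai = adm_integrable
    have "(\<integral>p. norm p * (fp p)^2 \<partial>lb3) + (\<integral>p. norm p * (fm p)^2 \<partial>lb3) = (\<integral>p. norm p * (fp p)^2 + norm p * (fm p)^2 \<partial>lb3)"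
      by (rule Bochner_Integration.integral_add[symmetric]) (rule ai p m)+
    also have "\<dots> = (\<integral>p. (norm p * (f p)^2 + norm p * (?r p)^2) / 2 \<partial>lb3)"
      by (intro Bochner_Integration.integral_cong refl) (simp add: fp_def fm_def field_simps power2_eq_square)
    also have "\<dots> = (\<integral>p. norm p * (f p)^2 + norm p * (?r p)^2 \<partial>lb3) / 2" by (rule integral_divide_zero)
    also have "(\<integral>p. norm p * (f p)^2 + norm p * (?r p)^2 \<partial>lb3) = (\<integral>p. norm p * (f p)^2 \<partial>lb3) + (\<integral>p. norm p * (?r p)^2 \<partial>lb3)"
      by (rule Bochner_Integration.integral_add) (rule ai f fr)+
    finally show ?thesis .
  qed
  ultimately have 2: "(\<integral>p. norm p * (f p)^2 \<partial>lb3) = (\<integral>p. norm p * (fp p)^2 \<partial>lb3) + (\<integral>p. norm p * (fm p)^2 \<partial>lb3)" by simp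
  show "Qf a \<mu> f = Qf a \<mu> fp + Qf a \<mu> fm"
    unfolding Qf_def 1 2 by (simp add: distrib_left)
qed

definition par3 :: "3 \<Rightarrow> (real^3 \<Rightarrow> real) \<Rightarrow> bool" where
  "par3 j f \<longleftrightarrow> (\<exists>e. (e = 1 \<or> e = - 1) \<and> (\<forall>x. f (refl3 j x) = e * f x))"

text \<open>One reflection at a time: since reflections commute, splitting along j preserves the
  parities already obtained. Three applications reach definite parities.\<close>

lemma Qf_step:
  assumes a: "0 < a" "a < 1" and \<mu>: "\<mu> > 0" and f: "adm f"
    and IH: "\<And>g. adm g \<Longrightarrow> par3 j g \<Longrightarrow> (\<And>k. par3 k f \<Longrightarrow> par3 k g) \<Longrightarrow> 0 \<le> Qf a \<mu> g"
  shows "0 \<le> Qf a \<mu> f"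
proof -
  let ?p = "\<lambda>x. (f x + f (refl3 j x)) / 2" and ?m = "\<lambda>x. (f x - f (refl3 j x)) / 2"
  note S = Qf_split[OF a \<mu> f, of j]
  have pp: "par3 j ?p" unfolding par3_def by (intro exI[of _ 1]) simp
  have pm: "par3 j ?m" unfolding par3_def by (intro exI[of _ "- 1"]) (simp add: field_simps)
  have k: "par3 k ?p" "par3 k ?m" if "par3 k f" for k
  proof -
    from that obtain e where e: "e = 1 \<or> e = - 1" "\<forall>x. f (refl3 k x) = e * f x" unfolding par3_def by (elim exE conjE)
    have e1: "f (refl3 k x) = e * f x" for x using e(2) by (rule spec)
    have e2: "f (refl3 j (refl3 k x)) = e * f (refl3 j x)" for x unfolding refl3_commute[of j k] by (rule e1)
    have "(f (refl3 k x) + f (refl3 j (refl3 k x))) / 2 = e * ((f x + f (refl3 j x)) / 2)" for x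
      unfolding e1 e2 by (simp add: distrib_left)
    with e(1) show "par3 k ?p" unfolding par3_def by (intro exI[of _ e] conjI allI)
    have "(f (refl3 k x) - f (refl3 j (refl3 k x))) / 2 = e * ((f x - f (refl3 j x)) / 2)" for x
      unfolding e1 e2 by (simp add: right_diff_distrib)
    with e(1) show "par3 k ?m" unfolding par3_def by (intro exI[of _ e] conjI allI)
  qed
  have p: "0 \<le> Qf a \<mu> ?p" by (rule IH[OF S(1) pp]) (rule k(1))
  have m: "0 \<le> Qf a \<mu> ?m" by (rule IH[OF S(2) pm]) (rule k(2))
  from add_nonneg_nonneg[OF p m] show ?thesis by (simp only: S(3))
qed

lemma Qf_nonneg:
  assumes a: "0 < a" "a < 1" and \<mu>: "\<mu> > 0" and f: "adm f"
  shows "0 \<le> Qf a \<mu> f"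
proof (rule Qf_step[OF a \<mu> f, of 1])
  fix f1 assume 1: "adm f1" "par3 1 f1"
  show "0 \<le> Qf a \<mu> f1"
  proof (rule Qf_step[OF a \<mu> 1(1), of 2])
    fix f2 assume 2: "adm f2" "par3 2 f2" "\<And>k. par3 k f1 \<Longrightarrow> par3 k f2"
    show "0 \<le> Qf a \<mu> f2"
    proof (rule Qf_step[OF a \<mu> 2(1), of 3])
      fix g assume g: "adm g" "par3 3 g" "\<And>k. par3 k f2 \<Longrightarrow> par3 k g"
      have "par3 k g" for k using exhaust_3[of k] g(2) g(3)[OF 2(2)] g(3)[OF 2(3)[OF 1(2)]] by auto
      then obtain e where "\<And>k. (e k = 1 \<or> e k = - 1) \<and> (\<forall>x. g (refl3 k x) = e k * g x)" unfolding par3_def by metis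
      then show "0 \<le> Qf a \<mu> g" by (intro Qf_sector[OF a \<mu> g(1), of e]) auto
    qed
  qed
qed

text \<open>Real and imaginary part of f decouple: with the conjugate on one factor the mixed terms
  are purely imaginary, and \<open>Qf_nonneg\<close> applies to each part.\<close>

lemma form_lower_bound:
  fixes f :: "real^3 \<Rightarrow> complex"
  assumes a: "0 < a" "a < 1" and \<mu>: "\<mu> > 0" and [measurable]: "f \<in> borel_measurable borel"
    and fin: "(\<integral>\<^sup>+p. ennreal (norm p * (cmod (f p))^2) \<partial>lb3) < \<infinity>"
  shows "- tau a * (\<integral>p. norm p * (cmod (f p))^2 \<partial>lb3) \<le> Re (\<integral>z. cnj (f (fst z)) * f (snd z) * complex_of_real (Gk a \<mu> (fst z) (snd z)) \<partial>lb33)"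
proof -
  have a': "0 \<le> a" using a by simp
  let ?r = "\<lambda>x. Re (f x)" and ?i = "\<lambda>x. Im (f x)"
  have r: "adm ?r" unfolding adm_def
  proof (intro conjI le_less_trans[OF _ fin] nn_integral_mono ennreal_leI mult_left_mono)
    show "(Re (f p))\<^sup>2 \<le> (cmod (f p))\<^sup>2" for p by (simp add: cmod_power2)
  qed auto
  have i: "adm ?i" unfolding adm_def
  proof (intro conjI le_less_trans[OF _ fin] nn_integral_mono ennreal_leI mult_left_mono)
    show "(Im (f p))\<^sup>2 \<le> (cmod (f p))\<^sup>2" for p by (simp add: cmod_power2)
  qed auto
  note I = II_Gk[OF a' a(2) \<mu>, unfolded II_def]
  let ?C = "\<lambda>z. cnj (f (fst z)) * f (snd z) * complex_of_real (Gk a \<mu> (fst z) (snd z))"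
  let ?R = "\<lambda>z. ?r (fst z) * ?r (snd z) * Gk a \<mu> (fst z) (snd z) + ?i (fst z) * ?i (snd z) * Gk a \<mu> (fst z) (snd z)"
  let ?S = "\<lambda>z. ?r (fst z) * ?i (snd z) * Gk a \<mu> (fst z) (snd z) - ?i (fst z) * ?r (snd z) * Gk a \<mu> (fst z) (snd z)"
  have C: "?C z = complex_of_real (?R z) + \<i> * complex_of_real (?S z)" for z
    by (rule complex_eqI) (simp_all add: algebra_simps)
  have iR: "integrable lb33 ?R" and iS: "integrable lb33 ?S"
    by (rule Bochner_Integration.integrable_add[OF I[OF r r] I[OF i i]], rule Bochner_Integration.integrable_diff[OF I[OF r i] I[OF i r]])
  have iC: "integrable lb33 ?C" unfolding C
    by (rule Bochner_Integration.integrable_add[OF integrable_of_real[OF iR] integrable_mult_right[OF integrable_of_real[OF iS]]])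
  have "Re (integral\<^sup>L lb33 ?C) = (\<integral>z. Re (?C z) \<partial>lb33)" using iC by (rule integral_Re[symmetric])
  also have "\<dots> = (\<integral>z. ?R z \<partial>lb33)" unfolding C by simp
  also have "\<dots> = IH ?r ?r (Gk a \<mu>) + IH ?i ?i (Gk a \<mu>)"
    unfolding IH_def by (rule Bochner_Integration.integral_add) (rule I r i)+
  finally have 1: "Re (integral\<^sup>L lb33 ?C) = IH ?r ?r (Gk a \<mu>) + IH ?i ?i (Gk a \<mu>)" .
  have "(\<integral>p. norm p * (cmod (f p))^2 \<partial>lb3) = (\<integral>p. norm p * (?r p)^2 + norm p * (?i p)^2 \<partial>lb3)"
    by (simp add: cmod_power2 distrib_left)
  also have "\<dots> = (\<integral>p. norm p * (?r p)^2 \<partial>lb3) + (\<integral>p. norm p * (?i p)^2 \<partial>lb3)"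
    by (rule Bochner_Integration.integral_add) (rule adm_integrable r i)+
  finally have 2: "tau a * (\<integral>p. norm p * (cmod (f p))^2 \<partial>lb3) = tau a * (\<integral>p. norm p * (?r p)^2 \<partial>lb3) + tau a * (\<integral>p. norm p * (?i p)^2 \<partial>lb3)"
    by (simp add: distrib_left)
  show ?thesis unfolding 1 using 2 Qf_nonneg[OF a \<mu> r] Qf_nonneg[OF a \<mu> i] unfolding Qf_def by linarith
qed

section \<open>The constant \<open>\<Lambda>(m, N)\<close>\<close>

text \<open>Read off the integral representation, whose integrand grows with a at every v.\<close>

lemma tau_mono:
  assumes "0 < a" "a \<le> b" "b < 1" shows "tau a \<le> tau b"
proof -
  have a: "0 < a" "a < 1" and b: "0 < b" "b < 1" using assms by auto
  have sq: "a^2 \<le> b^2" "b^2 < 1" using assms by (auto intro: power_mono simp: power_less_one_iff)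
  have "ennreal (tau a) \<le> ennreal (tau b)"
    unfolding tau_integral(1)[OF a, symmetric] tau_integral(1)[OF b, symmetric]
  proof (intro nn_integral_mono mult_right_mono ennreal_leI)
    fix v :: real
    have d: "v^2 / (v^2 + (1 - a^2)) \<le> v^2 / (v^2 + (1 - b^2))"
      using sq by (intro divide_left_mono) (auto intro!: mult_pos_pos add_nonneg_pos)
    have d2: "v^2 / (v^2 + (1 - a^2)) / (sqrt (1 + v^2))^3 \<le> v^2 / (v^2 + (1 - b^2)) / (sqrt (1 + v^2))^3"
      by (intro divide_right_mono d) auto
    show "4 * pi * a * (v^2 / (v^2 + (1 - a^2)) / (sqrt (1 + v^2))^3) \<le> 4 * pi * b * (v^2 / (v^2 + (1 - b^2)) / (sqrt (1 + v^2))^3)"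
    proof (rule mult_mono[OF _ d2])
      have "0 \<le> v^2 + (1 - a^2)" using sq zero_le_power2[of v] by linarith
      then show "0 \<le> v^2 / (v^2 + (1 - a^2)) / (sqrt (1 + v^2))^3" by (intro divide_nonneg_nonneg) auto
    qed (use assms in auto)
  qed auto
  then show ?thesis using tau_integral(2)[OF b] by (simp add: ennreal_le_iff)
qed

lemma tau_pos:
  assumes a: "0 < a" "a < 1" shows "tau a > 0"
proof -
  have a2: "a^2 < 1" using a by (simp add: power_less_one_iff)
  let ?f = "\<lambda>v. ennreal (4 * pi * a * (v^2 / (v^2 + (1 - a^2)) / (sqrt (1 + v^2))^3)) * indicator {0..} v"
  have "ennreal (tau a) \<noteq> 0"
  proof
    assume "ennreal (tau a) = 0"
    then have "AE v in lborel. ?f v = 0"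
      unfolding tau_integral(1)[OF a, symmetric] by (subst (asm) nn_integral_0_iff_AE) auto
    then have "AE v in lborel. v \<notin> {1..2::real}"
    proof eventually_elim
      case (elim v)
      show ?case
      proof
        assume v: "v \<in> {1..2}"
        then have "0 < v^2 / (v^2 + (1 - a^2)) / (sqrt (1 + v^2))^3"
          using a2 by (intro divide_pos_pos zero_less_power) (auto intro!: add_nonneg_pos)
        then have "0 < 4 * pi * a * (v^2 / (v^2 + (1 - a^2)) / (sqrt (1 + v^2))^3)"
          using a by (intro mult_pos_pos) auto
        then show False using elim v by (auto simp: indicator_def not_le[symmetric])
      qed
    qed
    then have "emeasure lborel {1..2::real} = 0" by (subst (asm) AE_iff_measurable[of "{1..2}"]) auto
    then show False by simp
  qed
  then show ?thesis using tau_integral(2)[OF a] by (cases "tau a = 0") auto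
qed

definition am :: "real \<Rightarrow> real" where "am m = 1 / (m + 1)"

lemma am: assumes "m > 0" shows "0 < am m" "am m < 1" "1 - (am m)^2 = m * (m + 2) / (m + 1)^2" "m * (m + 2) > 0"
    "sqrt (1 - (am m)^2) = sqrt (m * (m + 2)) / (m + 1)"
proof -
  show "0 < am m" "am m < 1" "m * (m + 2) > 0" using assms by (auto simp: am_def)
  show 1: "1 - (am m)^2 = m * (m + 2) / (m + 1)^2"
  proof -
    have "(m + 1)^2 \<noteq> 0" using assms by simp
    then show ?thesis unfolding am_def by (simp add: power_divide field_simps power2_eq_square)
  qed
  show "sqrt (1 - (am m)^2) = sqrt (m * (m + 2)) / (m + 1)"
    unfolding 1 using assms by (simp add: real_sqrt_divide)
qed

text \<open>Since sqrt (1 - a^2) = sqrt (m (m + 2)) / (m + 1), the bracket in \<Lambda> times this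
  root is a - sqrt (1 - a^2) arcsin a, the bracket in \<open>tau\<close>.\<close>

lemma Lambda_tau:
  assumes "m > 0"
  shows "LambdaMN m N * (2 * pi^2 * sqrt (1 - (am m)^2)) = real (N - 1) * tau (am m)"
proof -
  note a = am[OF assms]
  let ?q = "sqrt (m * (m + 2))"
  have q: "?q > 0" using a by simp
  have g: "2 / pi * n * M * X * (2 * pi^2 * Y) = n * (4 * pi * M * (X * Y))" for n M X Y :: real
    by (simp add: power2_eq_square)
  have "LambdaMN m N * (2 * pi^2 * sqrt (1 - (am m)^2)) = real (N - 1) * (4 * pi * (m + 1)^2 * ((1 / ?q - arcsin (am m)) * (?q / (m + 1))))"
    unfolding LambdaMN_def a(5) am_def[symmetric] by (rule g)
  also have "(1 / ?q - arcsin (am m)) * (?q / (m + 1)) = am m - sqrt (1 - (am m)^2) * arcsin (am m)"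
  proof -
    have g2: "(1 / q - A) * (q / M) = 1 / M - q / M * A" if "q > 0" for q A M :: real
      using that by (cases "M = 0") (simp_all add: field_simps)
    show ?thesis unfolding a(5) unfolding am_def by (rule g2[OF q])
  qed
  also have "4 * pi * (m + 1)^2 * (am m - sqrt (1 - (am m)^2) * arcsin (am m)) = tau (am m)"
    unfolding tau_def using assms by (simp add: am_def power_divide)
  finally show ?thesis .
qed

lemma Lambda_eq:
  assumes "m > 0"
  shows "LambdaMN m N = real (N - 1) * tau (am m) / (2 * pi^2 * sqrt (1 - (am m)^2))"
proof -
  have "2 * pi^2 * sqrt (1 - (am m)^2) > 0" using am[OF assms] assms by simp
  then have ne: "2 * pi^2 * sqrt (1 - (am m)^2) \<noteq> 0" by linarith
  show ?thesis by (simp only: nonzero_eq_divide_eq[OF ne] Lambda_tau[OF assms])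
qed

lemma Lambda_nonneg: "m > 0 \<Longrightarrow> 0 \<le> LambdaMN m N"
  unfolding Lambda_eq using tau_pos[of "am m"] am[of m] by (intro divide_nonneg_nonneg mult_nonneg_nonneg) auto

text \<open>Raising m lowers a; then tau does not increase while sqrt (1 - a^2) strictly increases
  in the denominator.\<close>

lemma Lambda_strict:
  assumes "0 < m" "m < m'" "N \<ge> 2"
  shows "LambdaMN m' N < LambdaMN m N"
proof -
  have m': "m' > 0" using assms by simp
  note a = am[OF assms(1)] and a' = am[OF m']
  have lt: "am m' < am m" using assms by (simp add: am_def frac_less2)
  have t: "tau (am m') \<le> tau (am m)" using a a' lt by (intro tau_mono) auto
  have "(am m')^2 < (am m)^2" using lt a' by (intro power_strict_mono) auto
  then have s: "sqrt (1 - (am m)^2) < sqrt (1 - (am m')^2)" by simp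
  have s0: "0 < sqrt (1 - (am m)^2)" using a assms by simp
  have "LambdaMN m' N < real (N - 1) * tau (am m') / (2 * pi^2 * sqrt (1 - (am m)^2))"
    unfolding Lambda_eq[OF m'] using s s0 assms tau_pos[OF a'(1,2)]
    by (intro divide_strict_left_mono mult_strict_left_mono mult_pos_pos) auto
  also have "\<dots> \<le> LambdaMN m N"
    unfolding Lambda_eq[OF assms(1)] using t s0 by (intro divide_right_mono mult_left_mono) auto
  finally show ?thesis .
qed

lemma Lambda_cont: "continuous_on {0<..} (\<lambda>m. LambdaMN m N)"
  unfolding LambdaMN_def
  by (intro continuous_intros continuous_on_arcsin) (auto simp: divide_simps)

text \<open>From arcsin a \<ge> a and 1 - s \<le> 1 - s^2 for s = sqrt (1 - a^2) one gets tau a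
  \<le> 4 pi a, hence \<Lambda> \<le> (N - 1) / m. The test mass m = N brings this below 1.\<close>

lemma Lambda_large:
  assumes "N \<ge> 2" shows "LambdaMN (real N) N < 1"
proof -
  define m where "m = real N"
  have m: "m > 0" using assms by (simp add: m_def)
  note a = am[OF m]
  let ?a = "am m" let ?s = "sqrt (1 - ?a^2)"
  have A0: "0 < 1 - ?a^2" unfolding a(3) using a(4) m by simp
  have s1: "sqrt (1 - ?a^2) < sqrt 1" using a(1) by (intro real_sqrt_less_mono) simp
  have s: "0 < ?s" "?s < 1" "?s^2 = 1 - ?a^2" using A0 s1 by (auto simp only: real_sqrt_gt_zero real_sqrt_one real_sqrt_pow2 less_imp_le)
  have "?a = sin (arcsin ?a)" using a by simp
  also have "\<dots> \<le> arcsin ?a" using a arcsin_le_arcsin[of 0 ?a] by (intro sin_x_le_x) auto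
  finally have as: "?a \<le> arcsin ?a" .
  have "tau ?a \<le> 4 * pi / ?a^2 * (?a - ?s * ?a)"
    unfolding tau_def by (rule mult_left_mono, rule diff_left_mono, rule mult_left_mono[OF as less_imp_le[OF s(1)]], simp)
  also have "\<dots> = 4 * pi / ?a * (1 - ?s)" using a by (simp add: power2_eq_square field_simps)
  also have "\<dots> \<le> 4 * pi / ?a * (1 - ?s^2)"
  proof (intro mult_left_mono)
    have "?s * ?s \<le> 1 * ?s" using s by (intro mult_right_mono) linarith+
    then show "1 - ?s \<le> 1 - ?s^2" unfolding power2_eq_square by linarith
  qed (use a in auto)
  also have "\<dots> = 4 * pi * ?a" unfolding s(3) using a(1) by (simp add: power2_eq_square)
  finally have t: "tau ?a \<le> 4 * pi * ?a" .
  have "LambdaMN m N \<le> real (N - 1) * (4 * pi * ?a) / (2 * pi^2 * ?s)"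
    unfolding Lambda_eq[OF m] using t s by (intro divide_right_mono mult_left_mono) auto
  also have "\<dots> = (real (N - 1) * 2 / pi) * (?a / ?s)" using s by (simp add: power2_eq_square field_simps)
  also have "?a / ?s = 1 / sqrt (m * (m + 2))" unfolding a(5) using m by (simp add: am_def)
  also have "(real (N - 1) * 2 / pi) * (1 / sqrt (m * (m + 2))) \<le> real (N - 1) * (1 / sqrt (m * (m + 2)))"
  proof (rule mult_right_mono)
    have "2 / pi \<le> 1" using pi_ge_two by simp
    from mult_left_mono[OF this, of "real (N - 1)"] show "real (N - 1) * 2 / pi \<le> real (N - 1)" by simp
  qed (use a in auto)
  also have "\<dots> \<le> real (N - 1) * (1 / m)"
  proof (intro mult_left_mono divide_left_mono)
    have "sqrt (m^2) \<le> sqrt (m * (m + 2))" using m by (intro real_sqrt_le_mono) (simp add: power2_eq_square)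
    then show "m \<le> sqrt (m * (m + 2))" using m by simp
  qed (use m in auto)
  also have "\<dots> < 1" using assms by (simp add: m_def)
  finally show ?thesis by (simp add: m_def)
qed

text \<open>For m \<le> 1 one has a \<ge> 1/2, so tau stays above tau (1/2), while sqrt (1 - a^2)
  \<le> sqrt (3 m) becomes small. The mass is chosen to make sqrt (3 m) at most
  \<open>t0\<close>.\<close>

lemma Lambda_small:
  assumes "N \<ge> 2" obtains m where "0 < m" "m \<le> 1" "LambdaMN m N \<ge> 1"
proof -
  define t0 where "t0 = tau (1/2) / (2 * pi^2)"
  have t0: "t0 > 0" using tau_pos[of "1/2"] by (simp add: t0_def)
  define m where "m = min 1 (t0^2 / 3)"
  have m: "0 < m" "m \<le> 1" "3 * m \<le> t0^2" using t0 by (auto simp: m_def)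
  note a = am[OF m(1)]
  have "1/2 \<le> am m" using m by (simp add: am_def field_simps)
  then have t: "tau (1/2) \<le> tau (am m)" using a by (intro tau_mono) auto
  have s: "0 < sqrt (1 - (am m)^2)" using a m by simp
  have "sqrt (1 - (am m)^2) \<le> sqrt (3 * m)"
  proof (rule real_sqrt_le_mono)
    have "m * (m + 2) / (m + 1)^2 \<le> m * (m + 2) / 1" using m by (intro divide_left_mono one_le_power) auto
    also have "\<dots> \<le> 3 * m" using mult_left_mono[OF m(2), of m] m(1) by (simp add: algebra_simps)
    finally show "1 - (am m)^2 \<le> 3 * m" unfolding a(3) .
  qed
  also have "\<dots> \<le> sqrt (t0^2)" by (intro real_sqrt_le_mono m)
  also have "\<dots> = t0" using t0 by simp
  finally have "1 \<le> t0 / sqrt (1 - (am m)^2)" using s by simp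
  also have "\<dots> = 1 * tau (1/2) / (2 * pi^2 * sqrt (1 - (am m)^2))" by (simp add: t0_def)
  also have "\<dots> \<le> real (N - 1) * tau (am m) / (2 * pi^2 * sqrt (1 - (am m)^2))"
    using t s assms tau_pos[of "1/2"] by (intro divide_right_mono mult_mono) auto
  finally have "LambdaMN m N \<ge> 1" unfolding Lambda_eq[OF m(1)] .
  with m show ?thesis using that by blast
qed

text \<open>\<open>mstar\<close> is a definite description, so a root must first be produced
  (intermediate values between \<open>Lambda_small\<close> and \<open>Lambda_large\<close>) and
  shown unique (strict monotonicity).\<close>

lemma Lambda_lt_1:
  assumes N: "N \<ge> 2" and m: "m > 0" "m > mstar N"
  shows "LambdaMN m N < 1"
proof -
  obtain m1 where m1: "0 < m1" "m1 \<le> 1" "LambdaMN m1 N \<ge> 1" by (rule Lambda_small[OF N])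
  have "\<exists>x\<ge>m1. x \<le> real N \<and> LambdaMN x N = 1"
  proof (rule IVT2')
    show "continuous_on {m1..real N} (\<lambda>m. LambdaMN m N)"
      by (rule continuous_on_subset[OF Lambda_cont]) (use m1 in auto)
  qed (use Lambda_large[OF N] m1 N in auto)
  then obtain x where "x \<ge> m1" and x2: "LambdaMN x N = 1" by auto
  then have x: "x > 0" "LambdaMN x N = 1" using m1(1) by auto
  have "mstar N = x" unfolding mstar_def
  proof (rule the_equality)
    fix y assume y: "0 < y \<and> LambdaMN y N = 1"
    show "y = x"
      using Lambda_strict[of y x N] Lambda_strict[of x y N] x y N by (cases y x rule: linorder_cases) auto
  qed (use x in auto)
  then have "LambdaMN m N < LambdaMN x N" using m x N by (intro Lambda_strict) auto
  then show ?thesis using x by simp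
qed

section \<open>Splitting and permuting coordinates\<close>

text \<open>The new momentum goes to position 0, so deleting index 0 undoes it.
  \<open>restrict\<close> keeps the result extensional, as points of the product space must
  be.\<close>

definition pcons :: "nat \<Rightarrow> real^3 \<Rightarrow> cfg \<Rightarrow> cfg" where
  "pcons n s k = restrict (\<lambda>j. case j of 0 \<Rightarrow> s | Suc i \<Rightarrow> k i) {..<Suc n}"

lemma pcons_0[simp]: "pcons n s k 0 = s"
  by (simp add: pcons_def)

lemma pcons_Suc[simp]: "i < n \<Longrightarrow> pcons n s k (Suc i) = k i"
  by (simp add: pcons_def)

lemma pcons_measurable: "(\<lambda>z. pcons n (fst z) (snd z)) \<in> measurable (lb3 \<Otimes>\<^sub>M Mc n) (Mc (Suc n))"
  unfolding pcons_def Mc_def[of "Suc n"]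
proof (rule measurable_restrict)
  fix j assume j: "j \<in> {..<Suc n}"
  show "(\<lambda>z. case j of 0 \<Rightarrow> fst z | Suc i \<Rightarrow> snd z i) \<in> measurable (lb3 \<Otimes>\<^sub>M Mc n) lborel"
  proof (cases j)
    case (Suc i)
    then have "i < n" using j by simp
    from measurable_Mc_component'[OF measurable_snd this] show ?thesis using Suc by simp
  qed simp
qed

lemma pcons_measurable'[measurable (raw)]:
  assumes "s \<in> borel_measurable M" "k \<in> measurable M (Mc n)"
  shows "(\<lambda>x. pcons n (s x) (k x)) \<in> measurable M (Mc (Suc n))"
proof -
  have "(\<lambda>x. (s x, k x)) \<in> measurable M (lb3 \<Otimes>\<^sub>M Mc n)" using assms by measurable
  from measurable_compose[OF this pcons_measurable] show ?thesis by simp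
qed

lemma Mc_Suc: "distr (lb3 \<Otimes>\<^sub>M Mc n) (Mc (Suc n)) (\<lambda>z. pcons n (fst z) (snd z)) = Mc (Suc n)"
proof -
  interpret PP: pair_sigma_finite lb3 "Mc n" ..
  have "distr (lb3 \<Otimes>\<^sub>M Mc n) (Mc (Suc n)) (\<lambda>z. pcons n (fst z) (snd z)) = PiM {..<Suc n} (\<lambda>_. lborel)"
  proof (rule lbps.PiM_eqI)
    show "sets (distr (lb3 \<Otimes>\<^sub>M Mc n) (Mc (Suc n)) (\<lambda>z. pcons n (fst z) (snd z))) = sets (PiM {..<Suc n} (\<lambda>_. lborel))"
      by (simp add: Mc_def)
    fix A :: "nat \<Rightarrow> (real^3) set" assume A: "\<And>i. i \<in> {..<Suc n} \<Longrightarrow> A i \<in> sets lborel"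
    have m: "Pi\<^sub>E {..<Suc n} A \<in> sets (Mc (Suc n))" unfolding Mc_def using A by (intro sets_PiM_I_finite) auto
    have "emeasure (distr (lb3 \<Otimes>\<^sub>M Mc n) (Mc (Suc n)) (\<lambda>z. pcons n (fst z) (snd z))) (Pi\<^sub>E {..<Suc n} A)
      = emeasure (lb3 \<Otimes>\<^sub>M Mc n) ((\<lambda>z. pcons n (fst z) (snd z)) -` Pi\<^sub>E {..<Suc n} A \<inter> space (lb3 \<Otimes>\<^sub>M Mc n))"
      by (rule emeasure_distr[OF pcons_measurable m])
    also have "(\<lambda>z. pcons n (fst z) (snd z)) -` Pi\<^sub>E {..<Suc n} A \<inter> space (lb3 \<Otimes>\<^sub>M Mc n) = A 0 \<times> Pi\<^sub>E {..<n} (\<lambda>i. A (Suc i))"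
    proof (intro set_eqI iffI)
      fix z assume z: "z \<in> (\<lambda>z. pcons n (fst z) (snd z)) -` Pi\<^sub>E {..<Suc n} A \<inter> space (lb3 \<Otimes>\<^sub>M Mc n)"
      then have mem: "pcons n (fst z) (snd z) j \<in> A j" if "j < Suc n" for j using that by (auto simp: PiE_def Pi_def)
      have "fst z \<in> A 0" using mem[of 0] by simp
      moreover have "snd z i \<in> A (Suc i)" if "i < n" for i using mem[of "Suc i"] that by simp
      moreover have "snd z \<in> extensional {..<n}" using z by (auto simp: space_pair_measure space_Mc PiE_def)
      ultimately show "z \<in> A 0 \<times> Pi\<^sub>E {..<n} (\<lambda>i. A (Suc i))" by (cases z) (auto simp: PiE_def Pi_def)
    next
      fix z assume z: "z \<in> A 0 \<times> Pi\<^sub>E {..<n} (\<lambda>i. A (Suc i))"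
      then have "pcons n (fst z) (snd z) j \<in> A j" if "j < Suc n" for j
        using that by (cases j) (auto simp: PiE_def Pi_def)
      moreover have "pcons n (fst z) (snd z) \<in> extensional {..<Suc n}" by (simp add: pcons_def)
      ultimately show "z \<in> (\<lambda>z. pcons n (fst z) (snd z)) -` Pi\<^sub>E {..<Suc n} A \<inter> space (lb3 \<Otimes>\<^sub>M Mc n)"
        using z by (auto simp: space_pair_measure space_Mc PiE_def Pi_def)
    qed
    also have "emeasure (lb3 \<Otimes>\<^sub>M Mc n) (A 0 \<times> Pi\<^sub>E {..<n} (\<lambda>i. A (Suc i))) = emeasure lb3 (A 0) * emeasure (Mc n) (Pi\<^sub>E {..<n} (\<lambda>i. A (Suc i)))"
      using A by (intro Mc.emeasure_pair_measure_Times) (auto simp: Mc_def intro!: sets_PiM_I_finite)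
    also have "emeasure (Mc n) (Pi\<^sub>E {..<n} (\<lambda>i. A (Suc i))) = (\<Prod>i<n. emeasure lborel (A (Suc i)))"
      unfolding Mc_def using A by (intro lbps.emeasure_PiM) auto
    also have "emeasure lb3 (A 0) * (\<Prod>i<n. emeasure lborel (A (Suc i))) = (\<Prod>i<Suc n. emeasure lborel (A i))"
      by (rule prod.lessThan_Suc_shift[symmetric])
    finally show "emeasure (distr (lb3 \<Otimes>\<^sub>M Mc n) (Mc (Suc n)) (\<lambda>z. pcons n (fst z) (snd z))) (Pi\<^sub>E {..<Suc n} A) = (\<Prod>i\<in>{..<Suc n}. emeasure lborel (A i))" .
  qed simp
  then show ?thesis by (simp add: Mc_def)
qed

interpretation lbMc: pair_sigma_finite "lborel :: (real^3) measure" "Mc n" for n ..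

lemma nn_integral_Mc_Suc:
  assumes [measurable]: "F \<in> borel_measurable (Mc (Suc n))"
  shows "(\<integral>\<^sup>+k. F k \<partial>Mc (Suc n)) = (\<integral>\<^sup>+k'. \<integral>\<^sup>+s. F (pcons n s k') \<partial>lb3 \<partial>Mc n)"
proof -
  have "(\<integral>\<^sup>+k. F k \<partial>Mc (Suc n)) = (\<integral>\<^sup>+k. F k \<partial>distr (lb3 \<Otimes>\<^sub>M Mc n) (Mc (Suc n)) (\<lambda>z. pcons n (fst z) (snd z)))"
    unfolding Mc_Suc ..
  also have "\<dots> = (\<integral>\<^sup>+z. F (pcons n (fst z) (snd z)) \<partial>(lb3 \<Otimes>\<^sub>M Mc n))"
    by (rule nn_integral_distr[OF pcons_measurable]) simp
  also have "\<dots> = (\<integral>\<^sup>+k'. \<integral>\<^sup>+s. F (pcons n s k') \<partial>lb3 \<partial>Mc n)"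
    by (subst lbMc.nn_integral_snd[symmetric]) auto
  finally show ?thesis .
qed

lemma integral_Mc_Suc:
  fixes F :: "cfg \<Rightarrow> 'a::{banach, second_countable_topology}"
  assumes F: "integrable (Mc (Suc n)) F"
  shows "(\<integral>k. F k \<partial>Mc (Suc n)) = (\<integral>k'. (\<integral>s. F (pcons n s k') \<partial>lb3) \<partial>Mc n)"
    "AE k' in Mc n. integrable lb3 (\<lambda>s. F (pcons n s k'))"
    "integrable (Mc n) (\<lambda>k'. \<integral>s. F (pcons n s k') \<partial>lb3)"
proof -
  have Fm: "F \<in> borel_measurable (Mc (Suc n))" using F by auto
  have i: "integrable (lb3 \<Otimes>\<^sub>M Mc n) (\<lambda>z. F (pcons n (fst z) (snd z)))"
  proof -
    have "integrable (distr (lb3 \<Otimes>\<^sub>M Mc n) (Mc (Suc n)) (\<lambda>z. pcons n (fst z) (snd z))) F" using F by (simp only: Mc_Suc)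
    then show ?thesis by (subst (asm) integrable_distr_eq[OF pcons_measurable Fm])
  qed
  have i': "integrable (lb3 \<Otimes>\<^sub>M Mc n) (case_prod (\<lambda>s k'. F (pcons n s k')))"
    using i by (simp add: case_prod_beta')
  have "(\<integral>k. F k \<partial>Mc (Suc n)) = (\<integral>k. F k \<partial>distr (lb3 \<Otimes>\<^sub>M Mc n) (Mc (Suc n)) (\<lambda>z. pcons n (fst z) (snd z)))"
    unfolding Mc_Suc ..
  also have "\<dots> = (\<integral>z. F (pcons n (fst z) (snd z)) \<partial>(lb3 \<Otimes>\<^sub>M Mc n))"
    by (rule integral_distr[OF pcons_measurable Fm])
  also have "\<dots> = (\<integral>k'. (\<integral>s. F (pcons n s k') \<partial>lb3) \<partial>Mc n)"
    using lbMc.integral_snd[OF i'] by (simp add: case_prod_beta')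
  finally show "(\<integral>k. F k \<partial>Mc (Suc n)) = (\<integral>k'. (\<integral>s. F (pcons n s k') \<partial>lb3) \<partial>Mc n)" .
  show "AE k' in Mc n. integrable lb3 (\<lambda>s. F (pcons n s k'))" by (rule lbMc.AE_integrable_snd[OF i'])
  show "integrable (Mc n) (\<lambda>k'. \<integral>s. F (pcons n s k') \<partial>lb3)" by (rule lbMc.integrable_snd[OF i'])
qed

definition sw :: "nat \<Rightarrow> nat \<Rightarrow> cfg \<Rightarrow> cfg" where
  "sw i j x = (\<lambda>l. if l = i then x j else if l = j then x i else x l)"

lemma sw_sw[simp]: "sw i j (sw i j x) = x"
  by (auto simp: sw_def)

lemma sw_space: assumes "i < n" "j < n" "x \<in> space (Mc n)" shows "sw i j x \<in> space (Mc n)"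
  using assms by (auto simp: space_Mc sw_def PiE_def extensional_def)

lemma sw_measurable: assumes "i < n" "j < n" shows "sw i j \<in> measurable (Mc n) (Mc n)"
proof -
  have "sw i j \<in> measurable (Mc n) (PiM {..<n} (\<lambda>_. lborel))"
  proof (rule measurable_PiM_single')
    fix l assume l: "l \<in> {..<n}"
    show "(\<lambda>x. sw i j x l) \<in> measurable (Mc n) lborel"
      using measurable_Mc_component[of i n] measurable_Mc_component[of j n] measurable_Mc_component[of l n] assms l
      by (cases "l = i"; cases "l = j") (auto simp: sw_def)
  next
    show "sw i j \<in> space (Mc n) \<rightarrow> (\<Pi>\<^sub>E i\<in>{..<n}. space lborel)"
      using sw_space[OF assms] by (auto simp: space_Mc)
  qed
  then show ?thesis by (simp add: Mc_def)
qed

lemma Mc_sw: assumes ij: "i < n" "j < n" shows "distr (Mc n) (Mc n) (sw i j) = Mc n"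
proof -
  have "distr (Mc n) (Mc n) (sw i j) = PiM {..<n} (\<lambda>_. lborel)"
  proof (rule lbps.PiM_eqI)
    show "sets (distr (Mc n) (Mc n) (sw i j)) = sets (PiM {..<n} (\<lambda>_. lborel))" by (simp add: Mc_def)
    fix A :: "nat \<Rightarrow> (real^3) set" assume A: "\<And>i. i \<in> {..<n} \<Longrightarrow> A i \<in> sets lborel"
    define t where "t l = (if l = i then j else if l = j then i else l)" for l
    have tt: "t (t l) = l" "l < n \<Longrightarrow> t l < n" for l using ij by (auto simp: t_def)
    have sw: "sw i j x l = x (t l)" for x l by (simp add: sw_def t_def)
    have m: "Pi\<^sub>E {..<n} A \<in> sets (Mc n)" unfolding Mc_def using A by (intro sets_PiM_I_finite) auto
    have "emeasure (distr (Mc n) (Mc n) (sw i j)) (Pi\<^sub>E {..<n} A) = emeasure (Mc n) (sw i j -` Pi\<^sub>E {..<n} A \<inter> space (Mc n))"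
      by (rule emeasure_distr[OF sw_measurable[OF ij] m])
    also have "sw i j -` Pi\<^sub>E {..<n} A \<inter> space (Mc n) = Pi\<^sub>E {..<n} (\<lambda>l. A (t l))"
    proof (intro set_eqI iffI)
      fix x assume x: "x \<in> sw i j -` Pi\<^sub>E {..<n} A \<inter> space (Mc n)"
      then have "x (t l) \<in> A l" if "l < n" for l using that unfolding sw[symmetric] by auto
      then have "x l \<in> A (t l)" if "l < n" for l using tt[of l] that by metis
      then show "x \<in> Pi\<^sub>E {..<n} (\<lambda>l. A (t l))" using x by (auto simp: space_Mc PiE_def)
    next
      fix x assume x: "x \<in> Pi\<^sub>E {..<n} (\<lambda>l. A (t l))"
      then have xs: "x \<in> space (Mc n)" by (auto simp: space_Mc PiE_def)
      have "sw i j x l \<in> A l" if "l < n" for l unfolding sw using x tt[of l] that by (metis PiE_mem lessThan_iff)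
      then show "x \<in> sw i j -` Pi\<^sub>E {..<n} A \<inter> space (Mc n)"
        using xs sw_space[OF ij xs] by (auto simp: space_Mc PiE_def)
    qed
    also have "emeasure (Mc n) (Pi\<^sub>E {..<n} (\<lambda>l. A (t l))) = (\<Prod>l<n. emeasure lborel (A (t l)))"
      unfolding Mc_def using A tt by (intro lbps.emeasure_PiM) auto
    also have "\<dots> = (\<Prod>l<n. emeasure lborel (A l))"
      by (rule prod.reindex_bij_witness[of _ t t]) (use tt in auto)
    finally show "emeasure (distr (Mc n) (Mc n) (sw i j)) (Pi\<^sub>E {..<n} A) = (\<Prod>i\<in>{..<n}. emeasure lborel (A i))" .
  qed simp
  then show ?thesis by (simp add: Mc_def)
qed

lemma integral_sw:
  fixes F :: "cfg \<Rightarrow> 'a::{banach, second_countable_topology}"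
  assumes "i < n" "j < n" "F \<in> borel_measurable (Mc n)"
  shows "(\<integral>k. F (sw i j k) \<partial>Mc n) = (\<integral>k. F k \<partial>Mc n)"
  using integral_distr[OF sw_measurable[OF assms(1,2)] assms(3)] unfolding Mc_sw[OF assms(1,2)] by simp

lemma AE_sw:
  assumes "i < n" "j < n" "AE k in Mc n. P k"
  shows "AE k in Mc n. P (sw i j k)"
proof -
  have "AE k in distr (Mc n) (Mc n) (sw i j). P k" unfolding Mc_sw[OF assms(1,2)] by (rule assms(3))
  then show ?thesis by (rule AE_distrD[OF sw_measurable[OF assms(1,2)]])
qed

text \<open>The preimage of a null set is a cylinder whose slices in the deleted momentum are empty
  or full; Fubini makes it null.\<close>

lemma AE_tail:
  assumes "AE k in Mc n. P k"
  shows "AE k in Mc (Suc n). P (drop_idx (Suc n) 0 k)"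
proof -
  obtain N where N: "N \<in> null_sets (Mc n)" "\<And>k. k \<in> space (Mc n) \<Longrightarrow> \<not> P k \<Longrightarrow> k \<in> N"
    using assms by (auto elim!: AE_E3)
  have Nm[measurable]: "N \<in> sets (Mc n)" using N by auto
  have dm: "(\<lambda>k. drop_idx (Suc n) 0 k) \<in> measurable (Mc (Suc n)) (Mc n)"
  proof -
    have "(\<lambda>k. drop_idx (Suc n) 0 k) = (\<lambda>k. restrict (\<lambda>j. k (Suc j)) {..<n})" by (auto simp: drop_idx_def)
    then show ?thesis unfolding Mc_def[of n] using measurable_Mc_component[of _ "Suc n"] by (auto intro!: measurable_restrict)
  qed
  have Em[measurable]: "(\<lambda>k. drop_idx (Suc n) 0 k) -` N \<inter> space (Mc (Suc n)) \<in> sets (Mc (Suc n))"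
    by (rule measurable_sets[OF dm Nm])
  let ?E = "(\<lambda>k. drop_idx (Suc n) 0 k) -` N \<inter> space (Mc (Suc n))"
  have d: "drop_idx (Suc n) 0 (pcons n s k) = k" if "k \<in> space (Mc n)" for s k
    using that by (auto simp: drop_idx_def pcons_def space_Mc PiE_def extensional_def)
  have "emeasure (Mc (Suc n)) ?E = (\<integral>\<^sup>+k. indicator ?E k \<partial>Mc (Suc n))" by simp
  also have "\<dots> = (\<integral>\<^sup>+k'. \<integral>\<^sup>+s. indicator ?E (pcons n s k') \<partial>lb3 \<partial>Mc n)"
    by (rule nn_integral_Mc_Suc) measurable
  also have "\<dots> = (\<integral>\<^sup>+k'. (\<integral>\<^sup>+(s :: real^3). 0 \<partial>lb3) \<partial>Mc n)"
  proof (rule nn_integral_cong_AE)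
    show "AE k' in Mc n. (\<integral>\<^sup>+s. indicator ?E (pcons n s k') \<partial>lb3) = (\<integral>\<^sup>+(s :: real^3). 0 \<partial>lb3)"
      using AE_not_in[OF N(1)] AE_space
    proof eventually_elim
      case (elim k')
      then show ?case by (intro nn_integral_cong) (auto simp: d indicator_def)
    qed
  qed
  also have "\<dots> = 0" by simp
  finally have "?E \<in> null_sets (Mc (Suc n))" by auto
  from AE_not_in[OF this] AE_space show ?thesis
  proof eventually_elim
    case (elim k)
    have "drop_idx (Suc n) 0 k \<in> space (Mc n)" using measurable_space[OF dm elim(2)] .
    then show ?case using N(2) elim by auto
  qed
qed

section \<open>Symbols and resolvent integrals\<close>

definition Sg :: "nat \<Rightarrow> cfg \<Rightarrow> real^3" where "Sg n k = (\<Sum>j<n. k j)"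

definition hq :: "real \<Rightarrow> nat \<Rightarrow> cfg \<Rightarrow> real" where
  "hq m n k = sqc n k + 2 / (m + 1) * crossc n k"

text \<open>What remains of \<open>hq\<close> in n + 1 momenta after completing the square in one of
  them (\<open>hq_pcons\<close>); it is the quantity under the root in \<open>L_lam\<close>.\<close>

definition Xq :: "real \<Rightarrow> nat \<Rightarrow> cfg \<Rightarrow> real" where
  "Xq m n k = m * (m + 2) / (m + 1)^2 * sqc n k + 2 * m / (m + 1)^2 * crossc n k"

lemma hq_measurable[measurable (raw)]:
  assumes [measurable]: "f \<in> measurable M (Mc n)"
  shows "(\<lambda>x. hq m n (f x)) \<in> borel_measurable M" "(\<lambda>x. Xq m n (f x)) \<in> borel_measurable M"
  unfolding hq_def Xq_def by measurable

lemma G_lam_hq: "G_lam m n lam k = 1 / (hq m n k + lam)"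
  by (simp add: G_lam_def hq_def)

lemma L_lam_Xq: "L_lam m (Suc n) lam k = 2 * pi^2 * sqrt (Xq m n k + lam)"
  by (simp add: L_lam_def Xq_def)

lemma sqc_nonneg[simp]: "0 \<le> sqc n k"
  by (simp add: sqc_def sum_nonneg)

text \<open>Trades the ordered double sum for the total momentum, which makes permutation symmetry
  and two-sided bounds of the symbols evident.\<close>

lemma norm_Sg: "(norm (Sg n k))^2 = sqc n k + 2 * crossc n k"
proof (induction n)
  case (Suc n)
  have "crossc (Suc n) k = (\<Sum>i<n. \<Sum>j\<in>{i<..<Suc n}. k i \<bullet> k j)"
  proof -
    have "{n<..<Suc n} = {}" by auto
    then show ?thesis by (simp add: crossc_def)
  qed
  also have "\<dots> = (\<Sum>i<n. k i \<bullet> k n + (\<Sum>j\<in>{i<..<n}. k i \<bullet> k j))"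
  proof (rule sum.cong)
    fix i assume "i \<in> {..<n}"
    then have "{i<..<Suc n} = insert n {i<..<n}" by auto
    then show "(\<Sum>j\<in>{i<..<Suc n}. k i \<bullet> k j) = k i \<bullet> k n + (\<Sum>j\<in>{i<..<n}. k i \<bullet> k j)" by simp
  qed simp
  also have "\<dots> = Sg n k \<bullet> k n + crossc n k" by (simp add: sum.distrib crossc_def Sg_def inner_sum_left)
  finally have c: "crossc (Suc n) k = Sg n k \<bullet> k n + crossc n k" .
  have "Sg (Suc n) k = Sg n k + k n" by (simp add: Sg_def)
  then have "(norm (Sg (Suc n) k))^2 = (norm (Sg n k))^2 + 2 * (Sg n k \<bullet> k n) + (norm (k n))^2"
    by (simp add: power2_norm_eq_inner inner_add_left inner_add_right inner_commute)
  then show ?case using Suc c by (simp add: sqc_def)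
qed (simp add: Sg_def sqc_def crossc_def)

lemma norm_Sg_le: "(norm (Sg n k))^2 \<le> real n * sqc n k"
proof -
  have "(norm (Sg n k))^2 \<le> (\<Sum>j<n. norm (k j))^2" unfolding Sg_def by (intro power_mono norm_sum) auto
  also have "\<dots> \<le> (\<Sum>j<n. (norm (k j))^2) * card {..<n}" by (rule sum_squared_le_sum_of_squares)
  finally show ?thesis by (simp add: sqc_def mult.commute)
qed

lemma hq_eq: "m > 0 \<Longrightarrow> hq m n k = (1 - am m) * sqc n k + am m * (norm (Sg n k))^2"
  unfolding hq_def norm_Sg am_def by (simp add: algebra_simps)

lemma Xq_eq: assumes "m > 0" shows "Xq m n k = (1 - am m) * sqc n k + am m * (1 - am m) * (norm (Sg n k))^2"
proof -
  have 1: "m * (m + 2) / (m + 1)^2 = (1 - am m) + am m * (1 - am m)" 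
    unfolding am(3)[OF assms, symmetric] by (simp add: power2_eq_square algebra_simps)
  have 2: "2 * m / (m + 1)^2 = 2 * (am m * (1 - am m))"
    using assms by (simp add: am_def power2_eq_square field_simps)
  show ?thesis unfolding Xq_def 1 2 norm_Sg by (simp add: algebra_simps)
qed

lemma hq_bounds:
  assumes "m > 0"
  shows "(1 - am m) * sqc n k \<le> hq m n k" "hq m n k \<le> (1 + real n) * sqc n k" "0 \<le> hq m n k"
proof -
  note a = am[OF assms]
  show 1: "(1 - am m) * sqc n k \<le> hq m n k" unfolding hq_eq[OF assms] using a by simp
  have "am m * (norm (Sg n k))^2 \<le> 1 * (real n * sqc n k)" using a norm_Sg_le[of n k] by (intro mult_mono) auto
  moreover have "(1 - am m) * sqc n k \<le> 1 * sqc n k" using a by (intro mult_right_mono) auto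
  ultimately show "hq m n k \<le> (1 + real n) * sqc n k" unfolding hq_eq[OF assms] by (simp add: algebra_simps)
  have "0 \<le> (1 - am m) * sqc n k" using a by simp
  then show "0 \<le> hq m n k" using 1 by linarith
qed

lemma Xq_bounds:
  assumes "m > 0"
  shows "(1 - am m) * sqc n k \<le> Xq m n k" "Xq m n k \<le> (1 + real n) * sqc n k" "0 \<le> Xq m n k"
proof -
  note a = am[OF assms]
  show 1: "(1 - am m) * sqc n k \<le> Xq m n k" unfolding Xq_eq[OF assms] using a by simp
  have "am m * (1 - am m) * (norm (Sg n k))^2 \<le> 1 * (real n * sqc n k)" 
    using a norm_Sg_le[of n k] by (intro mult_mono mult_le_one) auto
  moreover have "(1 - am m) * sqc n k \<le> 1 * sqc n k" using a by (intro mult_right_mono) auto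
  ultimately show "Xq m n k \<le> (1 + real n) * sqc n k" unfolding Xq_eq[OF assms] by (simp add: algebra_simps)
  have "0 \<le> (1 - am m) * sqc n k" using a by simp
  then show "0 \<le> Xq m n k" using 1 by linarith
qed

lemma sw_sum: 
  fixes f :: "real^3 \<Rightarrow> 'a::comm_monoid_add"
  assumes "i < n" "j < n" shows "(\<Sum>l<n. f (sw i j k l)) = (\<Sum>l<n. f (k l))"
  by (rule sum.reindex_bij_witness[where i="\<lambda>l. if l = i then j else if l = j then i else l" and j="\<lambda>l. if l = i then j else if l = j then i else l"])
     (use assms in \<open>auto simp: sw_def\<close>)

lemma hq_sw: assumes "m > 0" "i < n" "j < n" shows "hq m n (sw i j k) = hq m n k"
proof -
  have "Sg n (sw i j k) = Sg n k" unfolding Sg_def by (rule sw_sum[where f="\<lambda>x. x", OF assms(2,3)])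
  moreover have "sqc n (sw i j k) = sqc n k" unfolding sqc_def by (rule sw_sum[OF assms(2,3)])
  ultimately show ?thesis by (simp add: hq_eq[OF assms(1)])
qed

lemma sqc_pcons: "sqc (Suc n) (pcons n s k) = (norm s)^2 + sqc n k"
  unfolding sqc_def by (subst sum.lessThan_Suc_shift) simp

lemma Sg_pcons: "Sg (Suc n) (pcons n s k) = s + Sg n k"
  unfolding Sg_def by (subst sum.lessThan_Suc_shift) simp

text \<open>Completing the square in s about -a times the spectator total lowers the coefficient of
  its squared norm from a to a - a^2; this is the a (1 - a) of \<open>Xq_eq\<close>.\<close>

lemma hq_pcons:
  assumes "m > 0"
  shows "hq m (Suc n) (pcons n s k) = (norm (s + am m *\<^sub>R Sg n k))^2 + Xq m n k"
proof -
  have "(norm (s + Sg n k))^2 = (norm s)^2 + 2 * (s \<bullet> Sg n k) + (norm (Sg n k))^2"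
    by (simp add: power2_norm_eq_inner inner_add_left inner_add_right inner_commute)
  moreover have "(norm (s + am m *\<^sub>R Sg n k))^2 = (norm s)^2 + 2 * am m * (s \<bullet> Sg n k) + (am m)^2 * (norm (Sg n k))^2"
    by (simp only: power2_norm_eq_inner) (simp add: inner_add_left inner_add_right inner_commute power2_eq_square)
  ultimately show ?thesis unfolding hq_eq[OF assms] Xq_eq[OF assms] sqc_pcons Sg_pcons
    by (simp add: algebra_simps power2_eq_square)
qed

text \<open>The moment of |x|^3 represents 1/u^2 as a Gaussian integral, so that s and x can be
  exchanged; the powers of x cancel after the s-integration.\<close>

lemma resolvent_sq:
  fixes c :: "real^3"
  assumes A: "A > 0"
  shows "(\<integral>\<^sup>+s. ennreal (1 / ((norm (s + c))^2 + A)^2) \<partial>lb3) = ennreal (pi^2 / sqrt A)"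
proof -
  let ?F = "\<lambda>s x. ennreal (exp (- ((norm (s + c))^2 + A) * x^2) * \<bar>x\<bar>^3)"
  have "(\<integral>\<^sup>+s. ennreal (1 / ((norm (s + c))^2 + A)^2) \<partial>lb3) = (\<integral>\<^sup>+s. \<integral>\<^sup>+x. ?F s x \<partial>lborel \<partial>lb3)"
    using A by (intro nn_integral_cong nn_inv(2)[symmetric]) (simp add: add_nonneg_pos)
  also have "\<dots> = (\<integral>\<^sup>+x. \<integral>\<^sup>+s. ?F s x \<partial>lb3 \<partial>lborel)"
    by (rule lborel_pair.Fubini') measurable
  also have "\<dots> = (\<integral>\<^sup>+x. ennreal (pi * sqrt pi) * ennreal (exp (- A * x^2)) \<partial>lborel)"
  proof (rule nn_integral_cong_AE)
    have "AE x in (lborel :: real measure). x \<noteq> 0" by (rule AE_lborel_singleton)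
    then show "AE x in lborel. (\<integral>\<^sup>+s. ?F s x \<partial>lb3) = ennreal (pi * sqrt pi) * ennreal (exp (- A * x^2))"
    proof eventually_elim
      case (elim x)
      have x2: "x^2 > 0" using elim by simp
      have "?F s x = ennreal (exp (- A * x^2) * \<bar>x\<bar>^3) * ennreal (exp (- (x^2) * (norm (s - (- c)))^2))" for s
      proof -
        have "exp (- ((norm (s + c))^2 + A) * x^2) * \<bar>x\<bar>^3 = (exp (- A * x^2) * \<bar>x\<bar>^3) * exp (- (x^2) * (norm (s - (- c)))^2)"
          by (simp add: exp_add[symmetric] algebra_simps)
        then show ?thesis by (simp only: ennreal_mult'[OF mult_nonneg_nonneg[OF exp_ge_zero zero_le_power[OF abs_ge_zero]]])
      qed
      then have "(\<integral>\<^sup>+s. ?F s x \<partial>lb3) = ennreal (exp (- A * x^2) * \<bar>x\<bar>^3) * (\<integral>\<^sup>+s. ennreal (exp (- (x^2) * (norm (s - (- c)))^2)) \<partial>lb3)"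
        by (simp only:) (rule nn_integral_cmult, measurable)
      also have "\<dots> = ennreal (exp (- A * x^2) * \<bar>x\<bar>^3) * ennreal (sqrt (pi / x^2)^3)"
        by (simp only: nn_gauss_vec[OF x2])
      also have "\<dots> = ennreal ((exp (- A * x^2) * \<bar>x\<bar>^3) * sqrt (pi / x^2)^3)"
        by (rule ennreal_mult[symmetric]) auto
      also have "(exp (- A * x^2) * \<bar>x\<bar>^3) * sqrt (pi / x^2)^3 = (pi * sqrt pi) * exp (- A * x^2)"
      proof -
        have "\<bar>x\<bar> * sqrt (pi / x^2) = sqrt pi" using elim by (simp add: real_sqrt_divide)
        then have "(\<bar>x\<bar> * sqrt (pi / x^2))^3 = sqrt pi * sqrt pi * sqrt pi" by (simp only: power3_eq_cube)
        then have "\<bar>x\<bar>^3 * sqrt (pi / x^2)^3 = pi * sqrt pi" by (simp only: power_mult_distrib) simp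
        then show ?thesis by (simp only: mult.assoc) simp
      qed
      also have "ennreal ((pi * sqrt pi) * exp (- A * x^2)) = ennreal (pi * sqrt pi) * ennreal (exp (- A * x^2))"
        by (rule ennreal_mult) auto
      finally show ?case .
    qed
  qed
  also have "\<dots> = ennreal (pi * sqrt pi) * ennreal (sqrt (pi / A))"
    unfolding nn_inv(4)[OF A, symmetric] by (rule nn_integral_cmult) measurable
  also have "\<dots> = ennreal (pi * sqrt pi * sqrt (pi / A))" using A by (intro ennreal_mult[symmetric]) auto
  also have "pi * sqrt pi * sqrt (pi / A) = pi^2 / sqrt A" by (simp add: real_sqrt_divide power2_eq_square)
  finally show ?thesis .
qed

text \<open>A single resolvent is not integrable in three dimensions, but the difference is the
  integral of the squared resolvent over the spectral parameter. This is the origin of the weight 2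
  pi^2 sqrt in \<open>L_lam\<close>.\<close>

lemma resolvent_diff:
  fixes c :: "real^3"
  assumes X: "X \<ge> 0" and l: "0 < l" "l \<le> l'"
  shows "(\<integral>\<^sup>+s. ennreal (1 / ((norm (s + c))^2 + X + l) - 1 / ((norm (s + c))^2 + X + l')) \<partial>lb3)
    = ennreal (2 * pi^2 * (sqrt (X + l') - sqrt (X + l)))"
proof -
  let ?F = "\<lambda>s x. ennreal (1 / ((norm (s + c))^2 + (X + x))^2) * indicator {l..l'} x"
  have "(\<integral>\<^sup>+s. ennreal (1 / ((norm (s + c))^2 + X + l) - 1 / ((norm (s + c))^2 + X + l')) \<partial>lb3)
     = (\<integral>\<^sup>+s. \<integral>\<^sup>+x. ?F s x \<partial>lborel \<partial>lb3)"
  proof (rule nn_integral_cong)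
    fix s :: "real^3"
    have D: "DERIV (\<lambda>x. - 1 / (u + (X + x))) x :> 1 / (u + (X + x))^2" if "u + (X + x) > 0" for u x
      using that by (auto intro!: derivative_eq_intros simp: power2_eq_square)
    have "(\<integral>\<^sup>+x. ?F s x \<partial>lborel) = ennreal (- 1 / ((norm (s + c))^2 + (X + l')) - - 1 / ((norm (s + c))^2 + (X + l)))"
    proof (rule nn_integral_FTC_Icc)
      fix x assume "x \<in> {l..l'}"
      then have "(norm (s + c))^2 + (X + x) > 0" using X l by (intro add_nonneg_pos) auto
      then show "DERIV (\<lambda>x. - 1 / ((norm (s + c))^2 + (X + x))) x :> 1 / ((norm (s + c))^2 + (X + x))^2" by (rule D)
    qed (use l in auto)
    then show "ennreal (1 / ((norm (s + c))^2 + X + l) - 1 / ((norm (s + c))^2 + X + l')) = (\<integral>\<^sup>+x. ?F s x \<partial>lborel)"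
      by (simp add: add.assoc)
  qed
  also have "\<dots> = (\<integral>\<^sup>+x. \<integral>\<^sup>+s. ?F s x \<partial>lb3 \<partial>lborel)"
    by (rule lborel_pair.Fubini') measurable
  also have "\<dots> = (\<integral>\<^sup>+x. ennreal (pi^2 / sqrt (X + x)) * indicator {l..l'} x \<partial>lborel)"
  proof (rule nn_integral_cong)
    fix x :: real
    show "(\<integral>\<^sup>+s. ?F s x \<partial>lb3) = ennreal (pi^2 / sqrt (X + x)) * indicator {l..l'} x"
    proof (cases "x \<in> {l..l'}")
      case True
      then have "X + x > 0" using X l by auto
      then show ?thesis using True resolvent_sq[of "X + x" c] by simp
    qed simp
  qed
  also have "\<dots> = ennreal (2 * pi^2 * sqrt (X + l') - 2 * pi^2 * sqrt (X + l))"
  proof (rule nn_integral_FTC_Icc)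
    fix x assume "x \<in> {l..l'}"
    then have x: "X + x > 0" using X l by auto
    show "DERIV (\<lambda>x. 2 * pi^2 * sqrt (X + x)) x :> pi^2 / sqrt (X + x)"
      using x by (auto intro!: derivative_eq_intros simp: field_simps)
  qed (use l X in auto)
  finally show ?thesis by (simp add: right_diff_distrib)
qed

section \<open>Deleting a momentum\<close>

lemma drop_idx_measurable: assumes "i \<le> n" shows "drop_idx (Suc n) i \<in> measurable (Mc (Suc n)) (Mc n)"
proof -
  have "(\<lambda>k. drop_idx (Suc n) i k) = (\<lambda>k. restrict (\<lambda>j. if j < i then k j else k (Suc j)) {..<n})" by (simp add: drop_idx_def)
  moreover have "\<dots> \<in> measurable (Mc (Suc n)) (PiM {..<n} (\<lambda>_. lborel))"
  proof (rule measurable_restrict)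
    fix j assume "j \<in> {..<n}"
    then show "(\<lambda>k. if j < i then k j else k (Suc j)) \<in> measurable (Mc (Suc n)) lborel"
      using measurable_Mc_component[of j "Suc n"] measurable_Mc_component[of "Suc j" "Suc n"] by (cases "j < i") auto
  qed
  ultimately show ?thesis unfolding Mc_def[of n] by simp
qed

lemma drop_idx_pcons: "k \<in> space (Mc n) \<Longrightarrow> drop_idx (Suc n) 0 (pcons n s k) = k"
  by (auto simp: drop_idx_def pcons_def space_Mc PiE_def extensional_def)

text \<open>An adjacent transposition either exchanges the two deletions concerned or acts as a
  transposition on the surviving momenta, shifted down by one if the deleted index lies
  below.\<close>

lemma drop_idx_sw:
  shows "drop_idx (Suc n) i (sw i (Suc i) k) = drop_idx (Suc n) (Suc i) k"
    "drop_idx (Suc n) (Suc i) (sw i (Suc i) k) = drop_idx (Suc n) i k"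
    "j < i \<Longrightarrow> Suc i < Suc n \<Longrightarrow> drop_idx (Suc n) j (sw i (Suc i) k) = sw (i - 1) i (drop_idx (Suc n) j k)"
    "Suc i < j \<Longrightarrow> j < Suc n \<Longrightarrow> drop_idx (Suc n) j (sw i (Suc i) k) = sw i (Suc i) (drop_idx (Suc n) j k)"
  by (auto simp: drop_idx_def sw_def restrict_def fun_eq_iff less_Suc_eq)

text \<open>The assignment is crosswise: the argument containing s = k 0 arises by deleting t = k 1,
  and conversely.\<close>

lemma s_arg_drop: "s_arg (Suc n) k = drop_idx (Suc n) 1 k"
  by (auto simp: s_arg_def drop_idx_def restrict_def fun_eq_iff)

lemma t_arg_drop: "t_arg (Suc n) k = drop_idx (Suc n) 0 k"
  by (auto simp: t_arg_def drop_idx_def restrict_def fun_eq_iff)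

text \<open>Index 0 is \<open>AE_tail\<close>; adjacent transpositions preserve null sets and move
  the deletion from i to i + 1.\<close>

lemma AE_drop_idx:
  assumes P: "AE k in Mc n. P k" and i: "i \<le> n"
  shows "AE k in Mc (Suc n). P (drop_idx (Suc n) i k)"
  using i
proof (induction i)
  case 0
  show ?case by (rule AE_tail[OF P])
next
  case (Suc i)
  then have "AE k in Mc (Suc n). P (drop_idx (Suc n) i k)" by simp
  from AE_sw[OF _ _ this, of i "Suc i"] Suc.prems show ?case by (simp add: drop_idx_sw)
qed

section \<open>Antisymmetry and the Fourier transform\<close>

lemma antisym_sw: "antisym_f n f \<longleftrightarrow> (\<forall>i<n. \<forall>j<n. i \<noteq> j \<longrightarrow> (AE x in Mc n. f (sw i j x) = - f x))"
  unfolding antisym_f_def sw_def ..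

lemma sw_commute: "sw i j = sw j i"
  by (auto simp: sw_def fun_eq_iff)

lemma sw_conj: "i \<noteq> j \<Longrightarrow> i \<noteq> k \<Longrightarrow> j \<noteq> k \<Longrightarrow> sw i k x = sw j k (sw i j (sw j k x))"
  by (auto simp: sw_def fun_eq_iff)

text \<open>Induction on the distance of the two indices: a longer transposition is a shorter one
  conjugated by an adjacent one, and three sign changes are again one.\<close>

lemma antisym_adjacent:
  assumes adj: "\<And>i. Suc i < n \<Longrightarrow> AE x in Mc n. f (sw i (Suc i) x) = - f x"
  shows "antisym_f n f"
proof -
  have lt: "AE x in Mc n. f (sw i (Suc (i + d)) x) = - f x" if "Suc (i + d) < n" for i d
    using that
  proof (induction d)
    case 0
    then show ?case using adj[of i] by simp
  next
    case (Suc d)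
    let ?j = "Suc (i + d)"
    have j: "Suc ?j < n" "i < n" "?j < n" using Suc.prems by auto
    have A: "AE x in Mc n. f (sw ?j (Suc ?j) x) = - f x" by (rule adj[OF j(1)])
    have B: "AE x in Mc n. f (sw i ?j x) = - f x" using Suc by simp
    have C: "AE x in Mc n. f (sw ?j (Suc ?j) (sw i ?j (sw ?j (Suc ?j) x))) = - f (sw i ?j (sw ?j (Suc ?j) x))"
      using AE_sw[OF j(3,1) AE_sw[OF j(2,3) A]] by simp
    have D: "AE x in Mc n. f (sw i ?j (sw ?j (Suc ?j) x)) = - f (sw ?j (Suc ?j) x)"
      by (rule AE_sw[OF j(3,1) B])
    have E: "sw i (Suc ?j) x = sw ?j (Suc ?j) (sw i ?j (sw ?j (Suc ?j) x))" for x by (rule sw_conj) auto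
    have "AE x in Mc n. f (sw i (Suc ?j) x) = - f x" unfolding E using A C D by eventually_elim simp
    then show ?case by simp
  qed
  show ?thesis unfolding antisym_sw
  proof (intro allI impI)
    fix i j assume ij: "i < n" "j < n" "i \<noteq> j"
    show "AE x in Mc n. f (sw i j x) = - f x"
    proof (cases "i < j")
      case True
      then show ?thesis using lt[of i "j - i - 1"] ij by simp
    next
      case False
      then show ?thesis using lt[of j "i - j - 1"] ij sw_commute[of i j] by simp
    qed
  qed
qed

lemma sqi_sw:
  assumes f: "sqi (Mc n) f" and ij: "i < n" "j < n"
  shows "sqi (Mc n) (\<lambda>x. f (sw i j x))"
proof -
  have [measurable]: "f \<in> borel_measurable (Mc n)" "sw i j \<in> measurable (Mc n) (Mc n)" using f sw_measurable[OF ij] by auto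
  have "integrable (distr (Mc n) (Mc n) (sw i j)) (\<lambda>x. (cmod (f x))^2)" unfolding Mc_sw[OF ij] using f by auto
  then have "integrable (Mc n) (\<lambda>x. (cmod (f (sw i j x)))^2)" by (subst (asm) integrable_distr_eq) auto
  then show ?thesis by (simp add: sqi_def)
qed

lemma ip_sw:
  assumes f: "sqi (Mc n) f" "sqi (Mc n) g" and ij: "i < n" "j < n"
  shows "ip (Mc n) (\<lambda>x. f (sw i j x)) (\<lambda>x. g (sw i j x)) = ip (Mc n) f g"
  unfolding ip_def using f by (intro integral_sw[OF ij, where F="\<lambda>x. f x * cnj (g x)"] borel_measurable_times borel_measurable_cnj) auto

lemma dotc_sw: assumes "i < n" "j < n" shows "dotc n k (sw i j x) = dotc n (sw i j k) x"
  unfolding dotc_def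
  by (rule sum.reindex_bij_witness[where i="\<lambda>l. if l = i then j else if l = j then i else l" and j="\<lambda>l. if l = i then j else if l = j then i else l"])
     (use assms in \<open>auto simp: sw_def\<close>)

text \<open>A transposition preserves the measure and the phase k.x, so it commutes with the inverse
  transform of a test function and can be moved across the pairing.\<close>

lemma is_FT_sw:
  assumes f: "sqi (Mc n) f" and g: "is_FT n f g" and ij: "i < n" "j < n"
  shows "is_FT n (\<lambda>x. f (sw i j x)) (\<lambda>x. g (sw i j x))"
  unfolding is_FT_iff
proof (intro conjI allI impI)
  have gs: "sqi (Mc n) g" using g by (simp add: is_FT_iff)
  show "sqi (Mc n) (\<lambda>x. g (sw i j x))" by (rule sqi_sw[OF gs ij])
  fix \<phi> assume \<phi>: "testf n \<phi>"
  then have \<phi>s: "sqi (Mc n) \<phi>" "integrable (Mc n) \<phi>" by (auto simp: testf_def)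
  have [measurable]: "\<phi> \<in> borel_measurable (Mc n)" "sw i j \<in> measurable (Mc n) (Mc n)" using \<phi>s sw_measurable[OF ij] by auto
  let ?\<phi> = "\<lambda>x. \<phi> (sw i j x)"
  have "integrable (distr (Mc n) (Mc n) (sw i j)) \<phi>" unfolding Mc_sw[OF ij] using \<phi>s by auto
  then have "integrable (Mc n) ?\<phi>" by (subst (asm) integrable_distr_eq) auto
  then have t: "testf n ?\<phi>" using sqi_sw[OF \<phi>s(1) ij] by (simp add: testf_def)
  have inv: "invF_int n ?\<phi> x = invF_int n \<phi> (sw i j x)" if x: "x \<in> space (Mc n)" for x
  proof -
    have [measurable]: "(\<lambda>k. sw i j x) \<in> measurable (Mc n) (Mc n)" using sw_space[OF ij x] by simp
    have "(\<integral>k. exp (\<i> * complex_of_real (dotc n k x)) * ?\<phi> k \<partial>Mc n)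
      = (\<integral>k. exp (\<i> * complex_of_real (dotc n (sw i j k) (sw i j x))) * \<phi> (sw i j k) \<partial>Mc n)"
      by (simp add: dotc_sw[OF ij])
    also have "\<dots> = (\<integral>k. exp (\<i> * complex_of_real (dotc n k (sw i j x))) * \<phi> k \<partial>Mc n)"
      by (rule integral_sw[OF ij, where F="\<lambda>k. exp (\<i> * complex_of_real (dotc n k (sw i j x))) * \<phi> k"]) measurable
    finally show ?thesis by (simp add: invF_int_def)
  qed
  have "ip (Mc n) (\<lambda>x. g (sw i j x)) \<phi> = ip (Mc n) (\<lambda>x. g (sw i j x)) (\<lambda>x. ?\<phi> (sw i j x))" by simp
  also have "\<dots> = ip (Mc n) g ?\<phi>" by (rule ip_sw[OF gs sqi_sw[OF \<phi>s(1) ij] ij])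
  also have "\<dots> = ip (Mc n) f (invF_int n ?\<phi>)" using g t by (simp add: is_FT_iff)
  also have "\<dots> = ip (Mc n) (\<lambda>x. f (sw i j x)) (\<lambda>x. invF_int n ?\<phi> (sw i j x))"
    by (rule ip_sw[symmetric, OF f invF_sqi[OF t] ij])
  also have "\<dots> = ip (Mc n) (\<lambda>x. f (sw i j x)) (invF_int n \<phi>)"
    unfolding ip_def using inv sw_space[OF ij] by (intro Bochner_Integration.integral_cong) auto
  finally show "ip (Mc n) (\<lambda>x. g (sw i j x)) \<phi> = ip (Mc n) (\<lambda>x. f (sw i j x)) (invF_int n \<phi>)" .
qed

lemma is_FT_mult: assumes "is_FT n f g" shows "is_FT n (\<lambda>x. c * f x) (\<lambda>x. c * g x)"
  using assms unfolding is_FT_iff by (auto simp: ip_mult_left intro: sqi_mult)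

lemma nrm_0_AE_iff:
  assumes "sqi M f" shows "nrm M f = 0 \<longleftrightarrow> (AE x in M. f x = 0)"
proof
  assume "AE x in M. f x = 0"
  then have "nrm M f = nrm M (\<lambda>_. 0)" using assms by (intro nrm_cong_AE) auto
  then show "nrm M f = 0" by (simp add: nrm_def)
qed (rule nrm_eq_0_AE[OF assms])

text \<open>The defect f(sw x) + f x has transform g(sw k) + g k, and by Plancherel one vanishes
  almost everywhere exactly when the other does.\<close>

lemma antisym_FT_iff:
  assumes f: "sqi (Mc n) f" and g: "is_FT n f g"
  shows "antisym_f n f \<longleftrightarrow> antisym_f n g"
proof -
  have gs: "sqi (Mc n) g" using g by (simp add: is_FT_iff)
  have "(AE x in Mc n. f (sw i j x) = - f x) \<longleftrightarrow> (AE x in Mc n. g (sw i j x) = - g x)" if ij: "i < n" "j < n" for i j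
  proof -
    let ?u = "\<lambda>x. f (sw i j x) - (- 1) * f x" and ?v = "\<lambda>x. g (sw i j x) - (- 1) * g x"
    have v: "is_FT n ?u ?v" by (rule is_FT_diff[OF sqi_sw[OF f ij] sqi_mult[OF f] is_FT_sw[OF f g ij] is_FT_mult[OF g]])
    have us: "sqi (Mc n) ?u" by (rule sqi_diff[OF sqi_sw[OF f ij] sqi_mult[OF f]])
    have vs: "sqi (Mc n) ?v" by (rule sqi_diff[OF sqi_sw[OF gs ij] sqi_mult[OF gs]])
    have "(AE x in Mc n. ?u x = 0) \<longleftrightarrow> (AE x in Mc n. ?v x = 0)"
      unfolding nrm_0_AE_iff[OF us, symmetric] nrm_0_AE_iff[OF vs, symmetric] is_FT_nrm[OF us v] ..
    then show ?thesis by (simp add: eq_neg_iff_add_eq_0)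
  qed
  then show ?thesis unfolding antisym_sw by blast
qed

section \<open>The charge form\<close>

lemma ip_sum_right:
  assumes "finite A" "sqi M h" "\<And>i. i \<in> A \<Longrightarrow> sqi M (f i)"
  shows "sqi M (\<lambda>x. \<Sum>i\<in>A. c i * f i x)" "ip M h (\<lambda>x. \<Sum>i\<in>A. c i * f i x) = (\<Sum>i\<in>A. cnj (c i) * ip M h (f i))"
proof -
  have "sqi M (\<lambda>x. \<Sum>i\<in>A. c i * f i x) \<and> ip M h (\<lambda>x. \<Sum>i\<in>A. c i * f i x) = (\<Sum>i\<in>A. cnj (c i) * ip M h (f i))"
    using assms(1,3)
  proof (induction A rule: finite_induct)
    case empty
    then show ?case by (simp add: ip_def)
  next
    case (insert j A)
    have i: "sqi M (\<lambda>x. c j * f j x)" "sqi M (\<lambda>x. \<Sum>i\<in>A. c i * f i x)" using insert by (auto intro: sqi_mult)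
    show ?case using sqi_add[OF i] ip_add_right[OF i assms(2)] insert by (simp add: ip_mult_right)
  qed
  then show "sqi M (\<lambda>x. \<Sum>i\<in>A. c i * f i x)" "ip M h (\<lambda>x. \<Sum>i\<in>A. c i * f i x) = (\<Sum>i\<in>A. cnj (c i) * ip M h (f i))" by auto
qed

lemma ip_sum_left:
  assumes "finite A" "sqi M h" "\<And>i. i \<in> A \<Longrightarrow> sqi M (f i)"
  shows "ip M (\<lambda>x. \<Sum>i\<in>A. c i * f i x) h = (\<Sum>i\<in>A. c i * ip M (f i) h)"
proof -
  have "ip M (\<lambda>x. \<Sum>i\<in>A. c i * f i x) h = cnj (\<Sum>i\<in>A. cnj (c i) * ip M h (f i))"
    by (subst ip_cnj) (simp only: ip_sum_right(2)[OF assms])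
  also have "\<dots> = (\<Sum>i\<in>A. c i * cnj (ip M h (f i)))" by simp
  also have "\<dots> = (\<Sum>i\<in>A. c i * ip M (f i) h)" by (simp only: ip_cnj[symmetric])
  finally show ?thesis .
qed

section \<open>Norms of antisymmetrised charges\<close>

lemma sign_cancel: "(-1)^i * ((-1)^i * c) = (c :: complex)"
  by (cases "even i") simp_all

text \<open>The symmetric weight W enters as a square root so that weighted norms of charges become
  plain L2 norms; it will be a difference of resolvents or a squared resolvent.\<close>

definition uw :: "nat \<Rightarrow> (cfg \<Rightarrow> complex) \<Rightarrow> (cfg \<Rightarrow> real) \<Rightarrow> nat \<Rightarrow> cfg \<Rightarrow> complex" where
  "uw n \<eta> W i k = complex_of_real (sqrt (W k)) * \<eta> (drop_idx (Suc n) i k)"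

definition bw :: "nat \<Rightarrow> (cfg \<Rightarrow> complex) \<Rightarrow> (cfg \<Rightarrow> real) \<Rightarrow> cfg \<Rightarrow> complex" where
  "bw n \<eta> W k = (\<Sum>i<Suc n. (-1)^i * uw n \<eta> W i k)"

context
  fixes n :: nat and \<eta> :: "cfg \<Rightarrow> complex" and W :: "cfg \<Rightarrow> real"
  assumes anti: "antisym_f n \<eta>"
    and Wsw: "\<And>i k. Suc i < Suc n \<Longrightarrow> W (sw i (Suc i) k) = W k"
    and s0: "sqi (Mc (Suc n)) (uw n \<eta> W 0)"
begin

lemma uw_sw1:
  assumes "Suc i < Suc n"
  shows "uw n \<eta> W i (sw i (Suc i) k) = uw n \<eta> W (Suc i) k" "uw n \<eta> W (Suc i) (sw i (Suc i) k) = uw n \<eta> W i k"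
  by (simp_all only: uw_def Wsw[OF assms] drop_idx_sw)

lemma uw_sw2:
  assumes i: "Suc i < Suc n" and j: "j < Suc n" "j \<noteq> i" "j \<noteq> Suc i"
  shows "AE k in Mc (Suc n). uw n \<eta> W j (sw i (Suc i) k) = - uw n \<eta> W j k"
proof (cases "j < i")
  case True
  then have "AE k in Mc n. \<eta> (sw (i - 1) i k) = - \<eta> k" using anti i by (simp add: antisym_sw)
  from AE_drop_idx[OF this, of j] show ?thesis
    using True i by (auto simp: uw_def Wsw drop_idx_sw(3))
next
  case False
  then have ij: "Suc i < j" using j by auto
  then have "AE k in Mc n. \<eta> (sw i (Suc i) k) = - \<eta> k" using anti i j by (simp add: antisym_sw)
  from AE_drop_idx[OF this, of j] show ?thesis
    using ij i j by (auto simp: uw_def Wsw drop_idx_sw(4))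
qed

lemma sqi_uw: "i \<le> n \<Longrightarrow> sqi (Mc (Suc n)) (uw n \<eta> W i)"
proof (induction i)
  case (Suc i)
  then have "sqi (Mc (Suc n)) (\<lambda>k. uw n \<eta> W i (sw i (Suc i) k))" by (intro sqi_sw) auto
  then show ?case using uw_sw1(1)[of i] Suc by simp
qed (rule s0)

lemma sqi_bw: "sqi (Mc (Suc n)) (bw n \<eta> W)"
  unfolding bw_def[abs_def] by (rule ip_sum_right(1)[OF _ s0]) (auto intro: sqi_uw)

lemma bw_sw:
  assumes i: "Suc i < Suc n"
  shows "AE k in Mc (Suc n). bw n \<eta> W (sw i (Suc i) k) = - bw n \<eta> W k"
proof -
  have "AE k in Mc (Suc n). \<forall>j\<in>{..<Suc n} - {i, Suc i}. uw n \<eta> W j (sw i (Suc i) k) = - uw n \<eta> W j k"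
    by (rule eventually_ball_finite) (use uw_sw2[OF i] in auto)
  then show ?thesis
  proof eventually_elim
    case (elim k)
    let ?t = "\<lambda>l. if l = i then Suc i else if l = Suc i then i else l"
    let ?y = "\<lambda>j. (-1)^j * uw n \<eta> W j k"
    have "bw n \<eta> W (sw i (Suc i) k) = (\<Sum>j<Suc n. - ?y (?t j))"
      unfolding bw_def
    proof (rule sum.cong[OF refl])
      fix j assume j: "j \<in> {..<Suc n}"
      show "(-1)^j * uw n \<eta> W j (sw i (Suc i) k) = - ?y (?t j)"
        using uw_sw1[OF i] elim j by (cases "j = i"; cases "j = Suc i") auto
    qed
    also have "\<dots> = - (\<Sum>j<Suc n. ?y (?t j))" by (rule sum_negf)
    also have "(\<Sum>j<Suc n. ?y (?t j)) = (\<Sum>j<Suc n. ?y j)"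
      by (rule sum.reindex_bij_witness[where i="?t" and j="?t"]) (use i in auto)
    finally show ?case by (simp add: bw_def)
  qed
qed

lemma bw_antisym: "antisym_f (Suc n) (bw n \<eta> W)"
  by (rule antisym_adjacent[OF bw_sw])

text \<open>Transposing i and i + 1 in both arguments keeps the pairing, turns one deletion into the
  next, and changes the sign of \<open>bw\<close>.\<close>

lemma ip_bw_uw: "i \<le> n \<Longrightarrow> ip (Mc (Suc n)) (bw n \<eta> W) (uw n \<eta> W i) = (-1)^i * ip (Mc (Suc n)) (bw n \<eta> W) (uw n \<eta> W 0)"
proof (induction i)
  case (Suc i)
  let ?M = "Mc (Suc n)" let ?b = "bw n \<eta> W" let ?s = "sw i (Suc i)"
  have i: "Suc i < Suc n" "i < Suc n" "i \<le> n" using Suc.prems by auto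
  have bm: "sqi ?M (\<lambda>x. ?b (?s x))" by (rule sqi_sw[OF sqi_bw i(2,1)])
  have "ip ?M ?b (uw n \<eta> W (Suc i)) = ip ?M (\<lambda>x. ?b (?s (?s x))) (\<lambda>x. uw n \<eta> W i (?s x))"
    by (simp add: uw_sw1(1)[OF i(1)])
  also have "\<dots> = ip ?M (\<lambda>x. ?b (?s x)) (uw n \<eta> W i)" by (rule ip_sw[OF bm sqi_uw[OF i(3)] i(2,1)])
  also have "\<dots> = ip ?M (\<lambda>x. (-1) * ?b x) (uw n \<eta> W i)"
    using bm sqi_mult[OF sqi_bw, of "-1"] sqi_uw[OF i(3)] bw_sw[OF i(1)] by (intro ip_cong_AE) auto
  also have "\<dots> = (-1) * ip ?M ?b (uw n \<eta> W i)" by (rule ip_mult_left)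
  finally show ?case using Suc by simp
qed simp

text \<open>Transposing positions j + 1 and j + 2 moves the first deletion down by one, while the
  deletion of 0 still contains both momenta and merely changes sign.\<close>

lemma ip_uw_0: "j < n \<Longrightarrow> ip (Mc (Suc n)) (uw n \<eta> W (Suc j)) (uw n \<eta> W 0) = (-1)^j * ip (Mc (Suc n)) (uw n \<eta> W 1) (uw n \<eta> W 0)"
proof (induction j)
  case (Suc j)
  let ?M = "Mc (Suc n)" let ?s = "sw (Suc j) (Suc (Suc j))" let ?u = "uw n \<eta> W"
  have j: "Suc (Suc j) < Suc n" "Suc j < Suc n" "Suc j \<le> n" using Suc.prems by auto
  have um: "sqi ?M (\<lambda>x. ?u 0 (?s x))" by (rule sqi_sw[OF s0 j(2,1)])
  have u1: "sqi ?M (?u (Suc j))" by (rule sqi_uw[OF j(3)])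
  have "ip ?M (?u (Suc (Suc j))) (?u 0) = ip ?M (\<lambda>x. ?u (Suc j) (?s x)) (\<lambda>x. ?u 0 (?s (?s x)))"
    by (simp add: uw_sw1(1)[OF j(1)])
  also have "\<dots> = ip ?M (?u (Suc j)) (\<lambda>x. ?u 0 (?s x))" by (rule ip_sw[OF u1 um j(2,1)])
  also have "\<dots> = cnj (ip ?M (\<lambda>x. ?u 0 (?s x)) (?u (Suc j)))" by (rule ip_cnj)
  also have "ip ?M (\<lambda>x. ?u 0 (?s x)) (?u (Suc j)) = ip ?M (\<lambda>x. (-1) * ?u 0 x) (?u (Suc j))"
    using um sqi_mult[OF s0, of "-1"] u1 uw_sw2[OF j(1), of 0] by (intro ip_cong_AE) auto
  also have "\<dots> = (-1) * ip ?M (?u 0) (?u (Suc j))" by (rule ip_mult_left)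
  also have "cnj \<dots> = (-1) * ip ?M (?u (Suc j)) (?u 0)" unfolding ip_cnj[of ?M "?u (Suc j)" "?u 0"] by simp
  finally show ?case using Suc by simp
qed simp

text \<open>Each adjacent transposition moves the deleted index by one and flips all other signs, so only the
  pairings of the deletions 0 and 1 survive.\<close>
lemma weighted_norm:
  "(nrm (Mc (Suc n)) (bw n \<eta> W))^2 = real (Suc n) * ((nrm (Mc (Suc n)) (uw n \<eta> W 0))^2
     - real n * Re (ip (Mc (Suc n)) (uw n \<eta> W 1) (uw n \<eta> W 0)))"
proof -
  let ?M = "Mc (Suc n)" let ?b = "bw n \<eta> W" let ?u = "uw n \<eta> W"
  have "ip ?M ?b ?b = (\<Sum>i<Suc n. cnj ((-1)^i) * ip ?M ?b (?u i))"
  proof -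
    have "ip ?M ?b ?b = ip ?M ?b (\<lambda>k. \<Sum>i<Suc n. (-1)^i * ?u i k)" unfolding bw_def[abs_def] ..
    also have "\<dots> = (\<Sum>i<Suc n. cnj ((-1)^i) * ip ?M ?b (?u i))" by (rule ip_sum_right(2)[OF _ sqi_bw]) (auto intro: sqi_uw)
    finally show ?thesis .
  qed
  also have "\<dots> = (\<Sum>i<Suc n. ip ?M ?b (?u 0))"
  proof (intro sum.cong refl)
    fix i assume "i \<in> {..<Suc n}"
    then have "ip ?M ?b (?u i) = (-1)^i * ip ?M ?b (?u 0)" by (intro ip_bw_uw) simp
    then show "cnj ((-1)^i) * ip ?M ?b (?u i) = ip ?M ?b (?u 0)" by (simp add: sign_cancel)
  qed
  finally have 1: "ip ?M ?b ?b = of_nat (Suc n) * ip ?M ?b (?u 0)" by simp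
  have "ip ?M ?b (?u 0) = (\<Sum>i<Suc n. (-1)^i * ip ?M (?u i) (?u 0))"
    unfolding bw_def[abs_def] by (rule ip_sum_left[OF _ s0]) (auto intro: sqi_uw)
  also have "\<dots> = ip ?M (?u 0) (?u 0) + (\<Sum>i<n. (-1)^Suc i * ip ?M (?u (Suc i)) (?u 0))"
    by (subst sum.lessThan_Suc_shift) simp
  also have "(\<Sum>i<n. (-1)^Suc i * ip ?M (?u (Suc i)) (?u 0)) = (\<Sum>i<n. - ip ?M (?u 1) (?u 0))"
  proof (intro sum.cong refl)
    fix i assume "i \<in> {..<n}"
    then have "ip ?M (?u (Suc i)) (?u 0) = (-1)^i * ip ?M (?u 1) (?u 0)" by (intro ip_uw_0) simp
    then show "(-1)^Suc i * ip ?M (?u (Suc i)) (?u 0) = - ip ?M (?u 1) (?u 0)" by (simp add: sign_cancel)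
  qed
  finally have 2: "ip ?M ?b (?u 0) = ip ?M (?u 0) (?u 0) - of_nat n * ip ?M (?u 1) (?u 0)" by simp
  have "(nrm ?M ?b)^2 = Re (ip ?M ?b ?b)" by (simp add: ip_self)
  also have "\<dots> = real (Suc n) * Re (ip ?M ?b (?u 0))" unfolding 1 by simp
  also have "Re (ip ?M ?b (?u 0)) = (nrm ?M (?u 0))^2 - real n * Re (ip ?M (?u 1) (?u 0))" unfolding 2 by (simp add: ip_self)
  finally show ?thesis .
qed

end

section \<open>The charge space and continuity of the charge form\<close>

definition wh :: "nat \<Rightarrow> cfg \<Rightarrow> real" where "wh n k = sqrt (1 + sqc n k)"

lemma wh_measurable[measurable (raw)]:
  assumes [measurable]: "f \<in> measurable M (Mc n)"
  shows "(\<lambda>x. wh n (f x)) \<in> borel_measurable M"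
  unfolding wh_def by measurable

lemma wh_ge1: "1 \<le> wh n k"
  by (simp add: wh_def)

lemma wh_nonneg[simp]: "0 \<le> wh n k"
  by (simp add: wh_def)

text \<open>The Fourier image of \<open>Hhalf_f\<close>: by \<open>Hhalf_Hh\<close> and
  \<open>Hh_Hhalf\<close> charges may be handled directly in momentum space. Square integrability is
  contained in the weight being at least 1.\<close>

definition Hh :: "nat \<Rightarrow> (cfg \<Rightarrow> complex) \<Rightarrow> bool" where
  "Hh n \<eta> \<longleftrightarrow> \<eta> \<in> borel_measurable (Mc n) \<and> antisym_f n \<eta> \<and> integrable (Mc n) (\<lambda>k. wh n k * (cmod (\<eta> k))^2)"

definition Qh :: "nat \<Rightarrow> (cfg \<Rightarrow> complex) \<Rightarrow> real" where
  "Qh n \<eta> = (\<integral>k. wh n k * (cmod (\<eta> k))^2 \<partial>Mc n)"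

text \<open>\<open>Pd\<close>, \<open>Po\<close> and \<open>PP\<close> are the diagonal part, the off-diagonal part and the whole of \<open>\<Phi>\<close>, as
  functionals of \<open>\<eta>\<close>, the Fourier transform of \<open>\<xi>\<close>.\<close>
definition Pd :: "real \<Rightarrow> nat \<Rightarrow> real \<Rightarrow> real \<Rightarrow> (cfg \<Rightarrow> complex) \<Rightarrow> real" where
  "Pd m n l \<alpha> \<eta> = (\<integral>k. (cmod (\<eta> k))^2 * (\<alpha> + 2 * pi^2 * sqrt (Xq m n k + l)) \<partial>Mc n)"

definition Poi :: "real \<Rightarrow> nat \<Rightarrow> real \<Rightarrow> (cfg \<Rightarrow> complex) \<Rightarrow> cfg \<Rightarrow> complex" where
  "Poi m n l \<eta> k = cnj (\<eta> (drop_idx (Suc n) 1 k)) * \<eta> (drop_idx (Suc n) 0 k) * complex_of_real (1 / (hq m (Suc n) k + l))"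

definition Po :: "real \<Rightarrow> nat \<Rightarrow> real \<Rightarrow> (cfg \<Rightarrow> complex) \<Rightarrow> real" where
  "Po m n l \<eta> = real n * Re (\<integral>k. Poi m n l \<eta> k \<partial>Mc (Suc n))"

definition PP :: "real \<Rightarrow> nat \<Rightarrow> real \<Rightarrow> real \<Rightarrow> (cfg \<Rightarrow> complex) \<Rightarrow> real" where
  "PP m n l \<alpha> \<eta> = Pd m n l \<alpha> \<eta> + Po m n l \<eta>"

lemma Phi_PP: "Phi m (Suc n) l \<alpha> \<xi> = PP m n l \<alpha> (FT n \<xi>)"
  by (simp add: Phi_def PP_def Phi_diag_def Pd_def Phi_off_def Po_def Poi_def L_lam_Xq G_lam_hq s_arg_drop t_arg_drop)

lemma HhD:
  assumes "Hh n \<eta>"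
  shows "\<eta> \<in> borel_measurable (Mc n)" "antisym_f n \<eta>" "integrable (Mc n) (\<lambda>k. wh n k * (cmod (\<eta> k))^2)"
  using assms by (auto simp: Hh_def)

lemma Qh_nonneg: "0 \<le> Qh n \<eta>"
  unfolding Qh_def by simp

lemma Qh_nn: "Hh n \<eta> \<Longrightarrow> (\<integral>\<^sup>+k. ennreal (wh n k * (cmod (\<eta> k))^2) \<partial>Mc n) = ennreal (Qh n \<eta>)"
  unfolding Qh_def by (rule nn_integral_eq_integral) (auto dest: HhD)

lemma drop1_pcons: "drop_idx (Suc (Suc n)) 1 (pcons (Suc n) s (pcons n t K)) = pcons n s K"
proof
  fix j
  show "drop_idx (Suc (Suc n)) 1 (pcons (Suc n) s (pcons n t K)) j = pcons n s K j"
    by (cases j) (auto simp: drop_idx_def pcons_def restrict_def)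
qed

lemma drop0_pcons2: "drop_idx (Suc (Suc n)) 0 (pcons (Suc n) s (pcons n t K)) = pcons n t K"
proof
  fix j
  show "drop_idx (Suc (Suc n)) 0 (pcons (Suc n) s (pcons n t K)) j = pcons n t K j"
    by (auto simp: drop_idx_def pcons_def restrict_def)
qed

lemma hq_pos: "m > 0 \<Longrightarrow> l > 0 \<Longrightarrow> 0 < hq m n k + l"
  using hq_bounds(3)[of m n k] by linarith

lemma Poi_measurable:
  assumes [measurable]: "\<eta> \<in> borel_measurable (Mc n)" and n: "n \<ge> 1"
  shows "Poi m n l \<eta> \<in> borel_measurable (Mc (Suc n))"
proof -
  have [measurable]: "drop_idx (Suc n) 1 \<in> measurable (Mc (Suc n)) (Mc n)" "drop_idx (Suc n) 0 \<in> measurable (Mc (Suc n)) (Mc n)"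
    using n by (auto intro!: drop_idx_measurable)
  show ?thesis unfolding Poi_def[abs_def] by measurable
qed

text \<open>For fixed spectators, \<open>hq\<close> is at least (1 - a) times the sum of squares, so
  the integrand is dominated by the kernel without cross term and \<open>schur_bound\<close> applies
  on each slice; finally |p| is below the weight \<open>wh\<close>.\<close>

lemma Poi_bound:
  assumes m: "m > 0" and l: "l > 0" and n: "n \<ge> 1" and \<eta>[measurable]: "\<eta> \<in> borel_measurable (Mc n)"
  shows "(\<integral>\<^sup>+k. ennreal (cmod (Poi m n l \<eta> k)) \<partial>Mc (Suc n))
    \<le> ennreal (2 * pi^2 / (1 - am m)) * (\<integral>\<^sup>+k. ennreal (wh n k * (cmod (\<eta> k))^2) \<partial>Mc n)"
proof -
  obtain n' where n': "n = Suc n'" using n by (cases n) auto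
  note a = am[OF m]
  \<comment> \<open>Chosen so that the factor 1 - a can be taken out of the momenta and of l at
    once.\<close>
  define \<mu> where "\<mu> = l / (1 - am m)"
  have \<mu>: "\<mu> > 0" using a l by (simp add: \<mu>_def)
  have [measurable]: "Poi m n l \<eta> \<in> borel_measurable (Mc (Suc n))" by (rule Poi_measurable[OF \<eta> n])
  have [measurable]: "\<eta> \<in> borel_measurable (Mc (Suc n'))" "Poi m (Suc n') l \<eta> \<in> borel_measurable (Mc (Suc (Suc n')))"
    using \<eta> Poi_measurable[OF \<eta> n] n' by auto
  let ?f = "\<lambda>K p. cmod (\<eta> (pcons n' p K))"
  have pt: "cmod (Poi m n l \<eta> (pcons n s (pcons n' t K))) \<le> 1 / (1 - am m) * (\<bar>?f K t * ?f K s\<bar> * Gk 0 \<mu> t s)" for s t K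
  proof -
    let ?k = "pcons n s (pcons n' t K)"
    have h: "(1 - am m) * ((norm t)^2 + (norm s)^2 + \<mu>) \<le> hq m (Suc n) ?k + l"
    proof -
      have "(1 - am m) * ((norm t)^2 + (norm s)^2) \<le> (1 - am m) * sqc (Suc n) ?k"
        using a by (intro mult_left_mono) (auto simp: sqc_pcons n')
      also have "\<dots> \<le> hq m (Suc n) ?k" by (rule hq_bounds[OF m])
      finally show ?thesis using a by (simp add: \<mu>_def distrib_left)
    qed
    have p: "0 < (norm t)^2 + (norm s)^2 + \<mu>" using \<mu> by (simp add: add_nonneg_pos)
    have "1 / (hq m (Suc n) ?k + l) \<le> 1 / ((1 - am m) * ((norm t)^2 + (norm s)^2 + \<mu>))"
      using h p a by (intro divide_left_mono mult_pos_pos hq_pos[OF m l]) auto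
    also have "\<dots> = 1 / (1 - am m) * Gk 0 \<mu> t s" by (simp add: Gk_def)
    finally have g: "1 / (hq m (Suc n) ?k + l) \<le> 1 / (1 - am m) * Gk 0 \<mu> t s" .
    have "cmod (Poi m n l \<eta> ?k) = (?f K t * ?f K s) * (1 / (hq m (Suc n) ?k + l))"
      using hq_pos[OF m l, of "Suc n" ?k] unfolding Poi_def n' drop1_pcons drop0_pcons2 by (simp add: norm_mult norm_divide del: of_real_add)
    also have "\<dots> \<le> (?f K t * ?f K s) * (1 / (1 - am m) * Gk 0 \<mu> t s)" by (rule mult_left_mono[OF g]) simp
    finally show ?thesis by (simp add: abs_mult mult_ac)
  qed
  have "(\<integral>\<^sup>+k. ennreal (cmod (Poi m n l \<eta> k)) \<partial>Mc (Suc n))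
    = (\<integral>\<^sup>+k'. \<integral>\<^sup>+s. ennreal (cmod (Poi m n l \<eta> (pcons n s k'))) \<partial>lb3 \<partial>Mc n)"
    by (rule nn_integral_Mc_Suc) measurable
  also have "\<dots> = (\<integral>\<^sup>+K. \<integral>\<^sup>+t. \<integral>\<^sup>+s. ennreal (cmod (Poi m n l \<eta> (pcons n s (pcons n' t K)))) \<partial>lb3 \<partial>lb3 \<partial>Mc n')"
    unfolding n' by (rule nn_integral_Mc_Suc) measurable
  also have "\<dots> \<le> (\<integral>\<^sup>+K. \<integral>\<^sup>+t. \<integral>\<^sup>+s. ennreal (1 / (1 - am m) * (\<bar>?f K t * ?f K s\<bar> * Gk 0 \<mu> t s)) \<partial>lb3 \<partial>lb3 \<partial>Mc n')"
    by (intro nn_integral_mono ennreal_leI pt)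
  also have "\<dots> \<le> (\<integral>\<^sup>+K. ennreal (1 / (1 - am m)) * (ennreal (pi^2 / (1 - 0)) * ((\<integral>\<^sup>+p. ennreal (norm p * (?f K p)^2) \<partial>lb3) + (\<integral>\<^sup>+p. ennreal (norm p * (?f K p)^2) \<partial>lb3))) \<partial>Mc n')"
  proof (rule nn_integral_mono)
    fix K assume K[simp]: "K \<in> space (Mc n')"
    have [measurable]: "?f K \<in> borel_measurable borel" by measurable
    have "(\<integral>\<^sup>+t. \<integral>\<^sup>+s. ennreal (1 / (1 - am m) * (\<bar>?f K t * ?f K s\<bar> * Gk 0 \<mu> t s)) \<partial>lb3 \<partial>lb3)
      = (\<integral>\<^sup>+z. ennreal (1 / (1 - am m) * (\<bar>?f K (fst z) * ?f K (snd z)\<bar> * Gk 0 \<mu> (fst z) (snd z))) \<partial>lb33)"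
      by (subst lborel.nn_integral_fst[symmetric]) auto
    also have "\<dots> = (\<integral>\<^sup>+z. ennreal (1 / (1 - am m)) * ennreal (\<bar>?f K (fst z) * ?f K (snd z)\<bar> * Gk 0 \<mu> (fst z) (snd z)) \<partial>lb33)"
      using a by (intro nn_integral_cong ennreal_mult') simp
    also have "\<dots> = ennreal (1 / (1 - am m)) * (\<integral>\<^sup>+z. ennreal (\<bar>?f K (fst z) * ?f K (snd z)\<bar> * Gk 0 \<mu> (fst z) (snd z)) \<partial>lb33)"
      by (rule nn_integral_cmult) measurable
    also have "\<dots> \<le> ennreal (1 / (1 - am m)) * (ennreal (pi^2 / (1 - 0)) * ((\<integral>\<^sup>+p. ennreal (norm p * (?f K p)^2) \<partial>lb3) + (\<integral>\<^sup>+p. ennreal (norm p * (?f K p)^2) \<partial>lb3)))"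
      by (intro mult_left_mono schur_bound) (use \<mu> in auto)
    finally show "(\<integral>\<^sup>+t. \<integral>\<^sup>+s. ennreal (1 / (1 - am m) * (\<bar>?f K t * ?f K s\<bar> * Gk 0 \<mu> t s)) \<partial>lb3 \<partial>lb3)
      \<le> ennreal (1 / (1 - am m)) * (ennreal (pi^2 / (1 - 0)) * ((\<integral>\<^sup>+p. ennreal (norm p * (?f K p)^2) \<partial>lb3) + (\<integral>\<^sup>+p. ennreal (norm p * (?f K p)^2) \<partial>lb3)))" .
  qed
  also have "\<dots> = (\<integral>\<^sup>+K. ennreal (2 * pi^2 / (1 - am m)) * (\<integral>\<^sup>+p. ennreal (norm p * (?f K p)^2) \<partial>lb3) \<partial>Mc n')"
  proof (rule nn_integral_cong)
    fix K
    let ?I = "\<integral>\<^sup>+p. ennreal (norm p * (?f K p)^2) \<partial>lb3"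
    have "?I + ?I = ennreal 2 * ?I" by (simp add: mult_2)
    then have "ennreal (1 / (1 - am m)) * (ennreal (pi^2 / (1 - 0)) * (?I + ?I)) = (ennreal (1 / (1 - am m)) * ennreal (pi^2 / (1 - 0)) * ennreal 2) * ?I"
      by (simp only: mult.assoc)
    also have "ennreal (1 / (1 - am m)) * ennreal (pi^2 / (1 - 0)) * ennreal 2 = ennreal (2 * pi^2 / (1 - am m))"
      using a by (simp add: ennreal_mult''[symmetric] ennreal_mult[symmetric] mult_ac del: ennreal_numeral)
    finally show "ennreal (1 / (1 - am m)) * (ennreal (pi^2 / (1 - 0)) * (?I + ?I)) = ennreal (2 * pi^2 / (1 - am m)) * ?I" .
  qed
  also have "\<dots> = ennreal (2 * pi^2 / (1 - am m)) * (\<integral>\<^sup>+K. \<integral>\<^sup>+p. ennreal (norm p * (?f K p)^2) \<partial>lb3 \<partial>Mc n')"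
    by (rule nn_integral_cmult) measurable
  also have "\<dots> \<le> ennreal (2 * pi^2 / (1 - am m)) * (\<integral>\<^sup>+K. \<integral>\<^sup>+p. ennreal (wh n (pcons n' p K) * (?f K p)^2) \<partial>lb3 \<partial>Mc n')"
  proof (intro mult_left_mono nn_integral_mono ennreal_leI mult_right_mono)
    show "norm p \<le> wh n (pcons n' p K)" for p K unfolding wh_def n' sqc_pcons by (rule real_le_rsqrt) simp
  qed auto
  also have "(\<integral>\<^sup>+K. \<integral>\<^sup>+p. ennreal (wh n (pcons n' p K) * (?f K p)^2) \<partial>lb3 \<partial>Mc n') = (\<integral>\<^sup>+k. ennreal (wh n k * (cmod (\<eta> k))^2) \<partial>Mc n)"
    unfolding n' by (rule nn_integral_Mc_Suc[symmetric]) measurable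
  finally show ?thesis .
qed

lemma Poi_integrable:
  assumes m: "m > 0" and l: "l > 0" and n: "n \<ge> 1" and \<eta>: "Hh n \<eta>"
  shows "integrable (Mc (Suc n)) (Poi m n l \<eta>)" "\<bar>Po m n l \<eta>\<bar> \<le> real n * (2 * pi^2 / (1 - am m)) * Qh n \<eta>"
proof -
  note a = am[OF m]
  note e = HhD[OF \<eta>]
  have c: "0 \<le> 2 * pi^2 / (1 - am m)" using a by simp
  have b: "(\<integral>\<^sup>+k. ennreal (cmod (Poi m n l \<eta> k)) \<partial>Mc (Suc n)) \<le> ennreal (2 * pi^2 / (1 - am m) * Qh n \<eta>)"
    using Poi_bound[OF m l n e(1)] unfolding Qh_nn[OF \<eta>] ennreal_mult'[OF c] .
  show i: "integrable (Mc (Suc n)) (Poi m n l \<eta>)"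
    using b by (intro integrableI_bounded Poi_measurable[OF e(1) n]) (auto intro: le_less_trans)
  have "\<bar>Re (\<integral>k. Poi m n l \<eta> k \<partial>Mc (Suc n))\<bar> \<le> cmod (\<integral>k. Poi m n l \<eta> k \<partial>Mc (Suc n))" by (rule abs_Re_le_cmod)
  also have "\<dots> \<le> 2 * pi^2 / (1 - am m) * Qh n \<eta>"
  proof -
    have "ennreal (cmod (\<integral>k. Poi m n l \<eta> k \<partial>Mc (Suc n))) \<le> (\<integral>\<^sup>+k. ennreal (cmod (Poi m n l \<eta> k)) \<partial>Mc (Suc n))"
      by (rule integral_norm_bound_ennreal[OF i])
    also note b
    finally show ?thesis unfolding ennreal_le_iff[OF mult_nonneg_nonneg[OF c Qh_nonneg]] .
  qed
  finally have "\<bar>Re (\<integral>k. Poi m n l \<eta> k \<partial>Mc (Suc n))\<bar> \<le> 2 * pi^2 / (1 - am m) * Qh n \<eta>" .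
  from mult_left_mono[OF this, of "real n"] show "\<bar>Po m n l \<eta>\<bar> \<le> real n * (2 * pi^2 / (1 - am m)) * Qh n \<eta>"
    unfolding Po_def abs_mult by (simp only: mult.assoc abs_of_nat of_nat_0_le_iff)
qed

lemma sqrt_Xq_le:
  assumes m: "m > 0" and l: "l \<ge> 0"
  shows "sqrt (Xq m n k + l) \<le> sqrt (1 + real n + l) * wh n k"
proof -
  have "Xq m n k + l \<le> (1 + real n) * sqc n k + l" using Xq_bounds[OF m] by simp
  also have "\<dots> \<le> (1 + real n + l) * (1 + sqc n k)" using l sqc_nonneg[of n k] by (simp add: algebra_simps)
  finally have "sqrt (Xq m n k + l) \<le> sqrt ((1 + real n + l) * (1 + sqc n k))" by simp
  then show ?thesis by (simp only: wh_def real_sqrt_mult)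
qed

lemma Hh_integrable:
  assumes \<eta>: "Hh n \<eta>" and w[measurable]: "w \<in> borel_measurable (Mc n)" and le: "\<And>k. \<bar>w k\<bar> \<le> C * wh n k"
  shows "integrable (Mc n) (\<lambda>k. (cmod (\<eta> k))^2 * w k)" "\<bar>\<integral>k. (cmod (\<eta> k))^2 * w k \<partial>Mc n\<bar> \<le> C * Qh n \<eta>"
proof -
  note e = HhD[OF \<eta>]
  have [measurable]: "\<eta> \<in> borel_measurable (Mc n)" by (rule e)
  have i: "integrable (Mc n) (\<lambda>k. C * (wh n k * (cmod (\<eta> k))^2))" using e(3) by simp
  have b: "norm ((cmod (\<eta> k))^2 * w k) \<le> C * (wh n k * (cmod (\<eta> k))^2)" for k
    using mult_left_mono[OF le[of k], of "(cmod (\<eta> k))^2"] by (simp add: abs_mult mult_ac)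
  show i2: "integrable (Mc n) (\<lambda>k. (cmod (\<eta> k))^2 * w k)"
    by (rule Bochner_Integration.integrable_bound[OF i]) (measurable, intro AE_I2, rule order_trans[OF b], simp)
  have "\<bar>\<integral>k. (cmod (\<eta> k))^2 * w k \<partial>Mc n\<bar> \<le> (\<integral>k. norm ((cmod (\<eta> k))^2 * w k) \<partial>Mc n)"
    using integral_norm_bound[of "Mc n" "\<lambda>k. (cmod (\<eta> k))^2 * w k"] by simp
  also have "\<dots> \<le> (\<integral>k. C * (wh n k * (cmod (\<eta> k))^2) \<partial>Mc n)"
    by (rule integral_mono[OF integrable_norm[OF i2] i b])
  also have "\<dots> = C * Qh n \<eta>" unfolding Qh_def by simp
  finally show "\<bar>\<integral>k. (cmod (\<eta> k))^2 * w k \<partial>Mc n\<bar> \<le> C * Qh n \<eta>" .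
qed

lemma Hh_sqi: assumes \<eta>: "Hh n \<eta>" shows "sqi (Mc n) \<eta>"
proof -
  have "integrable (Mc n) (\<lambda>k. (cmod (\<eta> k))^2 * 1)"
    by (rule Hh_integrable(1)[OF \<eta>, where C=1]) (auto simp: wh_ge1)
  then show ?thesis using HhD[OF \<eta>] by (simp add: sqi_def)
qed

lemma Pd_weight:
  assumes m: "m > 0" and l: "l > 0"
  shows "\<bar>\<alpha> + 2 * pi^2 * sqrt (Xq m n k + l)\<bar> \<le> (\<bar>\<alpha>\<bar> + 2 * pi^2 * sqrt (1 + real n + l)) * wh n k"
proof -
  have "2 * pi^2 * sqrt (Xq m n k + l) \<le> 2 * pi^2 * (sqrt (1 + real n + l) * wh n k)"
    using sqrt_Xq_le[OF m, of l n k] l by (intro mult_left_mono) auto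
  moreover have "0 \<le> 2 * pi^2 * sqrt (Xq m n k + l)" using Xq_bounds(3)[OF m, of n k] l by simp
  moreover have "\<bar>\<alpha>\<bar> * 1 \<le> \<bar>\<alpha>\<bar> * wh n k" using wh_ge1 by (intro mult_left_mono) auto
  ultimately show ?thesis using abs_ge_self[of \<alpha>] abs_ge_minus_self[of \<alpha>]
    unfolding distrib_right mult.assoc abs_le_iff by (intro conjI) linarith+
qed

lemma Pd_integrable:
  assumes m: "m > 0" and l: "l > 0" and \<eta>: "Hh n \<eta>"
  shows "integrable (Mc n) (\<lambda>k. (cmod (\<eta> k))^2 * (\<alpha> + 2 * pi^2 * sqrt (Xq m n k + l)))"
    "\<bar>Pd m n l \<alpha> \<eta>\<bar> \<le> (\<bar>\<alpha>\<bar> + 2 * pi^2 * sqrt (1 + real n + l)) * Qh n \<eta>"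
  unfolding Pd_def by (rule Hh_integrable[OF \<eta> _ Pd_weight[OF m l]], measurable)+

lemma PP_abs_le:
  assumes m: "m > 0" and l: "l > 0" and n: "n \<ge> 1"
  obtains C where "C \<ge> 0" "\<And>\<eta>. Hh n \<eta> \<Longrightarrow> \<bar>PP m n l \<alpha> \<eta>\<bar> \<le> C * Qh n \<eta>"
proof
  let ?C1 = "\<bar>\<alpha>\<bar> + 2 * pi^2 * sqrt (1 + real n + l)" and ?C2 = "real n * (2 * pi^2 / (1 - am m))"
  show "?C1 + ?C2 \<ge> 0" using am[OF m] l by (intro add_nonneg_nonneg mult_nonneg_nonneg divide_nonneg_nonneg) auto
  fix \<eta> assume \<eta>: "Hh n \<eta>"
  show "\<bar>PP m n l \<alpha> \<eta>\<bar> \<le> (?C1 + ?C2) * Qh n \<eta>"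
    unfolding PP_def distrib_right[of ?C1 ?C2] using Pd_integrable(2)[OF m l \<eta>, of \<alpha>] Poi_integrable(2)[OF m l n \<eta>] by linarith
qed

section \<open>The resolvent identity for charges\<close>

definition Bf :: "nat \<Rightarrow> (cfg \<Rightarrow> complex) \<Rightarrow> cfg \<Rightarrow> complex" where
  "Bf n \<eta> k = (\<Sum>i<Suc n. (-1)^i * \<eta> (drop_idx (Suc n) i k))"

lemma bw_Bf: "bw n \<eta> W k = complex_of_real (sqrt (W k)) * Bf n \<eta> k"
  by (simp add: bw_def uw_def Bf_def sum_distrib_left mult_ac del: sum.lessThan_Suc)

lemma Bf_measurable: assumes [measurable]: "\<eta> \<in> borel_measurable (Mc n)" shows "Bf n \<eta> \<in> borel_measurable (Mc (Suc n))"
  unfolding Bf_def[abs_def]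
proof (intro borel_measurable_sum borel_measurable_times)
  fix i assume "i \<in> {..<Suc n}"
  then have [measurable]: "drop_idx (Suc n) i \<in> measurable (Mc (Suc n)) (Mc n)" by (intro drop_idx_measurable) auto
  show "(\<lambda>k. \<eta> (drop_idx (Suc n) i k)) \<in> borel_measurable (Mc (Suc n))" by measurable
qed simp

text \<open>After deletion of index 0 the charge does not depend on the first momentum, so only the
  integral V of the weight over that momentum survives.\<close>

lemma nn_tail:
  assumes [measurable]: "\<eta> \<in> borel_measurable (Mc n)" "W \<in> borel_measurable (Mc (Suc n))" and W0: "\<And>k. 0 \<le> W k"
    and I: "\<And>k. k \<in> space (Mc n) \<Longrightarrow> (\<integral>\<^sup>+s. ennreal (W (pcons n s k)) \<partial>lb3) = ennreal (V k)"
  shows "(\<integral>\<^sup>+k. ennreal ((cmod (uw n \<eta> W 0 k))^2) \<partial>Mc (Suc n)) = (\<integral>\<^sup>+k. ennreal ((cmod (\<eta> k))^2 * V k) \<partial>Mc n)"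
    "uw n \<eta> W 0 \<in> borel_measurable (Mc (Suc n))"
proof -
  have [measurable]: "drop_idx (Suc n) 0 \<in> measurable (Mc (Suc n)) (Mc n)" by (intro drop_idx_measurable) auto
  show [measurable]: "uw n \<eta> W 0 \<in> borel_measurable (Mc (Suc n))" unfolding uw_def[abs_def] by measurable
  have "(\<integral>\<^sup>+k. ennreal ((cmod (uw n \<eta> W 0 k))^2) \<partial>Mc (Suc n)) = (\<integral>\<^sup>+k'. \<integral>\<^sup>+s. ennreal ((cmod (uw n \<eta> W 0 (pcons n s k')))^2) \<partial>lb3 \<partial>Mc n)"
    by (rule nn_integral_Mc_Suc) measurable
  also have "\<dots> = (\<integral>\<^sup>+k. ennreal ((cmod (\<eta> k))^2 * V k) \<partial>Mc n)"
  proof (rule nn_integral_cong)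
    fix k assume k: "k \<in> space (Mc n)"
    have "(\<integral>\<^sup>+s. ennreal ((cmod (uw n \<eta> W 0 (pcons n s k)))^2) \<partial>lb3) = (\<integral>\<^sup>+s. ennreal ((cmod (\<eta> k))^2) * ennreal (W (pcons n s k)) \<partial>lb3)"
      by (intro nn_integral_cong)
         (simp add: uw_def drop_idx_pcons[OF k] norm_mult power_mult_distrib W0 ennreal_mult'[symmetric] mult.commute)
    also have "\<dots> = ennreal ((cmod (\<eta> k))^2) * (\<integral>\<^sup>+s. ennreal (W (pcons n s k)) \<partial>lb3)"
      using k by (intro nn_integral_cmult) measurable
    also have "\<dots> = ennreal ((cmod (\<eta> k))^2 * V k)" unfolding I[OF k] by (rule ennreal_mult'[symmetric]) simp
    finally show "(\<integral>\<^sup>+s. ennreal ((cmod (uw n \<eta> W 0 (pcons n s k)))^2) \<partial>lb3) = ennreal ((cmod (\<eta> k))^2 * V k)" .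
  qed
  finally show "(\<integral>\<^sup>+k. ennreal ((cmod (uw n \<eta> W 0 k))^2) \<partial>Mc (Suc n)) = (\<integral>\<^sup>+k. ennreal ((cmod (\<eta> k))^2 * V k) \<partial>Mc n)" .
qed

lemma nn_tail_sqi:
  assumes "\<eta> \<in> borel_measurable (Mc n)" "W \<in> borel_measurable (Mc (Suc n))" "\<And>k. 0 \<le> W k"
    and "\<And>k. k \<in> space (Mc n) \<Longrightarrow> (\<integral>\<^sup>+s. ennreal (W (pcons n s k)) \<partial>lb3) = ennreal (V k)"
    and V: "integrable (Mc n) (\<lambda>k. (cmod (\<eta> k))^2 * V k)" "\<And>k. 0 \<le> V k"
  shows "sqi (Mc (Suc n)) (uw n \<eta> W 0)" "(nrm (Mc (Suc n)) (uw n \<eta> W 0))^2 = (\<integral>k. (cmod (\<eta> k))^2 * V k \<partial>Mc n)"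
proof -
  note t = nn_tail[OF assms(1-4)]
  have e: "(\<integral>\<^sup>+k. ennreal ((cmod (uw n \<eta> W 0 k))^2) \<partial>Mc (Suc n)) = ennreal (\<integral>k. (cmod (\<eta> k))^2 * V k \<partial>Mc n)"
    by (rule trans[OF t(1) nn_integral_eq_integral[OF V(1)]]) (use V(2) in auto)
  show s: "sqi (Mc (Suc n)) (uw n \<eta> W 0)" unfolding sqi_iff_nn using t(2) e by auto
  have "ennreal ((nrm (Mc (Suc n)) (uw n \<eta> W 0))^2) = ennreal (\<integral>k. (cmod (\<eta> k))^2 * V k \<partial>Mc n)" using nn_nrm[OF s] e by simp
  then show "(nrm (Mc (Suc n)) (uw n \<eta> W 0))^2 = (\<integral>k. (cmod (\<eta> k))^2 * V k \<partial>Mc n)"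
    using V(2) by (subst (asm) ennreal_inj) auto
qed

text \<open>\<open>weighted_norm\<close> with the difference of resolvents as weight: the diagonal
  pairing becomes the change of \<open>Pd\<close> by \<open>resolvent_diff\<close>, the pairing of
  deletions 1 and 0 the change of \<open>Po\<close>. A difference is taken because |B|^2 / (h + l)
  alone is in general not integrable.\<close>

lemma Phi_resolvent_identity:
  assumes m: "m > 0" and l: "0 < l" "l \<le> l'" and n: "n \<ge> 1" and \<eta>: "Hh n \<eta>"
  defines "D \<equiv> \<lambda>k. 1 / (hq m (Suc n) k + l) - 1 / (hq m (Suc n) k + l')"
  shows "integrable (Mc (Suc n)) (\<lambda>k. D k * (cmod (Bf n \<eta> k))^2)"
    "(\<integral>k. D k * (cmod (Bf n \<eta> k))^2 \<partial>Mc (Suc n)) = real (Suc n) * (PP m n l' \<alpha> \<eta> - PP m n l \<alpha> \<eta>)"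
proof -
  note e = HhD[OF \<eta>]
  note [measurable] = e(1)
  have l': "l' > 0" using l by simp
  have Dm[measurable]: "D \<in> borel_measurable (Mc (Suc n))" unfolding D_def by measurable
  have D0: "0 \<le> D k" for k
    unfolding D_def using hq_pos[OF m l(1), of "Suc n" k] l by (simp add: frac_le)
  let ?V = "\<lambda>k. 2 * pi^2 * (sqrt (Xq m n k + l') - sqrt (Xq m n k + l))"
  have V: "(\<integral>\<^sup>+s. ennreal (D (pcons n s k)) \<partial>lb3) = ennreal (?V k)" for k
    unfolding D_def hq_pcons[OF m] by (rule resolvent_diff[OF Xq_bounds(3)[OF m] l])
  note i = Pd_integrable(1)[OF m _ \<eta>, where \<alpha>=\<alpha>]
  have eq: "(cmod (\<eta> k))^2 * ?V k = (cmod (\<eta> k))^2 * (\<alpha> + 2 * pi^2 * sqrt (Xq m n k + l')) - (cmod (\<eta> k))^2 * (\<alpha> + 2 * pi^2 * sqrt (Xq m n k + l))" for k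
    by (simp add: algebra_simps)
  have Vi: "integrable (Mc n) (\<lambda>k. (cmod (\<eta> k))^2 * ?V k)" unfolding eq by (intro Bochner_Integration.integrable_diff i l l')
  have "(\<integral>k. (cmod (\<eta> k))^2 * ?V k \<partial>Mc n) = Pd m n l' \<alpha> \<eta> - Pd m n l \<alpha> \<eta>"
    unfolding eq Pd_def by (intro Bochner_Integration.integral_diff i l l')
  then have u: "sqi (Mc (Suc n)) (uw n \<eta> D 0)" "(nrm (Mc (Suc n)) (uw n \<eta> D 0))^2 = Pd m n l' \<alpha> \<eta> - Pd m n l \<alpha> \<eta>"
    using nn_tail_sqi[OF e(1) Dm D0 V Vi] l by auto
  have Dsw: "D (sw i (Suc i) k) = D k" if "Suc i < Suc n" for i k
    unfolding D_def using hq_sw[OF m, of i "Suc n" "Suc i" k] that by simp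
  \<comment> \<open>\<open>Poi\<close> conjugates the deletion of index 1, whereas \<open>ip\<close>
    conjugates that of index 0; the discrepancy disappears in the real part.\<close>
  have Di: "uw n \<eta> D 1 k * cnj (uw n \<eta> D 0 k) = cnj (Poi m n l \<eta> k) - cnj (Poi m n l' \<eta> k)" for k
  proof -
    have "complex_of_real (sqrt (D k)) * complex_of_real (sqrt (D k)) = complex_of_real (D k)"
      using D0[of k] by (simp only: of_real_mult[symmetric] real_sqrt_mult_self abs_of_nonneg)
    then have "uw n \<eta> D 1 k * cnj (uw n \<eta> D 0 k) = complex_of_real (D k) * (\<eta> (drop_idx (Suc n) 1 k) * cnj (\<eta> (drop_idx (Suc n) 0 k)))"
      unfolding uw_def by (simp add: mult_ac)
    also have "\<dots> = cnj (Poi m n l \<eta> k) - cnj (Poi m n l' \<eta> k)"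
      unfolding Poi_def D_def of_real_diff by (simp add: algebra_simps)
    finally show ?thesis .
  qed
  have Pi: "integrable (Mc (Suc n)) (\<lambda>k. cnj (Poi m n l \<eta> k))" "integrable (Mc (Suc n)) (\<lambda>k. cnj (Poi m n l' \<eta> k))"
    using Poi_integrable(1)[OF m l(1) n \<eta>] Poi_integrable(1)[OF m l' n \<eta>] by auto
  have "ip (Mc (Suc n)) (uw n \<eta> D 1) (uw n \<eta> D 0) = cnj (\<integral>k. Poi m n l \<eta> k \<partial>Mc (Suc n)) - cnj (\<integral>k. Poi m n l' \<eta> k \<partial>Mc (Suc n))"
    unfolding ip_def Di Bochner_Integration.integral_diff[OF Pi] Bochner_Integration.integral_cnj ..
  then have rn: "real n * Re (ip (Mc (Suc n)) (uw n \<eta> D 1) (uw n \<eta> D 0)) = Po m n l \<eta> - Po m n l' \<eta>"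
    unfolding Po_def by (simp add: right_diff_distrib)
  have N: "(nrm (Mc (Suc n)) (bw n \<eta> D))^2 = real (Suc n) * (PP m n l' \<alpha> \<eta> - PP m n l \<alpha> \<eta>)"
  proof -
    have "(nrm (Mc (Suc n)) (bw n \<eta> D))^2 = real (Suc n) * ((nrm (Mc (Suc n)) (uw n \<eta> D 0))^2 - real n * Re (ip (Mc (Suc n)) (uw n \<eta> D 1) (uw n \<eta> D 0)))"
      by (rule weighted_norm[OF e(2) Dsw u(1)])
    with rn u(2) show ?thesis unfolding PP_def by (simp only:) (simp add: algebra_simps)
  qed
  have b: "(cmod (bw n \<eta> D k))^2 = D k * (cmod (Bf n \<eta> k))^2" for k
    using D0[of k] by (simp add: bw_Bf norm_mult power_mult_distrib)
  show "integrable (Mc (Suc n)) (\<lambda>k. D k * (cmod (Bf n \<eta> k))^2)"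
    using sqi_bw[OF e(2) Dsw u(1)] unfolding b[symmetric] by auto
  show "(\<integral>k. D k * (cmod (Bf n \<eta> k))^2 \<partial>Mc (Suc n)) = real (Suc n) * (PP m n l' \<alpha> \<eta> - PP m n l \<alpha> \<eta>)"
    using N unfolding nrm_sq b .
qed

lemma Ghat_Bf: "Ghat m (Suc n) l \<xi> k = complex_of_real (1 / (hq m (Suc n) k + l)) * Bf n (FT n \<xi>) k"
  unfolding Ghat_def Bf_def G_lam_hq sum_distrib_left by (intro sum.cong refl) (simp add: mult_ac)

text \<open>The same scheme with the squared resolvent as weight. Its integral over one momentum,
  pi^2 / sqrt (Xq + l), is bounded, so the potential of a charge is an antisymmetric L2
  function.\<close>

lemma resolvent_Bf:
  assumes m: "m > 0" and l: "0 < l" and \<eta>: "Hh n \<eta>"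
  shows "sqi (Mc (Suc n)) (\<lambda>k. complex_of_real (1 / (hq m (Suc n) k + l)) * Bf n \<eta> k)"
    "antisym_f (Suc n) (\<lambda>k. complex_of_real (1 / (hq m (Suc n) k + l)) * Bf n \<eta> k)"
proof -
  note e = HhD[OF \<eta>]
  note [measurable] = e(1)
  define W where "W k = (1 / (hq m (Suc n) k + l))^2" for k
  have Wm: "W \<in> borel_measurable (Mc (Suc n))" unfolding W_def[abs_def] by measurable
  have W0: "0 \<le> W k" for k by (simp add: W_def)
  let ?V = "\<lambda>k. pi^2 / sqrt (Xq m n k + l)"
  have Vb: "\<bar>?V k\<bar> \<le> pi^2 / sqrt l * wh n k" for k
  proof -
    have "sqrt l \<le> sqrt (Xq m n k + l)" using Xq_bounds(3)[OF m, of n k] by simp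
    then have "?V k \<le> pi^2 / sqrt l * 1" using l by (simp add: frac_le)
    also have "\<dots> \<le> pi^2 / sqrt l * wh n k" using l wh_ge1 by (intro mult_left_mono) auto
    finally show ?thesis using Xq_bounds(3)[OF m, of n k] l by simp
  qed
  have V: "(\<integral>\<^sup>+s. ennreal (W (pcons n s k)) \<partial>lb3) = ennreal (?V k)" for k
    unfolding W_def hq_pcons[OF m] using resolvent_sq[of "Xq m n k + l"] Xq_bounds(3)[OF m, of n k] l
    by (simp add: power_divide add.assoc)
  have Vi: "integrable (Mc n) (\<lambda>k. (cmod (\<eta> k))^2 * ?V k)" by (rule Hh_integrable(1)[OF \<eta> _ Vb]) measurable
  have u: "sqi (Mc (Suc n)) (uw n \<eta> W 0)"
    using Xq_bounds(3)[OF m] l by (intro nn_tail_sqi(1)[OF e(1) Wm W0 V Vi]) auto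
  have Wsw: "W (sw i (Suc i) k) = W k" if "Suc i < Suc n" for i k
    unfolding W_def using hq_sw[OF m, of i "Suc n" "Suc i" k] that by simp
  have b: "bw n \<eta> W = (\<lambda>k. complex_of_real (1 / (hq m (Suc n) k + l)) * Bf n \<eta> k)"
  proof
    fix k
    have "sqrt (W k) = 1 / (hq m (Suc n) k + l)" using hq_pos[OF m l, of "Suc n" k] by (simp add: W_def real_sqrt_divide)
    then show "bw n \<eta> W k = complex_of_real (1 / (hq m (Suc n) k + l)) * Bf n \<eta> k" unfolding bw_Bf by simp
  qed
  show "sqi (Mc (Suc n)) (\<lambda>k. complex_of_real (1 / (hq m (Suc n) k + l)) * Bf n \<eta> k)"
    using sqi_bw[OF e(2) Wsw u] unfolding b .
  show "antisym_f (Suc n) (\<lambda>k. complex_of_real (1 / (hq m (Suc n) k + l)) * Bf n \<eta> k)"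
    using bw_antisym[OF e(2) Wsw u] unfolding b .
qed

section \<open>Sharp lower bound of the off-diagonal part\<close>

lemma lb3_translate:
  fixes F :: "real^3 \<Rightarrow> 'a::{banach, second_countable_topology}"
  assumes F: "F \<in> borel_measurable borel"
  shows "(\<integral>x. F (x - c) \<partial>lb3) = (\<integral>x. F x \<partial>lb3)" "integrable lb3 (\<lambda>x. F (x - c)) \<longleftrightarrow> integrable lb3 F"
proof -
  have m: "(+) (- c) \<in> measurable lb3 borel" by measurable
  have "(\<integral>x. F x \<partial>lb3) = (\<integral>x. F x \<partial>distr lborel borel ((+) (- c)))" by (simp only: lborel_distr_plus)
  also have "\<dots> = (\<integral>x. F (x - c) \<partial>lb3)" by (subst integral_distr[OF m F]) simp
  finally show "(\<integral>x. F (x - c) \<partial>lb3) = (\<integral>x. F x \<partial>lb3)" ..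
  have "integrable lb3 F \<longleftrightarrow> integrable (distr lborel borel ((+) (- c))) F" by (simp only: lborel_distr_plus)
  also have "\<dots> \<longleftrightarrow> integrable lb3 (\<lambda>x. F (x - c))" by (subst integrable_distr_eq[OF m F]) simp
  finally show "integrable lb3 (\<lambda>x. F (x - c)) \<longleftrightarrow> integrable lb3 F" ..
qed

lemma norm_add_sq: "(norm (x + y :: real^3))^2 = (norm x)^2 + 2 * (x \<bullet> y) + (norm y)^2"
  by (simp add: power2_norm_eq_inner inner_add_left inner_add_right inner_commute)

lemma norm_scale_sq: "(norm (c *\<^sub>R x :: real^3))^2 = c^2 * (norm x)^2"
  by (simp add: power_mult_distrib)

text \<open>Translating the two active momenta by \<open>a/(1 + a)\<close> times the total spectator momentum removes the
  linear terms; \<open>mu0\<close> is the constant that remains, the same in both quadratic forms.\<close>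
definition mu0 :: "real \<Rightarrow> nat \<Rightarrow> cfg \<Rightarrow> real" where
  "mu0 m n K = (1 - am m) * sqc n K + am m * (1 - am m) / (1 + am m) * (norm (Sg n K))^2"

text \<open>The value c = a / (1 + a) kills the linear terms of both symbols, which are the first
  two identities; the other two say that the constants left over coincide.\<close>

lemma shift_coeff:
  assumes a: "0 < (a::real)"
  defines "c \<equiv> a / (1 + a)"
  shows "(1 - a) * c = a * (1 - 2 * c)" "(1 - a) * c = a * (1 - a) * (1 - c)"
    "2 * ((1 - a) * c^2) + a * (1 - 2 * c)^2 = a * (1 - a) / (1 + a)"
    "(1 - a) * c^2 + a * (1 - a) * (1 - c)^2 = a * (1 - a) / (1 + a)"
proof -
  have ne: "1 + a \<noteq> 0" using a by simp
  show "(1 - a) * c = a * (1 - 2 * c)" "(1 - a) * c = a * (1 - a) * (1 - c)"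
    "2 * ((1 - a) * c^2) + a * (1 - 2 * c)^2 = a * (1 - a) / (1 + a)"
    "(1 - a) * c^2 + a * (1 - a) * (1 - c)^2 = a * (1 - a) / (1 + a)"
    using ne unfolding c_def by (simp_all add: divide_simps) (simp_all add: algebra_simps power2_eq_square)
qed

text \<open>The coefficient 1 - a^2 of |p|^2, against 1 in \<open>hq_shift\<close>, is what puts
  sqrt (1 - a^2) into the denominator of \<Lambda>.\<close>

lemma Xq_shift:
  assumes m: "m > 0"
  shows "Xq m (Suc n) (pcons n (p - (am m / (1 + am m)) *\<^sub>R Sg n K) K) = (1 - (am m)^2) * (norm p)^2 + mu0 m n K"
proof -
  define a where "a = am m" define c where "c = a / (1 + a)" define P where "P = Sg n K"
  have a: "0 < a" using am[OF m] by (simp add: a_def)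
  note sc = shift_coeff[OF a, folded c_def]
  have 1: "(norm (p - c *\<^sub>R P))^2 = (norm p)^2 - 2 * c * (p \<bullet> P) + c^2 * (norm P)^2"
    using norm_add_sq[of p "(- c) *\<^sub>R P"] unfolding norm_scale_sq by simp
  have e2: "p - c *\<^sub>R P + P = p + (1 - c) *\<^sub>R P" by (simp add: scaleR_left_diff_distrib)
  have 2: "(norm (p - c *\<^sub>R P + P))^2 = (norm p)^2 + 2 * (1 - c) * (p \<bullet> P) + (1 - c)^2 * (norm P)^2"
    unfolding e2 norm_add_sq norm_scale_sq by simp
  have "(1 - a) * ((norm p)^2 - 2 * c * (p \<bullet> P) + c^2 * (norm P)^2 + sqc n K) + a * (1 - a) * ((norm p)^2 + 2 * (1 - c) * (p \<bullet> P) + (1 - c)^2 * (norm P)^2)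
    = (1 - a^2) * (norm p)^2 + (1 - a) * sqc n K + 2 * (p \<bullet> P) * (a * (1 - a) * (1 - c) - (1 - a) * c) + ((1 - a) * c^2 + a * (1 - a) * (1 - c)^2) * (norm P)^2"
    by (simp add: algebra_simps power2_eq_square)
  also have "\<dots> = (1 - a^2) * (norm p)^2 + ((1 - a) * sqc n K + a * (1 - a) / (1 + a) * (norm P)^2)"
    unfolding sc(4) sc(2)[symmetric] by simp
  finally show ?thesis unfolding Xq_eq[OF m] sqc_pcons Sg_pcons mu0_def a_def[symmetric] c_def[symmetric] P_def[symmetric] 1 2 .
qed

lemma hq_shift:
  assumes m: "m > 0"
  defines "c \<equiv> am m / (1 + am m)"
  shows "hq m (Suc (Suc n)) (pcons (Suc n) (p - c *\<^sub>R Sg n K) (pcons n (q - c *\<^sub>R Sg n K) K))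
    = (norm p)^2 + (norm q)^2 + 2 * am m * (p \<bullet> q) + mu0 m n K"
proof -
  define a where "a = am m" define P where "P = Sg n K"
  have a: "0 < a" using am[OF m] by (simp add: a_def)
  have c: "c = a / (1 + a)" by (simp add: c_def a_def)
  note sc = shift_coeff[OF a, folded c]
  have 1: "(norm (x - c *\<^sub>R P))^2 = (norm x)^2 - 2 * c * (x \<bullet> P) + c^2 * (norm P)^2" for x
    using norm_add_sq[of x "(- c) *\<^sub>R P"] unfolding norm_scale_sq by simp
  have e3: "(1 - 2 * c) *\<^sub>R P = ((1 - c) - c) *\<^sub>R P" by (rule arg_cong[where f="\<lambda>x. x *\<^sub>R P"]) simp
  have e2: "p - c *\<^sub>R P + (q - c *\<^sub>R P + P) = (p + q) + (1 - 2 * c) *\<^sub>R P"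
    unfolding e3 unfolding scaleR_left_diff_distrib scaleR_one by simp
  have 2: "(norm (p - c *\<^sub>R P + (q - c *\<^sub>R P + P)))^2 = ((norm p)^2 + 2 * (p \<bullet> q) + (norm q)^2) + 2 * (1 - 2 * c) * ((p \<bullet> P) + (q \<bullet> P)) + (1 - 2 * c)^2 * (norm P)^2"
    unfolding e2 norm_add_sq norm_scale_sq by (simp add: inner_add_left)
  have "(1 - a) * (((norm p)^2 - 2 * c * (p \<bullet> P) + c^2 * (norm P)^2) + (((norm q)^2 - 2 * c * (q \<bullet> P) + c^2 * (norm P)^2) + sqc n K))
     + a * (((norm p)^2 + 2 * (p \<bullet> q) + (norm q)^2) + 2 * (1 - 2 * c) * ((p \<bullet> P) + (q \<bullet> P)) + (1 - 2 * c)^2 * (norm P)^2)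
    = (norm p)^2 + (norm q)^2 + 2 * a * (p \<bullet> q) + (1 - a) * sqc n K + 2 * ((p \<bullet> P) + (q \<bullet> P)) * (a * (1 - 2 * c) - (1 - a) * c) + (2 * ((1 - a) * c^2) + a * (1 - 2 * c)^2) * (norm P)^2"
    by (simp add: algebra_simps)
  also have "\<dots> = (norm p)^2 + (norm q)^2 + 2 * a * (p \<bullet> q) + ((1 - a) * sqc n K + a * (1 - a) / (1 + a) * (norm P)^2)"
    unfolding sc(3) sc(1)[symmetric] by simp
  finally show ?thesis unfolding hq_eq[OF m] sqc_pcons Sg_pcons mu0_def a_def[symmetric] P_def[symmetric] 1 2 .
qed

lemma mu0_nonneg: "m > 0 \<Longrightarrow> 0 \<le> mu0 m n K"
  unfolding mu0_def using am[of m] by (intro add_nonneg_nonneg mult_nonneg_nonneg divide_nonneg_nonneg) auto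

definition sa :: "real \<Rightarrow> real" where "sa m = sqrt (1 - (am m)^2)"

lemma sa_pos: assumes "m > 0" shows "0 < sa m"
proof -
  have "0 < m * (m + 2) / (m + 1)^2" using assms by simp
  then show ?thesis unfolding sa_def am(3)[OF assms] by simp
qed

text \<open>With the spectators K fixed, translation by v brings the kernel into the form
  \<open>Gk\<close> with \<mu> = mu0 + l, so \<open>form_lower_bound\<close> applies. The resulting
  weight |p| is then replaced by the diagonal one through sa |p| \<le> sqrt Xq.\<close>

lemma slice_bound:
  assumes m: "m > 0" and l: "l > 0" and f[measurable]: "f \<in> borel_measurable borel"
    and i: "integrable lb3 (\<lambda>s. sqrt (Xq m (Suc n) (pcons n s K)) * (cmod (f s))^2)" and K[simp]: "K \<in> space (Mc n)"
  shows "- (tau (am m) / sa m) * (\<integral>s. sqrt (Xq m (Suc n) (pcons n s K)) * (cmod (f s))^2 \<partial>lb3)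
    \<le> Re (\<integral>t. (\<integral>s. cnj (f s) * f t * complex_of_real (1 / (hq m (Suc (Suc n)) (pcons (Suc n) s (pcons n t K)) + l)) \<partial>lb3) \<partial>lb3)"
proof -
  note a = am[OF m]
  have a0: "0 \<le> am m" using a by simp
  define v where "v = (am m / (1 + am m)) *\<^sub>R Sg n K"
  define g where "g p = f (p - v)" for p
  define \<mu> where "\<mu> = mu0 m n K + l"
  have \<mu>: "\<mu> > 0" using mu0_nonneg[OF m, of n K] l by (simp add: \<mu>_def)
  have [measurable]: "g \<in> borel_measurable borel" unfolding g_def[abs_def] by measurable
  let ?Y = "\<lambda>s. sqrt (Xq m (Suc n) (pcons n s K)) * (cmod (f s))^2"
  let ?F = "\<lambda>t s. cnj (f s) * f t * complex_of_real (1 / (hq m (Suc (Suc n)) (pcons (Suc n) s (pcons n t K)) + l))"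
  let ?G = "\<lambda>z. cnj (g (fst z)) * g (snd z) * complex_of_real (Gk (am m) \<mu> (fst z) (snd z))"
  have Y: "integrable lb3 (\<lambda>p. ?Y (p - v))" "(\<integral>p. ?Y (p - v) \<partial>lb3) = (\<integral>s. ?Y s \<partial>lb3)"
    using lb3_translate[of ?Y v] i by auto
  have le: "sa m * (norm p * (cmod (g p))^2) \<le> ?Y (p - v)" for p
  proof -
    have "(sa m * norm p)^2 = (1 - (am m)^2) * (norm p)^2" 
      using sa_pos[OF m] by (simp add: sa_def power_mult_distrib)
    also have "\<dots> \<le> Xq m (Suc n) (pcons n (p - v) K)" unfolding v_def Xq_shift[OF m] using mu0_nonneg[OF m] by simp
    finally have "sa m * norm p \<le> sqrt (Xq m (Suc n) (pcons n (p - v) K))" by (rule real_le_rsqrt)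
    from mult_right_mono[OF this, of "(cmod (g p))^2"] show ?thesis by (simp add: g_def mult.assoc)
  qed
  have gi: "integrable lb3 (\<lambda>p. sa m * (norm p * (cmod (g p))^2))"
  proof (rule Bochner_Integration.integrable_bound[OF Y(1)])
    have "norm (sa m * (norm p * (cmod (g p))^2)) \<le> norm (?Y (p - v))" for p
      using le[of p] sa_pos[OF m] by (simp only: real_norm_def) (simp only: abs_of_nonneg mult_nonneg_nonneg norm_ge_zero zero_le_power less_imp_le order_trans[OF _ abs_ge_self])
    then show "AE p in lb3. norm (sa m * (norm p * (cmod (g p))^2)) \<le> norm (?Y (p - v))" by simp
  qed measurable
  then have gi': "integrable lb3 (\<lambda>p. norm p * (cmod (g p))^2)" using sa_pos[OF m] by simp
  have fin: "(\<integral>\<^sup>+p. ennreal (norm p * (cmod (g p))^2) \<partial>lb3) < \<infinity>"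
    using gi' by (subst nn_integral_eq_integral) auto
  have adm: "adm (\<lambda>p. cmod (g p))" unfolding adm_def using fin by simp
  have Gi: "integrable lb33 ?G"
  proof (rule Bochner_Integration.integrable_bound)
    show "integrable lb33 (\<lambda>z. cmod (g (fst z)) * cmod (g (snd z)) * Gk (am m) \<mu> (fst z) (snd z))"
      using II_Gk[OF a0 a(2) \<mu> adm adm] by (simp add: II_def)
    show "AE z in lb33. norm (?G z) \<le> norm (cmod (g (fst z)) * cmod (g (snd z)) * Gk (am m) \<mu> (fst z) (snd z))"
      by (simp add: norm_mult)
  qed measurable
  have FG: "?F (q - v) (p - v) = ?G (p, q)" for p q
    unfolding v_def hq_shift[OF m] by (simp add: g_def v_def Gk_def \<mu>_def add.assoc)
  have Fm: "(\<lambda>s. ?F t s) \<in> borel_measurable borel" "(\<lambda>t. \<integral>s. ?F t s \<partial>lb3) \<in> borel_measurable borel" for t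
    by measurable
  have "(\<integral>t. \<integral>s. ?F t s \<partial>lb3 \<partial>lb3) = (\<integral>q. \<integral>s. ?F (q - v) s \<partial>lb3 \<partial>lb3)"
    by (rule lb3_translate(1)[OF Fm(2), symmetric])
  also have "\<dots> = (\<integral>q. \<integral>p. ?F (q - v) (p - v) \<partial>lb3 \<partial>lb3)"
    by (intro Bochner_Integration.integral_cong refl lb3_translate(1)[OF Fm(1), symmetric])
  also have "\<dots> = (\<integral>q. \<integral>p. ?G (p, q) \<partial>lb3 \<partial>lb3)" unfolding FG ..
  also have "\<dots> = integral\<^sup>L lb33 ?G"
    using lborel_pair.integral_snd[of "\<lambda>p q. ?G (p, q)"] Gi by (simp add: case_prod_beta')
  finally have eq: "(\<integral>t. \<integral>s. ?F t s \<partial>lb3 \<partial>lb3) = integral\<^sup>L lb33 ?G" .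
  have "sa m * (\<integral>p. norm p * (cmod (g p))^2 \<partial>lb3) = (\<integral>p. sa m * (norm p * (cmod (g p))^2) \<partial>lb3)" by simp
  also have "\<dots> \<le> (\<integral>p. ?Y (p - v) \<partial>lb3)" by (rule integral_mono[OF gi Y(1) le])
  finally have "(\<integral>p. norm p * (cmod (g p))^2 \<partial>lb3) \<le> (\<integral>s. ?Y s \<partial>lb3) / sa m"
    unfolding Y(2) using sa_pos[OF m] by (simp add: pos_le_divide_eq mult.commute)
  from mult_left_mono[OF this, of "tau (am m)"] tau_pos[OF a(1,2)]
  have "- (tau (am m) / sa m) * (\<integral>s. ?Y s \<partial>lb3) \<le> - tau (am m) * (\<integral>p. norm p * (cmod (g p))^2 \<partial>lb3)" by simp
  also have "\<dots> \<le> Re (integral\<^sup>L lb33 ?G)"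
    by (rule form_lower_bound[OF a(1,2) \<mu> _ fin]) measurable
  finally show ?thesis unfolding eq .
qed

text \<open>Integration of \<open>slice_bound\<close> over the spectators, the slices having finite
  weighted norm for almost every K. The prefactor n of \<open>Po\<close> together with tau / sa
  makes up \<Lambda> 2 pi^2.\<close>

lemma Po_lower:
  assumes m: "m > 0" and l: "l > 0" and n: "n \<ge> 1" and \<eta>: "Hh n \<eta>"
  shows "integrable (Mc n) (\<lambda>k. (cmod (\<eta> k))^2 * sqrt (Xq m n k))"
    "- (LambdaMN m (Suc n) * (2 * pi^2)) * (\<integral>k. (cmod (\<eta> k))^2 * sqrt (Xq m n k) \<partial>Mc n) \<le> Po m n l \<eta>"
proof -
  obtain n' where n': "n = Suc n'" using n by (cases n) auto
  note e = HhD[OF \<eta>]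
  have [measurable]: "\<eta> \<in> borel_measurable (Mc (Suc n'))" using e n' by simp
  have \<eta>m[measurable]: "\<eta> \<in> borel_measurable (Mc n)" by (rule e)
  show Xi: "integrable (Mc n) (\<lambda>k. (cmod (\<eta> k))^2 * sqrt (Xq m n k))"
  proof (rule Hh_integrable(1)[OF \<eta>])
    show "\<bar>sqrt (Xq m n k)\<bar> \<le> sqrt (1 + real n + 0) * wh n k" for k
      using sqrt_Xq_le[OF m order_refl, of n k] Xq_bounds(3)[OF m, of n k] by simp
  qed measurable
  let ?Z = "\<lambda>k. sqrt (Xq m n k) * (cmod (\<eta> k))^2"
  have Zi: "integrable (Mc (Suc n')) ?Z" using Xi n' by (simp add: mult.commute)
  note Z = integral_Mc_Suc[OF Zi]
  have Pi: "integrable (Mc (Suc n)) (Poi m n l \<eta>)" by (rule Poi_integrable(1)[OF m l n \<eta>])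
  note P = integral_Mc_Suc[OF Pi]
  note P2 = integral_Mc_Suc[OF P(3)[unfolded n']]
  let ?h = "\<lambda>K. \<integral>t. (\<integral>s. Poi m n l \<eta> (pcons n s (pcons n' t K)) \<partial>lb3) \<partial>lb3"
  have hi: "integrable (Mc n') ?h" using P2(3) n' by simp
  have hI: "(\<integral>k. Poi m n l \<eta> k \<partial>Mc (Suc n)) = (\<integral>K. ?h K \<partial>Mc n')" using P(1) P2(1) n' by simp
  have "(\<integral>K. - (tau (am m) / sa m) * (\<integral>s. ?Z (pcons n' s K) \<partial>lb3) \<partial>Mc n') \<le> (\<integral>K. Re (?h K) \<partial>Mc n')"
  proof (rule integral_mono_AE)
    show "integrable (Mc n') (\<lambda>K. - (tau (am m) / sa m) * (\<integral>s. ?Z (pcons n' s K) \<partial>lb3))" using Z(3) by simp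
    show "integrable (Mc n') (\<lambda>K. Re (?h K))" using hi by simp
    show "AE K in Mc n'. - (tau (am m) / sa m) * (\<integral>s. ?Z (pcons n' s K) \<partial>lb3) \<le> Re (?h K)"
      using Z(2) AE_space
    proof eventually_elim
      case (elim K)
      note [simp] = elim(2)
      have fm: "(\<lambda>s. \<eta> (pcons n' s K)) \<in> borel_measurable borel" by measurable
      show ?case
        using slice_bound[OF m l fm _ elim(2)] elim(1) unfolding Poi_def n' drop1_pcons drop0_pcons2 by simp
    qed
  qed
  also have "\<dots> = Re (\<integral>k. Poi m n l \<eta> k \<partial>Mc (Suc n))" unfolding hI by (rule integral_Re[OF hi])
  also have "(\<integral>K. - (tau (am m) / sa m) * (\<integral>s. ?Z (pcons n' s K) \<partial>lb3) \<partial>Mc n') = - (tau (am m) / sa m) * (\<integral>k. (cmod (\<eta> k))^2 * sqrt (Xq m n k) \<partial>Mc n)"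
    unfolding n' using Z(1) n' by (simp add: mult.commute)
  finally have b: "- (tau (am m) / sa m) * (\<integral>k. (cmod (\<eta> k))^2 * sqrt (Xq m n k) \<partial>Mc n) \<le> Re (\<integral>k. Poi m n l \<eta> k \<partial>Mc (Suc n))" .
  have L: "LambdaMN m (Suc n) * (2 * pi^2) = real n * (tau (am m) / sa m)"
    using Lambda_tau[OF m, of "Suc n"] sa_pos[OF m] unfolding sa_def[symmetric] by (simp add: field_simps)
  from mult_left_mono[OF b, of "real n"] show "- (LambdaMN m (Suc n) * (2 * pi^2)) * (\<integral>k. (cmod (\<eta> k))^2 * sqrt (Xq m n k) \<partial>Mc n) \<le> Po m n l \<eta>"
    unfolding L Po_def by (simp add: mult.assoc)
qed

text \<open>The first inequality is Cauchy-Schwarz for the vectors (L, sqrt (1 - L^2)) and (sqrt X,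
  sqrt l); it is sharp at X = L^2 l / (1 - L^2). The second keeps a multiple of sqrt (X + l), which
  coercivity needs.\<close>

lemma sqrt_gap:
  assumes X: "X \<ge> 0" and l: "l > 0" and L: "0 \<le> L" "L < 1"
  shows "L * sqrt X + sqrt (l * (1 - L^2)) \<le> sqrt (X + l)" "(1 - L) * sqrt (X + l) \<le> sqrt (X + l) - L * sqrt X"
proof -
  define x where "x = sqrt X" define y where "y = sqrt l" define s where "s = sqrt (1 - L^2)"
  have L2: "L^2 \<le> 1" using L by (simp add: power_le_one)
  have e: "x^2 = X" "y^2 = l" "s^2 = 1 - L^2" using X l L2 by (auto simp: x_def y_def s_def)
  have "(L * x + y * s)^2 = L^2 * x^2 + y^2 * s^2 + 2 * (L * y) * (x * s)" by (simp add: power2_eq_square algebra_simps)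
  also have "\<dots> \<le> L^2 * x^2 + y^2 * s^2 + ((L * y)^2 + (x * s)^2)" using sum_squares_bound[of "L * y" "x * s"] by simp
  also have "\<dots> = x^2 * (L^2 + s^2) + y^2 * (s^2 + L^2)" by (simp add: power_mult_distrib algebra_simps)
  also have "\<dots> = X + l" using e by simp
  finally have "L * x + y * s \<le> sqrt (X + l)" by (rule real_le_rsqrt)
  then show "L * sqrt X + sqrt (l * (1 - L^2)) \<le> sqrt (X + l)" by (simp add: x_def y_def s_def real_sqrt_mult)
  have "L * sqrt X \<le> L * sqrt (X + l)" using L l by (intro mult_left_mono) auto
  then show "(1 - L) * sqrt (X + l) \<le> sqrt (X + l) - L * sqrt X" by (simp add: left_diff_distrib)
qed

text \<open>Common source of positivity and coercivity: once the off-diagonal part is absorbed, any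
  weight lying pointwise below the remaining symbol bounds the form from below.\<close>

lemma PP_lower:
  assumes m: "m > 0" and l: "l > 0" and n: "n \<ge> 1" and \<eta>: "Hh n \<eta>"
    and w: "w \<in> borel_measurable (Mc n)" "\<And>k. \<bar>w k\<bar> \<le> C * wh n k"
    and le: "\<And>k. w k \<le> \<alpha> + 2 * pi^2 * (sqrt (Xq m n k + l) - LambdaMN m (Suc n) * sqrt (Xq m n k))"
  shows "(\<integral>k. (cmod (\<eta> k))^2 * w k \<partial>Mc n) \<le> PP m n l \<alpha> \<eta>"
proof -
  let ?L = "LambdaMN m (Suc n)"
  note P = Po_lower[OF m l n \<eta>]
  note D = Pd_integrable(1)[OF m l \<eta>, of \<alpha>]
  have eq: "(cmod (\<eta> k))^2 * (\<alpha> + 2 * pi^2 * (sqrt (Xq m n k + l) - ?L * sqrt (Xq m n k)))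
    = (cmod (\<eta> k))^2 * (\<alpha> + 2 * pi^2 * sqrt (Xq m n k + l)) - (?L * (2 * pi^2)) * ((cmod (\<eta> k))^2 * sqrt (Xq m n k))" for k
    by (simp add: algebra_simps)
  have i2: "integrable (Mc n) (\<lambda>k. (?L * (2 * pi^2)) * ((cmod (\<eta> k))^2 * sqrt (Xq m n k)))" using P(1) by simp
  have "(\<integral>k. (cmod (\<eta> k))^2 * w k \<partial>Mc n) \<le> (\<integral>k. (cmod (\<eta> k))^2 * (\<alpha> + 2 * pi^2 * (sqrt (Xq m n k + l) - ?L * sqrt (Xq m n k))) \<partial>Mc n)"
  proof (rule integral_mono)
    show "integrable (Mc n) (\<lambda>k. (cmod (\<eta> k))^2 * w k)" by (rule Hh_integrable(1)[OF \<eta> w])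
    show "integrable (Mc n) (\<lambda>k. (cmod (\<eta> k))^2 * (\<alpha> + 2 * pi^2 * (sqrt (Xq m n k + l) - ?L * sqrt (Xq m n k))))"
      unfolding eq by (rule Bochner_Integration.integrable_diff[OF D i2])
  qed (intro mult_left_mono le, simp)
  also have "\<dots> = Pd m n l \<alpha> \<eta> - (?L * (2 * pi^2)) * (\<integral>k. (cmod (\<eta> k))^2 * sqrt (Xq m n k) \<partial>Mc n)"
    unfolding eq Bochner_Integration.integral_diff[OF D i2] Pd_def by simp
  also have "\<dots> \<le> PP m n l \<alpha> \<eta>" using P(2) unfolding PP_def by simp
  finally show ?thesis .
qed

lemma PP_nonneg:
  assumes m: "m > 0" and l: "l > 0" and n: "n \<ge> 1" and \<eta>: "Hh n \<eta>" and L: "LambdaMN m (Suc n) < 1"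
    and \<alpha>: "0 \<le> \<alpha> + 2 * pi^2 * sqrt (l * (1 - (LambdaMN m (Suc n))^2))"
  shows "0 \<le> PP m n l \<alpha> \<eta>"
proof -
  have "(\<integral>k. (cmod (\<eta> k))^2 * 0 \<partial>Mc n) \<le> PP m n l \<alpha> \<eta>"
  proof (rule PP_lower[OF m l n \<eta>])
    fix k
    have "sqrt (l * (1 - (LambdaMN m (Suc n))^2)) \<le> sqrt (Xq m n k + l) - LambdaMN m (Suc n) * sqrt (Xq m n k)"
      using sqrt_gap(1)[OF Xq_bounds(3)[OF m] l Lambda_nonneg[OF m] L, of n k] by simp
    then have "2 * pi^2 * sqrt (l * (1 - (LambdaMN m (Suc n))^2)) \<le> 2 * pi^2 * (sqrt (Xq m n k + l) - LambdaMN m (Suc n) * sqrt (Xq m n k))"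
      by (rule mult_left_mono) simp
    then show "0 \<le> \<alpha> + 2 * pi^2 * (sqrt (Xq m n k + l) - LambdaMN m (Suc n) * sqrt (Xq m n k))" using \<alpha> by linarith
    show "\<bar>0\<bar> \<le> 0 * wh n k" by simp
  qed simp
  then show ?thesis by simp
qed

text \<open>The gap leaves 2 pi^2 (1 - \<Lambda>) sqrt (X + l). One half absorbs \<alpha>, for which
  l must be large; the other half dominates both the weight \<open>wh\<close> and the constant sqrt
  l.\<close>

lemma PP_coercive:
  assumes m: "m > 0" and n: "n \<ge> 1" and L: "LambdaMN m (Suc n) < 1"
    and l: "l \<ge> 1" "\<bar>\<alpha>\<bar> \<le> pi^2 * (1 - LambdaMN m (Suc n)) * sqrt l" and \<eta>: "Hh n \<eta>"
  shows "pi^2 * (1 - LambdaMN m (Suc n)) * sqrt (1 - am m) * Qh n \<eta> \<le> PP m n l \<alpha> \<eta>"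
    "pi^2 * (1 - LambdaMN m (Suc n)) * sqrt l * (nrm (Mc n) \<eta>)^2 \<le> PP m n l \<alpha> \<eta>"
proof -
  let ?L = "LambdaMN m (Suc n)" let ?c = "pi^2 * (1 - ?L)"
  have l0: "l > 0" using l by simp
  have c: "?c \<ge> 0" using L by simp
  have lower: "?c * sqrt (Xq m n k + l) \<le> \<alpha> + 2 * pi^2 * (sqrt (Xq m n k + l) - ?L * sqrt (Xq m n k))" for k
  proof -
    have "?c * sqrt l \<le> ?c * sqrt (Xq m n k + l)" using c Xq_bounds(3)[OF m, of n k] by (intro mult_left_mono) auto
    then have 1: "- \<alpha> \<le> ?c * sqrt (Xq m n k + l)" using l(2) by linarith
    from mult_left_mono[OF sqrt_gap(2)[OF Xq_bounds(3)[OF m] l0 Lambda_nonneg[OF m] L, of n k], of "2 * pi^2"]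
    have "?c * sqrt (Xq m n k + l) + ?c * sqrt (Xq m n k + l) \<le> 2 * pi^2 * (sqrt (Xq m n k + l) - ?L * sqrt (Xq m n k))"
      by (simp add: mult.assoc)
    then show ?thesis using 1 by linarith
  qed
  have "(\<integral>k. (cmod (\<eta> k))^2 * (?c * sqrt (1 - am m) * wh n k) \<partial>Mc n) \<le> PP m n l \<alpha> \<eta>"
  proof (rule PP_lower[OF m l0 n \<eta>])
    fix k
    show "\<bar>?c * sqrt (1 - am m) * wh n k\<bar> \<le> (?c * sqrt (1 - am m)) * wh n k"
      using c am[OF m] by (subst abs_of_nonneg) auto
    have "(1 - am m) * 1 \<le> 1 * l" using am[OF m] l by (intro mult_mono) auto
    then have "(1 - am m) * (1 + sqc n k) \<le> Xq m n k + l" using Xq_bounds(1)[OF m, of n k] by (simp add: distrib_left)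
    then have "sqrt (1 - am m) * wh n k \<le> sqrt (Xq m n k + l)" unfolding wh_def real_sqrt_mult[symmetric] by simp
    from mult_left_mono[OF this c] lower[of k]
    show "?c * sqrt (1 - am m) * wh n k \<le> \<alpha> + 2 * pi^2 * (sqrt (Xq m n k + l) - ?L * sqrt (Xq m n k))" by (simp only: mult.assoc)
  qed measurable
  also have "(\<integral>k. (cmod (\<eta> k))^2 * (?c * sqrt (1 - am m) * wh n k) \<partial>Mc n) = (\<integral>k. (?c * sqrt (1 - am m)) * (wh n k * (cmod (\<eta> k))^2) \<partial>Mc n)"
    by (intro Bochner_Integration.integral_cong refl) (simp only: mult_ac)
  also have "\<dots> = ?c * sqrt (1 - am m) * Qh n \<eta>" unfolding Qh_def by (rule Bochner_Integration.integral_mult_right_zero)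
  finally show "?c * sqrt (1 - am m) * Qh n \<eta> \<le> PP m n l \<alpha> \<eta>" .
  have "(\<integral>k. (cmod (\<eta> k))^2 * (?c * sqrt l) \<partial>Mc n) \<le> PP m n l \<alpha> \<eta>"
  proof (rule PP_lower[OF m l0 n \<eta>])
    fix k
    have "?c * sqrt l * 1 \<le> ?c * sqrt l * wh n k" using c l wh_ge1 by (intro mult_left_mono) auto
    then show "\<bar>?c * sqrt l\<bar> \<le> (?c * sqrt l) * wh n k" using c l by (subst abs_of_nonneg) auto
    have "?c * sqrt l \<le> ?c * sqrt (Xq m n k + l)" using c Xq_bounds(3)[OF m, of n k] by (intro mult_left_mono) auto
    then show "?c * sqrt l \<le> \<alpha> + 2 * pi^2 * (sqrt (Xq m n k + l) - ?L * sqrt (Xq m n k))" using lower[of k] by linarith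
  qed simp
  also have "(\<integral>k. (cmod (\<eta> k))^2 * (?c * sqrt l) \<partial>Mc n) = ?c * sqrt l * (nrm (Mc n) \<eta>)^2"
    unfolding nrm_sq by (simp add: mult.commute)
  finally show "?c * sqrt l * (nrm (Mc n) \<eta>)^2 \<le> PP m n l \<alpha> \<eta>" .
qed

section \<open>Independence of \<open>\<lambda>\<close> and uniqueness of the charge\<close>

definition Rr :: "real \<Rightarrow> nat \<Rightarrow> real \<Rightarrow> (cfg \<Rightarrow> complex) \<Rightarrow> (cfg \<Rightarrow> complex) \<Rightarrow> cfg \<Rightarrow> complex" where
  "Rr m n l P \<eta> k = P k - complex_of_real (1 / (hq m (Suc n) k + l)) * Bf n \<eta> k"

text \<open>The H1 condition on the regular part of \<psi>, with h + l in place of 1 + |k|^2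
  (equivalent by \<open>H1_weight_iff\<close>), so that the energy \<open>EE\<close> is its
  integral.\<close>

definition Cf :: "real \<Rightarrow> nat \<Rightarrow> real \<Rightarrow> (cfg \<Rightarrow> complex) \<Rightarrow> (cfg \<Rightarrow> complex) \<Rightarrow> bool" where
  "Cf m n l P \<eta> \<longleftrightarrow> integrable (Mc (Suc n)) (\<lambda>k. (hq m (Suc n) k + l) * (cmod (Rr m n l P \<eta> k))^2)"

definition EE :: "real \<Rightarrow> nat \<Rightarrow> real \<Rightarrow> (cfg \<Rightarrow> complex) \<Rightarrow> (cfg \<Rightarrow> complex) \<Rightarrow> real" where
  "EE m n l P \<eta> = (\<integral>k. (hq m (Suc n) k + l) * (cmod (Rr m n l P \<eta> k))^2 \<partial>Mc (Suc n))"

text \<open>\<open>TT\<close> is the value of the form in terms of \<open>P\<close> and \<open>\<eta>\<close>, the Fourier transforms of \<open>\<psi>\<close> and \<open>\<xi>\<close>.\<close>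
definition TT :: "real \<Rightarrow> nat \<Rightarrow> real \<Rightarrow> real \<Rightarrow> (cfg \<Rightarrow> complex) \<Rightarrow> (cfg \<Rightarrow> complex) \<Rightarrow> real" where
  "TT m n l \<alpha> P \<eta> = EE m n l P \<eta> + real (Suc n) * PP m n l \<alpha> \<eta> - l * (nrm (Mc (Suc n)) P)^2"

lemma complete_square:
  assumes u: "u > 0"
  shows "u * (cmod (P - complex_of_real (1 / u) * B))^2 = u * (cmod P)^2 - 2 * Re (cnj P * B) + (1 / u) * (cmod B)^2"
proof -
  have g: "u * ((x - b / u)^2 + (y - c / u)^2) = u * (x^2 + y^2) - 2 * (x * b + y * c) + (1 / u) * (b^2 + c^2)" for x y b c
    using u by (simp add: field_simps power2_eq_square)
  show ?thesis unfolding cmod_power2 using g[of "Re P" "Re B" "Im P" "Im B"] by simp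
qed

lemma Rr_measurable:
  assumes "\<eta> \<in> borel_measurable (Mc n)" and [measurable]: "P \<in> borel_measurable (Mc (Suc n))"
  shows "Rr m n l P \<eta> \<in> borel_measurable (Mc (Suc n))"
proof -
  have [measurable]: "Bf n \<eta> \<in> borel_measurable (Mc (Suc n))" by (rule Bf_measurable[OF assms(1)])
  show ?thesis unfolding Rr_def[abs_def] by measurable
qed

text \<open>In the expanded squares the mixed term of P and B carries no parameter and cancels in
  the difference. What remains is the resolvent difference times |B|^2 and a multiple of |P|^2, both
  integrable, so finiteness and value transfer together.\<close>

lemma lambda_independence:
  assumes m: "m > 0" and l: "0 < l" "l \<le> l'" and n: "n \<ge> 1" and \<eta>: "Hh n \<eta>" and P: "sqi (Mc (Suc n)) P"
  shows "Cf m n l P \<eta> \<longleftrightarrow> Cf m n l' P \<eta>" "Cf m n l P \<eta> \<Longrightarrow> TT m n l \<alpha> P \<eta> = TT m n l' \<alpha> P \<eta>"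
proof -
  let ?D = "\<lambda>k. 1 / (hq m (Suc n) k + l) - 1 / (hq m (Suc n) k + l')"
  let ?F = "\<lambda>l k. (hq m (Suc n) k + l) * (cmod (Rr m n l P \<eta> k))^2"
  have l': "0 < l'" using l by simp
  note I = Phi_resolvent_identity[OF m l n \<eta>]
  let ?H = "\<lambda>k. ?D k * (cmod (Bf n \<eta> k))^2 - (l' - l) * (cmod (P k))^2"
  have eq: "?F l k = ?F l' k + ?H k" for k
    unfolding Rr_def complete_square[OF hq_pos[OF m l(1)]] complete_square[OF hq_pos[OF m l']] by (simp add: algebra_simps)
  have Pi: "integrable (Mc (Suc n)) (\<lambda>k. (l' - l) * (cmod (P k))^2)" using P by auto
  have Hi: "integrable (Mc (Suc n)) ?H" by (rule Bochner_Integration.integrable_diff[OF I(1) Pi])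
  have HI: "integral\<^sup>L (Mc (Suc n)) ?H = real (Suc n) * (PP m n l' \<alpha> \<eta> - PP m n l \<alpha> \<eta>) - (l' - l) * (nrm (Mc (Suc n)) P)^2"
    unfolding Bochner_Integration.integral_diff[OF I(1) Pi] I(2)[of \<alpha>] nrm_sq by simp
  show iff: "Cf m n l P \<eta> \<longleftrightarrow> Cf m n l' P \<eta>"
  proof
    assume "Cf m n l' P \<eta>"
    from Bochner_Integration.integrable_add[OF this[unfolded Cf_def] Hi] show "Cf m n l P \<eta>" unfolding Cf_def eq[symmetric] .
  next
    assume "Cf m n l P \<eta>"
    from Bochner_Integration.integrable_diff[OF this[unfolded Cf_def] Hi] show "Cf m n l' P \<eta>" unfolding Cf_def eq by simp
  qed
  assume "Cf m n l P \<eta>"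
  then have F': "integrable (Mc (Suc n)) (?F l')" using iff by (simp add: Cf_def)
  have "EE m n l P \<eta> = EE m n l' P \<eta> + integral\<^sup>L (Mc (Suc n)) ?H"
    unfolding EE_def eq by (rule Bochner_Integration.integral_add[OF F' Hi])
  then show "TT m n l \<alpha> P \<eta> = TT m n l' \<alpha> P \<eta>" unfolding HI TT_def by (simp only:) (simp add: algebra_simps)
qed

lemma lambda_indep:
  assumes m: "m > 0" and l: "0 < l" "0 < l'" and n: "n \<ge> 1" and \<eta>: "Hh n \<eta>" and P: "sqi (Mc (Suc n)) P" and C: "Cf m n l P \<eta>"
  shows "Cf m n l' P \<eta>" "TT m n l \<alpha> P \<eta> = TT m n l' \<alpha> P \<eta>"
proof -
  have "Cf m n l' P \<eta> \<and> TT m n l \<alpha> P \<eta> = TT m n l' \<alpha> P \<eta>"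
  proof (cases "l \<le> l'")
    case True
    then show ?thesis using lambda_independence[OF m l(1) True n \<eta> P] C by blast
  next
    case False
    then have "l' \<le> l" by simp
    from lambda_independence[OF m l(2) this n \<eta> P] C show ?thesis by metis
  qed
  then show "Cf m n l' P \<eta>" "TT m n l \<alpha> P \<eta> = TT m n l' \<alpha> P \<eta>" by auto
qed

lemma Bf_diff: "Bf n (\<lambda>k. \<eta> k - \<eta>' k) k = Bf n \<eta> k - Bf n \<eta>' k"
  unfolding Bf_def by (simp add: right_diff_distrib sum_subtractf del: sum.lessThan_Suc)

lemma Rr_diff: "Rr m n l (\<lambda>k. P k - P' k) (\<lambda>k. \<eta> k - \<eta>' k) k = Rr m n l P \<eta> k - Rr m n l P' \<eta>' k"
  unfolding Rr_def Bf_diff by (simp add: right_diff_distrib)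

lemma antisym_diff:
  assumes "antisym_f n f" "antisym_f n g" shows "antisym_f n (\<lambda>x. f x - g x)"
  unfolding antisym_sw
proof (intro allI impI)
  fix i j assume ij: "i < n" "j < n" "i \<noteq> j"
  then have "AE x in Mc n. f (sw i j x) = - f x" "AE x in Mc n. g (sw i j x) = - g x" using assms by (auto simp: antisym_sw)
  then show "AE x in Mc n. f (sw i j x) - g (sw i j x) = - (f x - g x)" by eventually_elim simp
qed

lemma weighted_sq_diff_integrable:
  assumes w: "w \<in> borel_measurable M" "\<And>k. 0 \<le> (w k :: real)" and m: "f \<in> borel_measurable M" "g \<in> borel_measurable M"
    and i: "integrable M (\<lambda>k. w k * (cmod (f k))^2)" "integrable M (\<lambda>k. w k * (cmod (g k))^2)"
  shows "integrable M (\<lambda>k. w k * (cmod (f k - g k))^2)"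
proof (rule Bochner_Integration.integrable_bound)
  show "integrable M (\<lambda>k. 2 * (w k * (cmod (f k))^2) + 2 * (w k * (cmod (g k))^2))" using i by auto
  note [measurable] = w(1) m
  show "(\<lambda>k. w k * (cmod (f k - g k))^2) \<in> borel_measurable M" by measurable
  have "w k * (cmod (f k - g k))^2 \<le> 2 * (w k * (cmod (f k))^2) + 2 * (w k * (cmod (g k))^2)" for k
    using mult_left_mono[OF cmod_add_sq[of "f k" "- g k"] w(2)[of k]] by (simp add: algebra_simps)
  then have "norm (w k * (cmod (f k - g k))^2) \<le> norm (2 * (w k * (cmod (f k))^2) + 2 * (w k * (cmod (g k))^2))" for k
    using w(2)[of k] by simp
  then show "AE k in M. norm (w k * (cmod (f k - g k))^2) \<le> norm (2 * (w k * (cmod (f k))^2) + 2 * (w k * (cmod (g k))^2))" by simp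
qed

lemma Hh_diff: assumes "Hh n \<eta>" "Hh n \<eta>'" shows "Hh n (\<lambda>k. \<eta> k - \<eta>' k)"
  using HhD[OF assms(1)] HhD[OF assms(2)] unfolding Hh_def
  by (intro conjI antisym_diff weighted_sq_diff_integrable borel_measurable_diff) auto

lemma hq_w:
  assumes "m > 0" "l > 0"
  shows "(\<lambda>k. hq m n k + l) \<in> borel_measurable (Mc n)" "\<And>k. 0 \<le> hq m n k + l"
  using hq_pos[OF assms] by (auto intro: less_imp_le)

lemma Cf_diff:
  assumes m: "m > 0" and l: "l > 0" and "Hh n \<eta>" "Hh n \<eta>'" "sqi (Mc (Suc n)) P" "sqi (Mc (Suc n)) P'"
    and "Cf m n l P \<eta>" "Cf m n l P' \<eta>'"
  shows "Cf m n l (\<lambda>k. P k - P' k) (\<lambda>k. \<eta> k - \<eta>' k)"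
  using assms(3-) unfolding Cf_def Rr_diff
  by (intro weighted_sq_diff_integrable hq_w[OF m l] Rr_measurable) (auto dest: HhD)

text \<open>The resolvent identity bounds \<open>\<Phi>[\<lambda>']\<close> of the difference uniformly in \<open>\<lambda>'\<close>, while coercivity makes
  it grow like \<open>sqrt \<lambda>'\<close> unless the difference vanishes.\<close>
lemma charge_unique:
  assumes m: "m > 0" and l: "l > 0" and n: "n \<ge> 1" and L: "LambdaMN m (Suc n) < 1"
    and \<eta>: "Hh n \<eta>" "Hh n \<eta>'" and P: "sqi (Mc (Suc n)) P" and C: "Cf m n l P \<eta>" "Cf m n l P \<eta>'"
  shows "AE k in Mc n. \<eta> k = \<eta>' k"
proof -
  define \<delta> where "\<delta> = (\<lambda>k. \<eta> k - \<eta>' k)"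
  have \<delta>: "Hh n \<delta>" unfolding \<delta>_def by (rule Hh_diff[OF \<eta>])
  have \<delta>s: "sqi (Mc n) \<delta>" by (rule Hh_sqi[OF \<delta>])
  let ?h = "hq m (Suc n)" let ?B = "\<lambda>k. (cmod (Bf n \<delta> k))^2"
  \<comment> \<open>Two charges of the same function differ by a charge of the zero function, whose
    energy density is |B|^2 / (h + l). That finiteness is the contradiction to be exploited.\<close>
  have "Cf m n l (\<lambda>k. 0) \<delta>" using Cf_diff[OF m l \<eta> P P C] by (simp add: \<delta>_def)
  then have iB: "integrable (Mc (Suc n)) (\<lambda>k. 1 / (?h k + l) * ?B k)"
    unfolding Cf_def Rr_def complete_square[OF hq_pos[OF m l]] by simp
  define M where "M = (\<integral>k. 1 / (?h k + l) * ?B k \<partial>Mc (Suc n))"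
  let ?c = "pi^2 * (1 - LambdaMN m (Suc n))"
  have c: "?c > 0" using L by simp
  define K where "K = M / real (Suc n) + PP m n l 0 \<delta>"
  have bound: "?c * sqrt l' * (nrm (Mc n) \<delta>)^2 \<le> K" if l': "l' \<ge> 1" "l' \<ge> l" for l'
  proof -
    note I = Phi_resolvent_identity[OF m l l'(2) n \<delta>]
    have "real (Suc n) * (PP m n l' 0 \<delta> - PP m n l 0 \<delta>) \<le> M"
      unfolding I(2)[symmetric] M_def
    proof (rule integral_mono[OF I(1) iB])
      fix k
      have "0 < ?h k + l'" using hq_pos[OF m, of l' "Suc n" k] l' l by simp
      then show "(1 / (?h k + l) - 1 / (?h k + l')) * ?B k \<le> 1 / (?h k + l) * ?B k"
        by (intro mult_right_mono) auto
    qed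
    then have "PP m n l' 0 \<delta> - PP m n l 0 \<delta> \<le> M / real (Suc n)" by (simp only: pos_le_divide_eq of_nat_0_less_iff zero_less_Suc mult.commute)
    moreover have "?c * sqrt l' * (nrm (Mc n) \<delta>)^2 \<le> PP m n l' 0 \<delta>"
    proof (rule PP_coercive(2)[OF m n L l'(1) _ \<delta>])
      show "\<bar>0\<bar> \<le> ?c * sqrt l'" unfolding abs_zero using l' by (intro mult_nonneg_nonneg[OF less_imp_le[OF c]] real_sqrt_ge_zero) simp
    qed
    ultimately show ?thesis by (simp add: K_def)
  qed
  have "nrm (Mc n) \<delta> = 0"
  proof (rule ccontr)
    assume "nrm (Mc n) \<delta> \<noteq> 0"
    then have q: "?c * (nrm (Mc n) \<delta>)^2 > 0" using c by simp
    \<comment> \<open>The square y^2 will serve as l', so that its root exceeds (|K| + 1) / (c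
      |\<delta>|^2) and the left side passes K.\<close>
    define y where "y = max (max 1 l) ((\<bar>K\<bar> + 1) / (?c * (nrm (Mc n) \<delta>)^2))"
    have y: "y \<ge> 1" "y \<ge> l" "y \<ge> (\<bar>K\<bar> + 1) / (?c * (nrm (Mc n) \<delta>)^2)" by (auto simp: y_def)
    have "1 * y \<le> y * y" using y by (intro mult_right_mono) auto
    then have y2: "y^2 \<ge> 1" "y^2 \<ge> l" unfolding power2_eq_square using y(1,2) by linarith+
    have "?c * sqrt (y^2) * (nrm (Mc n) \<delta>)^2 = y * (?c * (nrm (Mc n) \<delta>)^2)" using y by simp
    also have "\<dots> \<ge> \<bar>K\<bar> + 1" using y(3) q by (simp only: pos_divide_le_eq)
    finally show False using bound[OF y2] by linarith
  qed
  from nrm_eq_0_AE[OF \<delta>s this] show ?thesis by (simp add: \<delta>_def)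
qed

section \<open>The form in position space\<close>

text \<open>Transforms are known only up to null sets, so each ingredient of the form must ignore
  them; here this includes null sets of n momenta seen through a deletion from n + 1.\<close>

lemma Bf_cong_AE:
  assumes "AE k in Mc n. \<eta> k = \<eta>' k"
  shows "AE k in Mc (Suc n). Bf n \<eta> k = Bf n \<eta>' k"
proof -
  have "AE k in Mc (Suc n). \<forall>i\<in>{..<Suc n}. \<eta> (drop_idx (Suc n) i k) = \<eta>' (drop_idx (Suc n) i k)"
  proof (rule eventually_ball_finite)
    show "\<forall>i\<in>{..<Suc n}. AE k in Mc (Suc n). \<eta> (drop_idx (Suc n) i k) = \<eta>' (drop_idx (Suc n) i k)"
      using AE_drop_idx[OF assms] by auto
  qed simp
  then show ?thesis
  proof eventually_elim
    case (elim k)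
    then show ?case unfolding Bf_def by (intro sum.cong) auto
  qed
qed

lemma Rr_cong_AE:
  assumes "AE k in Mc n. \<eta> k = \<eta>' k" "AE k in Mc (Suc n). P k = P' k"
  shows "AE k in Mc (Suc n). Rr m n l P \<eta> k = Rr m n l P' \<eta>' k"
  using Bf_cong_AE[OF assms(1)] assms(2) by eventually_elim (simp add: Rr_def)

lemma weighted_cong_AE:
  assumes w: "w \<in> borel_measurable M" and m: "f \<in> borel_measurable M" "g \<in> borel_measurable M" and e: "AE k in M. f k = g k"
  shows "integrable M (\<lambda>k. w k * (cmod (f k))^2) \<longleftrightarrow> integrable M (\<lambda>k. w k * (cmod (g k))^2)"
    "(\<integral>k. w k * (cmod (f k))^2 \<partial>M) = (\<integral>k. w k * (cmod (g k))^2 \<partial>M)"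
proof -
  note [measurable] = w m
  have a: "AE k in M. w k * (cmod (f k))^2 = w k * (cmod (g k))^2" using e by eventually_elim simp
  show "integrable M (\<lambda>k. w k * (cmod (f k))^2) \<longleftrightarrow> integrable M (\<lambda>k. w k * (cmod (g k))^2)"
    by (rule integrable_cong_AE[OF _ _ a]) measurable
  show "(\<integral>k. w k * (cmod (f k))^2 \<partial>M) = (\<integral>k. w k * (cmod (g k))^2 \<partial>M)"
    by (rule integral_cong_AE[OF _ _ a]) measurable
qed

lemma Cf_cong:
  assumes \<eta>: "\<eta> \<in> borel_measurable (Mc n)" "\<eta>' \<in> borel_measurable (Mc n)" "AE k in Mc n. \<eta> k = \<eta>' k"
    and P: "P \<in> borel_measurable (Mc (Suc n))" "P' \<in> borel_measurable (Mc (Suc n))" "AE k in Mc (Suc n). P k = P' k"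
  shows "Cf m n l P \<eta> \<longleftrightarrow> Cf m n l P' \<eta>'" "EE m n l P \<eta> = EE m n l P' \<eta>'"
proof -
  have w: "(\<lambda>k. hq m (Suc n) k + l) \<in> borel_measurable (Mc (Suc n))" by measurable
  note c = weighted_cong_AE[OF w Rr_measurable[OF \<eta>(1) P(1)] Rr_measurable[OF \<eta>(2) P(2)] Rr_cong_AE[OF \<eta>(3) P(3)]]
  show "Cf m n l P \<eta> \<longleftrightarrow> Cf m n l P' \<eta>'" unfolding Cf_def by (rule c)
  show "EE m n l P \<eta> = EE m n l P' \<eta>'" unfolding EE_def by (rule c)
qed

lemma PP_cong:
  assumes n: "n \<ge> 1" and \<eta>: "\<eta> \<in> borel_measurable (Mc n)" "\<eta>' \<in> borel_measurable (Mc n)" "AE k in Mc n. \<eta> k = \<eta>' k"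
  shows "PP m n l \<alpha> \<eta> = PP m n l \<alpha> \<eta>'"
proof -
  have w: "(\<lambda>k. \<alpha> + 2 * pi^2 * sqrt (Xq m n k + l)) \<in> borel_measurable (Mc n)" by measurable
  have "Pd m n l \<alpha> \<eta> = Pd m n l \<alpha> \<eta>'"
    using weighted_cong_AE(2)[OF w \<eta>] unfolding Pd_def by (simp add: mult.commute)
  moreover have "(\<integral>k. Poi m n l \<eta> k \<partial>Mc (Suc n)) = (\<integral>k. Poi m n l \<eta>' k \<partial>Mc (Suc n))"
  proof (rule integral_cong_AE)
    show "AE k in Mc (Suc n). Poi m n l \<eta> k = Poi m n l \<eta>' k"
      using AE_drop_idx[OF \<eta>(3) le0] AE_drop_idx[OF \<eta>(3) n] by eventually_elim (simp add: Poi_def)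
  qed (intro Poi_measurable \<eta> n)+
  ultimately show ?thesis by (simp add: PP_def Po_def)
qed

lemma TT_cong:
  assumes n: "n \<ge> 1" and \<eta>: "\<eta> \<in> borel_measurable (Mc n)" "\<eta>' \<in> borel_measurable (Mc n)" "AE k in Mc n. \<eta> k = \<eta>' k"
    and P: "P \<in> borel_measurable (Mc (Suc n))" "P' \<in> borel_measurable (Mc (Suc n))" "AE k in Mc (Suc n). P k = P' k"
  shows "TT m n l \<alpha> P \<eta> = TT m n l \<alpha> P' \<eta>'"
  unfolding TT_def Cf_cong(2)[OF \<eta> P] PP_cong[OF n \<eta>] nrm_cong_AE[OF P] ..

lemma integrable_iff_nn:
  fixes f :: "'a \<Rightarrow> real"
  assumes "f \<in> borel_measurable M" "\<And>x. 0 \<le> f x"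
  shows "integrable M f \<longleftrightarrow> (\<integral>\<^sup>+x. ennreal (f x) \<partial>M) < \<infinity>"
  using assms by (subst integrable_iff_bounded) simp

section \<open>Sobolev conditions on the Fourier side\<close>

lemma Hhalf_Hh:
  assumes "Hhalf_f n \<xi>" shows "sqi (Mc n) \<xi>" "Hh n (FT n \<xi>)"
proof -
  show s: "sqi (Mc n) \<xi>" using assms by (simp add: Hhalf_f_def L2f_def L2_sqi)
  have [measurable]: "FT n \<xi> \<in> borel_measurable (Mc n)" using FT_sqi[OF s] by auto
  have "antisym_f n (FT n \<xi>)" using assms antisym_FT_iff[OF s is_FT_FT[OF s]] by (simp add: Hhalf_f_def L2f_def)
  moreover have "integrable (Mc n) (\<lambda>k. wh n k * (cmod (FT n \<xi> k))^2)"
    using assms by (subst integrable_iff_nn) (auto simp: Hhalf_f_def wh_def)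
  ultimately show "Hh n (FT n \<xi>)" by (simp add: Hh_def)
qed

lemma Hh_Hhalf:
  assumes \<eta>: "Hh n \<eta>" shows "Hhalf_f n (iFT n \<eta>)"
proof -
  have s: "sqi (Mc n) \<eta>" by (rule Hh_sqi[OF \<eta>])
  note i = iFT_FT[OF s]
  have "antisym_f n (iFT n \<eta>)" using antisym_FT_iff[OF i] HhD[OF \<eta>] by simp
  moreover have "(\<integral>\<^sup>+k. ennreal (sqrt (1 + sqc n k) * (cmod (FT n (iFT n \<eta>) k))^2) \<partial>Mc n) = (\<integral>\<^sup>+k. ennreal (wh n k * (cmod (\<eta> k))^2) \<partial>Mc n)"
    by (rule nn_integral_cong_AE) (use FT_iFT[OF s] in eventually_elim, simp add: wh_def)
  ultimately show ?thesis using i(1) Qh_nn[OF \<eta>] by (simp add: Hhalf_f_def L2f_def L2_sqi)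
qed

text \<open>The weights are comparable: from below because a < 1 and l > 0, from above because the
  squared total momentum is at most N times the sum of squares.\<close>

lemma H1_weight_iff:
  assumes m: "m > 0" and l: "l > 0" and f[measurable]: "f \<in> borel_measurable (Mc N)"
  shows "(\<integral>\<^sup>+k. ennreal ((1 + sqc N k) * (cmod (f k))^2) \<partial>Mc N) < \<infinity> \<longleftrightarrow> integrable (Mc N) (\<lambda>k. (hq m N k + l) * (cmod (f k))^2)"
proof -
  have nn: "0 \<le> (1 + sqc N k) * (cmod (f k))^2" "0 \<le> (hq m N k + l) * (cmod (f k))^2" for k
    using hq_pos[OF m l, of N k] by (auto intro!: mult_nonneg_nonneg simp: less_imp_le)
  have a: "1 - am m > 0" using am[OF m] by simp
  have 1: "hq m N k + l \<le> (1 + real N + l) * (1 + sqc N k)" for k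
  proof -
    have "(1 + real N + l) * (1 + sqc N k) = (1 + real N) * sqc N k + l + (1 + real N + l * sqc N k)" by (simp add: algebra_simps)
    moreover have "0 \<le> 1 + real N + l * sqc N k" using l by simp
    ultimately show ?thesis using hq_bounds(2)[OF m, of N k] by linarith
  qed
  have 2: "1 + sqc N k \<le> (1 / (1 - am m) + 1 / l) * (hq m N k + l)" for k
  proof -
    have "sqc N k \<le> 1 / (1 - am m) * hq m N k" using hq_bounds(1)[OF m, of N k] a by (simp add: pos_le_divide_eq mult.commute)
    moreover have "0 \<le> 1 / (1 - am m) * l" using a l by simp
    moreover have "0 \<le> 1 / l * hq m N k" using hq_bounds(3)[OF m, of N k] l by simp
    moreover have "1 / l * l = 1" using l by simp
    ultimately show ?thesis unfolding distrib_left distrib_right by linarith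
  qed
  have "integrable (Mc N) (\<lambda>k. (1 + sqc N k) * (cmod (f k))^2) \<longleftrightarrow> integrable (Mc N) (\<lambda>k. (hq m N k + l) * (cmod (f k))^2)"
  proof
    assume "integrable (Mc N) (\<lambda>k. (1 + sqc N k) * (cmod (f k))^2)"
    then have "integrable (Mc N) (\<lambda>k. (1 + real N + l) * ((1 + sqc N k) * (cmod (f k))^2))" by simp
    then show "integrable (Mc N) (\<lambda>k. (hq m N k + l) * (cmod (f k))^2)"
    proof (rule Bochner_Integration.integrable_bound)
      have "norm ((hq m N k + l) * (cmod (f k))^2) \<le> norm ((1 + real N + l) * ((1 + sqc N k) * (cmod (f k))^2))" for k
        using mult_right_mono[OF 1[of k], of "(cmod (f k))^2"] nn[of k] l by (simp add: mult.assoc)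
      then show "AE k in Mc N. norm ((hq m N k + l) * (cmod (f k))^2) \<le> norm ((1 + real N + l) * ((1 + sqc N k) * (cmod (f k))^2))" by simp
    qed measurable
  next
    assume "integrable (Mc N) (\<lambda>k. (hq m N k + l) * (cmod (f k))^2)"
    then have "integrable (Mc N) (\<lambda>k. (1 / (1 - am m) + 1 / l) * ((hq m N k + l) * (cmod (f k))^2))" by (rule integrable_mult_right)
    then show "integrable (Mc N) (\<lambda>k. (1 + sqc N k) * (cmod (f k))^2)"
    proof (rule Bochner_Integration.integrable_bound)
      have "norm ((1 + sqc N k) * (cmod (f k))^2) \<le> norm ((1 / (1 - am m) + 1 / l) * ((hq m N k + l) * (cmod (f k))^2))" for k
        using mult_right_mono[OF 2[of k] zero_le_power2[of "cmod (f k)"]] nn(1)[of k] unfolding mult.assoc real_norm_def by linarith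
      then show "AE k in Mc N. norm ((1 + sqc N k) * (cmod (f k))^2) \<le> norm ((1 / (1 - am m) + 1 / l) * ((hq m N k + l) * (cmod (f k))^2))" by simp
    qed measurable
  qed
  then show ?thesis by (subst (asm) integrable_iff_nn) (use nn in auto)
qed

section \<open>Translation of a function and a charge to momentum space\<close>

context
  fixes m l :: real and n :: nat and \<psi> \<xi> :: "cfg \<Rightarrow> complex"
  assumes m: "m > 0" and l: "l > 0" and n: "n \<ge> 1" and \<psi>: "L2f (Suc n) \<psi>" and \<xi>: "Hhalf_f n \<xi>"
begin

lemma psi_sqi: "sqi (Mc (Suc n)) \<psi>"
  using \<psi> by (simp add: L2f_def L2_sqi)

lemma Gpot_props:
  "sqi (Mc (Suc n)) (Gpot m (Suc n) l \<xi>)" "antisym_f (Suc n) (Gpot m (Suc n) l \<xi>)"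
  "AE k in Mc (Suc n). FT (Suc n) (\<lambda>y. \<psi> y - Gpot m (Suc n) l \<xi> y) k = Rr m n l (FT (Suc n) \<psi>) (FT n \<xi>) k"
proof -
  note \<eta> = Hhalf_Hh(2)[OF \<xi>]
  have g: "Ghat m (Suc n) l \<xi> = (\<lambda>k. complex_of_real (1 / (hq m (Suc n) k + l)) * Bf n (FT n \<xi>) k)" by (rule ext) (rule Ghat_Bf)
  have s: "sqi (Mc (Suc n)) (Ghat m (Suc n) l \<xi>)" "antisym_f (Suc n) (Ghat m (Suc n) l \<xi>)"
    unfolding g by (rule resolvent_Bf[OF m l \<eta>])+
  show G: "sqi (Mc (Suc n)) (Gpot m (Suc n) l \<xi>)" unfolding Gpot_def by (rule iFT_FT(1)[OF s(1)])
  show "antisym_f (Suc n) (Gpot m (Suc n) l \<xi>)" using s(2) unfolding Gpot_def by (simp only: antisym_FT_iff[OF iFT_FT[OF s(1)]])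
  show "AE k in Mc (Suc n). FT (Suc n) (\<lambda>y. \<psi> y - Gpot m (Suc n) l \<xi> y) k = Rr m n l (FT (Suc n) \<psi>) (FT n \<xi>) k"
    using FT_diff[OF psi_sqi G] FT_iFT[OF s(1)] by eventually_elim (simp only: Gpot_def Rr_def g)
qed

lemma phi_L2f: "L2f (Suc n) (\<lambda>y. \<psi> y - Gpot m (Suc n) l \<xi> y)"
  unfolding L2f_def L2_sqi
  by (intro conjI sqi_diff psi_sqi Gpot_props(1) antisym_diff Gpot_props(2)) (use \<psi> in \<open>simp add: L2f_def\<close>)

lemma phi_measurable:
  "FT (Suc n) (\<lambda>y. \<psi> y - Gpot m (Suc n) l \<xi> y) \<in> borel_measurable (Mc (Suc n))"
  "Rr m n l (FT (Suc n) \<psi>) (FT n \<xi>) \<in> borel_measurable (Mc (Suc n))"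
  using FT_sqi[OF sqi_diff[OF psi_sqi Gpot_props(1)]] HhD(1)[OF Hhalf_Hh(2)[OF \<xi>]] FT_sqi[OF psi_sqi] by (auto intro!: Rr_measurable)

text \<open>The regular part is automatically an antisymmetric L2 function, so only the weighted
  integrability in \<open>H1f\<close> is a condition, and its transform is \<open>Rr\<close> almost
  everywhere.\<close>

lemma witness_iff: "H1f (Suc n) (\<lambda>y. \<psi> y - Gpot m (Suc n) l \<xi> y) \<longleftrightarrow> Cf m n l (FT (Suc n) \<psi>) (FT n \<xi>)"
  unfolding H1f_def Cf_def H1_weight_iff[OF m l phi_measurable(1)]
  using phi_L2f weighted_cong_AE(1)[OF hq_w(1)[OF m l] phi_measurable Gpot_props(3)] by simp

lemma form_value:
  assumes C: "Cf m n l (FT (Suc n) \<psi>) (FT n \<xi>)"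
  shows "F0 m (Suc n) (\<lambda>y. \<psi> y - Gpot m (Suc n) l \<xi> y) + l * norm2 (Suc n) (\<lambda>y. \<psi> y - Gpot m (Suc n) l \<xi> y)
    - l * norm2 (Suc n) \<psi> + real (Suc n) * Phi m (Suc n) l \<alpha> \<xi> = TT m n l \<alpha> (FT (Suc n) \<psi>) (FT n \<xi>)"
proof -
  let ?\<phi> = "\<lambda>y. \<psi> y - Gpot m (Suc n) l \<xi> y"
  let ?f = "FT (Suc n) ?\<phi>"
  have \<phi>s: "sqi (Mc (Suc n)) ?\<phi>" by (rule sqi_diff[OF psi_sqi Gpot_props(1)])
  note w = weighted_cong_AE[OF hq_w(1)[OF m l] phi_measurable Gpot_props(3)]
  have i: "integrable (Mc (Suc n)) (\<lambda>k. (hq m (Suc n) k + l) * (cmod (?f k))^2)" using C w(1) by (simp add: Cf_def)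
  have i2: "integrable (Mc (Suc n)) (\<lambda>k. l * (cmod (?f k))^2)" using FT_sqi[OF \<phi>s] by auto
  \<comment> \<open>The kinetic term is recovered as a difference of two finite integrals, so that
    the explicit l |\<phi>|^2 in \<open>Form\<close> completes it to \<open>EE\<close>.\<close>
  have "F0 m (Suc n) ?\<phi> = (\<integral>k. (hq m (Suc n) k + l) * (cmod (?f k))^2 - l * (cmod (?f k))^2 \<partial>Mc (Suc n))"
    unfolding F0_def hq_def by (simp add: algebra_simps)
  also have "\<dots> = (\<integral>k. (hq m (Suc n) k + l) * (cmod (?f k))^2 \<partial>Mc (Suc n)) - (\<integral>k. l * (cmod (?f k))^2 \<partial>Mc (Suc n))"
    by (rule Bochner_Integration.integral_diff[OF i i2])
  also have "(\<integral>k. (hq m (Suc n) k + l) * (cmod (?f k))^2 \<partial>Mc (Suc n)) = EE m n l (FT (Suc n) \<psi>) (FT n \<xi>)"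
    unfolding EE_def by (rule w(2))
  also have "(\<integral>k. l * (cmod (?f k))^2 \<partial>Mc (Suc n)) = l * norm2 (Suc n) ?\<phi>"
    unfolding norm2_nrm FT_nrm[OF \<phi>s, symmetric] nrm_sq by simp
  finally show ?thesis unfolding TT_def Phi_PP norm2_nrm[of _ \<psi>] FT_nrm[OF psi_sqi] by simp
qed

end

lemma FormDomD:
  assumes m: "m > 0" and l: "l > 0" and n: "n \<ge> 1" and \<psi>: "\<psi> \<in> FormDom m (Suc n) l"
  obtains \<eta> where "L2f (Suc n) \<psi>" "Hh n \<eta>" "Cf m n l (FT (Suc n) \<psi>) \<eta>"
proof -
  have L: "L2f (Suc n) \<psi>" using \<psi> by (simp add: FormDom_def)
  obtain \<xi> where \<xi>: "Hhalf_f n \<xi>" "H1f (Suc n) (\<lambda>y. \<psi> y - Gpot m (Suc n) l \<xi> y)" using \<psi> by (auto simp: FormDom_def)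
  show ?thesis using that[OF L Hhalf_Hh(2)[OF \<xi>(1)]] witness_iff[OF m l n L \<xi>(1)] \<xi>(2) by simp
qed

text \<open>By uniqueness of the charge, the value does not depend on the choice made by \<open>SOME\<close> in \<open>Form\<close>.\<close>
lemma Form_TT:
  assumes m: "m > 0" and l: "l > 0" and n: "n \<ge> 1" and L: "LambdaMN m (Suc n) < 1"
    and \<psi>: "L2f (Suc n) \<psi>" and \<eta>: "Hh n \<eta>" and C: "Cf m n l (FT (Suc n) \<psi>) \<eta>"
  shows "\<psi> \<in> FormDom m (Suc n) l" "Form m (Suc n) l \<alpha> \<psi> = TT m n l \<alpha> (FT (Suc n) \<psi>) \<eta>"
proof -
  let ?W = "\<lambda>\<xi>. Hhalf_f n \<xi> \<and> H1f (Suc n) (\<lambda>y. \<psi> y - Gpot m (Suc n) l \<xi> y)"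
  have Ps: "sqi (Mc (Suc n)) (FT (Suc n) \<psi>)" using \<psi> by (intro FT_sqi) (simp add: L2f_def L2_sqi)
  then have Pm: "FT (Suc n) \<psi> \<in> borel_measurable (Mc (Suc n))" by auto
  \<comment> \<open>A position-space charge with transform \<eta>, showing that the choice in
    \<open>Form\<close> is made from a nonempty set.\<close>
  have x: "Hhalf_f n (iFT n \<eta>)" by (rule Hh_Hhalf[OF \<eta>])
  have "Cf m n l (FT (Suc n) \<psi>) (FT n (iFT n \<eta>))"
    using Cf_cong(1)[OF HhD(1)[OF Hhalf_Hh(2)[OF x]] HhD(1)[OF \<eta>] FT_iFT[OF Hh_sqi[OF \<eta>]] Pm Pm] C by simp
  then have ex: "?W (iFT n \<eta>)" using x witness_iff[OF m l n \<psi> x] by simp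
  then show "\<psi> \<in> FormDom m (Suc n) l" using \<psi> by (auto simp: FormDom_def)
  define \<xi> where "\<xi> = (SOME \<xi>. ?W \<xi>)"
  have \<xi>: "Hhalf_f n \<xi>" "H1f (Suc n) (\<lambda>y. \<psi> y - Gpot m (Suc n) l \<xi> y)" using someI[of ?W, OF ex] by (auto simp: \<xi>_def)
  have C': "Cf m n l (FT (Suc n) \<psi>) (FT n \<xi>)" using witness_iff[OF m l n \<psi> \<xi>(1)] \<xi>(2) by simp
  note H = Hhalf_Hh(2)[OF \<xi>(1)]
  have "Form m (Suc n) l \<alpha> \<psi> = TT m n l \<alpha> (FT (Suc n) \<psi>) (FT n \<xi>)"
    using form_value[OF m l n \<psi> \<xi>(1) C', of \<alpha>] unfolding Form_def Let_def \<xi>_def by simp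
  also have "\<dots> = TT m n l \<alpha> (FT (Suc n) \<psi>) \<eta>"
    by (rule TT_cong[OF n HhD(1)[OF H] HhD(1)[OF \<eta>] charge_unique[OF m l n L H \<eta> Ps C' C] Pm Pm]) simp
  finally show "Form m (Suc n) l \<alpha> \<psi> = TT m n l \<alpha> (FT (Suc n) \<psi>) \<eta>" .
qed

section \<open>Lower bounds and closedness\<close>

text \<open>Multiplication by sqrt w is an isometry into plain L2; strict positivity of w allows
  dividing the limit by it.\<close>

lemma weighted_complete:
  fixes f :: "nat \<Rightarrow> 'a \<Rightarrow> complex"
  assumes w[measurable]: "w \<in> borel_measurable M" and w0: "\<And>k. 0 < (w k :: real)"
    and fm[measurable]: "\<And>j. f j \<in> borel_measurable M" and fi: "\<And>j. integrable M (\<lambda>k. w k * (cmod (f j k))^2)"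
    and cau: "\<And>e. e > 0 \<Longrightarrow> \<exists>K. \<forall>j\<ge>K. \<forall>l\<ge>K. (\<integral>k. w k * (cmod (f j k - f l k))^2 \<partial>M) < e"
  obtains g where "g \<in> borel_measurable M" "integrable M (\<lambda>k. w k * (cmod (g k))^2)"
    "(\<lambda>j. \<integral>k. w k * (cmod (f j k - g k))^2 \<partial>M) \<longlonglongrightarrow> 0"
proof -
  let ?u = "\<lambda>h k. complex_of_real (sqrt (w k)) * h k"
  have sq: "(cmod (complex_of_real (sqrt (w k)) * y))^2 = w k * (cmod y)^2" for k y
    using w0[of k] by (simp add: norm_mult power_mult_distrib less_imp_le)
  have d: "?u h k - ?u h' k = ?u (\<lambda>k. h k - h' k) k" for h h' k by (simp add: right_diff_distrib)
  have us: "sqi M (?u (f j))" for j unfolding sqi_def sq using fi by simp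
  have "\<exists>K. \<forall>j\<ge>K. \<forall>l\<ge>K. nrm M (\<lambda>k. ?u (f j) k - ?u (f l) k) < e" if e: "e > 0" for e
  proof -
    obtain K where K: "\<And>j l. j \<ge> K \<Longrightarrow> l \<ge> K \<Longrightarrow> (\<integral>k. w k * (cmod (f j k - f l k))^2 \<partial>M) < e^2" using cau[of "e^2"] e by auto
    have "nrm M (\<lambda>k. ?u (f j) k - ?u (f l) k) < e" if "j \<ge> K" "l \<ge> K" for j l
    proof (rule power2_less_imp_less)
      show "(nrm M (\<lambda>k. ?u (f j) k - ?u (f l) k))^2 < e^2" using K[OF that] unfolding nrm_sq d sq .
    qed (use e in simp)
    then show ?thesis by blast
  qed
  from sqi_complete[of M "\<lambda>j. ?u (f j)", OF us this]
  obtain h where h: "sqi M h" "(\<lambda>j. nrm M (\<lambda>k. ?u (f j) k - h k)) \<longlonglongrightarrow> 0" by blast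
  have [measurable]: "h \<in> borel_measurable M" using h by auto
  define g where "g k = h k / complex_of_real (sqrt (w k))" for k
  have hg: "h = ?u g"
  proof
    fix k
    have "sqrt (w k) > 0" using w0[of k] by simp
    then show "h k = ?u g k" by (simp add: g_def)
  qed
  show thesis
  proof
    show "g \<in> borel_measurable M" unfolding g_def[abs_def] by measurable
    show "integrable M (\<lambda>k. w k * (cmod (g k))^2)" using h(1) unfolding hg sqi_def sq by simp
    have "(\<lambda>j. (nrm M (\<lambda>k. ?u (f j) k - h k))^2) \<longlonglongrightarrow> 0^2" by (rule tendsto_power[OF h(2)])
    then show "(\<lambda>j. \<integral>k. w k * (cmod (f j k - g k))^2 \<partial>M) \<longlonglongrightarrow> 0" unfolding hg nrm_sq d sq by simp
  qed
qed

lemma tendsto_0_sqD: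
  assumes "(\<lambda>j. (x j :: real)^2) \<longlonglongrightarrow> 0" shows "x \<longlonglongrightarrow> 0"
  using tendsto_real_sqrt[OF assms] by (simp add: tendsto_rabs_zero_iff)

lemma weighted_tendsto_nrm:
  assumes le: "\<And>j. (nrm M (u j))^2 \<le> C * q j" and q: "q \<longlonglongrightarrow> (0::real)"
  shows "(\<lambda>j. nrm M (u j)) \<longlonglongrightarrow> 0"
proof (rule tendsto_0_sqD, rule tendsto_sandwich[OF _ _ tendsto_const])
  show "(\<lambda>j. C * q j) \<longlonglongrightarrow> 0" using tendsto_mult_right_zero[OF q] by simp
qed (use le in auto)

lemma nrm_sw: assumes "sqi (Mc n) f" "i < n" "j < n" shows "nrm (Mc n) (\<lambda>x. f (sw i j x)) = nrm (Mc n) f"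
proof -
  have "complex_of_real ((nrm (Mc n) (\<lambda>x. f (sw i j x)))^2) = complex_of_real ((nrm (Mc n) f)^2)"
    unfolding ip_self[symmetric] by (rule ip_sw[OF assms(1,1,2,3)])
  then have "(nrm (Mc n) (\<lambda>x. f (sw i j x)))^2 = (nrm (Mc n) f)^2" by (simp only: of_real_eq_iff)
  then show ?thesis by (rule power2_eq_imp_eq) auto
qed

text \<open>The defect of f under a transposition equals that of f - u j, hence has norm at most
  twice the distance from \<open>u j\<close> to f, for every j.\<close>

lemma antisym_limit:
  assumes u: "\<And>j. sqi (Mc n) (u j)" "\<And>j. antisym_f n (u j)" and f: "sqi (Mc n) f"
    and lim: "(\<lambda>j. nrm (Mc n) (\<lambda>x. u j x - f x)) \<longlonglongrightarrow> 0"
  shows "antisym_f n f"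
  unfolding antisym_sw
proof (intro allI impI)
  fix i l assume il: "i < n" "l < n" "i \<noteq> l"
  let ?v = "\<lambda>x. f (sw i l x) - (- 1) * f x"
  have vs: "sqi (Mc n) ?v" by (rule sqi_diff[OF sqi_sw[OF f il(1,2)] sqi_mult[OF f]])
  have le: "nrm (Mc n) ?v \<le> 2 * nrm (Mc n) (\<lambda>x. u j x - f x)" for j
  proof -
    let ?d = "\<lambda>x. f x - u j x"
    have ds: "sqi (Mc n) ?d" by (rule sqi_diff[OF f u(1)])
    have d2: "sqi (Mc n) (\<lambda>x. ?d (sw i l x))" by (rule sqi_sw[OF ds il(1,2)])
    have "AE x in Mc n. u j (sw i l x) = - u j x" using u(2)[of j] il by (simp add: antisym_sw)
    then have "AE x in Mc n. ?v x = ?d (sw i l x) + ?d x" by eventually_elim simp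
    then have "nrm (Mc n) ?v = nrm (Mc n) (\<lambda>x. ?d (sw i l x) + ?d x)"
      using vs sqi_add[OF d2 ds] by (intro nrm_cong_AE) auto
    also have "\<dots> \<le> nrm (Mc n) (\<lambda>x. ?d (sw i l x)) + nrm (Mc n) ?d" by (rule nrm_triangle[OF d2 ds])
    also have "\<dots> = 2 * nrm (Mc n) ?d" unfolding nrm_sw[OF ds il(1,2)] by simp
    finally show ?thesis unfolding nrm_minus_commute[of "Mc n" "u j"] .
  qed
  have "nrm (Mc n) ?v \<le> 0"
    by (rule LIMSEQ_le_const[OF tendsto_mult_right_zero[OF lim, of 2]]) (use le in auto)
  then have "nrm (Mc n) ?v = 0" using nrm_nonneg[of "Mc n" ?v] by linarith
  from nrm_eq_0_AE[OF vs this] show "AE x in Mc n. f (sw i l x) = - f x"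
    by eventually_elim (simp add: eq_neg_iff_add_eq_0)
qed

text \<open>A squared resolvent is at most 2/l times the difference of the resolvents at l and 2 l,
  so the resolvent identity and continuity of the charge form give the bound without a new
  integral.\<close>

lemma resolvent_Bf_bound:
  assumes m: "m > 0" and l: "l > 0" and n: "n \<ge> 1"
  obtains C where "\<And>\<eta>. Hh n \<eta> \<Longrightarrow> (nrm (Mc (Suc n)) (\<lambda>k. complex_of_real (1 / (hq m (Suc n) k + l)) * Bf n \<eta> k))^2 \<le> C * Qh n \<eta>"
proof -
  let ?h = "hq m (Suc n)"
  have l2: "0 < 2 * l" "l \<le> 2 * l" using l by auto
  obtain C1 where C1: "\<And>\<eta>. Hh n \<eta> \<Longrightarrow> \<bar>PP m n l 0 \<eta>\<bar> \<le> C1 * Qh n \<eta>" using PP_abs_le[OF m l n, where \<alpha>=0] by blast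
  obtain C2 where C2: "\<And>\<eta>. Hh n \<eta> \<Longrightarrow> \<bar>PP m n (2 * l) 0 \<eta>\<bar> \<le> C2 * Qh n \<eta>" using PP_abs_le[OF m l2(1) n, where \<alpha>=0] by blast
  show thesis
  proof
    fix \<eta> assume \<eta>: "Hh n \<eta>"
    let ?D = "\<lambda>k. 1 / (?h k + l) - 1 / (?h k + 2 * l)"
    let ?g = "\<lambda>k. complex_of_real (1 / (?h k + l)) * Bf n \<eta> k"
    note I = Phi_resolvent_identity[OF m l l2(2) n \<eta>]
    have Di: "integrable (Mc (Suc n)) (\<lambda>k. 2 / l * (?D k * (cmod (Bf n \<eta> k))^2))" using I(1) by (rule integrable_mult_right)
    have gs: "sqi (Mc (Suc n)) ?g" by (rule resolvent_Bf(1)[OF m l \<eta>])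
    have pt: "(1 / (u + l))^2 \<le> 2 / l * (1 / (u + l) - 1 / (u + 2 * l))" if "u \<ge> 0" for u
    proof -
      have p: "u + l > 0" "u + 2 * l > 0" using that l by auto
      have "1 / (u + l) - 1 / (u + 2 * l) = l / ((u + l) * (u + 2 * l))" using p by (simp add: field_simps)
      then have "2 / l * (1 / (u + l) - 1 / (u + 2 * l)) = 2 / ((u + l) * (u + 2 * l))" using l by simp
      moreover have "2 / ((u + l) * (2 * (u + l))) \<le> 2 / ((u + l) * (u + 2 * l))"
      proof (rule divide_left_mono)
        show "(u + l) * (u + 2 * l) \<le> (u + l) * (2 * (u + l))" using p that by (intro mult_left_mono) auto
        show "0 < (u + l) * (2 * (u + l)) * ((u + l) * (u + 2 * l))" using p by (intro mult_pos_pos) auto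
      qed simp
      moreover have g: "(1 / x)^2 = 2 / (x * (2 * x))" for x :: real by (simp add: power2_eq_square)
      ultimately show ?thesis unfolding g by (simp only:)
    qed
    have "(nrm (Mc (Suc n)) ?g)^2 \<le> (\<integral>k. 2 / l * (?D k * (cmod (Bf n \<eta> k))^2) \<partial>Mc (Suc n))"
      unfolding nrm_sq
    proof (rule integral_mono[OF _ Di])
      show "integrable (Mc (Suc n)) (\<lambda>k. (cmod (?g k))^2)" using gs by auto
      fix k
      have "(cmod (?g k))^2 = (1 / (?h k + l))^2 * (cmod (Bf n \<eta> k))^2"
        by (simp only: norm_mult norm_of_real power_mult_distrib power2_abs)
      also have "\<dots> \<le> 2 / l * ?D k * (cmod (Bf n \<eta> k))^2"
        by (rule mult_right_mono[OF pt[OF hq_bounds(3)[OF m]]]) simp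
      finally show "(cmod (?g k))^2 \<le> 2 / l * (?D k * (cmod (Bf n \<eta> k))^2)" by (simp only: mult.assoc)
    qed
    also have "\<dots> = 2 / l * (real (Suc n) * (PP m n (2 * l) 0 \<eta> - PP m n l 0 \<eta>))"
      unfolding I(2)[symmetric] by (rule Bochner_Integration.integral_mult_right_zero)
    also have "\<dots> \<le> 2 / l * (real (Suc n) * (C2 * Qh n \<eta> + C1 * Qh n \<eta>))"
      using C1[OF \<eta>] C2[OF \<eta>] l by (intro mult_left_mono) auto
    also have "\<dots> = 2 / l * (real (Suc n) * (C2 + C1)) * Qh n \<eta>" by (simp only: distrib_right mult.assoc)
    finally show "(nrm (Mc (Suc n)) ?g)^2 \<le> 2 / l * (real (Suc n) * (C2 + C1)) * Qh n \<eta>" .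
  qed
qed

lemma EE_nonneg: "m > 0 \<Longrightarrow> l > 0 \<Longrightarrow> 0 \<le> EE m n l P \<eta>"
  unfolding EE_def by (intro integral_nonneg_AE AE_I2 mult_nonneg_nonneg hq_w(2)) auto

text \<open>The parameter l of the estimate is free: by \<open>lambda_indep\<close> the value
  computed with lam may be rewritten with l, where the energy is nonnegative.\<close>

lemma Form_lower:
  assumes m: "m > 0" and lam: "lam > 0" and n: "n \<ge> 1" and L: "LambdaMN m (Suc n) < 1"
    and l: "l > 0" and pos: "\<And>\<eta>. Hh n \<eta> \<Longrightarrow> 0 \<le> PP m n l \<alpha> \<eta>" and \<psi>: "\<psi> \<in> FormDom m (Suc n) lam"
  shows "- l * norm2 (Suc n) \<psi> \<le> Form m (Suc n) lam \<alpha> \<psi>"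
proof -
  obtain \<eta> where e: "L2f (Suc n) \<psi>" "Hh n \<eta>" "Cf m n lam (FT (Suc n) \<psi>) \<eta>" by (rule FormDomD[OF m lam n \<psi>])
  have s: "sqi (Mc (Suc n)) \<psi>" using e by (simp add: L2f_def L2_sqi)
  have "Form m (Suc n) lam \<alpha> \<psi> = TT m n l \<alpha> (FT (Suc n) \<psi>) \<eta>"
    using Form_TT(2)[OF m lam n L e] lambda_indep(2)[OF m lam l n e(2) FT_sqi[OF s] e(3)] by simp
  also have "\<dots> = EE m n l (FT (Suc n) \<psi>) \<eta> + real (Suc n) * PP m n l \<alpha> \<eta> - l * norm2 (Suc n) \<psi>"
    unfolding TT_def norm2_nrm FT_nrm[OF s] ..
  also have "\<dots> \<ge> 0 + 0 - l * norm2 (Suc n) \<psi>"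
    using EE_nonneg[OF m l] pos[OF e(2)] by (intro diff_right_mono add_mono mult_nonneg_nonneg) auto
  finally show ?thesis by simp
qed

text \<open>Closedness evaluates the form on differences, where \<open>FT\<close> is additive only
  almost everywhere and the chosen charge is unrelated to the given ones; uniqueness allows the
  difference of charges to be used.\<close>

lemma Form_diff:
  assumes m: "m > 0" and lam: "lam > 0" and n: "n \<ge> 1" and L: "LambdaMN m (Suc n) < 1" and l: "l > 0"
    and 1: "L2f (Suc n) \<psi>" "Hh n \<eta>" "Cf m n lam (FT (Suc n) \<psi>) \<eta>"
    and 2: "L2f (Suc n) \<psi>'" "Hh n \<eta>'" "Cf m n lam (FT (Suc n) \<psi>') \<eta>'"
  shows "Form m (Suc n) lam \<alpha> (\<lambda>x. \<psi> x - \<psi>' x)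
    = TT m n l \<alpha> (\<lambda>k. FT (Suc n) \<psi> k - FT (Suc n) \<psi>' k) (\<lambda>k. \<eta> k - \<eta>' k)"
proof -
  have s: "sqi (Mc (Suc n)) \<psi>" "sqi (Mc (Suc n)) \<psi>'" "antisym_f (Suc n) \<psi>" "antisym_f (Suc n) \<psi>'"
    using 1 2 by (auto simp: L2f_def L2_sqi)
  have d: "L2f (Suc n) (\<lambda>x. \<psi> x - \<psi>' x)" using s by (simp add: L2f_def L2_sqi sqi_diff antisym_diff)
  have F: "sqi (Mc (Suc n)) (FT (Suc n) (\<lambda>x. \<psi> x - \<psi>' x))" by (rule FT_sqi[OF sqi_diff[OF s(1,2)]])
  have G: "sqi (Mc (Suc n)) (\<lambda>k. FT (Suc n) \<psi> k - FT (Suc n) \<psi>' k)" by (rule sqi_diff[OF FT_sqi[OF s(1)] FT_sqi[OF s(2)]])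
  note H = Hh_diff[OF 1(2) 2(2)]
  note fd = FT_diff[OF s(1,2)]
  have C: "Cf m n lam (\<lambda>k. FT (Suc n) \<psi> k - FT (Suc n) \<psi>' k) (\<lambda>k. \<eta> k - \<eta>' k)"
    by (rule Cf_diff[OF m lam 1(2) 2(2) FT_sqi[OF s(1)] FT_sqi[OF s(2)] 1(3) 2(3)])
  then have C': "Cf m n lam (FT (Suc n) (\<lambda>x. \<psi> x - \<psi>' x)) (\<lambda>k. \<eta> k - \<eta>' k)"
    using Cf_cong(1)[OF HhD(1)[OF H] HhD(1)[OF H] _ sqiD(1)[OF F] sqiD(1)[OF G] fd] by simp
  have "Form m (Suc n) lam \<alpha> (\<lambda>x. \<psi> x - \<psi>' x) = TT m n lam \<alpha> (FT (Suc n) (\<lambda>x. \<psi> x - \<psi>' x)) (\<lambda>k. \<eta> k - \<eta>' k)"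
    by (rule Form_TT(2)[OF m lam n L d H C'])
  also have "\<dots> = TT m n lam \<alpha> (\<lambda>k. FT (Suc n) \<psi> k - FT (Suc n) \<psi>' k) (\<lambda>k. \<eta> k - \<eta>' k)"
    by (rule TT_cong[OF n HhD(1)[OF H] HhD(1)[OF H] _ sqiD(1)[OF F] sqiD(1)[OF G] fd]) simp
  also have "\<dots> = TT m n l \<alpha> (\<lambda>k. FT (Suc n) \<psi> k - FT (Suc n) \<psi>' k) (\<lambda>k. \<eta> k - \<eta>' k)"
    by (rule lambda_indep(2)[OF m lam l n H G C])
  finally show ?thesis .
qed

text \<open>At a large auxiliary l the form plus l |\<psi>|^2 is a sum of two nonnegative terms, so
  a form-Cauchy sequence has Cauchy regular parts in the energy norm and Cauchy charges in
  \<open>Qh\<close>. Both converge; it remains to see that the limits belong to the L2 limit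
  \<psi>.\<close>

lemma Form_closed:
  assumes m: "m > 0" and lam: "lam > 0" and n: "n \<ge> 1" and L: "LambdaMN m (Suc n) < 1"
  shows "closed_form (Suc n) (FormDom m (Suc n) lam) (Form m (Suc n) lam \<alpha>)"
  unfolding closed_form_def
proof (intro conjI allI impI; (elim conjE)?)
  show "FormDom m (Suc n) lam \<subseteq> {f. L2f (Suc n) f}" by (auto simp: FormDom_def)
  fix \<psi>s :: "nat \<Rightarrow> cfg \<Rightarrow> complex" and \<psi>
  let ?M = "Mc (Suc n)" let ?F = "Form m (Suc n) lam \<alpha>" let ?D = "FormDom m (Suc n) lam"
  assume dom: "\<forall>j. \<psi>s j \<in> ?D" and \<psi>: "L2f (Suc n) \<psi>"
    and lim: "(\<lambda>j. norm2 (Suc n) (\<lambda>x. \<psi>s j x - \<psi> x)) \<longlonglongrightarrow> 0"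
    and cau: "\<forall>\<epsilon>>0. \<exists>K. \<forall>j\<ge>K. \<forall>l\<ge>K. \<bar>?F (\<lambda>x. \<psi>s j x - \<psi>s l x)\<bar> < \<epsilon>"
  define c where "c = pi^2 * (1 - LambdaMN m (Suc n))"
  have c: "c > 0" using L by (simp add: c_def)
  \<comment> \<open>Large enough that sqrt l \<ge> |\<alpha>| / c, the threshold in
    \<open>PP_coercive\<close>.\<close>
  define l where "l = max 1 ((\<bar>\<alpha>\<bar> / c)^2)"
  have l1: "l \<ge> 1" and l0: "l > 0" by (auto simp: l_def)
  have "sqrt ((\<bar>\<alpha>\<bar> / c)^2) \<le> sqrt l" by (rule real_sqrt_le_mono) (simp add: l_def)
  then have "\<bar>\<alpha>\<bar> / c \<le> sqrt l" using c by simp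
  then have l\<alpha>: "\<bar>\<alpha>\<bar> \<le> pi^2 * (1 - LambdaMN m (Suc n)) * sqrt l" using c by (simp add: c_def[symmetric] pos_divide_le_eq mult.commute)
  define c0 where "c0 = pi^2 * (1 - LambdaMN m (Suc n)) * sqrt (1 - am m)"
  have c0: "c0 > 0" using c am[OF m] by (simp add: c0_def c_def)
  have coer: "c0 * Qh n \<eta> \<le> PP m n l \<alpha> \<eta>" if "Hh n \<eta>" for \<eta>
    unfolding c0_def by (rule PP_coercive(1)[OF m n L l1 l\<alpha> that])
  have "\<forall>j. \<exists>\<eta>. L2f (Suc n) (\<psi>s j) \<and> Hh n \<eta> \<and> Cf m n lam (FT (Suc n) (\<psi>s j)) \<eta>"
    using dom FormDomD[OF m lam n] by metis
  then obtain \<eta> where \<eta>: "\<And>j. L2f (Suc n) (\<psi>s j)" "\<And>j. Hh n (\<eta> j)" "\<And>j. Cf m n lam (FT (Suc n) (\<psi>s j)) (\<eta> j)" by metis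
  define P where "P j = FT (Suc n) (\<psi>s j)" for j
  define P0 where "P0 = FT (Suc n) \<psi>"
  have s: "sqi ?M (\<psi>s j)" for j using \<eta>(1)[of j] by (simp add: L2f_def L2_sqi)
  have s0: "sqi ?M \<psi>" using \<psi> by (simp add: L2f_def L2_sqi)
  have Ps: "sqi ?M (P j)" for j unfolding P_def by (rule FT_sqi[OF s])
  have P0s: "sqi ?M P0" unfolding P0_def by (rule FT_sqi[OF s0])
  have nrm\<psi>: "(\<lambda>j. nrm ?M (\<lambda>x. \<psi>s j x - \<psi> x)) \<longlonglongrightarrow> 0" using lim unfolding norm2_nrm by (rule tendsto_0_sqD)
  have FTd: "nrm ?M (\<lambda>k. FT (Suc n) f k - FT (Suc n) g k) = nrm ?M (\<lambda>x. f x - g x)" if "sqi ?M f" "sqi ?M g" for f g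
  proof -
    have "nrm ?M (\<lambda>k. FT (Suc n) f k - FT (Suc n) g k) = nrm ?M (FT (Suc n) (\<lambda>x. f x - g x))"
      using sqiD(1)[OF sqi_diff[OF FT_sqi[OF that(1)] FT_sqi[OF that(2)]]] sqiD(1)[OF FT_sqi[OF sqi_diff[OF that]]] FT_diff[OF that]
      by (intro nrm_cong_AE) auto
    then show ?thesis unfolding FT_nrm[OF sqi_diff[OF that]] .
  qed
  have limP: "(\<lambda>j. nrm ?M (\<lambda>k. P j k - P0 k)) \<longlonglongrightarrow> 0" unfolding P_def P0_def FTd[OF s s0] by (rule nrm\<psi>)
  have Cl: "Cf m n l (P j) (\<eta> j)" for j unfolding P_def by (rule lambda_indep(1)[OF m lam l0 n \<eta>(2) FT_sqi[OF s] \<eta>(3)])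
  have Fd: "?F (\<lambda>x. \<psi>s j x - \<psi>s i x) = TT m n l \<alpha> (\<lambda>k. P j k - P i k) (\<lambda>k. \<eta> j k - \<eta> i k)" for i j
    unfolding P_def by (rule Form_diff[OF m lam n L l0 \<eta> \<eta>])
  \<comment> \<open>The sum of energy and charge form is small because the form value and the
    compensating l |P|^2 are; nonnegativity then controls each summand, the charge through the
    constant c0.\<close>
  have energy: "\<exists>K. \<forall>j\<ge>K. \<forall>i\<ge>K. EE m n l (\<lambda>k. P j k - P i k) (\<lambda>k. \<eta> j k - \<eta> i k) < e \<and> Qh n (\<lambda>k. \<eta> j k - \<eta> i k) < e"
    if e: "e > 0" for e
  proof -
    define e' where "e' = min e (real (Suc n) * c0 * e)"
    have e': "e' > 0" "e' \<le> e" "e' \<le> real (Suc n) * c0 * e" using e c0 by (auto simp: e'_def)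
    obtain K1 where K1: "\<And>i j. j \<ge> K1 \<Longrightarrow> i \<ge> K1 \<Longrightarrow> \<bar>?F (\<lambda>x. \<psi>s j x - \<psi>s i x)\<bar> < e' / 2" using cau e' by (metis half_gt_zero)
    \<comment> \<open>This threshold makes l times the squared L2 distance smaller than e'/2, the
      other e'/2 being allotted to the form value.\<close>
    have "sqrt (e' / (2 * l)) > 0" using e' l0 by simp
    from nrm_limit_Cauchy[OF s s0 nrm\<psi> this] obtain K2 where
      K2: "\<And>i j. j \<ge> K2 \<Longrightarrow> i \<ge> K2 \<Longrightarrow> nrm ?M (\<lambda>x. \<psi>s j x - \<psi>s i x) < sqrt (e' / (2 * l))" by blast
    have "EE m n l (\<lambda>k. P j k - P i k) (\<lambda>k. \<eta> j k - \<eta> i k) < e \<and> Qh n (\<lambda>k. \<eta> j k - \<eta> i k) < e"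
      if ij: "j \<ge> max K1 K2" "i \<ge> max K1 K2" for i j
    proof -
      let ?E = "EE m n l (\<lambda>k. P j k - P i k) (\<lambda>k. \<eta> j k - \<eta> i k)" and ?P = "PP m n l \<alpha> (\<lambda>k. \<eta> j k - \<eta> i k)" and ?Q = "Qh n (\<lambda>k. \<eta> j k - \<eta> i k)"
      have H: "Hh n (\<lambda>k. \<eta> j k - \<eta> i k)" by (rule Hh_diff[OF \<eta>(2) \<eta>(2)])
      have "(nrm ?M (\<lambda>k. P j k - P i k))^2 < (sqrt (e' / (2 * l)))^2"
        unfolding P_def FTd[OF s s] using K2[of j i] ij by (intro power_strict_mono) auto
      then have "l * (nrm ?M (\<lambda>k. P j k - P i k))^2 < e' / 2" using e' l0 by (simp add: pos_less_divide_eq field_simps)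
      moreover have "?E + real (Suc n) * ?P - l * (nrm ?M (\<lambda>k. P j k - P i k))^2 < e' / 2"
      proof -
        have "K1 \<le> j" "K1 \<le> i" using ij by auto
        from K1[OF this] show ?thesis unfolding Fd TT_def by linarith
      qed
      ultimately have sum: "?E + real (Suc n) * ?P < e'" by linarith
      have E0: "0 \<le> ?E" by (rule EE_nonneg[OF m l0])
      have "c0 * ?Q \<le> ?P" by (rule coer[OF H])
      then have N: "real (Suc n) * (c0 * ?Q) \<le> real (Suc n) * ?P" by (rule mult_left_mono) simp
      have Q0: "0 \<le> real (Suc n) * (c0 * ?Q)" using c0 Qh_nonneg[of n] by (intro mult_nonneg_nonneg) auto
      have "(real (Suc n) * c0) * ?Q < (real (Suc n) * c0) * e" unfolding mult.assoc[of "real (Suc n)" c0 ?Q] using sum E0 N e'(3) by linarith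
      then have "?Q < e" using c0 by (simp add: mult_less_cancel_left_pos)
      moreover have "?E < e" using sum N Q0 e'(2) by linarith
      ultimately show ?thesis by simp
    qed
    then show ?thesis by blast
  qed
  have w1: "wh n \<in> borel_measurable (Mc n)" "\<And>k. 0 < wh n k" using wh_ge1[of n] by (auto intro: less_le_trans[OF zero_less_one] simp: wh_def[abs_def])
  have cau1: "\<exists>K. \<forall>j\<ge>K. \<forall>i\<ge>K. (\<integral>k. wh n k * (cmod (\<eta> j k - \<eta> i k))^2 \<partial>Mc n) < e" if "e > 0" for e
    using energy[OF that] unfolding Qh_def by blast
  obtain \<eta>0 where \<eta>0: "\<eta>0 \<in> borel_measurable (Mc n)" "integrable (Mc n) (\<lambda>k. wh n k * (cmod (\<eta>0 k))^2)"
    "(\<lambda>j. \<integral>k. wh n k * (cmod (\<eta> j k - \<eta>0 k))^2 \<partial>Mc n) \<longlonglongrightarrow> 0"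
    using weighted_complete[OF w1 HhD(1)[OF \<eta>(2)] HhD(3)[OF \<eta>(2)] cau1] by blast
  have \<eta>0s: "sqi (Mc n) \<eta>0" unfolding sqi_def
  proof (intro conjI \<eta>0(1))
    note [measurable] = \<eta>0(1)
    show "integrable (Mc n) (\<lambda>k. (cmod (\<eta>0 k))^2)"
    proof (rule Bochner_Integration.integrable_bound[OF \<eta>0(2)])
      have "1 * (cmod (\<eta>0 k))^2 \<le> wh n k * (cmod (\<eta>0 k))^2" for k by (rule mult_right_mono[OF wh_ge1]) simp
      then show "AE k in Mc n. norm ((cmod (\<eta>0 k))^2) \<le> norm (wh n k * (cmod (\<eta>0 k))^2)" by simp
    qed measurable
  qed
  have \<eta>js: "sqi (Mc n) (\<eta> j)" for j by (rule Hh_sqi[OF \<eta>(2)])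
  have le1: "(nrm (Mc n) (\<lambda>k. \<eta> j k - \<eta>0 k))^2 \<le> 1 * (\<integral>k. wh n k * (cmod (\<eta> j k - \<eta>0 k))^2 \<partial>Mc n)" for j
    unfolding nrm_sq mult_1
  proof (rule integral_mono)
    show "integrable (Mc n) (\<lambda>k. (cmod (\<eta> j k - \<eta>0 k))^2)" by (rule sqiD(2)[OF sqi_diff[OF \<eta>js \<eta>0s]])
    show "integrable (Mc n) (\<lambda>k. wh n k * (cmod (\<eta> j k - \<eta>0 k))^2)"
      by (rule weighted_sq_diff_integrable[OF w1(1) _ HhD(1)[OF \<eta>(2)] \<eta>0(1) HhD(3)[OF \<eta>(2)] \<eta>0(2)]) simp
    show "(cmod (\<eta> j k - \<eta>0 k))^2 \<le> wh n k * (cmod (\<eta> j k - \<eta>0 k))^2" for k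
      using mult_right_mono[OF wh_ge1[of n k], of "(cmod (\<eta> j k - \<eta>0 k))^2"] by simp
  qed
  have "antisym_f n \<eta>0"
    by (rule antisym_limit[OF \<eta>js HhD(2)[OF \<eta>(2)] \<eta>0s weighted_tendsto_nrm[OF le1 \<eta>0(3)]])
  then have H0: "Hh n \<eta>0" using \<eta>0 by (simp add: Hh_def)
  have Hd: "Hh n (\<lambda>k. \<eta> j k - \<eta>0 k)" for j by (rule Hh_diff[OF \<eta>(2) H0])
  have limQ: "(\<lambda>j. Qh n (\<lambda>k. \<eta> j k - \<eta>0 k)) \<longlonglongrightarrow> 0" using \<eta>0(3) unfolding Qh_def .
  let ?w = "\<lambda>k. hq m (Suc n) k + l"
  define R where "R j = Rr m n l (P j) (\<eta> j)" for j
  define R0 where "R0 = Rr m n l P0 \<eta>0"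
  have Rm: "R j \<in> borel_measurable ?M" for j unfolding R_def by (rule Rr_measurable[OF HhD(1)[OF \<eta>(2)] sqiD(1)[OF Ps]])
  have R0m: "R0 \<in> borel_measurable ?M" unfolding R0_def by (rule Rr_measurable[OF HhD(1)[OF H0] sqiD(1)[OF P0s]])
  have w2: "?w \<in> borel_measurable ?M" "\<And>k. 0 < ?w k" using hq_w(1)[OF m l0] hq_pos[OF m l0] by auto
  have Ri: "integrable ?M (\<lambda>k. ?w k * (cmod (R j k))^2)" for j using Cl[of j] unfolding Cf_def R_def .
  have cau2: "\<exists>K. \<forall>j\<ge>K. \<forall>i\<ge>K. (\<integral>k. ?w k * (cmod (R j k - R i k))^2 \<partial>?M) < e" if "e > 0" for e
    using energy[OF that] unfolding EE_def Rr_diff R_def by blast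
  obtain r where r: "r \<in> borel_measurable ?M" "integrable ?M (\<lambda>k. ?w k * (cmod (r k))^2)"
    "(\<lambda>j. \<integral>k. ?w k * (cmod (R j k - r k))^2 \<partial>?M) \<longlonglongrightarrow> 0"
    using weighted_complete[OF w2 Rm Ri cau2] by blast
  have wr: "integrable ?M (\<lambda>k. ?w k * (cmod (R j k - r k))^2)" for j
    by (rule weighted_sq_diff_integrable[OF w2(1) less_imp_le[OF w2(2)] Rm r(1) Ri r(2)])
  \<comment> \<open>The weight h + l is at least l, so energy convergence implies L2
    convergence.\<close>
  have unw: "sqi ?M f \<and> (nrm ?M f)^2 \<le> 1 / l * (\<integral>k. ?w k * (cmod (f k))^2 \<partial>?M)"
    if f: "f \<in> borel_measurable ?M" "integrable ?M (\<lambda>k. ?w k * (cmod (f k))^2)" for f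
  proof -
    have le: "(cmod (f k))^2 \<le> 1 / l * (?w k * (cmod (f k))^2)" for k
    proof -
      have "1 \<le> 1 / l * ?w k" using hq_bounds(3)[OF m, of "Suc n" k] l0 by (simp add: pos_le_divide_eq)
      from mult_right_mono[OF this, of "(cmod (f k))^2"] show ?thesis by (simp only: mult.assoc mult_1 zero_le_power2)
    qed
    have i: "integrable ?M (\<lambda>k. 1 / l * (?w k * (cmod (f k))^2))" using f(2) by (rule integrable_mult_right)
    have sf: "sqi ?M f" by (rule sqi_bound[OF f(1) i]) (use le in auto)
    have "(nrm ?M f)^2 \<le> (\<integral>k. 1 / l * (?w k * (cmod (f k))^2) \<partial>?M)"
      unfolding nrm_sq by (rule integral_mono[OF sqiD(2)[OF sf] i le])
    also have "\<dots> = 1 / l * (\<integral>k. ?w k * (cmod (f k))^2 \<partial>?M)" by (rule Bochner_Integration.integral_mult_right_zero)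
    finally show ?thesis using sf by simp
  qed
  have ds: "sqi ?M (\<lambda>k. R j k - r k)" for j using unw[OF borel_measurable_diff[OF Rm r(1)] wr] by blast
  have lim1: "(\<lambda>j. nrm ?M (\<lambda>k. R j k - r k)) \<longlonglongrightarrow> 0"
    by (rule weighted_tendsto_nrm[OF _ r(3), where C="1 / l"]) (use unw[OF borel_measurable_diff[OF Rm r(1)] wr] in blast)
  let ?g = "\<lambda>j k. complex_of_real (1 / ?w k) * Bf n (\<lambda>k. \<eta> j k - \<eta>0 k) k"
  obtain C where C: "\<And>\<eta>. Hh n \<eta> \<Longrightarrow> (nrm ?M (\<lambda>k. complex_of_real (1 / ?w k) * Bf n \<eta> k))^2 \<le> C * Qh n \<eta>"
    using resolvent_Bf_bound[OF m l0 n] by blast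
  have limg: "(\<lambda>j. nrm ?M (?g j)) \<longlonglongrightarrow> 0" by (rule weighted_tendsto_nrm[OF C[OF Hd] limQ])
  have gs: "sqi ?M (?g j)" for j by (rule resolvent_Bf(1)[OF m l0 Hd])
  have RR: "R j k - R0 k = (P j k - P0 k) - ?g j k" for j k
    unfolding R_def R0_def Rr_diff[symmetric] unfolding Rr_def ..
  have ps: "sqi ?M (\<lambda>k. P j k - P0 k)" for j by (rule sqi_diff[OF Ps P0s])
  have d0s: "sqi ?M (\<lambda>k. R j k - R0 k)" for j unfolding RR by (rule sqi_diff[OF ps gs])
  \<comment> \<open>A second route to the limit of \<open>R j\<close>: \<psi> converges in L2 and
    the potentials of the charges converge by \<open>resolvent_Bf_bound\<close>.\<close>
  have lim2: "(\<lambda>j. nrm ?M (\<lambda>k. R j k - R0 k)) \<longlonglongrightarrow> 0"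
  proof (rule tendsto_sandwich[OF _ _ tendsto_const])
    show "(\<lambda>j. nrm ?M (\<lambda>k. P j k - P0 k) + nrm ?M (?g j)) \<longlonglongrightarrow> 0" using tendsto_add[OF limP limg] by simp
    have "nrm ?M (\<lambda>k. R j k - R0 k) \<le> nrm ?M (\<lambda>k. P j k - P0 k) + nrm ?M (?g j)" for j
      using nrm_triangle[OF ps sqi_mult[OF gs, of "- 1"]] unfolding RR nrm_mult by simp
    then show "\<forall>\<^sub>F j in sequentially. nrm ?M (\<lambda>k. R j k - R0 k) \<le> nrm ?M (\<lambda>k. P j k - P0 k) + nrm ?M (?g j)" by simp
  qed simp
  have tele: "(R j k - R0 k) + - 1 * (R j k - r k) = r k - R0 k" for j k by (simp add: algebra_simps)
  have rR: "sqi ?M (\<lambda>k. r k - R0 k)" using sqi_add[OF d0s[of 0] sqi_mult[OF ds[of 0], of "- 1"]] unfolding tele .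
  have "nrm ?M (\<lambda>k. r k - R0 k) \<le> nrm ?M (\<lambda>k. R j k - R0 k) + nrm ?M (\<lambda>k. R j k - r k)" for j
    using nrm_triangle[OF d0s[of j] sqi_mult[OF ds[of j], of "- 1"]] unfolding tele nrm_mult by simp
  then have "nrm ?M (\<lambda>k. r k - R0 k) \<le> 0 + 0"
    by (intro LIMSEQ_le_const[OF tendsto_add[OF lim2 lim1]]) auto
  \<comment> \<open>The energy limit r and the regular part \<open>R0\<close> of the pair (P0,
    \<eta>0) are L2 limits of the same sequence, hence equal almost everywhere; so \<eta>0 is a
    charge of \<psi>.\<close>
  then have "nrm ?M (\<lambda>k. r k - R0 k) = 0" using nrm_nonneg[of ?M "\<lambda>k. r k - R0 k"] by linarith
  from nrm_eq_0_AE[OF rR this] have rR0: "AE k in ?M. r k = R0 k" by simp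
  have "Cf m n l P0 \<eta>0"
    using r(2) weighted_cong_AE(1)[OF w2(1) r(1) R0m rR0] unfolding Cf_def R0_def by simp
  then have C0: "Cf m n lam (FT (Suc n) \<psi>) \<eta>0"
    using lambda_indep(1)[OF m l0 lam n H0 P0s] by (simp add: P0_def)
  show "\<psi> \<in> ?D" by (rule Form_TT(1)[OF m lam n L \<psi> H0 C0])
  have FT0: "?F (\<lambda>x. \<psi>s j x - \<psi> x) = EE m n l (\<lambda>k. P j k - P0 k) (\<lambda>k. \<eta> j k - \<eta>0 k)
      + real (Suc n) * PP m n l \<alpha> (\<lambda>k. \<eta> j k - \<eta>0 k) - l * (nrm ?M (\<lambda>k. P j k - P0 k))^2" for j
    unfolding P_def P0_def TT_def[symmetric] by (rule Form_diff[OF m lam n L l0 \<eta> \<psi> H0 C0])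
  have "EE m n l (\<lambda>k. P j k - P0 k) (\<lambda>k. \<eta> j k - \<eta>0 k) = (\<integral>k. ?w k * (cmod (R j k - r k))^2 \<partial>?M)" for j
    unfolding EE_def Rr_diff R_def[symmetric] R0_def[symmetric]
    by (rule weighted_cong_AE(2)[OF w2(1) borel_measurable_diff[OF Rm R0m] borel_measurable_diff[OF Rm r(1)]])
       (use rR0 in eventually_elim, simp)
  then have limE: "(\<lambda>j. EE m n l (\<lambda>k. P j k - P0 k) (\<lambda>k. \<eta> j k - \<eta>0 k)) \<longlonglongrightarrow> 0" using r(3) by simp
  obtain C' where C': "\<And>\<eta>. Hh n \<eta> \<Longrightarrow> \<bar>PP m n l \<alpha> \<eta>\<bar> \<le> C' * Qh n \<eta>" using PP_abs_le[OF m l0 n] by metis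
  have limPP: "(\<lambda>j. PP m n l \<alpha> (\<lambda>k. \<eta> j k - \<eta>0 k)) \<longlonglongrightarrow> 0"
  proof (rule Lim_null_comparison)
    show "\<forall>\<^sub>F j in sequentially. norm (PP m n l \<alpha> (\<lambda>k. \<eta> j k - \<eta>0 k)) \<le> C' * Qh n (\<lambda>k. \<eta> j k - \<eta>0 k)" using C'[OF Hd] by simp
    show "(\<lambda>j. C' * Qh n (\<lambda>k. \<eta> j k - \<eta>0 k)) \<longlonglongrightarrow> 0" by (rule tendsto_mult_right_zero[OF limQ])
  qed
  have limP2: "(\<lambda>j. (nrm ?M (\<lambda>k. P j k - P0 k))^2) \<longlonglongrightarrow> 0" using tendsto_power[OF limP, of 2] by simp
  show "(\<lambda>j. ?F (\<lambda>x. \<psi>s j x - \<psi> x)) \<longlonglongrightarrow> 0"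
    unfolding FT0 using tendsto_diff[OF tendsto_add[OF limE tendsto_mult_right_zero[OF limPP, of "real (Suc n)"]]
        tendsto_mult_right_zero[OF limP2, of l]] by simp
qed

theorem mainTheorem1:
  fixes N :: nat and m \<alpha> lam :: real
  assumes "N \<ge> 2" and "m > 0" and "m > mstar N" and "lam > 0"
  shows "closed_form N (FormDom m N lam) (Form m N lam \<alpha>)
    \<and> (\<exists>c. \<forall>\<psi>\<in>FormDom m N lam. Form m N lam \<alpha> \<psi> \<ge> - c * norm2 N \<psi>)
    \<and> (\<alpha> \<ge> 0 \<longrightarrow> (\<forall>\<psi>\<in>FormDom m N lam. Form m N lam \<alpha> \<psi> \<ge> 0))
    \<and> (\<alpha> < 0 \<longrightarrow> (\<forall>\<psi>\<in>FormDom m N lam.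
          Form m N lam \<alpha> \<psi> \<ge> - (\<alpha>^2 / (4 * pi^4 * (1 - LambdaMN m N))) * norm2 N \<psi>))"
proof -
  \<comment> \<open>n = N - 1 is the number of momenta of a charge; n \<ge> 1 lets one of them be
    split off as the active variable.\<close>
  obtain n where N: "N = Suc n" and n: "n \<ge> 1" using assms(1) by (cases N) auto
  note m = assms(2) and lam = assms(4)
  have L: "LambdaMN m (Suc n) < 1" using Lambda_lt_1[of N m] assms N by simp
  let ?L = "LambdaMN m (Suc n)"
  have L0: "0 \<le> ?L" by (rule Lambda_nonneg[OF m])
  have nonneg: "0 \<le> Form m (Suc n) lam \<alpha> \<psi>" if a: "\<alpha> \<ge> 0" and \<psi>: "\<psi> \<in> FormDom m (Suc n) lam" for \<psi>
  proof -
    \<comment> \<open>For \<alpha> \<ge> 0 every l > 0 is admissible, so the bound -l |\<psi>|^2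
      holds along l = 1 / (j + 1) and positivity follows in the limit.\<close>
    have b: "- l * norm2 (Suc n) \<psi> \<le> Form m (Suc n) lam \<alpha> \<psi>" if l: "l > 0" for l
    proof (rule Form_lower[OF m lam n L l _ \<psi>])
      fix \<eta> assume "Hh n \<eta>"
      then show "0 \<le> PP m n l \<alpha> \<eta>" using a l L L0 by (intro PP_nonneg[OF m l n _ L]) (auto simp: power_le_one)
    qed
    show ?thesis
    proof (rule LIMSEQ_le_const2)
      have "(\<lambda>j. - inverse (real (Suc j)) * norm2 (Suc n) \<psi>) \<longlonglongrightarrow> - 0 * norm2 (Suc n) \<psi>"
        by (intro tendsto_intros LIMSEQ_inverse_real_of_nat)
      then show "(\<lambda>j. - inverse (real (Suc j)) * norm2 (Suc n) \<psi>) \<longlonglongrightarrow> 0" by simp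
    qed (use b in auto)
  qed
  have neg: "- (\<alpha>^2 / (4 * pi^4 * (1 - ?L))) * norm2 (Suc n) \<psi> \<le> Form m (Suc n) lam \<alpha> \<psi>"
    if a: "\<alpha> < 0" and \<psi>: "\<psi> \<in> FormDom m (Suc n) lam" for \<psi>
  proof (rule Form_lower[OF m lam n L _ _ \<psi>])
    \<comment> \<open>\<open>PP_nonneg\<close> asks for 2 pi^2 sqrt (l (1 - \<Lambda>^2)) \<ge>
      |\<alpha>|. With this l the square of the left side is \<alpha>^2 (1 + \<Lambda>), which is
      enough as \<Lambda> \<ge> 0.\<close>
    let ?l = "\<alpha>^2 / (4 * pi^4 * (1 - ?L))"
    show l: "?l > 0" using a L by simp
    fix \<eta> assume \<eta>: "Hh n \<eta>"
    have "?l * (1 - ?L^2) = (\<bar>\<alpha>\<bar> / (2 * pi^2))^2 * (1 + ?L)"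
    proof -
      have "x / (4 * q * (1 - y)) * (1 - y^2) = x / (4 * q) * (1 + y)" if "1 - y > 0" "q > 0" for x y q :: real
        using that by (simp add: field_simps power2_eq_square)
      from this[of ?L "pi^4" "\<alpha>^2"] L show ?thesis by (simp add: power_divide power_mult_distrib)
    qed
    also have "\<dots> \<ge> (\<bar>\<alpha>\<bar> / (2 * pi^2))^2 * 1" using L0 by (intro mult_left_mono) auto
    finally have "\<bar>\<alpha>\<bar> / (2 * pi^2) \<le> sqrt (?l * (1 - ?L^2))" by (intro real_le_rsqrt) simp
    then have "\<bar>\<alpha>\<bar> \<le> 2 * pi^2 * sqrt (?l * (1 - ?L^2))" by (simp add: pos_divide_le_eq mult.commute)
    then show "0 \<le> PP m n ?l \<alpha> \<eta>" by (intro PP_nonneg[OF m l n \<eta> L]) linarith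
  qed
  have "\<exists>c. \<forall>\<psi>\<in>FormDom m (Suc n) lam. Form m (Suc n) lam \<alpha> \<psi> \<ge> - c * norm2 (Suc n) \<psi>"
  proof (cases "\<alpha> \<ge> 0")
    case True
    then show ?thesis using nonneg by (intro exI[of _ 0]) auto
  next
    case False
    then show ?thesis using neg by (intro exI[of _ "\<alpha>^2 / (4 * pi^4 * (1 - ?L))"]) auto
  qed
  then show ?thesis using Form_closed[OF m lam n L] nonneg neg unfolding N by auto
qed

end
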